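(* Let $X$ be an infinite dimensional Banach space with an unconditional basis such that $X$ does not contain $\ell_1^n$ uniformly. Then $X$ contains an arbitrarily distortable infinite dimensional closed subspace.
   Context: A Banach space $X$ contains $\ell_1^n$ uniformly if there is a constant $C$ such that for every integer $n\ge 1$ there are vectors $x_1,\ldots,x_n\in X$ and numbers $0<d\le D$ with $D/d\le C$ such that $d\sum_{i=1}^n|c_i|\le\|\sum_{i=1}^n c_ix_i\|\le D\sum_{i=1}^n|c_i|$ for all scalars $c_1,\ldots,c_n$. For a real number $\lambda>1$, an infinite dimensional Banach space $(Z,\|\cdot\|)$ is $\lambda$-distortable if there exists an equivalent norm $|\cdot|$ on $Z$ such that for every infinite dimensional vector subspace $Y$ of $Z$, $$\sup\{|y|/|z| : y,z\in Y,\ \|y\|=\|z\|=1\}\ge\lambda.$$ $Z$ is arbitrarily distortable if it is $\lambda$-distortable for every $\lambda>1$. (A subspace of $X$ is equipped with the norm of $X$.) *)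

theory Defs
  imports "HOL-Analysis.Analysis"
begin

text \<open>
  Scalars range over a type of sort \<open>{real_normed_field, euclidean_space}\<close>.  The library's instances
  are \<open>real\<close> and \<open>complex\<close>, and by Frobenius' theorem there are no others up to isometric isomorphism
  (a finite-dimensional commutative field extension of the reals with multiplicative norm).
  A Banach space over such a field is a type of class \<open>banach\<close> (carrying the norm, the metric and the
  underlying real structure) together with a compatible scalar multiplication.
\<close>

locale banach_space_over = vector_space scl
  for scl :: "'k::{real_normed_field,euclidean_space} \<Rightarrow> 'a::banach \<Rightarrow> 'a" +
  assumes norm_scl: "norm (scl c x) = norm c * norm x"
    and scl_of_real: "scl (of_real r) x = r *\<^sub>R x"

lemma banach_space_over_real:
  "banach_space_over (scaleR :: real \<Rightarrow> 'a::banach \<Rightarrow> 'a)"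
  by unfold_locales (auto simp: algebra_simps)

lemma banach_space_over_self:
  "banach_space_over ((*) :: 'k::{real_normed_field,euclidean_space,banach} \<Rightarrow> 'k \<Rightarrow> 'k)"
  by unfold_locales (auto simp: algebra_simps norm_mult scaleR_conv_of_real)

definition infinite_dimensional ::
  "('k::{real_normed_field,euclidean_space} \<Rightarrow> 'a::banach \<Rightarrow> 'a) \<Rightarrow> 'a set \<Rightarrow> bool" where
  "infinite_dimensional scl Y \<longleftrightarrow> \<not> (\<exists>B. finite B \<and> module.span scl B = Y)"

definition schauder_basis ::
  "('k::{real_normed_field,euclidean_space} \<Rightarrow> 'a::banach \<Rightarrow> 'a) \<Rightarrow> (nat \<Rightarrow> 'a) \<Rightarrow> bool" where
  "schauder_basis scl e \<longleftrightarrow> (\<forall>x. \<exists>!a. (\<lambda>n. scl (a n) (e n)) sums x)"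

text \<open>\<open>has_sum\<close> is convergence along the net of finite subsets, i.e. unconditional convergence.\<close>

definition unconditional_basis ::
  "('k::{real_normed_field,euclidean_space} \<Rightarrow> 'a::banach \<Rightarrow> 'a) \<Rightarrow> (nat \<Rightarrow> 'a) \<Rightarrow> bool" where
  "unconditional_basis scl e \<longleftrightarrow> schauder_basis scl e \<and>
     (\<forall>x a. (\<lambda>n. scl (a n) (e n)) sums x \<longrightarrow> ((\<lambda>n. scl (a n) (e n)) has_sum x) UNIV)"

definition contains_l1n_uniformly ::
  "('k::{real_normed_field,euclidean_space} \<Rightarrow> 'a::banach \<Rightarrow> 'a) \<Rightarrow> bool" where
  "contains_l1n_uniformly scl \<longleftrightarrow>
     (\<exists>C::real. \<forall>n\<ge>1. \<exists>(x :: nat \<Rightarrow> 'a) (d::real) (D::real).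
        0 < d \<and> d \<le> D \<and> D / d \<le> C \<and>
        (\<forall>c :: nat \<Rightarrow> 'k.
           d * (\<Sum>i=1..n. norm (c i)) \<le> norm (\<Sum>i=1..n. scl (c i) (x i)) \<and>
           norm (\<Sum>i=1..n. scl (c i) (x i)) \<le> D * (\<Sum>i=1..n. norm (c i))))"

definition is_norm_on ::
  "('k::{real_normed_field,euclidean_space} \<Rightarrow> 'a::banach \<Rightarrow> 'a) \<Rightarrow> 'a set \<Rightarrow> ('a \<Rightarrow> real) \<Rightarrow> bool" where
  "is_norm_on scl Z N \<longleftrightarrow>
     (\<forall>x\<in>Z. 0 \<le> N x \<and> (N x = 0 \<longleftrightarrow> x = 0)) \<and>
     (\<forall>c. \<forall>x\<in>Z. N (scl c x) = norm c * N x) \<and>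
     (\<forall>x\<in>Z. \<forall>y\<in>Z. N (x + y) \<le> N x + N y)"

definition equivalent_norm_on ::
  "('k::{real_normed_field,euclidean_space} \<Rightarrow> 'a::banach \<Rightarrow> 'a) \<Rightarrow> 'a set \<Rightarrow> ('a \<Rightarrow> real) \<Rightarrow> bool" where
  "equivalent_norm_on scl Z N \<longleftrightarrow> is_norm_on scl Z N \<and>
     (\<exists>a b. 0 < a \<and> 0 < b \<and> (\<forall>x\<in>Z. a * norm x \<le> N x \<and> N x \<le> b * norm x))"

text \<open>
  Meant for infinite dimensional closed subspaces \<open>Z\<close>.  For \<open>N\<close> equivalent to the norm and
  \<open>Y \<noteq> {0}\<close> the set of quotients is nonempty and bounded, so the real-valued \<open>Sup\<close> is the supremum.
\<close>

definition distortable ::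
  "('k::{real_normed_field,euclidean_space} \<Rightarrow> 'a::banach \<Rightarrow> 'a) \<Rightarrow> 'a set \<Rightarrow> real \<Rightarrow> bool" where
  "distortable scl Z lam \<longleftrightarrow>
     (\<exists>N. equivalent_norm_on scl Z N \<and>
        (\<forall>Y. module.subspace scl Y \<and> Y \<subseteq> Z \<and> infinite_dimensional scl Y \<longrightarrow>
           Sup {N y / N z | y z. y \<in> Y \<and> z \<in> Y \<and> norm y = 1 \<and> norm z = 1} \<ge> lam))"

definition arbitrarily_distortable ::
  "('k::{real_normed_field,euclidean_space} \<Rightarrow> 'a::banach \<Rightarrow> 'a) \<Rightarrow> 'a set \<Rightarrow> bool" where
  "arbitrarily_distortable scl Z \<longleftrightarrow> (\<forall>lam>1. distortable scl Z lam)"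

end

theory Submission
  imports Defs
begin

text \<open>
  After renorming, the unconditional basis turns \<open>X\<close> into a lattice norm \<open>\<rho>\<close> on finitely supported
  nonnegative sequences, and the absence of \<open>\<ell>\<^sub>1\<^sup>n\<close> says that neither disjoint \<open>\<ell>\<^sub>\<infinity>\<^sup>n\<close> nor disjoint \<open>\<ell>\<^sub>1\<^sup>n\<close>
  occur uniformly in \<open>\<rho>\<close>.  It suffices that on every block sublattice, for every \<open>D\<close>, some equivalent
  lattice norm distorts a further block sublattice, together with all its block sublattices, by \<open>D\<close>: a
  diagonal block sequence then serves all \<open>D\<close>, and its closed span is the required subspace, because
  every infinite dimensional subspace of it almost contains blocks.

  Suppose that this fails for some \<open>D\<close>.  Applied to the norms \<open>sup \<Sum> \<rho> (E\<^sub>i x)\<close> over \<open>n\<close> successive sets, the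
  failure yields a block sublattice in which \<open>n\<close> successive blocks satisfy upper and lower estimates that
  match up to a constant, as in an asymptotic \<open>\<ell>\<^sub>p\<close> space.  By Lozanovskii's theorem a probability vector \<open>v\<close>
  factors as \<open>v = s s'\<close> with \<open>s\<close> in the unit ball of a Tsirelson space and \<open>s'\<close> in the dual unit ball.  The
  maximum of \<open>\<Sum> v ln s\<close> is an entropy whose defect under averaging cannot stay large, so among the
  averages of successive probability vectors there are some whose factor \<open>s\<close> is nearly an average of
  \<open>N\<close> unit vectors.  Such averages are nearly disjoint from mixtures of rapidly increasing sequences of
  them, while both kinds exist in the span of every sequence of successive probability vectors.

  A regular pair consists of \<open>y\<close> in \<open>X\<close> and a functional \<open>g\<close> with \<open>y g\<close> a probability vector such that sets
  of small \<open>y g\<close>-mass carry only a small part of the norms of \<open>y\<close> and \<open>g\<close>.  Every block sublattice contains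
  regular pairs, and the asymptotic estimates make averages of their products again products of regular
  pairs.  The functionals \<open>g\<close> belonging to mixtures define a norm that is large on the corresponding \<open>y\<close>
  and small on the \<open>y\<close> belonging to averages: a distortion by more than \<open>D\<close>.
\<close>

section \<open>Lattice norms on finitely supported sequences\<close>

text \<open>The Tsirelson space is auxiliary and unrelated to the norm of \<open>X\<close>. Products
  \<open>y g\<close> turn pairs from \<open>X\<close> into probability vectors, whose overlap is
  measured by \<open>\<Sum> min v w\<close>, without any norm. The way back exists because a
  suitably weighted sum of vectors times the matching sum of functionals is exactly the average of
  the products, so averages made for the Tsirelson space lift to \<open>X\<close>. Two opposite
  features of the Tsirelson space matter. Its lower estimate has a constant \<open>\<theta>\<close>
  independent of the number of vectors: averaging \<open>n\<close> successive vectors that start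
  late enough lowers the entropy by at least \<open>ln n - ln (1 / \<theta>)\<close>, while the loss
  never exceeds \<open>ln n\<close>. In a tall tower of nested averages the total defect thus stays
  below \<open>ln (1 / \<theta>)\<close>, and some level has a small one. On the other hand a sum of
  \<open>m\<close> rapidly increasing averages has norm at most \<open>1 + 2 * \<theta> * m\<close>,
  which bounds the overlap by a multiple of \<open>sqrt \<theta>\<close>. Hence
  \<open>\<theta>\<close> is fixed last, after the regularity thresholds of
  \<open>X\<close>.\<close>

definition supp :: "(nat \<Rightarrow> real) \<Rightarrow> nat set" where
  "supp f = {i. f i \<noteq> 0}"

definition c00_pos :: "(nat \<Rightarrow> real) set" where
  "c00_pos = {f. (\<forall>i. 0 \<le> f i) \<and> finite (supp f)}"

definition restr :: "nat set \<Rightarrow> (nat \<Rightarrow> real) \<Rightarrow> nat \<Rightarrow> real" where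
  "restr A f = (\<lambda>i. if i \<in> A then f i else 0)"

definition pairing :: "(nat \<Rightarrow> real) \<Rightarrow> (nat \<Rightarrow> real) \<Rightarrow> real" where
  "pairing f g = (\<Sum>i\<in>supp f. f i * g i)"

text \<open>All pairs of indices are compared, not only neighbours: members may be empty, and
  comparing neighbours would then say nothing about the sets on both sides of an empty one.\<close>

definition successive :: "nat \<Rightarrow> (nat \<Rightarrow> nat set) \<Rightarrow> bool" where
  "successive n A \<longleftrightarrow> (\<forall>i j. i < j \<longrightarrow> j < n \<longrightarrow> (\<forall>a\<in>A i. \<forall>b\<in>A j. a < b))"

definition unit :: "nat \<Rightarrow> nat \<Rightarrow> real" where
  "unit n = (\<lambda>i. if i = n then 1 else 0)"

lemma in_supp_iff: "i \<in> supp f \<longleftrightarrow> f i \<noteq> 0"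
  by (simp add: supp_def)

lemma c00_pos_subsetI: "(\<And>i. 0 \<le> f i) \<Longrightarrow> supp f \<subseteq> S \<Longrightarrow> finite S \<Longrightarrow> f \<in> c00_pos"
  by (simp add: c00_pos_def finite_subset)

lemma c00_pos_nonneg: "f \<in> c00_pos \<Longrightarrow> 0 \<le> f i"
  and c00_pos_finite: "f \<in> c00_pos \<Longrightarrow> finite (supp f)"
  by (simp_all add: c00_pos_def)

lemma c00_pos_zero [simp]: "(\<lambda>i. 0) \<in> c00_pos"
  by (simp add: c00_pos_def supp_def)

lemma c00_pos_mult:
  assumes "f \<in> c00_pos" "\<And>i. 0 \<le> g i"
  shows "(\<lambda>i. g i * f i) \<in> c00_pos"
  by (rule c00_pos_subsetI[where S="supp f"]) (use assms in \<open>auto simp: c00_pos_def supp_def\<close>)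

lemma c00_pos_scale: "f \<in> c00_pos \<Longrightarrow> 0 \<le> c \<Longrightarrow> (\<lambda>i. c * f i) \<in> c00_pos"
  using c00_pos_mult[of f "\<lambda>_. c"] by simp

lemma c00_pos_divide: "f \<in> c00_pos \<Longrightarrow> 0 \<le> c \<Longrightarrow> (\<lambda>i. f i / c) \<in> c00_pos"
  using c00_pos_mult[of f "\<lambda>_. 1 / c"] by simp

lemma c00_pos_add:
  assumes "f \<in> c00_pos" "g \<in> c00_pos" shows "(\<lambda>i. f i + g i) \<in> c00_pos"
  by (rule c00_pos_subsetI[where S="supp f \<union> supp g"])
    (use assms in \<open>auto simp: c00_pos_def supp_def\<close>)

lemma supp_sum_subset: "supp (\<lambda>k. \<Sum>i\<in>I. f i k) \<subseteq> (\<Union>i\<in>I. supp (f i))"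
  by (auto simp: supp_def dest: sum.not_neutral_contains_not_neutral)

lemma c00_pos_sum:
  assumes "finite I" "\<And>i. i \<in> I \<Longrightarrow> f i \<in> c00_pos"
  shows "(\<lambda>k. \<Sum>i\<in>I. f i k) \<in> c00_pos"
  by (rule c00_pos_subsetI[OF _ supp_sum_subset]) (use assms in \<open>auto simp: c00_pos_def intro!: sum_nonneg\<close>)

lemma c00_pos_restr: "f \<in> c00_pos \<Longrightarrow> restr A f \<in> c00_pos"
  by (rule c00_pos_subsetI[where S="supp f"]) (auto simp: c00_pos_def supp_def restr_def)

lemma c00_pos_unit: "unit n \<in> c00_pos"
  by (rule c00_pos_subsetI[where S="{n}"]) (auto simp: supp_def unit_def)

lemma supp_restr: "supp (restr A f) = A \<inter> supp f"
  by (auto simp: supp_def restr_def)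

lemma restr_le: "f \<in> c00_pos \<Longrightarrow> restr A f i \<le> f i"
  by (simp add: restr_def c00_pos_nonneg)

lemma pairing_superset:
  assumes "supp f \<subseteq> S" "finite S"
  shows "pairing f g = (\<Sum>i\<in>S. f i * g i)"
  unfolding pairing_def using assms
  by (intro sum.mono_neutral_left) (auto simp: supp_def)

lemma pairing_nonneg: "f \<in> c00_pos \<Longrightarrow> (\<And>i. 0 \<le> g i) \<Longrightarrow> 0 \<le> pairing f g"
  unfolding pairing_def by (intro sum_nonneg) (auto simp: c00_pos_def)

lemma pairing_add_left:
  assumes "f \<in> c00_pos" "f' \<in> c00_pos"
  shows "pairing (\<lambda>i. f i + f' i) g = pairing f g + pairing f' g"
proof -
  let ?S = "supp f \<union> supp f'"
  have fin: "finite ?S" using assms by (simp add: c00_pos_def)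
  have "supp (\<lambda>i. f i + f' i) \<subseteq> ?S" by (auto simp: supp_def)
  then show ?thesis using fin
    by (simp add: pairing_superset[of _ ?S] sum.distrib[symmetric] algebra_simps)
qed

lemma pairing_scale_left:
  assumes "f \<in> c00_pos" shows "pairing (\<lambda>i. c * f i) g = c * pairing f g"
proof -
  have "supp (\<lambda>i. c * f i) \<subseteq> supp f" by (auto simp: supp_def)
  then show ?thesis using assms
    by (simp add: pairing_superset[of _ "supp f"] c00_pos_def sum_distrib_left algebra_simps)
qed

lemma pairing_sum_left:
  assumes "finite I" "\<And>i. i \<in> I \<Longrightarrow> f i \<in> c00_pos"
  shows "pairing (\<lambda>k. \<Sum>i\<in>I. f i k) g = (\<Sum>i\<in>I. pairing (f i) g)"
  using assms
proof (induction I rule: finite_induct)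
  case empty
  then show ?case by (simp add: pairing_def supp_def)
next
  case (insert x F)
  have "(\<lambda>k. \<Sum>i\<in>insert x F. f i k) = (\<lambda>k. f x k + (\<Sum>i\<in>F. f i k))"
    using insert by auto
  then show ?case using insert by (simp add: pairing_add_left c00_pos_sum)
qed

lemma pairing_add_right: "pairing f (\<lambda>i. g i + g' i) = pairing f g + pairing f g'"
  by (simp add: pairing_def algebra_simps sum.distrib)

lemma pairing_scale_right: "pairing f (\<lambda>i. c * g i) = c * pairing f g"
  by (simp add: pairing_def algebra_simps sum_distrib_left)

lemma pairing_sum_right:
  "pairing f (\<lambda>k. \<Sum>i\<in>I. g i k) = (\<Sum>i\<in>I. pairing f (g i))"
  by (simp add: pairing_def sum_distrib_left) (rule sum.swap)

lemma pairing_mono_left: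
  assumes "f \<in> c00_pos" "f' \<in> c00_pos" "\<And>i. f i \<le> f' i" "\<And>i. 0 \<le> g i"
  shows "pairing f g \<le> pairing f' g"
proof -
  have "supp f \<subseteq> supp f'" using assms(1,3) unfolding c00_pos_def supp_def
    by auto (metis order_antisym_conv)
  then show ?thesis using assms
    by (simp add: pairing_superset[of _ "supp f'"] c00_pos_def sum_mono mult_right_mono)
qed

lemma pairing_mono_right:
  assumes "f \<in> c00_pos" "\<And>i. g i \<le> g' i"
  shows "pairing f g \<le> pairing f g'"
  unfolding pairing_def using assms by (intro sum_mono mult_left_mono) (auto simp: c00_pos_def)

lemma pairing_restr_right:
  assumes "f \<in> c00_pos"
  shows "pairing f (restr A g) = pairing (restr A f) g"
  using assms
  by (simp add: pairing_superset[of _ "supp f"] c00_pos_def supp_restr)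
    (rule sum.cong, auto simp: restr_def)

lemma restr_restr: "restr A (restr B f) = restr (A \<inter> B) f"
  by (auto simp: restr_def)

lemma restr_idem: "supp f \<subseteq> A \<Longrightarrow> restr A f = f"
  by (auto simp: restr_def supp_def fun_eq_iff)

lemma sum_restr_disjoint_le:
  assumes "f \<in> c00_pos" "finite I" "\<And>i j. i \<in> I \<Longrightarrow> j \<in> I \<Longrightarrow> i \<noteq> j \<Longrightarrow> A i \<inter> A j = {}"
  shows "(\<Sum>i\<in>I. restr (A i) f k) \<le> f k"
proof (cases "\<exists>i\<in>I. k \<in> A i")
  case True
  then obtain i where i: "i \<in> I" "k \<in> A i" by blast
  have "(\<Sum>j\<in>I. restr (A j) f k) = (\<Sum>j\<in>{i}. restr (A j) f k)"
    using i assms by (intro sum.mono_neutral_right) (auto simp: restr_def)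
  then show ?thesis using i by (simp add: restr_def)
next
  case False
  then show ?thesis using c00_pos_nonneg[OF assms(1)] by (simp add: restr_def)
qed

lemma successiveD: "successive n A \<Longrightarrow> i < j \<Longrightarrow> j < n \<Longrightarrow> a \<in> A i \<Longrightarrow> b \<in> A j \<Longrightarrow> a < b"
  unfolding successive_def by blast

lemma successive_disjoint:
  "successive n A \<Longrightarrow> i < n \<Longrightarrow> j < n \<Longrightarrow> i \<noteq> j \<Longrightarrow> A i \<inter> A j = {}"
proof (rule ccontr)
  assume h: "successive n A" "i < n" "j < n" "i \<noteq> j" "A i \<inter> A j \<noteq> {}"
  then obtain a where a: "a \<in> A i" "a \<in> A j" by blast
  have "i < j \<or> j < i" using h(4) by linarith
  then have "a < a"
    using successiveD[OF h(1) _ h(3) a] successiveD[OF h(1) _ h(2) a(2,1)] by blast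
  then show False by simp
qed

lemma successive_subset:
  "successive n A \<Longrightarrow> (\<And>i. i < n \<Longrightarrow> B i \<subseteq> A i) \<Longrightarrow> successive n B"
proof (unfold successive_def, intro allI impI ballI)
  fix i j a b
  assume h: "\<forall>i j. i < j \<longrightarrow> j < n \<longrightarrow> (\<forall>a\<in>A i. \<forall>b\<in>A j. a < b)"
    "\<And>i. i < n \<Longrightarrow> B i \<subseteq> A i" "i < j" "j < n" "a \<in> B i" "b \<in> B j"
  have "i < n" using h(3,4) by simp
  then have "a \<in> A i" using h(2) h(5) by blast
  moreover have "b \<in> A j" using h(2)[OF h(4)] h(6) by blast
  ultimately show "a < b" using h(1,3,4) by blast
qed

text \<open>Along the pairs of overlapping members of two successive families both indices are
  nondecreasing, so the sum of the indices determines the pair.\<close>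

lemma sum_overlaps_le:
  assumes A: "successive n A" and B: "successive m B"
    and le: "\<And>i j. i < n \<Longrightarrow> j < m \<Longrightarrow> F i j \<le> (c::real)"
    and zero: "\<And>i j. i < n \<Longrightarrow> j < m \<Longrightarrow> A i \<inter> B j = {} \<Longrightarrow> F i j \<le> 0" and "0 \<le> c"
  shows "(\<Sum>i<n. \<Sum>j<m. F i j) \<le> c * (real n + real m)"
proof -
  define P where "P = {p \<in> {..<n} \<times> {..<m}. A (fst p) \<inter> B (snd p) \<noteq> {}}"
  have no: False if ij: "(i, j) \<in> P" "(i', j') \<in> P" "i < i'" "j' < j" for i j i' j'
  proof -
    obtain x x' where "x \<in> A i" "x \<in> B j" "x' \<in> A i'" "x' \<in> B j'"
      using ij by (auto simp: P_def)
    moreover have "i' < n" "j < m" using ij by (auto simp: P_def)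
    ultimately have "x < x'" "x' < x" using successiveD[OF A ij(3)] successiveD[OF B ij(4)] by auto
    then show False by simp
  qed
  have "inj_on (\<lambda>(i, j). i + j) P"
  proof (rule inj_onI, clarsimp)
    fix i j i' j' assume h: "(i, j) \<in> P" "(i', j') \<in> P" "i + j = i' + j'"
    show "i = i' \<and> j = j'"
    proof (cases i i' rule: linorder_cases)
      case less
      then have "j' < j" using h(3) by simp
      then show ?thesis using no[OF h(1,2) less] by simp
    next
      case equal
      then show ?thesis using h(3) by simp
    next
      case greater
      then have "j < j'" using h(3) by simp
      then show ?thesis using no[OF h(2,1) greater] by simp
    qed
  qed
  moreover have "(\<lambda>(i, j). i + j) ` P \<subseteq> {..<n + m}" by (auto simp: P_def)
  ultimately have card: "card P \<le> n + m"
    using card_mono[of "{..<n + m}" "(\<lambda>(i, j). i + j) ` P"] by (simp add: card_image)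
  have "(\<Sum>i<n. \<Sum>j<m. F i j) = (\<Sum>p\<in>{..<n} \<times> {..<m}. F (fst p) (snd p))"
    by (simp add: sum.cartesian_product split_def)
  also have "\<dots> \<le> (\<Sum>p\<in>{..<n} \<times> {..<m}. if p \<in> P then c else 0)"
    by (intro sum_mono) (use le zero in \<open>auto simp: P_def\<close>)
  also have "\<dots> = (\<Sum>p\<in>({..<n} \<times> {..<m}) \<inter> P. c)"
    by (subst sum.inter_restrict) auto
  also have "({..<n} \<times> {..<m}) \<inter> P = P" by (auto simp: P_def)
  also have "(\<Sum>p\<in>P. c) = real (card P) * c" by simp
  also have "\<dots> \<le> real (n + m) * c" using card assms(5) by (intro mult_right_mono) auto
  finally show ?thesis by (simp add: mult.commute)
qed

section \<open>Lattice norms, dual norms and norming functionals\<close>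

definition mass :: "(nat \<Rightarrow> real) \<Rightarrow> real" where
  "mass v = sum v (supp v)"

lemma mass_superset: "supp v \<subseteq> S \<Longrightarrow> finite S \<Longrightarrow> mass v = sum v S"
  unfolding mass_def by (intro sum.mono_neutral_left) (auto simp: supp_def)

text \<open>Only the positive cone is axiomatized. A lattice norm is determined by its values on
  moduli, so the scalar field disappears from the whole combinatorial part.\<close>

locale lattice_norm =
  fixes \<rho> :: "(nat \<Rightarrow> real) \<Rightarrow> real"
  assumes nonneg: "f \<in> c00_pos \<Longrightarrow> 0 \<le> \<rho> f"
    and definite: "f \<in> c00_pos \<Longrightarrow> \<rho> f = 0 \<Longrightarrow> f = (\<lambda>i. 0)"
    and scale: "f \<in> c00_pos \<Longrightarrow> 0 \<le> c \<Longrightarrow> \<rho> (\<lambda>i. c * f i) = c * \<rho> f"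
    and triangle: "f \<in> c00_pos \<Longrightarrow> g \<in> c00_pos \<Longrightarrow> \<rho> (\<lambda>i. f i + g i) \<le> \<rho> f + \<rho> g"
    and mono: "f \<in> c00_pos \<Longrightarrow> g \<in> c00_pos \<Longrightarrow> (\<And>i. f i \<le> g i) \<Longrightarrow> \<rho> f \<le> \<rho> g"

text \<open>For nonnegative \<open>g\<close> this bounds the dual norm by \<open>C\<close>; testing
  on the positive cone is then enough.\<close>

definition dominated :: "((nat \<Rightarrow> real) \<Rightarrow> real) \<Rightarrow> (nat \<Rightarrow> real) \<Rightarrow> real \<Rightarrow> bool" where
  "dominated \<rho> g C \<longleftrightarrow> (\<forall>x\<in>c00_pos. pairing x g \<le> C * \<rho> x)"

lemma dominatedD: "dominated \<rho> g C \<Longrightarrow> x \<in> c00_pos \<Longrightarrow> pairing x g \<le> C * \<rho> x"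
  by (simp add: dominated_def)

context lattice_norm
begin

lemma zero: "\<rho> (\<lambda>i. 0) = 0"
  using scale[of "\<lambda>i. 0" 0] by simp

lemma pos: "f \<in> c00_pos \<Longrightarrow> f i \<noteq> 0 \<Longrightarrow> 0 < \<rho> f"
  using nonneg[of f] definite[of f] by fastforce

lemma sum_le:
  assumes "finite I" "\<And>i. i \<in> I \<Longrightarrow> f i \<in> c00_pos"
  shows "\<rho> (\<lambda>k. \<Sum>i\<in>I. f i k) \<le> (\<Sum>i\<in>I. \<rho> (f i))"
  using assms
proof (induction I rule: finite_induct)
  case empty
  then show ?case by (simp add: zero)
next
  case (insert x F)
  have "(\<lambda>k. \<Sum>i\<in>insert x F. f i k) = (\<lambda>k. f x k + (\<Sum>i\<in>F. f i k))"
    using insert by auto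
  moreover have "\<rho> (\<lambda>k. f x k + (\<Sum>i\<in>F. f i k)) \<le> \<rho> (f x) + \<rho> (\<lambda>k. \<Sum>i\<in>F. f i k)"
    using insert by (intro triangle c00_pos_sum) auto
  ultimately show ?case using insert by simp
qed

lemma restr_mono: "f \<in> c00_pos \<Longrightarrow> \<rho> (restr A f) \<le> \<rho> f"
  by (intro mono) (auto simp: c00_pos_restr restr_le)

lemma normalize:
  assumes "f \<in> c00_pos" "f i \<noteq> 0"
  shows "(\<lambda>i. f i / \<rho> f) \<in> c00_pos" "\<rho> (\<lambda>i. f i / \<rho> f) = 1"
  using scale[of f "1 / \<rho> f"] pos[OF assms] assms by (auto intro: c00_pos_divide)

lemma dominated_mono:
  assumes "dominated \<rho> g C" "\<And>i. g' i \<le> g i" "C \<le> C'"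
  shows "dominated \<rho> g' C'"
  unfolding dominated_def
proof
  fix x assume x: "x \<in> c00_pos"
  have "pairing x g' \<le> pairing x g" by (intro pairing_mono_right x assms)
  also have "\<dots> \<le> C * \<rho> x" using assms x by (simp add: dominated_def)
  also have "\<dots> \<le> C' * \<rho> x" using assms nonneg[OF x] by (simp add: mult_right_mono)
  finally show "pairing x g' \<le> C' * \<rho> x" .
qed

lemma dominated_restr:
  assumes "dominated \<rho> g C" "\<And>i. 0 \<le> g i"
  shows "dominated \<rho> (restr A g) C"
  by (rule dominated_mono[OF assms(1)]) (use assms in \<open>auto simp: restr_def\<close>)

lemma dominated_scale:
  assumes "dominated \<rho> g C" "0 \<le> c"
  shows "dominated \<rho> (\<lambda>i. c * g i) (c * C)"
  using assms by (simp add: dominated_def pairing_scale_right mult_left_mono mult.assoc)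

lemma dominated_sum:
  assumes "\<And>i. i \<in> I \<Longrightarrow> dominated \<rho> (g i) (C i)"
  shows "dominated \<rho> (\<lambda>k. \<Sum>i\<in>I. g i k) (\<Sum>i\<in>I. C i)"
  using assms by (simp add: dominated_def pairing_sum_right sum_distrib_right sum_mono)

text \<open>Hahn-Banach, one coordinate at a time, for the sublinear functional that sends
  \<open>x\<close> to \<open>\<rho>\<close> of its positive part; the positive part is what will
  make the functional positive. The scalar \<open>t\<close> is kept as a formal variable, so it does
  not matter whether \<open>y\<close> already lies in the span of the coordinates treated.\<close>

lemma norming_extension:
  fixes y :: "nat \<Rightarrow> real"
  assumes y: "y \<in> c00_pos"
  shows "\<exists>g. \<forall>t x. supp x \<subseteq> {..<n} \<longrightarrow>
    t * \<rho> y + (\<Sum>i<n. g i * x i) \<le> \<rho> (\<lambda>i. max 0 (t * y i + x i))"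
proof (induction n)
  case 0
  have "t * \<rho> y \<le> \<rho> (\<lambda>i. max 0 (t * y i))" for t
  proof (cases "t \<ge> 0")
    case True
    then have "(\<lambda>i. max 0 (t * y i)) = (\<lambda>i. t * y i)" using y by (auto simp: c00_pos_def)
    then show ?thesis using scale[OF y True] by simp
  next
    case False
    then have "(\<lambda>i. max 0 (t * y i)) = (\<lambda>i. 0)" using y
      by (auto simp: c00_pos_def max_def fun_eq_iff mult_nonpos_nonneg order_antisym)
    then show ?thesis using False nonneg[OF y] by (simp add: zero mult_nonpos_nonneg)
  qed
  then show ?case by (auto simp: supp_def)
next
  case (Suc n)
  then obtain g where g: "\<And>t x. supp x \<subseteq> {..<n} \<Longrightarrow>
    t * \<rho> y + (\<Sum>i<n. g i * x i) \<le> \<rho> (\<lambda>i. max 0 (t * y i + x i))" by blast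
  define L where "L = (\<lambda>t x. t * \<rho> y + (\<Sum>i<n. g i * x i))"
  define q where "q = (\<lambda>x. \<rho> (\<lambda>i. max 0 (x i)))"
  define e where "e = unit n"
  have mem: "(\<lambda>i. max 0 (x i)) \<in> c00_pos" if "finite (supp x)" for x :: "nat \<Rightarrow> real"
    using that by (auto intro!: c00_pos_subsetI[where S="supp x"] simp: supp_def)
  have finy: "finite (supp (\<lambda>i. t * y i + x i + s * e i))" if "supp x \<subseteq> {..<n}" for t x s
    by (rule finite_subset[of _ "supp y \<union> {..n}"])
      (use that y in \<open>auto simp: supp_def e_def unit_def c00_pos_def split: if_splits\<close>)
  have q_add: "q (\<lambda>i. x i + x' i) \<le> q x + q x'" if "finite (supp x)" "finite (supp x')" for x x'
  proof -
    have f3: "finite (supp (\<lambda>i. x i + x' i))"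
      by (rule finite_subset[of _ "supp x \<union> supp x'"]) (use that in \<open>auto simp: supp_def\<close>)
    have "q (\<lambda>i. x i + x' i) \<le> \<rho> (\<lambda>i. max 0 (x i) + max 0 (x' i))"
      unfolding q_def by (intro mono c00_pos_add mem that f3) (auto simp: max_def)
    also have "\<dots> \<le> q x + q x'" unfolding q_def by (intro triangle mem that)
    finally show ?thesis .
  qed
  have q_scale: "q (\<lambda>i. c * x i) = c * q x" if "finite (supp x)" "c > 0" for x c
  proof -
    have "(\<lambda>i. max 0 (c * x i)) = (\<lambda>i. c * max 0 (x i))"
      using that by (auto simp: max_def fun_eq_iff zero_le_mult_iff)
    then show ?thesis using scale[OF mem[OF that(1)], of c] that unfolding q_def by simp
  qed
  \<comment> \<open>Sublinearity puts every lower bound for the new coefficient below every upper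
    bound, so an admissible value \<open>c\<close> exists.\<close>
  have key: "L t x - q (\<lambda>i. t * y i + x i + (-1) * e i) \<le> q (\<lambda>i. t' * y i + x' i + 1 * e i) - L t' x'"
    if "supp x \<subseteq> {..<n}" "supp x' \<subseteq> {..<n}" for t x t' x'
  proof -
    have "L t x + L t' x' = L (t + t') (\<lambda>i. x i + x' i)"
      by (simp add: L_def algebra_simps sum.distrib)
    also have "\<dots> \<le> q (\<lambda>i. (t + t') * y i + (x i + x' i))"
      unfolding L_def q_def by (rule g) (use that in \<open>auto simp: supp_def subset_eq, force\<close>)
    also have "\<dots> = q (\<lambda>i. (t * y i + x i + (-1) * e i) + (t' * y i + x' i + 1 * e i))"
      by (simp add: algebra_simps)
    also have "\<dots> \<le> q (\<lambda>i. t * y i + x i + (-1) * e i) + q (\<lambda>i. t' * y i + x' i + 1 * e i)"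
      by (intro q_add finy that)
    finally show ?thesis by simp
  qed
  define M where "M = {L t x - q (\<lambda>i. t * y i + x i + (-1) * e i) | t x. supp x \<subseteq> {..<n}}"
  define c where "c = Sup M"
  have z: "supp (\<lambda>i. 0) \<subseteq> {..<n}" by (simp add: supp_def)
  have ne: "M \<noteq> {}" using z unfolding M_def by blast
  have bdd: "bdd_above M" unfolding M_def bdd_above_def using key[OF _ z] by blast
  have lo: "L t x - q (\<lambda>i. t * y i + x i + (-1) * e i) \<le> c" if "supp x \<subseteq> {..<n}" for t x
    unfolding c_def by (intro cSup_upper bdd) (use that in \<open>auto simp: M_def\<close>)
  have hi: "c \<le> q (\<lambda>i. t * y i + x i + 1 * e i) - L t x" if "supp x \<subseteq> {..<n}" for t x
    unfolding c_def by (intro cSup_least ne) (use that key in \<open>auto simp: M_def\<close>)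
  show ?case
  proof (intro exI[of _ "g(n := c)"] allI impI)
    fix t x assume x: "supp x \<subseteq> {..<Suc n}"
    define s x0 where "s = x n" and "x0 = x(n := 0)"
    have x0: "supp x0 \<subseteq> {..<n}" using x by (auto simp: x0_def supp_def less_Suc_eq)
    have xe: "x i = x0 i + s * e i" for i by (simp add: x0_def s_def e_def unit_def)
    have Lx: "t * \<rho> y + (\<Sum>i<Suc n. (g(n := c)) i * x i) = L t x0 + s * c"
      by (simp add: L_def x0_def s_def mult.commute)
    have "L t x0 + s * c \<le> q (\<lambda>i. t * y i + x0 i + s * e i)"
    proof (cases "s = 0")
      case True
      then show ?thesis using g[OF x0, of t] by (simp add: L_def q_def)
    next
      case False
      \<comment> \<open>By homogeneity only the coefficients 1 and -1 of the new coordinate have to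
        be checked; these cases are \<open>hi\<close> and \<open>lo\<close>.\<close>
      define r where "r = \<bar>s\<bar>"
      have r: "r > 0" using False by (simp add: r_def)
      have xr: "supp (\<lambda>i. x0 i / r) \<subseteq> {..<n}" using x0 by (auto simp: supp_def)
      have Lr: "L t x0 = r * L (t / r) (\<lambda>i. x0 i / r)"
        using r by (simp add: L_def distrib_left sum_distrib_left)
      define sg where "sg = s / r"
      have sg: "sg = 1 \<or> sg = -1" using False by (auto simp: sg_def r_def abs_if)
      have "L (t / r) (\<lambda>i. x0 i / r) + sg * c \<le> q (\<lambda>i. (t / r) * y i + x0 i / r + sg * e i)"
        using lo[OF xr, of "t / r"] hi[OF xr, of "t / r"] sg by auto
      then have "r * (L (t / r) (\<lambda>i. x0 i / r) + sg * c) \<le> r * q (\<lambda>i. (t / r) * y i + x0 i / r + sg * e i)"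
        using r by simp
      also have "\<dots> = q (\<lambda>i. r * ((t / r) * y i + x0 i / r + sg * e i))"
        using q_scale[OF finy[OF xr, of "t / r" sg] r] by simp
      also have "(\<lambda>i. r * ((t / r) * y i + x0 i / r + sg * e i)) = (\<lambda>i. t * y i + x0 i + s * e i)"
        using r by (simp add: distrib_left sg_def)
      finally show ?thesis using r by (simp add: Lr distrib_left sg_def)
    qed
    then show "t * \<rho> y + (\<Sum>i<Suc n. (g(n := c)) i * x i) \<le> \<rho> (\<lambda>i. max 0 (t * y i + x i))"
      unfolding Lx q_def by (simp add: xe add.assoc)
  qed
qed

lemma norming_functional:
  assumes y: "y \<in> c00_pos"
  obtains g where "g \<in> c00_pos" "supp g \<subseteq> supp y" "pairing y g = \<rho> y" "dominated \<rho> g 1"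
proof -
  obtain n where n: "supp y \<subseteq> {..<n}"
    using c00_pos_finite[OF y] by (meson finite_nat_iff_bounded)
  obtain g where g: "\<And>t x. supp x \<subseteq> {..<n} \<Longrightarrow>
    t * \<rho> y + (\<Sum>i<n. g i * x i) \<le> \<rho> (\<lambda>i. max 0 (t * y i + x i))"
    using norming_extension[OF y, of n] by blast
  define h where "h = restr (supp y) g"
  \<comment> \<open>Tested at the negative of a unit vector, whose positive part vanishes.\<close>
  have g0: "0 \<le> g i" if "i < n" for i
  proof -
    have "(\<Sum>j<n. g j * (- unit i j)) \<le> \<rho> (\<lambda>j. max 0 (- unit i j))"
      using g[of "\<lambda>j. - unit i j" 0] that by (auto simp: supp_def unit_def split: if_splits)
    moreover have "(\<lambda>j. max 0 (- unit i j)) = (\<lambda>j. 0)" by (auto simp: unit_def)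
    moreover have "(\<Sum>j<n. g j * (- unit i j)) = - g i"
      using that by (simp add: unit_def sum_negf if_distrib[of "\<lambda>x. _ * x"] sum.delta cong: if_cong)
    ultimately show ?thesis by (simp add: zero)
  qed
  have h: "h \<in> c00_pos"
    by (rule c00_pos_subsetI[where S="supp y"])
      (use g0 n c00_pos_finite[OF y] in \<open>auto simp: h_def restr_def supp_def\<close>)
  have dom: "dominated \<rho> h 1" unfolding dominated_def
  proof
    fix x assume x: "x \<in> c00_pos"
    let ?x = "restr (supp y) x"
    have sx: "supp ?x \<subseteq> {..<n}" using n by (auto simp: supp_restr)
    have "pairing x h = pairing ?x g" unfolding h_def by (rule pairing_restr_right[OF x])
    also have "\<dots> = (\<Sum>i<n. g i * ?x i)"
      by (subst pairing_superset[OF sx]) (simp_all add: mult.commute)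
    also have "\<dots> \<le> \<rho> (\<lambda>i. max 0 (?x i))" using g[OF sx, of 0] by simp
    also have "(\<lambda>i. max 0 (?x i)) = ?x" using c00_pos_nonneg[OF c00_pos_restr[OF x]] by simp
    also have "\<rho> ?x \<le> \<rho> x" by (rule restr_mono[OF x])
    finally show "pairing x h \<le> 1 * \<rho> x" by simp
  qed
  \<comment> \<open>The choice \<open>t = 1\<close>, \<open>x = - y\<close> ties the formal variable
    \<open>t\<close> back to \<open>y\<close> and yields the norming property.\<close>
  have "\<rho> y + (\<Sum>i<n. g i * (- y i)) \<le> \<rho> (\<lambda>i. max 0 (0::real))"
    using g[of "\<lambda>i. - y i" 1] n by (auto simp: supp_def)
  then have "\<rho> y \<le> (\<Sum>i<n. y i * g i)" by (simp add: zero sum_negf mult.commute)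
  also have "\<dots> = pairing y g" by (rule pairing_superset[symmetric]) (use n in auto)
  also have "\<dots> = pairing y h" unfolding h_def by (simp add: pairing_restr_right[OF y] restr_idem)
  finally have "pairing y h = \<rho> y" using dominatedD[OF dom y] by simp
  then show ?thesis using that[OF h _ _ dom] by (auto simp: h_def supp_restr)
qed

end

section \<open>Tsirelson spaces\<close>

text \<open>The norming set of Figiel and Johnson, nonnegative functionals only. Admissibility, that
  \<open>n\<close> functionals are combined only beyond position \<open>n\<close>, is what separates
  the space from \<open>l_1\<close> when \<open>\<theta> < 1\<close>.\<close>

inductive tsirelson :: "real \<Rightarrow> (nat \<Rightarrow> real) \<Rightarrow> bool" for \<theta> where
  zero: "tsirelson \<theta> (\<lambda>k. 0)"
| unit: "tsirelson \<theta> (unit n)"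
| step: "(\<And>i. i < n \<Longrightarrow> tsirelson \<theta> (f i)) \<Longrightarrow> successive n (\<lambda>i. supp (f i)) \<Longrightarrow>
    (\<And>i k. i < n \<Longrightarrow> k \<in> supp (f i) \<Longrightarrow> n \<le> k) \<Longrightarrow> tsirelson \<theta> (\<lambda>k. \<theta> * (\<Sum>i<n. f i k))"

definition tsirelson_norm :: "real \<Rightarrow> (nat \<Rightarrow> real) \<Rightarrow> real" where
  "tsirelson_norm \<theta> x = (SUP f\<in>{f. tsirelson \<theta> f}. pairing x f)"

lemma sum_successive_le:
  assumes "successive n (\<lambda>i. supp (f i))" "\<And>i. i < n \<Longrightarrow> f i k \<le> c" "0 \<le> c"
  shows "(\<Sum>i<n. f i k) \<le> (c::real)"
proof (cases "\<exists>i<n. f i k \<noteq> 0")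
  case True
  then obtain i where i: "i < n" "f i k \<noteq> 0" by blast
  have "f j k = 0" if "j < n" "j \<noteq> i" for j
    using successive_disjoint[OF assms(1) i(1) that(1)] that i by (auto simp: supp_def)
  then have "(\<Sum>j<n. f j k) = (\<Sum>j\<in>{i}. f j k)"
    using i by (intro sum.mono_neutral_right) auto
  then show ?thesis using assms(2)[OF i(1)] by simp
next
  case False
  then show ?thesis using assms by simp
qed

locale tsirelson_space =
  fixes \<theta> :: real
  assumes theta: "0 < \<theta>" "\<theta> \<le> 1"
begin

abbreviation "\<tau> \<equiv> tsirelson_norm \<theta>"

lemma tsirelson_c00_pos: "tsirelson \<theta> f \<Longrightarrow> f \<in> c00_pos \<and> (\<forall>k. f k \<le> 1)"
proof (induction rule: tsirelson.induct)
  case zero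
  show ?case by simp
next
  case (unit n)
  show ?case using c00_pos_unit by (auto simp: unit_def)
next
  case (step n f)
  then have f: "f i \<in> c00_pos" "f i k \<le> 1" if "i < n" for i k using that by auto
  have "(\<Sum>i<n. f i k) \<le> 1" for k
    by (rule sum_successive_le) (use step f in auto)
  moreover have "0 \<le> (\<Sum>i<n. f i k)" for k using f by (intro sum_nonneg) (auto simp: c00_pos_def)
  ultimately have "\<theta> * (\<Sum>i<n. f i k) \<le> 1" for k
    using theta mult_le_one[of \<theta> "\<Sum>i<n. f i k"] by simp
  then show ?case using f theta by (auto intro!: c00_pos_scale c00_pos_sum)
qed

lemma tsirelson_restr: "tsirelson \<theta> f \<Longrightarrow> tsirelson \<theta> (restr A f)"
proof (induction rule: tsirelson.induct)
  case zero
  then show ?case using tsirelson.zero by (simp add: restr_def)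
next
  case (unit n)
  have "restr A (unit n) = (if n \<in> A then unit n else (\<lambda>k. 0))"
    by (auto simp: restr_def unit_def fun_eq_iff)
  then show ?case by (simp add: tsirelson.zero tsirelson.unit)
next
  case (step n f)
  have eq: "restr A (\<lambda>k. \<theta> * (\<Sum>i<n. f i k)) = (\<lambda>k. \<theta> * (\<Sum>i<n. restr A (f i) k))"
    by (auto simp: restr_def)
  show ?case unfolding eq
  proof (rule tsirelson.step)
    show "successive n (\<lambda>i. supp (restr A (f i)))"
      by (rule successive_subset[OF \<open>successive n (\<lambda>i. supp (f i))\<close>]) (simp add: supp_restr)
  qed (use step in \<open>auto simp: supp_restr\<close>)
qed

lemma pairing_le_sum: "x \<in> c00_pos \<Longrightarrow> tsirelson \<theta> f \<Longrightarrow> pairing x f \<le> mass x"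
  unfolding pairing_def mass_def using tsirelson_c00_pos[of f]
  by (intro sum_mono) (auto simp: c00_pos_def intro: mult_left_le)

lemma bdd_pairing: "x \<in> c00_pos \<Longrightarrow> bdd_above ((\<lambda>f. pairing x f) ` {f. tsirelson \<theta> f})"
  using pairing_le_sum unfolding bdd_above_def by blast

lemma pairing_le_norm: "x \<in> c00_pos \<Longrightarrow> tsirelson \<theta> f \<Longrightarrow> pairing x f \<le> \<tau> x"
  unfolding tsirelson_norm_def by (intro cSUP_upper bdd_pairing) auto

lemma norm_leI: "(\<And>f. tsirelson \<theta> f \<Longrightarrow> pairing x f \<le> B) \<Longrightarrow> \<tau> x \<le> B"
  unfolding tsirelson_norm_def by (intro cSUP_least) (use tsirelson.zero in auto)

lemma norm_attained_approx:
  assumes "x \<in> c00_pos" "\<epsilon> > 0"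
  obtains f where "tsirelson \<theta> f" "\<tau> x - \<epsilon> < pairing x f"
  using less_cSUP_iff[of "{f. tsirelson \<theta> f}" "pairing x" "\<tau> x - \<epsilon>"] bdd_pairing[OF assms(1)]
    assms tsirelson.zero unfolding tsirelson_norm_def by auto

lemma pairing_unit: "x \<in> c00_pos \<Longrightarrow> pairing x (unit k) = x k"
  by (subst pairing_superset[of _ "insert k (supp x)"])
    (auto simp: c00_pos_def unit_def if_distrib[of "\<lambda>y. _ * y"] supp_def cong: if_cong)

lemma coordinate_le_norm: "x \<in> c00_pos \<Longrightarrow> x k \<le> \<tau> x"
  using pairing_le_norm[OF _ tsirelson.unit, of x k] by (simp add: pairing_unit)

lemma norm_nonneg: "x \<in> c00_pos \<Longrightarrow> 0 \<le> \<tau> x"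
  using coordinate_le_norm[of x 0] c00_pos_nonneg[of x 0] by simp

sublocale lattice_norm \<tau>
proof
  fix f g :: "nat \<Rightarrow> real" and c :: real
  assume f: "f \<in> c00_pos"
  show "0 \<le> \<tau> f" by (rule norm_nonneg[OF f])
  show "f = (\<lambda>i. 0)" if "\<tau> f = 0"
    using coordinate_le_norm[OF f] c00_pos_nonneg[OF f] that by (auto intro!: ext order_antisym)
  have le: "\<tau> (\<lambda>i. c * f i) \<le> c * \<tau> f" if "f \<in> c00_pos" "0 \<le> c" for f c
    by (rule norm_leI) (simp add: that pairing_scale_left pairing_le_norm mult_left_mono)
  show "\<tau> (\<lambda>i. c * f i) = c * \<tau> f" if c: "0 \<le> c"
  proof (cases "c = 0")
    case True
    then show ?thesis using le[of f 0] norm_nonneg[OF c00_pos_zero] f by simp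
  next
    case False
    have "\<tau> (\<lambda>i. (1 / c) * (c * f i)) \<le> (1 / c) * \<tau> (\<lambda>i. c * f i)"
      by (intro le c00_pos_scale f c) (use c in auto)
    then have "c * \<tau> f \<le> \<tau> (\<lambda>i. c * f i)" using False c by (simp add: field_simps)
    then show ?thesis using le[OF f c] by simp
  qed
  assume g: "g \<in> c00_pos"
  show "\<tau> (\<lambda>i. f i + g i) \<le> \<tau> f + \<tau> g"
    by (rule norm_leI) (simp add: f g pairing_add_left pairing_le_norm add_mono)
  show "\<tau> f \<le> \<tau> g" if "\<And>i. f i \<le> g i"
  proof (rule norm_leI)
    fix h assume h: "tsirelson \<theta> h"
    then have "pairing f h \<le> pairing g h"
      using f g that tsirelson_c00_pos[OF h] by (intro pairing_mono_left) (auto simp: c00_pos_def)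
    then show "pairing f h \<le> \<tau> g" using pairing_le_norm[OF g h] by simp
  qed
qed

lemma norm_le_mass: "x \<in> c00_pos \<Longrightarrow> \<tau> x \<le> mass x"
  by (rule norm_leI) (rule pairing_le_sum)

text \<open>Almost norming functionals of the pieces, cut down to the supports of the pieces, form
  an admissible family, and combining them by \<open>step\<close> stays in the norming set.\<close>

lemma lower_l1_estimate:
  assumes s: "\<And>i. i < n \<Longrightarrow> s i \<in> c00_pos" and suc: "successive n (\<lambda>i. supp (s i))"
    and adm: "\<And>i k. i < n \<Longrightarrow> k \<in> supp (s i) \<Longrightarrow> n \<le> k"
  shows "\<theta> * (\<Sum>i<n. \<tau> (s i)) \<le> \<tau> (\<lambda>k. \<Sum>i<n. s i k)"
proof (rule field_le_epsilon)
  fix \<epsilon> :: real assume e: "\<epsilon> > 0"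
  define d where "d = \<epsilon> / (real n + 1)"
  have d: "d > 0" using e by (simp add: d_def)
  have "\<forall>i. \<exists>f. i < n \<longrightarrow> tsirelson \<theta> f \<and> \<tau> (s i) - d < pairing (s i) f"
    using norm_attained_approx[OF s d] by metis
  then obtain f where f: "\<And>i. i < n \<Longrightarrow> tsirelson \<theta> (f i)"
    "\<And>i. i < n \<Longrightarrow> \<tau> (s i) - d < pairing (s i) (f i)" by metis
  define h where "h = (\<lambda>k. \<theta> * (\<Sum>i<n. restr (supp (s i)) (f i) k))"
  have h: "tsirelson \<theta> h" unfolding h_def
    by (rule tsirelson.step)
      (use f adm in \<open>auto simp: supp_restr tsirelson_restr intro!: successive_subset[OF suc]\<close>)
  have "pairing (\<lambda>k. \<Sum>j<n. s j k) (restr (supp (s i)) (f i)) \<ge> pairing (s i) (f i)" if i: "i < n" for i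
  proof -
    have fi: "0 \<le> restr (supp (s i)) (f i) k" for k
      using tsirelson_c00_pos[OF f(1)[OF i]] by (simp add: restr_def c00_pos_def)
    have "pairing (s i) (f i) = pairing (s i) (restr (supp (s i)) (f i))"
      by (simp add: pairing_def restr_def cong: sum.cong)
    also have "\<dots> \<le> (\<Sum>j<n. pairing (s j) (restr (supp (s i)) (f i)))"
      by (rule member_le_sum) (use i s fi in \<open>auto intro!: pairing_nonneg\<close>)
    also have "\<dots> = pairing (\<lambda>k. \<Sum>j<n. s j k) (restr (supp (s i)) (f i))"
      using s by (intro pairing_sum_left[symmetric]) auto
    finally show ?thesis .
  qed
  then have "(\<Sum>i<n. pairing (s i) (f i)) \<le> (\<Sum>i<n. pairing (\<lambda>k. \<Sum>j<n. s j k) (restr (supp (s i)) (f i)))"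
    by (intro sum_mono) auto
  moreover have "(\<Sum>i<n. \<tau> (s i)) - real n * d \<le> (\<Sum>i<n. pairing (s i) (f i))"
    using sum_mono[of "{..<n}" "\<lambda>i. \<tau> (s i) - d" "\<lambda>i. pairing (s i) (f i)"] f(2)
    by (force simp: sum_subtractf)
  ultimately have "\<theta> * ((\<Sum>i<n. \<tau> (s i)) - real n * d) \<le> pairing (\<lambda>k. \<Sum>j<n. s j k) h"
    unfolding h_def pairing_scale_right pairing_sum_right using theta by (intro mult_left_mono) auto
  also have "\<dots> \<le> \<tau> (\<lambda>k. \<Sum>j<n. s j k)"
    by (rule pairing_le_norm[OF _ h]) (use s in \<open>auto intro!: c00_pos_sum\<close>)
  finally have 1: "\<theta> * (\<Sum>i<n. \<tau> (s i)) \<le> \<tau> (\<lambda>k. \<Sum>j<n. s j k) + \<theta> * (real n * d)"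
    by (simp add: algebra_simps)
  have "real n * d \<le> \<epsilon>" using e by (simp add: d_def field_simps)
  then have "\<theta> * (real n * d) \<le> \<epsilon>" using theta d mult_left_le_one_le[of "real n * d" \<theta>] by simp
  then show "\<theta> * (\<Sum>i<n. \<tau> (s i)) \<le> \<tau> (\<lambda>k. \<Sum>i<n. s i k) + \<epsilon>" using 1 by simp
qed

end

section \<open>Lozanovskii factorization of probability vectors\<close>

definition prob_vector :: "(nat \<Rightarrow> real) \<Rightarrow> bool" where
  "prob_vector v \<longleftrightarrow> v \<in> c00_pos \<and> mass v = 1"

lemma ln_ge_diff_square:
  fixes x :: real assumes "\<bar>x\<bar> \<le> 1 / 2" shows "x - 2 * x\<^sup>2 \<le> ln (1 + x)"
  using abs_ln_one_plus_x_minus_x_bound[OF assms] by linarith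

text \<open>Stands in for a derivative at 0: after division by \<open>t\<close> the right hand side
  tends to 0.\<close>

lemma first_order_nonpos:
  fixes A B :: real
  assumes "\<delta> > 0" "\<And>t. 0 < t \<Longrightarrow> t < \<delta> \<Longrightarrow> t * A \<le> t\<^sup>2 * B"
  shows "A \<le> 0"
proof (rule ccontr)
  assume "\<not> A \<le> 0"
  then have A: "A > 0" by simp
  define t where "t = min (\<delta> / 2) (A / (2 * (\<bar>B\<bar> + 1)))"
  have t: "0 < t" "t < \<delta>" using A assms(1) by (auto simp: t_def min_less_iff_disj)
  have "t * A \<le> t * (t * B)" using assms(2)[OF t] by (simp add: power2_eq_square)
  then have "A \<le> t * B" using t by simp
  also have "\<dots> \<le> t * (\<bar>B\<bar> + 1)" using t by (intro mult_left_mono) auto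
  also have "\<dots> \<le> A / (2 * (\<bar>B\<bar> + 1)) * (\<bar>B\<bar> + 1)" by (intro mult_right_mono) (auto simp: t_def)
  also have "\<dots> = A / 2" by (simp add: field_simps)
  finally show False using A by simp
qed

context tsirelson_space
begin

text \<open>The product of the powers of \<open>s i\<close> with exponents \<open>v i\<close> is
  maximized instead of the sum of logarithms, because it is continuous up to the faces of the
  compact unit ball where some \<open>s i\<close> vanishes. Its maximum is positive, so the
  maximizer avoids these faces.\<close>

lemma maximal_product:
  assumes v: "prob_vector v"
  obtains s where "s \<in> c00_pos" "supp s = supp v" "\<tau> s \<le> 1"
    "\<And>s'. s' \<in> c00_pos \<Longrightarrow> supp s' = supp v \<Longrightarrow> \<tau> s' \<le> 1 \<Longrightarrow>
      (\<Sum>i\<in>supp v. v i * ln (s' i)) \<le> (\<Sum>i\<in>supp v. v i * ln (s i))"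
proof -
  define F where "F = supp v"
  have F: "finite F" using v by (simp add: prob_vector_def c00_pos_def F_def)
  have Fne: "F \<noteq> {}" using v by (auto simp: prob_vector_def mass_def F_def)
  have v0: "0 < v i" if "i \<in> F" for i
    using that v by (auto simp: prob_vector_def c00_pos_def F_def supp_def order_less_le)
  define B where "B = {s. (\<forall>i. s i \<in> (if i \<in> F then {0..1} else {0})) \<and>
    (\<forall>f. tsirelson \<theta> f \<longrightarrow> (\<Sum>i\<in>F. s i * f i) \<le> 1)}"
  have "compactin (product_topology (\<lambda>i::nat. euclidean) UNIV)
      (PiE UNIV (\<lambda>i. if i \<in> F then {0..1::real} else {0}))"
    by (subst compactin_PiE) auto
  then have "compact (PiE UNIV (\<lambda>i. if i \<in> F then {0..1::real} else {0}))"
    by (simp add: euclidean_product_topology)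
  moreover have "closed {s. \<forall>f. tsirelson \<theta> f \<longrightarrow> (\<Sum>i\<in>F. s i * f i) \<le> 1}"
    by (intro closed_Collect_all closed_Collect_imp open_Collect_const closed_Collect_le
        continuous_intros continuous_on_sum continuous_on_mult continuous_on_product_coordinates)
  ultimately have "compact (PiE UNIV (\<lambda>i. if i \<in> F then {0..1::real} else {0}) \<inter>
    {s. \<forall>f. tsirelson \<theta> f \<longrightarrow> (\<Sum>i\<in>F. s i * f i) \<le> 1})"
    by (rule compact_Int_closed)
  also have "\<dots> = B" by (auto simp: B_def PiE_def Pi_def)
  finally have comp: "compact B" .
  have B_I: "s \<in> B" if "s \<in> c00_pos" "supp s \<subseteq> F" "\<tau> s \<le> 1" for s
  proof -
    have "s i \<le> 1" for i using coordinate_le_norm[OF that(1), of i] that(3) by simp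
    moreover have "(\<Sum>i\<in>F. s i * f i) \<le> 1" if "tsirelson \<theta> f" for f
      using pairing_le_norm[OF \<open>s \<in> c00_pos\<close> that] \<open>\<tau> s \<le> 1\<close>
      by (simp add: pairing_superset[OF \<open>supp s \<subseteq> F\<close> F])
    ultimately show ?thesis using that by (auto simp: B_def c00_pos_def supp_def)
  qed
  have B_D: "s \<in> c00_pos" "supp s \<subseteq> F" "\<tau> s \<le> 1" if "s \<in> B" for s
  proof -
    show sub: "supp s \<subseteq> F" using that by (auto simp: B_def supp_def split: if_splits)
    show "s \<in> c00_pos"
      by (rule c00_pos_subsetI[OF _ sub F]) (use that in \<open>auto simp: B_def split: if_splits\<close>)
    show "\<tau> s \<le> 1"
      by (rule norm_leI) (use that in \<open>auto simp: B_def pairing_superset[OF sub F]\<close>)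
  qed
  define P where "P = (\<lambda>s::nat \<Rightarrow> real. \<Prod>i\<in>F. s i powr v i)"
  have "continuous_on B P" unfolding P_def
    by (intro continuous_on_prod continuous_on_powr' continuous_on_const)
      (auto simp: B_def v0 split: if_splits intro!: continuous_on_subset[OF continuous_on_product_coordinates])
  \<comment> \<open>A competitor with positive product. The uniform distribution lies in the unit
    ball because the norm is at most the mass.\<close>
  define s0 where "s0 = (\<lambda>i. if i \<in> F then 1 / real (card F) else 0)"
  have s0c: "s0 \<in> c00_pos" by (rule c00_pos_subsetI[OF _ _ F]) (auto simp: s0_def supp_def)
  have s0F: "supp s0 \<subseteq> F" by (auto simp: s0_def supp_def)
  have "\<tau> s0 \<le> mass s0" by (rule norm_le_mass[OF s0c])
  also have "mass s0 = 1" using F Fne by (simp add: mass_superset[OF s0F F]) (simp add: s0_def)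
  finally have s0B: "s0 \<in> B" using B_I s0c s0F by blast
  obtain s where s: "s \<in> B" "\<And>s'. s' \<in> B \<Longrightarrow> P s' \<le> P s"
    using continuous_attains_sup[OF comp _ \<open>continuous_on B P\<close>] s0B by blast
  have "0 < P s0" unfolding P_def s0_def using F Fne by (intro prod_pos) (auto simp: card_gt_0_iff)
  then have Ps: "0 < P s" using s(2)[OF s0B] by simp
  then have spos: "0 < s i" if "i \<in> F" for i
    using that F B_D(1)[OF s(1)] by (fastforce simp: P_def c00_pos_def order_less_le prod_zero_iff)
  have lnP: "ln (P s') = (\<Sum>i\<in>F. v i * ln (s' i))" if "\<And>i. i \<in> F \<Longrightarrow> 0 < s' i" for s'
  proof -
    have "s' i \<noteq> 0" if "i \<in> F" for i using \<open>\<And>i. i \<in> F \<Longrightarrow> 0 < s' i\<close>[OF that] by simp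
    then show ?thesis unfolding P_def using F by (subst ln_prod) (auto simp: ln_powr)
  qed
  show ?thesis
  proof (rule that[of s])
    show "s \<in> c00_pos" "\<tau> s \<le> 1" using B_D s by auto
    show "supp s = supp v" unfolding F_def[symmetric] using B_D(2)[OF s(1)] spos
      by (force simp: supp_def)
    fix s' assume s': "s' \<in> c00_pos" "supp s' = supp v" "\<tau> s' \<le> 1"
    have pos': "0 < s' i" if "i \<in> F" for i
      using that s' by (auto simp: F_def supp_def c00_pos_def order_less_le)
    have "P s' \<le> P s" using s' by (intro s(2) B_I) (auto simp: F_def)
    moreover have "s' i \<noteq> 0" if "i \<in> F" for i using pos'[OF that] by simp
    then have "0 < P s'" unfolding P_def by (intro prod_pos) auto
    ultimately have "ln (P s') \<le> ln (P s)" by simp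
    then show "(\<Sum>i\<in>supp v. v i * ln (s' i)) \<le> (\<Sum>i\<in>supp v. v i * ln (s i))"
      using lnP[OF pos'] lnP[OF spos] by (simp add: F_def)
  qed
qed

text \<open>The first order condition for a maximizer \<open>s\<close> of \<open>\<Sum> v i * ln (s i)\<close> over the unit ball bounds the
  dual norm of \<open>v / s\<close>.\<close>

lemma lozanovskii:
  assumes v: "prob_vector v"
  obtains s where "s \<in> c00_pos" "supp s = supp v" "\<tau> s \<le> 1" "dominated \<tau> (\<lambda>i. v i / s i) 1"
proof -
  obtain s where s: "s \<in> c00_pos" "supp s = supp v" "\<tau> s \<le> 1"
    and max: "\<And>s'. s' \<in> c00_pos \<Longrightarrow> supp s' = supp v \<Longrightarrow> \<tau> s' \<le> 1 \<Longrightarrow>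
      (\<Sum>i\<in>supp v. v i * ln (s' i)) \<le> (\<Sum>i\<in>supp v. v i * ln (s i))"
    using maximal_product[OF v] by blast
  define F where "F = supp v"
  have F: "finite F" using v by (simp add: prob_vector_def c00_pos_def F_def)
  have spos: "0 < s i" if "i \<in> F" for i
    using that s by (auto simp: F_def supp_def c00_pos_def order_less_le)
  have v0: "0 \<le> v i" for i using v by (simp add: prob_vector_def c00_pos_def)
  have vsum: "(\<Sum>i\<in>F. v i) = 1" using v by (simp add: prob_vector_def mass_def F_def)
  have unit_ball: "pairing g (\<lambda>i. v i / s i) \<le> 1" if g: "g \<in> c00_pos" "\<tau> g \<le> 1" for g
  proof -
    define g' where "g' = restr F g"
    have g': "g' \<in> c00_pos" "\<tau> g' \<le> 1"
      using restr_mono[OF g(1), of F] g by (auto simp: g'_def c00_pos_restr)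
    define r where "r = (\<lambda>i. g' i / s i)"
    have r0: "0 \<le> r i" for i using g' s by (simp add: r_def c00_pos_def)
    \<comment> \<open>A common bound for all \<open>\<bar>r i - 1\<bar>\<close>, kept positive by
      the last summand; \<open>t < 1 / (2 * R)\<close> then keeps the logarithm in the range of
      \<open>ln_ge_diff_square\<close>.\<close>
    define R where "R = (\<Sum>i\<in>F. \<bar>r i - 1\<bar>) + 1"
    have Rp: "R > 0" unfolding R_def by (intro add_nonneg_pos sum_nonneg) auto
    have rR: "\<bar>r i - 1\<bar> \<le> R" if "i \<in> F" for i
      using member_le_sum[of i F "\<lambda>i. \<bar>r i - 1\<bar>"] that F by (simp add: R_def)
    have "(\<Sum>i\<in>F. v i * (r i - 1)) \<le> 0"
    proof (rule first_order_nonpos[where \<delta>="min (1/2) (1 / (2 * R))" and B="\<Sum>i\<in>F. v i * (2 * (r i - 1)\<^sup>2)"])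
      show "0 < min (1/2) (1 / (2 * R))" using Rp by simp
      fix t assume t: "0 < t" "t < min (1/2) (1 / (2 * R))"
      define s' where "s' = (\<lambda>i. (1 - t) * s i + t * g' i)"
      have s'c: "s' \<in> c00_pos" unfolding s'_def
        using t by (intro c00_pos_add c00_pos_scale s g') auto
      have s'F: "supp s' = F"
      proof
        show "supp s' \<subseteq> F" using s(2) by (auto simp: s'_def supp_def g'_def restr_def F_def)
        show "F \<subseteq> supp s'"
        proof
          fix i assume "i \<in> F"
          then have "0 < (1 - t) * s i" using spos t by simp
          moreover have "0 \<le> t * g' i" using t g' by (simp add: c00_pos_def)
          ultimately show "i \<in> supp s'" by (simp add: s'_def supp_def)
        qed
      qed
      have "\<tau> s' \<le> \<tau> (\<lambda>i. (1 - t) * s i) + \<tau> (\<lambda>i. t * g' i)"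
        unfolding s'_def using t by (intro triangle c00_pos_scale s g') auto
      also have "\<dots> = (1 - t) * \<tau> s + t * \<tau> g'" using t s g' by (simp add: scale)
      also have "\<dots> \<le> (1 - t) * 1 + t * 1" using t s g' by (intro add_mono mult_left_mono) auto
      finally have "\<tau> s' \<le> 1" by simp
      then have "(\<Sum>i\<in>F. v i * ln (s' i)) \<le> (\<Sum>i\<in>F. v i * ln (s i))"
        using max[OF s'c] s'F by (simp add: F_def)
      moreover have "v i * ln (s i) + v i * (t * (r i - 1) - 2 * (t * (r i - 1))\<^sup>2) \<le> v i * ln (s' i)"
        if i: "i \<in> F" for i
      proof -
        have "s' i = s i * (1 + t * (r i - 1))" using spos[OF i] by (simp add: s'_def r_def field_simps)
        moreover have b: "\<bar>t * (r i - 1)\<bar> \<le> 1 / 2"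
        proof -
          have "\<bar>t * (r i - 1)\<bar> \<le> t * R" using t rR[OF i] by (simp add: abs_mult)
          also have "\<dots> \<le> 1 / (2 * R) * R" using t Rp by (intro mult_right_mono) auto
          finally show ?thesis using Rp by simp
        qed
        moreover have "0 < 1 + t * (r i - 1)" using b by (simp add: abs_le_iff)
        ultimately have "ln (s' i) = ln (s i) + ln (1 + t * (r i - 1))"
          using spos[OF i] by (simp add: ln_mult)
        then have "ln (s i) + (t * (r i - 1) - 2 * (t * (r i - 1))\<^sup>2) \<le> ln (s' i)"
          using ln_ge_diff_square[OF b] by simp
        from mult_left_mono[OF this v0[of i]] show ?thesis by (simp add: distrib_left)
      qed
      ultimately have "(\<Sum>i\<in>F. v i * ln (s i) + v i * (t * (r i - 1) - 2 * (t * (r i - 1))\<^sup>2)) \<le> (\<Sum>i\<in>F. v i * ln (s i))"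
        using sum_mono[of F "\<lambda>i. v i * ln (s i) + v i * (t * (r i - 1) - 2 * (t * (r i - 1))\<^sup>2)" "\<lambda>i. v i * ln (s' i)"] by auto
      then have "(\<Sum>i\<in>F. v i * (t * (r i - 1) - 2 * (t * (r i - 1))\<^sup>2)) \<le> 0"
        by (simp add: sum.distrib)
      also have "(\<Sum>i\<in>F. v i * (t * (r i - 1) - 2 * (t * (r i - 1))\<^sup>2)) =
          t * (\<Sum>i\<in>F. v i * (r i - 1)) - t\<^sup>2 * (\<Sum>i\<in>F. v i * (2 * (r i - 1)\<^sup>2))"
        by (simp add: sum_distrib_left sum_subtractf[symmetric] algebra_simps power2_eq_square)
      finally show "t * (\<Sum>i\<in>F. v i * (r i - 1)) \<le> t\<^sup>2 * (\<Sum>i\<in>F. v i * (2 * (r i - 1)\<^sup>2))" by simp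
    qed
    then have "(\<Sum>i\<in>F. v i * r i) \<le> 1" using vsum by (simp add: algebra_simps sum_subtractf)
    moreover have "pairing g (\<lambda>i. v i / s i) = (\<Sum>i\<in>F. v i * r i)"
    proof -
      have "pairing g (\<lambda>i. v i / s i) = (\<Sum>i\<in>supp g \<union> F. g i * (v i / s i))"
        using F g by (intro pairing_superset) (auto simp: c00_pos_def)
      also have "\<dots> = (\<Sum>i\<in>F. g i * (v i / s i))"
        using F g by (intro sum.mono_neutral_right) (auto simp: c00_pos_def F_def supp_def)
      also have "\<dots> = (\<Sum>i\<in>F. v i * r i)"
        by (intro sum.cong) (auto simp: r_def g'_def restr_def)
      finally show ?thesis .
    qed
    ultimately show ?thesis by simp
  qed
  have "dominated \<tau> (\<lambda>i. v i / s i) 1" unfolding dominated_def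
  proof
    fix g assume g: "g \<in> c00_pos"
    show "pairing g (\<lambda>i. v i / s i) \<le> 1 * \<tau> g"
    proof (cases "\<exists>i. g i \<noteq> 0")
      case True
      then obtain i where i: "g i \<noteq> 0" by blast
      have p: "0 < \<tau> g" by (rule pos[OF g i])
      have "pairing (\<lambda>i. g i / \<tau> g) (\<lambda>i. v i / s i) \<le> 1"
        using unit_ball normalize[OF g i] by simp
      then have "\<tau> g * pairing (\<lambda>i. g i / \<tau> g) (\<lambda>i. v i / s i) \<le> \<tau> g * 1"
        using p by (intro mult_left_mono) auto
      moreover have "\<tau> g * pairing (\<lambda>i. g i / \<tau> g) (\<lambda>i. v i / s i) = pairing g (\<lambda>i. v i / s i)"
        using p pairing_scale_left[OF g, of "1 / \<tau> g" "\<lambda>i. v i / s i"] by simp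
      ultimately show ?thesis by linarith
    next
      case False
      then show ?thesis using nonneg[OF g] by (simp add: pairing_def)
    qed
  qed
  then show ?thesis using that s by blast
qed

end

section \<open>Entropy of averages of probability vectors\<close>

definition average :: "(nat \<Rightarrow> nat \<Rightarrow> real) \<Rightarrow> nat \<Rightarrow> nat \<Rightarrow> real" where
  "average w n = (\<lambda>k. (\<Sum>i<n. w i k) / real n)"

lemma average_c00_pos: "(\<And>i. i < n \<Longrightarrow> w i \<in> c00_pos) \<Longrightarrow> average w n \<in> c00_pos"
  unfolding average_def by (intro c00_pos_divide c00_pos_sum) auto

lemma supp_average:
  assumes "\<And>i. i < n \<Longrightarrow> w i \<in> c00_pos"
  shows "supp (average w n) = (\<Union>i<n. supp (w i))"
proof -
  have "(\<Sum>i<n. w i k) = 0 \<longleftrightarrow> (\<forall>i<n. w i k = 0)" for k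
    by (subst sum_nonneg_eq_0_iff) (use assms in \<open>auto simp: c00_pos_def\<close>)
  then show ?thesis by (cases "n = 0") (auto simp: supp_def average_def)
qed

lemma sum_average:
  assumes "\<And>i. i < n \<Longrightarrow> w i \<in> c00_pos"
  shows "(\<Sum>k\<in>supp (average w n). average w n k * \<phi> k) =
    (\<Sum>i<n. \<Sum>k\<in>supp (w i). w i k * \<phi> k) / real n"
proof -
  let ?U = "\<Union>i<n. supp (w i)"
  have fin: "finite ?U" using assms by (auto simp: c00_pos_def)
  have "(\<Sum>k\<in>?U. average w n k * \<phi> k) = (\<Sum>k\<in>?U. \<Sum>i<n. w i k * \<phi> k) / real n"
    by (simp add: average_def sum_divide_distrib sum_distrib_right)
  also have "(\<Sum>k\<in>?U. \<Sum>i<n. w i k * \<phi> k) = (\<Sum>i<n. \<Sum>k\<in>?U. w i k * \<phi> k)" by (rule sum.swap)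
  also have "\<dots> = (\<Sum>i<n. \<Sum>k\<in>supp (w i). w i k * \<phi> k)"
    by (intro sum.cong refl sum.mono_neutral_right fin) (auto simp: supp_def)
  finally show ?thesis by (simp add: supp_average[OF assms])
qed

lemma prob_vector_average:
  assumes "\<And>i. i < n \<Longrightarrow> prob_vector (w i)" "n \<ge> 1"
  shows "prob_vector (average w n)"
proof -
  have "mass (average w n) = (\<Sum>i<n. mass (w i)) / real n"
    using sum_average[of n w "\<lambda>_. 1"] assms by (simp add: mass_def prob_vector_def)
  then show ?thesis using assms by (simp add: prob_vector_def average_c00_pos)
qed

lemma sum_blocks:
  fixes f :: "nat \<Rightarrow> real"
  shows "(\<Sum>i<m * n. f i) = (\<Sum>j<m. \<Sum>i<n. f (j * n + i))"
proof -
  have "sum f {j * n..<j * n + n} = (\<Sum>i<n. f (j * n + i))" for j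
    using sum.shift_bounds_nat_ivl[of f 0 "j * n" n] by (simp add: atLeast0LessThan add.commute)
  then show ?thesis by (simp add: sum.nat_group[symmetric])
qed

text \<open>Allows an average over \<open>m ^ Suc l\<close> vectors to be read as an average of
  \<open>m\<close> averages of the preceding level.\<close>

lemma average_mult:
  "average w (m * n) = average (\<lambda>j. average (\<lambda>i. w (j * n + i)) n) m"
  by (rule ext) (simp add: average_def sum_blocks sum_divide_distrib[symmetric] mult.commute[of "real m"])

lemma successive_shift:
  "successive (a + n) A \<Longrightarrow> successive n (\<lambda>i. A (a + i))"
  unfolding successive_def by (metis nat_add_left_cancel_less)

context tsirelson_space
begin

definition factor :: "(nat \<Rightarrow> real) \<Rightarrow> nat \<Rightarrow> real" where
  "factor v = (SOME s. s \<in> c00_pos \<and> supp s = supp v \<and> \<tau> s \<le> 1 \<and> dominated \<tau> (\<lambda>i. v i / s i) 1)"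

text \<open>Although \<open>factor\<close> is a choice, the value does not depend on it: by
  \<open>entropy_ge\<close> it is the largest value of \<open>\<Sum> v * ln s\<close> over the unit
  ball.\<close>

definition entropy :: "(nat \<Rightarrow> real) \<Rightarrow> real" where
  "entropy v = (\<Sum>k\<in>supp v. v k * ln (factor v k))"

lemma factor:
  assumes "prob_vector v"
  shows "factor v \<in> c00_pos" "supp (factor v) = supp v" "\<tau> (factor v) \<le> 1"
    "dominated \<tau> (\<lambda>i. v i / factor v i) 1"
proof -
  have "\<exists>s. s \<in> c00_pos \<and> supp s = supp v \<and> \<tau> s \<le> 1 \<and> dominated \<tau> (\<lambda>i. v i / s i) 1"
    using lozanovskii[OF assms] by blast
  from someI_ex[OF this]
  show "factor v \<in> c00_pos" "supp (factor v) = supp v" "\<tau> (factor v) \<le> 1"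
    "dominated \<tau> (\<lambda>i. v i / factor v i) 1" unfolding factor_def by blast+
qed

lemma factor_pos: "prob_vector v \<Longrightarrow> k \<in> supp v \<Longrightarrow> 0 < factor v k"
  using factor(1,2)[of v] by (auto simp: c00_pos_def supp_def order_less_le)

lemma sum_ratio_le:
  assumes v: "prob_vector v" and s: "s \<in> c00_pos" "\<tau> s \<le> 1"
  shows "(\<Sum>k\<in>supp v. v k * (s k / factor v k)) \<le> 1"
proof -
  have "(\<Sum>k\<in>supp v. v k * (s k / factor v k)) = (\<Sum>k\<in>supp v. s k * (v k / factor v k))"
    by (simp add: mult.commute)
  also have "\<dots> = (\<Sum>k\<in>supp s \<union> supp v. s k * (v k / factor v k))"
    using v s by (intro sum.mono_neutral_left) (auto simp: prob_vector_def c00_pos_def supp_def)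
  also have "\<dots> = pairing s (\<lambda>k. v k / factor v k)"
    using v s by (intro pairing_superset[symmetric]) (auto simp: prob_vector_def c00_pos_def)
  also have "\<dots> \<le> 1 * \<tau> s" by (rule dominatedD[OF factor(4)[OF v] s(1)])
  finally show ?thesis using s by simp
qed

text \<open>The inequality \<open>ln x \<le> x - 1\<close> at \<open>x = s / factor v\<close>,
  averaged with the weights \<open>v\<close>. The mean of this quotient is the pairing of
  \<open>s\<close> with the dual factor of \<open>v\<close>, hence at most 1.\<close>

lemma entropy_ge:
  assumes v: "prob_vector v" and s: "s \<in> c00_pos" "\<tau> s \<le> 1" "supp v \<subseteq> supp s"
  shows "(\<Sum>k\<in>supp v. v k * ln (s k)) \<le> entropy v"
proof -
  have "v k * ln (s k) - v k * ln (factor v k) \<le> v k * (s k / factor v k) - v k" if k: "k \<in> supp v" for k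
  proof -
    have p: "0 < s k" "0 < factor v k"
      using k s factor_pos[OF v k] by (auto simp: supp_def c00_pos_def order_less_le)
    then have "ln (s k) - ln (factor v k) \<le> s k / factor v k - 1"
      using ln_le_minus_one[of "s k / factor v k"] by (simp add: ln_div)
    moreover have "0 \<le> v k" using v by (simp add: prob_vector_def c00_pos_def)
    ultimately have "v k * (ln (s k) - ln (factor v k)) \<le> v k * (s k / factor v k - 1)"
      by (rule mult_left_mono)
    then show ?thesis by (simp add: algebra_simps)
  qed
  then have "(\<Sum>k\<in>supp v. v k * ln (s k)) - entropy v \<le> (\<Sum>k\<in>supp v. v k * (s k / factor v k)) - mass v"
    unfolding entropy_def mass_def sum_subtractf[symmetric] by (intro sum_mono) auto
  then show ?thesis using sum_ratio_le[OF v s(1,2)] v by (simp add: prob_vector_def)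
qed

text \<open>Restricted to the support of \<open>w i\<close> and normalized, the factor of the
  average competes for \<open>entropy (w i)\<close>. The lower estimate bounds the sum of the norms
  of these restrictions by \<open>1 / \<theta>\<close>, so by concavity the mean of the logarithms
  of the norms is at most \<open>ln (1 / (\<theta> * n))\<close>.\<close>

lemma entropy_average_le:
  assumes w: "\<And>i. i < n \<Longrightarrow> prob_vector (w i)" and suc: "successive n (\<lambda>i. supp (w i))"
    and adm: "\<And>i k. i < n \<Longrightarrow> k \<in> supp (w i) \<Longrightarrow> n \<le> k" and n: "n \<ge> 1"
  shows "entropy (average w n) \<le> (\<Sum>i<n. entropy (w i)) / real n - ln (real n) + ln (1 / \<theta>)"
proof -
  define v where "v = average w n"
  define s where "s = factor v"
  define r where "r = (\<lambda>i. restr (supp (w i)) s)"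
  have v: "prob_vector v" unfolding v_def by (rule prob_vector_average) (use w n in auto)
  have wc: "w i \<in> c00_pos" if "i < n" for i using w that by (simp add: prob_vector_def)
  have sv: "supp v = (\<Union>i<n. supp (w i))" unfolding v_def by (rule supp_average[OF wc])
  have sc: "s \<in> c00_pos" "supp s = supp v" "\<tau> s \<le> 1" using factor[OF v] by (auto simp: s_def)
  have rc: "r i \<in> c00_pos" for i unfolding r_def by (rule c00_pos_restr[OF sc(1)])
  have rs: "supp (r i) = supp (w i)" if "i < n" for i using that sc(2) sv by (auto simp: r_def supp_restr)
  have rp: "0 < \<tau> (r i)" if i: "i < n" for i
  proof -
    obtain k where "k \<in> supp (w i)" using w[OF i] by (force simp: prob_vector_def mass_def)
    then show ?thesis using pos[OF rc, of i k] rs[OF i] by (auto simp: supp_def)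
  qed
  \<comment> \<open>The mean of the norms allowed by the lower estimate. The tangent of
    \<open>ln\<close> at \<open>c\<close> takes the place of Jensen's inequality.\<close>
  define c where "c = 1 / (\<theta> * real n)"
  have c: "c > 0" using theta n by (simp add: c_def)
  have piece: "(\<Sum>k\<in>supp (w i). w i k * ln (s k)) \<le> entropy (w i) + (ln c + \<tau> (r i) / c - 1)" if i: "i < n" for i
  proof -
    obtain k0 where k0: "r i k0 \<noteq> 0" using rp[OF i] zero by (metis ext less_irrefl)
    define s' where "s' = (\<lambda>k. r i k / \<tau> (r i))"
    have "(\<Sum>k\<in>supp (w i). w i k * ln (s' k)) \<le> entropy (w i)"
      using normalize[OF rc k0] rs[OF i] rp[OF i]
      by (intro entropy_ge w i) (auto simp: s'_def supp_def)
    moreover have "w i k * ln (s' k) = w i k * ln (s k) - w i k * ln (\<tau> (r i))" if k: "k \<in> supp (w i)" for k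
    proof -
      have "s k > 0" using k i sv sc by (auto simp: supp_def c00_pos_def order_less_le)
      then have "ln (s' k) = ln (s k) - ln (\<tau> (r i))"
        using k rp[OF i] by (simp add: s'_def r_def restr_def ln_div)
      then show ?thesis by (simp add: right_diff_distrib)
    qed
    moreover have "(\<Sum>k\<in>supp (w i). w i k * ln (\<tau> (r i))) = ln (\<tau> (r i))"
      using w[OF i] by (simp add: prob_vector_def mass_def sum_distrib_right[symmetric])
    moreover have "ln (\<tau> (r i)) \<le> ln c + \<tau> (r i) / c - 1"
      using ln_le_minus_one[of "\<tau> (r i) / c"] rp[OF i] c by (simp add: ln_div)
    ultimately show ?thesis by (simp add: sum_subtractf)
  qed
  have "\<theta> * (\<Sum>i<n. \<tau> (r i)) \<le> \<tau> (\<lambda>k. \<Sum>i<n. r i k)"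
    by (rule lower_l1_estimate) (use rc rs adm in \<open>auto intro!: successive_subset[OF suc]\<close>)
  also have "\<dots> \<le> \<tau> s"
  proof (rule mono)
    show "(\<lambda>k. \<Sum>i<n. r i k) \<in> c00_pos" using rc by (intro c00_pos_sum) auto
    show "(\<Sum>i<n. r i k) \<le> s k" for k unfolding r_def
      using successive_disjoint[OF suc] by (intro sum_restr_disjoint_le[OF sc(1)]) auto
  qed (rule sc)
  finally have tot: "\<theta> * (\<Sum>i<n. \<tau> (r i)) \<le> 1" using sc by simp
  have "entropy v = (\<Sum>i<n. \<Sum>k\<in>supp (w i). w i k * ln (s k)) / real n"
    unfolding entropy_def s_def[symmetric] unfolding v_def by (rule sum_average[OF wc])
  also have "\<dots> \<le> (\<Sum>i<n. entropy (w i) + (ln c + \<tau> (r i) / c - 1)) / real n"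
    by (intro divide_right_mono sum_mono piece) auto
  also have "\<dots> = (\<Sum>i<n. entropy (w i)) / real n + ln c + \<theta> * (\<Sum>i<n. \<tau> (r i)) - 1"
    using n theta by (simp add: sum.distrib sum_subtractf add_divide_distrib diff_divide_distrib c_def
        sum_divide_distrib[symmetric] sum_distrib_right[symmetric])
  also have "\<dots> \<le> (\<Sum>i<n. entropy (w i)) / real n + ln c" using tot by simp
  also have "ln c = - ln (real n) + ln (1 / \<theta>)" using theta n by (simp add: c_def ln_div ln_mult)
  finally show ?thesis by (simp add: v_def)
qed

text \<open>The comparison of \<open>s\<close> with an average of unit ball vectors is demanded only
  up to the factor 4 and off a set of small \<open>v\<close>-mass: a small entropy defect controls
  the quotient only on average.\<close>

definition averaged :: "nat \<Rightarrow> real \<Rightarrow> (nat \<Rightarrow> real) \<Rightarrow> bool" where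
  "averaged N \<epsilon> v \<longleftrightarrow> (\<exists>s s' b. s \<in> c00_pos \<and> s' \<in> c00_pos \<and> v = (\<lambda>k. s k * s' k) \<and> dominated \<tau> s' 1 \<and>
    (\<forall>i<N. b i \<in> c00_pos \<and> \<tau> (b i) \<le> 1 \<and> supp (b i) \<subseteq> supp v) \<and> successive N (\<lambda>i. supp (b i)) \<and>
    mass (restr {k. 4 * average b N k < s k} v) \<le> \<epsilon>)"

text \<open>The average of the factors of the \<open>w j\<close> competes for the entropy of the
  average. If it is nearly optimal, its quotient \<open>r\<close> by the true factor makes the
  nonnegative quantity \<open>r - 1 - ln r\<close> small on average, and so \<open>r\<close> is
  rarely below 1/4.\<close>

lemma averagedI:
  assumes w: "\<And>j. j < m \<Longrightarrow> prob_vector (w j)" and suc: "successive m (\<lambda>j. supp (w j))" and m: "m \<ge> 1"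
    and ent: "entropy (average w m) \<le> (\<Sum>j<m. entropy (w j)) / real m - ln (real m) + \<epsilon>"
  shows "averaged m (2 * \<epsilon>) (average w m)"
proof -
  define v where "v = average w m"
  define s where "s = factor v"
  define b where "b = (\<lambda>j. factor (w j))"
  have v: "prob_vector v" unfolding v_def by (rule prob_vector_average) (use w m in auto)
  have wc: "w i \<in> c00_pos" if "i < m" for i using w that by (simp add: prob_vector_def)
  have v0: "0 \<le> v k" for k using v by (simp add: prob_vector_def c00_pos_def)
  have sv: "supp v = (\<Union>i<m. supp (w i))" unfolding v_def by (rule supp_average[OF wc])
  have sc: "s \<in> c00_pos" "supp s = supp v" using factor[OF v] by (auto simp: s_def)
  have bc: "b j \<in> c00_pos" "\<tau> (b j) \<le> 1" "supp (b j) = supp (w j)" if "j < m" for j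
    using factor[OF w[OF that]] by (auto simp: b_def)
  have avc: "average b m \<in> c00_pos" using bc by (intro average_c00_pos)
  have "\<tau> (average b m) = \<tau> (\<lambda>k. (1 / real m) * (\<Sum>j<m. b j k))" by (simp add: average_def)
  also have "\<dots> = (1 / real m) * \<tau> (\<lambda>k. \<Sum>j<m. b j k)"
    by (intro scale c00_pos_sum) (use bc in auto)
  also have "\<dots> \<le> (1 / real m) * (\<Sum>j<m. 1)"
    by (intro mult_left_mono order_trans[OF sum_le] sum_mono) (use bc in auto)
  also have "\<dots> = 1" using m by simp
  finally have av1: "\<tau> (average b m) \<le> 1" .
  have low: "w j k * (ln (b j k) - ln (real m)) \<le> w j k * ln (average b m k)" if j: "j < m" "k \<in> supp (w j)" for j k
  proof -
    have bp: "b j k > 0" using j bc[OF j(1)] by (auto simp: supp_def c00_pos_def order_less_le)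
    have "b j k / real m \<le> average b m k" unfolding average_def
      by (intro divide_right_mono member_le_sum) (use j bc in \<open>auto simp: c00_pos_def\<close>)
    then have "ln (b j k / real m) \<le> ln (average b m k)" using bp m by (intro ln_mono) auto
    then show ?thesis using bp m wc[OF j(1)] by (intro mult_left_mono) (auto simp: ln_div c00_pos_def)
  qed
  have "(\<Sum>j<m. entropy (w j)) / real m - ln (real m) = (\<Sum>j<m. entropy (w j) - ln (real m)) / real m"
    using m by (simp add: sum_subtractf diff_divide_distrib)
  also have "\<dots> = (\<Sum>j<m. \<Sum>k\<in>supp (w j). w j k * (ln (b j k) - ln (real m))) / real m"
  proof -
    have "(\<Sum>k\<in>supp (w j). w j k * ln (real m)) = ln (real m)" if "j < m" for j
      using w[OF that] by (simp add: prob_vector_def mass_def sum_distrib_right[symmetric])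
    then show ?thesis by (simp add: right_diff_distrib sum_subtractf entropy_def b_def)
  qed
  also have "\<dots> \<le> (\<Sum>j<m. \<Sum>k\<in>supp (w j). w j k * ln (average b m k)) / real m"
    by (intro divide_right_mono sum_mono low) auto
  also have "\<dots> = (\<Sum>k\<in>supp v. v k * ln (average b m k))"
    unfolding v_def by (rule sum_average[OF wc, symmetric])
  finally have ent': "entropy v - \<epsilon> \<le> (\<Sum>k\<in>supp v. v k * ln (average b m k))"
    using ent by (simp add: v_def)
  define r where "r = (\<lambda>k. average b m k / s k)"
  have sp: "0 < s k" if "k \<in> supp v" for k using factor_pos[OF v that] by (simp add: s_def)
  have avp: "0 < average b m k" if "k \<in> supp v" for k
  proof -
    have "k \<in> supp (average b m)" using that bc by (subst supp_average) (auto simp: sv)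
    then show ?thesis using avc by (auto simp: supp_def c00_pos_def order_less_le)
  qed
  have rp: "0 < r k" if "k \<in> supp v" for k using sp avp that by (simp add: r_def)
  have lnr: "ln (r k) = ln (average b m k) - ln (s k)" if "k \<in> supp v" for k
    using sp[OF that] avp[OF that] by (simp add: r_def ln_div)
  have "(\<Sum>k\<in>supp v. v k * (r k - 1 - ln (r k))) =
      (\<Sum>k\<in>supp v. v k * r k) - mass v - ((\<Sum>k\<in>supp v. v k * ln (average b m k)) - entropy v)"
    by (simp add: lnr algebra_simps sum_subtractf sum.distrib mass_def entropy_def s_def cong: sum.cong)
  also have "\<dots> \<le> \<epsilon>"
    using sum_ratio_le[OF v avc av1] ent' v by (simp add: r_def s_def prob_vector_def)
  finally have dev: "(\<Sum>k\<in>supp v. v k * (r k - 1 - ln (r k))) \<le> \<epsilon>" .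
  define G where "G = {k. 4 * average b m k < s k}"
  have "mass (restr G v) / 2 = (\<Sum>k\<in>supp v. restr G v k / 2)"
    unfolding sum_divide_distrib[symmetric]
    by (subst mass_superset[of _ "supp v"]) (use v in \<open>auto simp: supp_restr prob_vector_def c00_pos_def\<close>)
  also have "\<dots> \<le> (\<Sum>k\<in>supp v. v k * (r k - 1 - ln (r k)))"
  proof (rule sum_mono)
    fix k assume k: "k \<in> supp v"
    have 0: "0 \<le> r k - 1 - ln (r k)" using ln_le_minus_one[OF rp[OF k]] by simp
    show "restr G v k / 2 \<le> v k * (r k - 1 - ln (r k))"
    proof (cases "k \<in> G")
      case True
      then have r4: "4 * r k < 1" using sp[OF k] by (simp add: G_def r_def field_simps)
      \<comment> \<open>For \<open>r < 1 / 4\<close> this gives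
        \<open>r - 1 - ln r \<ge> 2 * ln 2 - 3 * r > 1 / 2\<close>, which is where the 2 in
        \<open>2 * \<epsilon>\<close> comes from.\<close>
      have "ln (4 * r k) \<le> 4 * r k - 1" using rp[OF k] by (intro ln_le_minus_one) simp
      moreover have "ln (4 * r k) = ln 4 + ln (r k)" using rp[OF k] by (simp add: ln_mult)
      moreover have "ln (4::real) = 2 * ln 2" using ln_realpow[of "2::real" 2] by simp
      ultimately have "1 / 2 \<le> r k - 1 - ln (r k)" using ln2_ge_two_thirds r4 by linarith
      from mult_left_mono[OF this v0[of k]] show ?thesis using True by (simp add: restr_def)
    next
      case False
      then show ?thesis using v0 0 by (simp add: restr_def)
    qed
  qed
  finally have "mass (restr G v) \<le> 2 * \<epsilon>" using dev by simp
  moreover have "v = (\<lambda>k. s k * (v k / s k))"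
    using sc(2) by (auto simp: supp_def fun_eq_iff)
  moreover have "(\<lambda>k. v k / s k) \<in> c00_pos"
    using v sc by (intro c00_pos_subsetI[where S="supp v"]) (auto simp: prob_vector_def c00_pos_def supp_def)
  moreover have "dominated \<tau> (\<lambda>k. v k / s k) 1" using factor(4)[OF v] by (simp add: s_def)
  moreover have "successive m (\<lambda>j. supp (b j))" by (rule successive_subset[OF suc]) (simp add: bc)
  ultimately show ?thesis unfolding averaged_def v_def[symmetric] G_def
    by (intro exI[of _ s] exI[of _ "\<lambda>k. v k / s k"] exI[of _ b]) (use sc bc sv in auto)
qed

text \<open>The entropy defect of an admissible average is at most \<open>ln (1 / \<theta>)\<close>,
  however long it is. If each of \<open>K\<close> nested levels of \<open>m\<close>-fold averages
  had defect more than \<open>\<epsilon> / 2\<close> everywhere, the defects would accumulate beyond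
  this bound.\<close>

lemma averaged_exists:
  assumes u: "\<And>i. prob_vector (u i)" and suc: "\<And>n. successive n (\<lambda>i. supp (u i))"
    and adm: "\<And>i k. k \<in> supp (u i) \<Longrightarrow> i \<le> k" and m: "m \<ge> 1" and e: "\<epsilon> > 0"
  obtains a n where "p \<le> a" "n \<le> a" "1 \<le> n" "averaged m \<epsilon> (average (\<lambda>i. u (a + i)) n)"
proof -
  obtain K :: nat where K: "ln (1 / \<theta>) < real K * (\<epsilon> / 2)"
    using reals_Archimedean3[of "\<epsilon> / 2"] e by auto
  define E where "E = (\<lambda>a l. entropy (average (\<lambda>i. u (a + i)) (m ^ l)))"
  \<comment> \<open>Starting at \<open>m ^ K\<close> or later makes the average over the full height
    of the tower admissible.\<close>
  define a0 where "a0 = max p (m ^ K)"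
  have suc': "successive n (\<lambda>i. supp (u (a + i)))" for a n
    using successive_shift[OF suc[of "a + n"]] by simp
  have split: "average (\<lambda>i. u (a + i)) (m ^ Suc l) =
      average (\<lambda>j. average (\<lambda>i. u (a + j * m ^ l + i)) (m ^ l)) m" for a l
    using average_mult[of "\<lambda>i. u (a + i)" m "m ^ l"] by (simp add: add.assoc)
  have "\<exists>l<K. \<exists>a\<ge>a0. E a (Suc l) \<le> (\<Sum>j<m. E (a + j * m ^ l) l) / real m - ln (real m) + \<epsilon> / 2"
  proof (rule ccontr)
    assume "\<not> ?thesis"
    then have bad: "(\<Sum>j<m. E (a + j * m ^ l) l) / real m - ln (real m) + \<epsilon> / 2 \<le> E a (Suc l)"
      if "l < K" "a \<ge> a0" for l a using that by (meson linear not_le)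
    have grow: "(\<Sum>i<m ^ l. entropy (u (a + i))) / real (m ^ l) - real l * ln (real m) + real l * (\<epsilon> / 2) \<le> E a l"
      if "l \<le> K" "a \<ge> a0" for l a using that
    proof (induction l arbitrary: a)
      case 0
      have "average (\<lambda>i. u (a + i)) 1 = u a" by (simp add: average_def)
      then show ?case by (simp add: E_def)
    next
      case (Suc l)
      have IH: "(\<Sum>i<m ^ l. entropy (u (a + j * m ^ l + i))) / real (m ^ l) - real l * ln (real m) + real l * (\<epsilon> / 2)
          \<le> E (a + j * m ^ l) l" for j
        using Suc by (intro Suc.IH) auto
      have "(\<Sum>i<m ^ Suc l. entropy (u (a + i))) = (\<Sum>j<m. \<Sum>i<m ^ l. entropy (u (a + j * m ^ l + i)))"
        by (simp add: sum_blocks add.assoc)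
      then have "(\<Sum>i<m ^ Suc l. entropy (u (a + i))) / real (m ^ Suc l) - real l * ln (real m) + real l * (\<epsilon> / 2)
        = (\<Sum>j<m. (\<Sum>i<m ^ l. entropy (u (a + j * m ^ l + i))) / real (m ^ l) - real l * ln (real m) + real l * (\<epsilon> / 2)) / real m"
        using m by (simp add: sum.distrib sum_subtractf add_divide_distrib diff_divide_distrib
            sum_divide_distrib[symmetric])
      also have "\<dots> \<le> (\<Sum>j<m. E (a + j * m ^ l) l) / real m"
        by (intro divide_right_mono sum_mono IH) auto
      also have "\<dots> \<le> E a (Suc l) + ln (real m) - \<epsilon> / 2" using bad[of l a] Suc by simp
      finally show ?case by (simp add: algebra_simps add_divide_distrib)
    qed
    have "E a0 K \<le> (\<Sum>i<m ^ K. entropy (u (a0 + i))) / real (m ^ K) - ln (real (m ^ K)) + ln (1 / \<theta>)"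
      unfolding E_def
    proof (rule entropy_average_le)
      show "m ^ K \<le> k" if "k \<in> supp (u (a0 + i))" for i k
        using adm[OF that] by (simp add: a0_def)
    qed (use u suc' m in auto)
    moreover have "ln (real (m ^ K)) = real K * ln (real m)" using m by (simp add: ln_realpow)
    ultimately show False using grow[of K a0] K by simp
  qed
  then obtain l a where l: "l < K" "a \<ge> a0"
    "E a (Suc l) \<le> (\<Sum>j<m. E (a + j * m ^ l) l) / real m - ln (real m) + \<epsilon> / 2" by blast
  have "averaged m (2 * (\<epsilon> / 2)) (average (\<lambda>j. average (\<lambda>i. u (a + j * m ^ l + i)) (m ^ l)) m)"
  proof (rule averagedI)
    show "prob_vector (average (\<lambda>i. u (a + j * m ^ l + i)) (m ^ l))" for j
      using u m by (intro prob_vector_average) auto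
    have supp: "supp (average (\<lambda>i. u (a + j * m ^ l + i)) (m ^ l)) = (\<Union>i<m ^ l. supp (u (a + j * m ^ l + i)))" for j
      using u by (intro supp_average) (simp add: prob_vector_def)
    show "successive m (\<lambda>j. supp (average (\<lambda>i. u (a + j * m ^ l + i)) (m ^ l)))"
      unfolding successive_def supp
    proof (clarsimp)
      fix j j' x y i i' assume h: "j < j'" "j' < m" "i < m ^ l" "i' < m ^ l"
        "x \<in> supp (u (a + j * m ^ l + i))" "y \<in> supp (u (a + j' * m ^ l + i'))"
      have "j * m ^ l + i < Suc j * m ^ l" using h by simp
      also have "\<dots> \<le> j' * m ^ l" using h by (intro mult_right_mono) auto
      finally have "a + j * m ^ l + i < a + j' * m ^ l + i'" by simp
      from successiveD[OF suc this _ h(5,6), of "Suc (a + j' * m ^ l + i')"] show "x < y" by simp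
    qed
    show "entropy (average (\<lambda>j. average (\<lambda>i. u (a + j * m ^ l + i)) (m ^ l)) m)
        \<le> (\<Sum>j<m. entropy (average (\<lambda>i. u (a + j * m ^ l + i)) (m ^ l))) / real m - ln (real m) + \<epsilon> / 2"
      using l(3) unfolding E_def split .
  qed (use m in auto)
  then have "averaged m \<epsilon> (average (\<lambda>i. u (a + i)) (m ^ Suc l))" unfolding split by simp
  moreover have "m ^ Suc l \<le> a"
  proof -
    have "m ^ Suc l \<le> m ^ K" using l m by (intro power_increasing) auto
    then show ?thesis using l by (simp add: a0_def)
  qed
  ultimately show ?thesis using that[of a "m ^ Suc l"] l m by (simp add: a0_def)
qed

end

section \<open>Separation of averages from mixtures of rapidly increasing sequences\<close>

lemma le_weighted_sum:
  fixes x a b \<kappa> :: real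
  assumes "0 \<le> x" "x\<^sup>2 \<le> 16 * (a * b)" "0 < \<kappa>" "0 \<le> a" "0 \<le> b"
  shows "x \<le> 2 * (\<kappa> * a + b / \<kappa>)"
proof (rule power2_le_imp_le)
  have "0 \<le> (\<kappa> * a - b / \<kappa>)\<^sup>2" by simp
  moreover have "(\<kappa> * a + b / \<kappa>)\<^sup>2 = (\<kappa> * a - b / \<kappa>)\<^sup>2 + 4 * (a * b)"
    using assms by (simp add: power2_eq_square field_simps)
  ultimately have "4 * (a * b) \<le> (\<kappa> * a + b / \<kappa>)\<^sup>2" by simp
  moreover have "(2 * (\<kappa> * a + b / \<kappa>))\<^sup>2 = 4 * (\<kappa> * a + b / \<kappa>)\<^sup>2"
    by (simp only: power_mult_distrib) simp
  ultimately show "x\<^sup>2 \<le> (2 * (\<kappa> * a + b / \<kappa>))\<^sup>2" using assms(2) by linarith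
qed (use assms in simp)

lemma sum_pairing_le:
  assumes "f \<in> c00_pos" "\<And>i. 0 \<le> g i" "finite S"
  shows "(\<Sum>i\<in>S. f i * g i) \<le> pairing f g"
proof -
  have "(\<Sum>i\<in>S. f i * g i) \<le> (\<Sum>i\<in>S \<union> supp f. f i * g i)"
    using assms by (intro sum_mono2) (auto simp: c00_pos_def)
  also have "\<dots> = pairing f g" using assms by (intro pairing_superset[symmetric]) (auto simp: c00_pos_def)
  finally show ?thesis .
qed

lemma pairing_average_left:
  assumes "\<And>i. i < n \<Longrightarrow> w i \<in> c00_pos"
  shows "pairing (average w n) g = (\<Sum>i<n. pairing (w i) g) / real n"
proof -
  have "pairing (average w n) g = pairing (\<lambda>k. (1 / real n) * (\<Sum>i<n. w i k)) g" by (simp add: average_def)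
  also have "\<dots> = (1 / real n) * pairing (\<lambda>k. \<Sum>i<n. w i k) g"
    by (intro pairing_scale_left c00_pos_sum) (use assms in auto)
  also have "pairing (\<lambda>k. \<Sum>i<n. w i k) g = (\<Sum>i<n. pairing (w i) g)"
    by (intro pairing_sum_left) (use assms in auto)
  finally show ?thesis by simp
qed

lemma pairing_average_right: "pairing f (average g n) = (\<Sum>i<n. pairing f (g i)) / real n"
  using pairing_scale_right[of f "1 / real n" "\<lambda>k. \<Sum>i<n. g i k"]
  by (simp add: average_def pairing_sum_right)

lemma pairing_disjoint: "supp f \<inter> supp g = {} \<Longrightarrow> pairing f g = 0"
  unfolding pairing_def by (intro sum.neutral) (auto simp: supp_def)

context tsirelson_space
begin

lemma pairing_le_one: "x \<in> c00_pos \<Longrightarrow> \<tau> x \<le> 1 \<Longrightarrow> tsirelson \<theta> f \<Longrightarrow> pairing x f \<le> 1"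
  using pairing_le_norm[of x f] by simp

text \<open>Rapidly increasing sequences of averages: all but one of the averages are either missed by a
  functional of the norming set or long compared with its number of pieces.\<close>

lemma norm_sum_averages_le:
  assumes b: "\<And>j i. j < m \<Longrightarrow> i < N j \<Longrightarrow> b j i \<in> c00_pos"
    and b1: "\<And>j i. j < m \<Longrightarrow> i < N j \<Longrightarrow> \<tau> (b j i) \<le> 1"
    and sb: "\<And>j. j < m \<Longrightarrow> successive (N j) (\<lambda>i. supp (b j i))"
    and bu: "\<And>j i. j < m \<Longrightarrow> i < N j \<Longrightarrow> supp (b j i) \<subseteq> A j"
    and sA: "successive m A" and N1: "\<And>j. j < m \<Longrightarrow> 1 \<le> N j"
    and NA: "\<And>j j' k. j < m \<Longrightarrow> j' < j \<Longrightarrow> k \<in> A j' \<Longrightarrow> k \<le> N j"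
  shows "\<tau> (\<lambda>k. \<Sum>j<m. average (b j) (N j) k) \<le> 1 + 2 * \<theta> * real m"
proof (rule norm_leI)
  fix f assume f: "tsirelson \<theta> f"
  define tb where "tb = (\<lambda>j. average (b j) (N j))"
  have tbc: "tb j \<in> c00_pos" if "j < m" for j
    unfolding tb_def using b that by (intro average_c00_pos)
  have stb: "supp (tb j) \<subseteq> A j" if "j < m" for j
    unfolding tb_def using bu[OF that] by (subst supp_average[OF b[OF that]]) (auto dest: subsetD)
  have pt: "pairing (tb j) g = (\<Sum>i<N j. pairing (b j i) g) / real (N j)" if "j < m" for j g
    unfolding tb_def by (intro pairing_average_left b that)
  have one: "pairing (tb j) g \<le> 1" if "tsirelson \<theta> g" "j < m" for j g
  proof -
    have "(\<Sum>i<N j. pairing (b j i) g) \<le> (\<Sum>i<N j. 1)"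
      by (intro sum_mono pairing_le_one b b1 that) auto
    then show ?thesis using N1[OF that(2)] that by (simp add: pt)
  qed
  have total: "pairing (\<lambda>k. \<Sum>j<m. tb j k) f = (\<Sum>j<m. pairing (tb j) f)"
    by (intro pairing_sum_left) (use tbc in auto)
  have pos: "0 \<le> 2 * \<theta> * real m" using theta by simp
  have "pairing (\<lambda>k. \<Sum>j<m. tb j k) f \<le> 1 + 2 * \<theta> * real m"
    using f
  proof (cases rule: tsirelson.cases)
    case zero
    then show ?thesis using pos by (simp add: pairing_def)
  next
    case (unit n)
    have "pairing (\<lambda>k. \<Sum>j<m. tb j k) f = (\<Sum>j<m. tb j n)"
      unfolding unit by (rule pairing_unit) (use tbc in \<open>auto intro!: c00_pos_sum\<close>)
    also have "\<dots> \<le> 1"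
    proof (rule sum_successive_le)
      show "successive m (\<lambda>j. supp (tb j))" by (rule successive_subset[OF sA stb])
      show "tb j n \<le> 1" if "j < m" for j
        using one[OF tsirelson.unit that, of n] pairing_unit[OF tbc[OF that]] by simp
    qed simp
    finally show ?thesis using pos by simp
  next
    case (step n g)
    have gc: "g i \<in> c00_pos" if "i < n" for i using tsirelson_c00_pos step(2) that by blast
    have f0: "f k = 0" if "k < n" for k
    proof -
      have "g i k = 0" if "i < n" for i using step(4)[OF that, of k] \<open>k < n\<close> by (auto simp: supp_def)
      then show ?thesis unfolding step(1) by simp
    qed
    have miss: "pairing (tb j) f = 0" if "j < m" "\<forall>k\<in>A j. k < n" for j
      using stb[OF that(1)] that(2) f0 by (intro pairing_disjoint) (auto simp: supp_def)
    have long: "pairing (tb j) f \<le> 2 * \<theta>" if j: "j < m" and "n \<le> N j" for j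
    proof -
      \<comment> \<open>At most \<open>n + N j\<close> pairs of pieces overlap, which is at most
        twice the length of the average; what survives is the factor \<open>\<theta>\<close> in
        front of \<open>f\<close>.\<close>
      have "(\<Sum>i<n. \<Sum>l<N j. pairing (b j l) (g i)) \<le> 1 * (real n + real (N j))"
      proof (rule sum_overlaps_le[OF step(3) sb[OF j]])
        show "pairing (b j l) (g i) \<le> 1" if "i < n" "l < N j" for i l
          using that j step(2) by (intro pairing_le_one b b1) auto
        show "pairing (b j l) (g i) \<le> 0" if "i < n" "l < N j" "supp (g i) \<inter> supp (b j l) = {}" for i l
          using that by (simp add: pairing_disjoint Int_commute)
      qed simp
      also have "\<dots> \<le> 2 * real (N j)" using that by simp
      finally have "(\<Sum>l<N j. \<Sum>i<n. pairing (b j l) (g i)) / real (N j) \<le> 2"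
        using N1[OF j] by (subst sum.swap) (simp add: field_simps)
      then have "\<theta> * ((\<Sum>l<N j. \<Sum>i<n. pairing (b j l) (g i)) / real (N j)) \<le> \<theta> * 2"
        using theta by (intro mult_left_mono) auto
      moreover have "pairing (tb j) f = \<theta> * ((\<Sum>l<N j. \<Sum>i<n. pairing (b j l) (g i)) / real (N j))"
        unfolding step(1) pairing_scale_right pairing_sum_right
        by (subst sum.swap) (simp add: pt[OF j] sum_divide_distrib[symmetric])
      ultimately show ?thesis by simp
    qed
    show ?thesis
    proof (cases "\<exists>j<m. \<exists>k\<in>A j. n \<le> k")
      case False
      then have "(\<Sum>j<m. pairing (tb j) f) = 0"
        by (intro sum.neutral ballI miss) (auto simp: not_le)
      then show ?thesis using total pos by simp
    next
      case True
      \<comment> \<open>The only average that may be neither missed by \<open>f\<close> nor long: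
        the first one whose set reaches \<open>n\<close>. It contributes the summand 1.\<close>
      define j0 where "j0 = (LEAST j. j < m \<and> (\<exists>k\<in>A j. n \<le> k))"
      have j0: "j0 < m" "\<exists>k\<in>A j0. n \<le> k"
        using LeastI_ex[of "\<lambda>j. j < m \<and> (\<exists>k\<in>A j. n \<le> k)"] True by (auto simp: j0_def)
      have before: "\<forall>k\<in>A j. k < n" if "j < j0" for j
        using not_less_Least[of j "\<lambda>j. j < m \<and> (\<exists>k\<in>A j. n \<le> k)"] that j0(1)
        by (auto simp: j0_def not_le)
      have "pairing (tb j) f \<le> (if j = j0 then 1 else 0) + 2 * \<theta>" if j: "j < m" for j
      proof (cases j j0 rule: linorder_cases)
        case less
        then show ?thesis using miss[OF j before] theta by simp
      next
        case equal
        then show ?thesis using one[OF f j] theta by simp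
      next
        case greater
        then show ?thesis using long[OF j] NA[OF j greater] j0(2) by fastforce
      qed
      then have "(\<Sum>j<m. pairing (tb j) f) \<le> (\<Sum>j<m. (if j = j0 then 1 else 0) + 2 * \<theta>)"
        by (intro sum_mono) auto
      also have "\<dots> = 1 + 2 * \<theta> * real m" using j0(1) by (simp add: sum.distrib)
      finally show ?thesis using total by simp
    qed
  qed
  then show "pairing (\<lambda>k. \<Sum>j<m. average (b j) (N j) k) f \<le> 1 + 2 * \<theta> * real m"
    by (simp add: tb_def)
qed

text \<open>The last condition is the growth of a rapidly increasing sequence. Lengths are compared
  with positions because a functional of the norming set has no more pieces than the position where
  it starts.\<close>

definition mixed :: "nat \<Rightarrow> real \<Rightarrow> (nat \<Rightarrow> real) \<Rightarrow> bool" where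
  "mixed m \<epsilon> w \<longleftrightarrow> (\<exists>u N. w = average u m \<and> successive m (\<lambda>j. supp (u j)) \<and>
    (\<forall>j<m. u j \<in> c00_pos \<and> 1 \<le> N j \<and> averaged (N j) \<epsilon> (u j)) \<and>
    (\<forall>j<m. \<forall>j'<j. \<forall>k\<in>supp (u j'). k \<le> N j))"

text \<open>The product \<open>v * w\<close> is regrouped by exchanging factors: the primal factor
  of \<open>v\<close> meets the dual factor of \<open>w\<close> and conversely. Counting overlaps
  bounds the first cross pairing by \<open>2 / m\<close>, the estimate for rapidly increasing
  sequences bounds the second by \<open>1 + 2 * \<theta> * m\<close>. As
  \<open>1 / m \<le> \<theta>\<close>, the geometric mean of the two is of order
  \<open>sqrt \<theta>\<close>, and it dominates the minimum.\<close>

theorem averaged_mixed_separated: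
  assumes v: "averaged N \<epsilon> v" and w: "mixed m \<epsilon> w" and N: "m \<le> N" and m: "1 / \<theta> \<le> real m"
    and S: "finite S"
  shows "(\<Sum>k\<in>S. min (v k) (w k)) \<le> 2 * \<epsilon> + 10 * sqrt \<theta>"
proof -
  have m0: "0 < m" using m theta by (cases m) (auto simp: field_simps)
  obtain s s' b where s: "s \<in> c00_pos" "s' \<in> c00_pos" "v = (\<lambda>k. s k * s' k)" "dominated \<tau> s' 1"
    and b: "\<And>i. i < N \<Longrightarrow> b i \<in> c00_pos" "\<And>i. i < N \<Longrightarrow> \<tau> (b i) \<le> 1"
      "successive N (\<lambda>i. supp (b i))"
    and vG: "mass (restr {k. 4 * average b N k < s k} v) \<le> \<epsilon>"
    using v unfolding averaged_def by blast
  obtain u M where u: "w = average u m" "successive m (\<lambda>j. supp (u j))"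
    "\<And>j. j < m \<Longrightarrow> u j \<in> c00_pos" "\<And>j. j < m \<Longrightarrow> 1 \<le> M j" "\<And>j. j < m \<Longrightarrow> averaged (M j) \<epsilon> (u j)"
    "\<And>j j' k. j < m \<Longrightarrow> j' < j \<Longrightarrow> k \<in> supp (u j') \<Longrightarrow> k \<le> M j"
    using w unfolding mixed_def by blast
  define Q where "Q = (\<lambda>j t t' c. t \<in> c00_pos \<and> t' \<in> c00_pos \<and> u j = (\<lambda>k. t k * t' k) \<and> dominated \<tau> t' 1 \<and>
    (\<forall>i<M j. c i \<in> c00_pos \<and> \<tau> (c i) \<le> 1 \<and> supp (c i) \<subseteq> supp (u j)) \<and> successive (M j) (\<lambda>i. supp (c i)) \<and>
    mass (restr {k. 4 * average c (M j) k < t k} (u j)) \<le> \<epsilon>)"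
  have "\<forall>j. \<exists>t t' c. j < m \<longrightarrow> Q j t t' c"
    using u(5) unfolding averaged_def Q_def by blast
  then obtain t t' c where Q: "\<And>j. j < m \<Longrightarrow> Q j (t j) (t' j) (c j)" by metis
  have t: "t j \<in> c00_pos" "t' j \<in> c00_pos" "u j = (\<lambda>k. t j k * t' j k)" "dominated \<tau> (t' j) 1" if "j < m" for j
    using Q[OF that] unfolding Q_def by blast+
  have c: "c j i \<in> c00_pos" "\<tau> (c j i) \<le> 1" "supp (c j i) \<subseteq> supp (u j)" if "j < m" "i < M j" for j i
    using Q[OF that(1)] that(2) unfolding Q_def by blast+
  have sc: "successive (M j) (\<lambda>i. supp (c j i))" if "j < m" for j
    using Q[OF that] unfolding Q_def by blast
  have uG: "mass (restr {k. 4 * average (c j) (M j) k < t j k} (u j)) \<le> \<epsilon>" if "j < m" for j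
    using Q[OF that] unfolding Q_def by blast
  define r where "r = (\<lambda>j. restr (supp (u j)) (t' j))"
  define T' where "T' = average r m"
  define TB where "TB = (\<lambda>k. \<Sum>j<m. average (c j) (M j) k)"
  define sb where "sb = average b N"
  define G where "G = {k. 4 * sb k < s k}"
  define H where "H = (\<lambda>j. {k. 4 * average (c j) (M j) k < t j k})"
  \<comment> \<open>Balances the cross pairings: \<open>\<kappa> * (2 / m)\<close> is
    \<open>2 * sqrt \<theta>\<close> and \<open>(1 + 2 * \<theta> * m) / \<kappa>\<close> is at most
    \<open>3 * sqrt \<theta>\<close>, hence the constant 10.\<close>
  define \<kappa> where "\<kappa> = real m * sqrt \<theta>"
  have \<kappa>: "\<kappa> > 0" using m0 theta by (simp add: \<kappa>_def)
  have sbc: "sb \<in> c00_pos" unfolding sb_def by (intro average_c00_pos b)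
  have rc: "r j \<in> c00_pos" if "j < m" for j unfolding r_def by (intro c00_pos_restr t that)
  have T'c: "T' \<in> c00_pos" unfolding T'_def by (intro average_c00_pos rc)
  have cc: "average (c j) (M j) \<in> c00_pos" if "j < m" for j using c that by (intro average_c00_pos) auto
  have TBc: "TB \<in> c00_pos" unfolding TB_def using cc by (intro c00_pos_sum) auto
  have vc: "v \<in> c00_pos" using c00_pos_mult[OF s(2), of s] s by (simp add: c00_pos_def)
  have T'1: "pairing sb T' \<le> 2 / real m"
  proof -
    have "(\<Sum>j<m. \<Sum>i<N. pairing (b i) (r j)) \<le> 1 * (real m + real N)"
    proof (rule sum_overlaps_le[OF _ b(3)])
      show "successive m (\<lambda>j. supp (r j))"
        by (rule successive_subset[OF u(2)]) (simp add: r_def supp_restr)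
      show "pairing (b i) (r j) \<le> 1" if ij: "j < m" "i < N" for i j
      proof -
        have "dominated \<tau> (r j) 1" unfolding r_def
          using t(2)[OF ij(1)] by (intro dominated_restr t ij) (auto simp: c00_pos_def)
        from dominatedD[OF this b(1)[OF ij(2)]] b(2)[OF ij(2)] show ?thesis by simp
      qed
      show "pairing (b i) (r j) \<le> 0" if "supp (r j) \<inter> supp (b i) = {}" for i j
        using that by (simp add: pairing_disjoint Int_commute)
    qed simp
    also have "\<dots> \<le> 2 * real N" using N by simp
    finally have "(\<Sum>j<m. \<Sum>i<N. pairing (b i) (r j)) / real N / real m \<le> 2 / real m"
      using N m0 by (intro divide_right_mono) (auto simp: field_simps)
    then show ?thesis unfolding T'_def sb_def pairing_average_right
      by (simp add: pairing_average_left[OF b(1)] sum_divide_distrib)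
  qed
  have TB1: "pairing TB s' \<le> 1 + 2 * \<theta> * real m"
  proof -
    have "pairing TB s' \<le> 1 * \<tau> TB" by (rule dominatedD[OF s(4) TBc])
    also have "\<tau> TB \<le> 1 + 2 * \<theta> * real m" unfolding TB_def
      by (rule norm_sum_averages_le[where A = "\<lambda>j. supp (u j)"]) (use c sc u in \<open>blast+\<close>)
    finally show ?thesis by simp
  qed
  have nn: "0 \<le> sb k" "0 \<le> T' k" "0 \<le> TB k" "0 \<le> s' k" "0 \<le> v k" "0 \<le> s k" for k
    using sbc T'c TBc s vc by (auto simp: c00_pos_def)
  have unn: "0 \<le> u j k" if "j < m" for j k using u(3)[OF that] by (simp add: c00_pos_def)
  have wnn: "0 \<le> w k" for k using unn by (auto simp: u(1) average_def intro!: divide_nonneg_nonneg sum_nonneg)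
  have key: "min (v k) (w k) \<le> restr G v k + (\<Sum>j<m. restr (H j) (u j) k) / real m
      + 2 * (\<kappa> * (sb k * T' k) + (TB k * s' k) / \<kappa>)" (is "_ \<le> ?A + ?B + ?C") for k
  proof -
    have A: "0 \<le> ?A" using nn by (simp add: restr_def)
    have B: "0 \<le> ?B" by (intro divide_nonneg_nonneg sum_nonneg) (auto simp: restr_def unn)
    have C: "0 \<le> ?C" using nn \<kappa> by simp
    show ?thesis
    proof (cases "\<exists>j<m. k \<in> supp (u j)")
      case False
      then have "w k = 0" by (simp add: u(1) average_def supp_def)
      then show ?thesis using A B C nn(5)[of k] by simp
    next
      case True
      then obtain j where j: "j < m" "k \<in> supp (u j)" by blast
      have "u i k = 0" if "i < m" "i \<noteq> j" for i
        using successive_disjoint[OF u(2) that(1) j(1) that(2)] j(2) by (auto simp: supp_def)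
      then have "(\<Sum>i<m. u i k) = (\<Sum>i\<in>{j}. u i k)"
        using j by (intro sum.mono_neutral_right) auto
      then have wk: "w k = u j k / real m" by (simp add: u(1) average_def)
      show ?thesis
      proof (cases "k \<in> G")
        case True
        then show ?thesis using B C by (simp add: restr_def)
      next
        case nG: False
        show ?thesis
        proof (cases "k \<in> H j")
          case True
          have "restr (H j) (u j) k \<le> (\<Sum>j<m. restr (H j) (u j) k)"
            using j unn by (intro member_le_sum) (auto simp: restr_def)
          then have "w k \<le> ?B" using True by (simp add: wk restr_def divide_right_mono)
          then show ?thesis using A C by linarith
        next
          case nH: False
          have t0: "0 \<le> t j k" "0 \<le> t' j k" using t(1,2)[OF j(1)] by (auto simp: c00_pos_def)
          have 1: "s k \<le> 4 * sb k" using nG by (simp add: G_def)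
          have "average (c j) (M j) k \<le> TB k" unfolding TB_def
            using cc j by (intro member_le_sum) (auto simp: c00_pos_def)
          then have 2: "t j k \<le> 4 * TB k" using nH by (simp add: H_def)
          have "r j k \<le> (\<Sum>j<m. r j k)" using j rc by (intro member_le_sum) (auto simp: c00_pos_def)
          then have 3: "t' j k / real m \<le> T' k"
            using j by (simp add: T'_def average_def r_def restr_def divide_right_mono)
          have "(min (v k) (w k))\<^sup>2 \<le> v k * w k"
            unfolding power2_eq_square using nn(5)[of k] wnn[of k] by (intro mult_mono) auto
          also have "v k * w k = (s k * (t' j k / real m)) * (t j k * s' k)"
            using t(3)[OF j(1)] by (simp add: s(3) wk)
          also have "\<dots> \<le> ((4 * sb k) * T' k) * ((4 * TB k) * s' k)"
            using 1 2 3 nn t0 by (intro mult_mono) auto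
          also have "\<dots> = 16 * ((sb k * T' k) * (TB k * s' k))" by simp
          finally have "min (v k) (w k) \<le> ?C"
            using \<kappa> nn wnn by (intro le_weighted_sum) (auto simp: min_def)
          then show ?thesis using A B by linarith
        qed
      qed
    qed
  qed
  have "(\<Sum>k\<in>S. min (v k) (w k)) \<le> (\<Sum>k\<in>S. restr G v k + (\<Sum>j<m. restr (H j) (u j) k) / real m
      + 2 * (\<kappa> * (sb k * T' k) + (TB k * s' k) / \<kappa>))"
    by (intro sum_mono key)
  also have "\<dots> = (\<Sum>k\<in>S. restr G v k) + (\<Sum>j<m. \<Sum>k\<in>S. restr (H j) (u j) k) / real m
      + 2 * (\<kappa> * (\<Sum>k\<in>S. sb k * T' k) + (\<Sum>k\<in>S. TB k * s' k) / \<kappa>)"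
    by (simp add: sum.distrib sum_distrib_left sum_divide_distrib sum.swap[of _ S])
  also have "\<dots> \<le> \<epsilon> + \<epsilon> + 2 * (\<kappa> * (2 / real m) + (1 + 2 * \<theta> * real m) / \<kappa>)"
  proof (intro add_mono mult_left_mono divide_right_mono)
    have le_mass: "(\<Sum>k\<in>S. f k) \<le> mass f" if "f \<in> c00_pos" for f
      using sum_pairing_le[OF that _ S, of "\<lambda>_. 1"] by (simp add: pairing_def mass_def)
    show "(\<Sum>k\<in>S. restr G v k) \<le> \<epsilon>"
      using le_mass[OF c00_pos_restr[OF vc, of G]] vG by (simp add: G_def sb_def)
    have "(\<Sum>j<m. \<Sum>k\<in>S. restr (H j) (u j) k) \<le> (\<Sum>j<m. \<epsilon>)"
      unfolding H_def by (intro sum_mono order_trans[OF le_mass[OF c00_pos_restr[OF u(3)]] uG]) auto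
    then show "(\<Sum>j<m. \<Sum>k\<in>S. restr (H j) (u j) k) / real m \<le> \<epsilon>"
      using m0 by (simp add: field_simps)
    show "(\<Sum>k\<in>S. sb k * T' k) \<le> 2 / real m"
      using sum_pairing_le[OF sbc _ S, of T'] nn(2) T'1 by simp
    show "(\<Sum>k\<in>S. TB k * s' k) \<le> 1 + 2 * \<theta> * real m"
      using sum_pairing_le[OF TBc _ S, of s'] nn(4) TB1 by simp
  qed (use \<kappa> in auto)
  also have "\<dots> \<le> 2 * \<epsilon> + 10 * sqrt \<theta>"
  proof -
    have q: "sqrt \<theta> > 0" "sqrt \<theta> * sqrt \<theta> = \<theta>" using theta by auto
    have "\<kappa> * (2 / real m) = 2 * sqrt \<theta>" using m0 by (simp add: \<kappa>_def)
    moreover have "1 / \<kappa> \<le> sqrt \<theta>"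
    proof -
      have "1 \<le> \<theta> * real m" using m theta by (simp add: field_simps)
      then have "1 \<le> sqrt \<theta> * \<kappa>" using q by (simp add: \<kappa>_def mult.left_commute mult.commute)
      then show ?thesis using \<kappa> by (simp add: field_simps)
    qed
    moreover have "2 * \<theta> * real m / \<kappa> = 2 * sqrt \<theta>"
      using m0 q by (simp add: \<kappa>_def field_simps)
    ultimately show ?thesis by (simp add: add_divide_distrib)
  qed
  finally show ?thesis .
qed

end

section \<open>Regular pairs\<close>

text \<open>For a lattice norm, disjoint vectors of norm at least \<open>\<eta>\<close> with sum in
  the unit ball span \<open>l_infinity^n\<close> with constant depending on \<open>\<eta>\<close>
  only; this is what is excluded for large \<open>n\<close>.\<close>

definition no_linf :: "((nat \<Rightarrow> real) \<Rightarrow> real) \<Rightarrow> bool" where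
  "no_linf \<rho> \<longleftrightarrow> (\<forall>\<eta>>0. \<exists>n::nat. \<forall>x. (\<forall>i<n. x i \<in> c00_pos \<and> \<eta> \<le> \<rho> (x i)) \<and>
     disjoint_family_on (\<lambda>i. supp (x i)) {..<n} \<longrightarrow> 1 < \<rho> (\<lambda>k. \<Sum>i<n. x i k))"

text \<open>Nonnegative coefficients suffice, since a lattice norm sees only the moduli of the
  coefficients of disjoint vectors.\<close>

definition no_l1 :: "((nat \<Rightarrow> real) \<Rightarrow> real) \<Rightarrow> bool" where
  "no_l1 \<rho> \<longleftrightarrow> (\<forall>\<eta>>0. \<exists>n::nat. \<forall>x. (\<forall>i<n. x i \<in> c00_pos \<and> \<rho> (x i) \<le> 1) \<and>
     disjoint_family_on (\<lambda>i. supp (x i)) {..<n} \<longrightarrow>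
     (\<exists>c. (\<forall>i<n. 0 \<le> c i) \<and> \<rho> (\<lambda>k. \<Sum>i<n. c i * x i k) < \<eta> * (\<Sum>i<n. c i)))"

lemma no_linfE:
  assumes "no_linf \<rho>" "\<eta> > 0"
  obtains n :: nat where "\<And>x. (\<And>i. i < n \<Longrightarrow> x i \<in> c00_pos) \<Longrightarrow> (\<And>i. i < n \<Longrightarrow> \<eta> \<le> \<rho> (x i)) \<Longrightarrow>
     disjoint_family_on (\<lambda>i. supp (x i)) {..<n} \<Longrightarrow> 1 < \<rho> (\<lambda>k. \<Sum>i<n. x i k)"
proof -
  obtain n :: nat where "\<forall>x. (\<forall>i<n. x i \<in> c00_pos \<and> \<eta> \<le> \<rho> (x i)) \<and>
     disjoint_family_on (\<lambda>i. supp (x i)) {..<n} \<longrightarrow> 1 < \<rho> (\<lambda>k. \<Sum>i<n. x i k)"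
    using assms(1)[unfolded no_linf_def, rule_format, OF assms(2)] by auto
  then show ?thesis by (intro that[of n]) simp
qed

lemma no_l1E:
  assumes "no_l1 \<rho>" "\<eta> > 0"
  obtains n :: nat where "\<And>x. (\<And>i. i < n \<Longrightarrow> x i \<in> c00_pos) \<Longrightarrow> (\<And>i. i < n \<Longrightarrow> \<rho> (x i) \<le> 1) \<Longrightarrow>
     disjoint_family_on (\<lambda>i. supp (x i)) {..<n} \<Longrightarrow>
     (\<exists>c. (\<forall>i<n. 0 \<le> c i) \<and> \<rho> (\<lambda>k. \<Sum>i<n. c i * x i k) < \<eta> * (\<Sum>i<n. c i))"
proof -
  obtain n :: nat where "\<forall>x. (\<forall>i<n. x i \<in> c00_pos \<and> \<rho> (x i) \<le> 1) \<and>
     disjoint_family_on (\<lambda>i. supp (x i)) {..<n} \<longrightarrow>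
     (\<exists>c. (\<forall>i<n. 0 \<le> c i) \<and> \<rho> (\<lambda>k. \<Sum>i<n. c i * x i k) < \<eta> * (\<Sum>i<n. c i))"
    using assms(1)[unfolded no_l1_def, rule_format, OF assms(2)] by auto
  then show ?thesis by (intro that[of n]) simp
qed

lemma ex_inj_into:
  assumes "finite I" "n \<le> card I"
  obtains h where "inj_on h {..<n::nat}" "h ` {..<n} \<subseteq> I"
proof -
  obtain T where T: "T \<subseteq> I" "card T = n" "finite T"
    using assms by (metis finite_subset obtain_subset_with_card_n)
  obtain h where "bij_betw h {0..<card T} T" using ex_bij_betw_nat_finite[OF T(3)] by blast
  then show ?thesis using that[of h] T by (auto simp: bij_betw_def atLeast0LessThan)
qed

lemma disjoint_family_on_reindex:
  assumes "disjoint_family_on A I" "inj_on f J" "f ` J \<subseteq> I" "i \<in> J" "j \<in> J" "i \<noteq> j"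
  shows "A (f i) \<inter> A (f j) = {}"
proof (rule disjoint_family_onD[OF assms(1)])
  show "f i \<in> I" "f j \<in> I" using assms by blast+
  show "f i \<noteq> f j" using assms by (auto dest: inj_onD)
qed

lemma disjoint_family_on_extend:
  assumes A: "disjoint_family_on A {..<r::nat}" and B: "B \<inter> (\<Union>i<r. A i) = {}"
  shows "disjoint_family_on (A(r := B)) {..<Suc r}"
  unfolding disjoint_family_on_def
proof (intro ballI impI)
  fix i j assume ij: "i \<in> {..<Suc r}" "j \<in> {..<Suc r}" "i \<noteq> j"
  show "(A(r := B)) i \<inter> (A(r := B)) j = {}"
  proof (cases "i = r \<or> j = r")
    case True
    then show ?thesis using ij B by (auto simp: less_Suc_eq)
  next
    case False
    then show ?thesis using ij disjoint_family_onD[OF A, of i j] by auto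
  qed
qed

lemma ex_maximal_nat:
  assumes "P (0::nat)" "\<And>r. P r \<Longrightarrow> r < n"
  obtains r where "P r" "\<not> P (Suc r)"
proof -
  have "\<exists>r. P r \<and> (\<forall>y. P y \<longrightarrow> y \<le> r)"
    by (rule ex_has_greatest_nat[of P 0 id n, simplified]) (use assms in \<open>auto intro: less_imp_le\<close>)
  then show ?thesis using that by (metis Suc_n_not_le_n)
qed

lemma pairing_restr_Compl:
  assumes "f \<in> c00_pos"
  shows "pairing f g = pairing (restr E f) g + pairing (restr (- E) f) g"
proof -
  have "f = (\<lambda>k. restr E f k + restr (- E) f k)" by (auto simp: restr_def)
  then show ?thesis
    using pairing_add_left[OF c00_pos_restr[OF assms] c00_pos_restr[OF assms], of E "- E" g] by simp
qed

text \<open>Uniform integrability: with respect to the probability vector \<open>y g\<close>, the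
  norm of \<open>y\<close> and the dual norm of \<open>g\<close> are absolutely continuous at the
  scale given by \<open>\<epsilon>\<close> and \<open>\<delta>\<close>. This is what lets statements
  about mass be read as statements about norms.\<close>

definition regular ::
  "((nat \<Rightarrow> real) \<Rightarrow> real) \<Rightarrow> real \<Rightarrow> real \<Rightarrow> real \<Rightarrow> (nat \<Rightarrow> real) \<Rightarrow> (nat \<Rightarrow> real) \<Rightarrow> bool" where
  "regular \<rho> C \<delta> \<epsilon> y g \<longleftrightarrow> y \<in> c00_pos \<and> g \<in> c00_pos \<and> supp g \<subseteq> supp y \<and> pairing y g = 1 \<and>
     \<rho> y \<le> C \<and> dominated \<rho> g C \<and>
     (\<forall>E. pairing (restr E y) g \<le> \<epsilon> \<longrightarrow> \<rho> (restr E y) \<le> \<delta> \<and> dominated \<rho> (restr E g) \<delta>)"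

context lattice_norm
begin

lemma card_large_pieces:
  assumes "no_linf \<rho>" "\<eta> > 0"
  obtains n where "\<And>y I A. y \<in> c00_pos \<Longrightarrow> \<rho> y \<le> 1 \<Longrightarrow> finite I \<Longrightarrow>
    disjoint_family_on A (I :: nat set) \<Longrightarrow> (\<And>i. i \<in> I \<Longrightarrow> \<eta> \<le> \<rho> (restr (A i) y)) \<Longrightarrow> card I < n"
proof -
  obtain n :: nat where n: "\<And>x. (\<And>i. i < n \<Longrightarrow> x i \<in> c00_pos) \<Longrightarrow> (\<And>i. i < n \<Longrightarrow> \<eta> \<le> \<rho> (x i)) \<Longrightarrow>
     disjoint_family_on (\<lambda>i. supp (x i)) {..<n} \<Longrightarrow> 1 < \<rho> (\<lambda>k. \<Sum>i<n. x i k)"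
    using no_linfE[OF assms] by blast
  show ?thesis
  proof (rule that, rule ccontr)
    fix y and I :: "nat set" and A
    assume h: "y \<in> c00_pos" "\<rho> y \<le> 1" "finite I" "disjoint_family_on A I"
      "\<And>i. i \<in> I \<Longrightarrow> \<eta> \<le> \<rho> (restr (A i) y)" "\<not> card I < n"
    obtain f where f: "inj_on f {..<n}" "f ` {..<n} \<subseteq> I"
      using ex_inj_into[OF h(3), of n] h(6) by auto
    have dis: "A (f i) \<inter> A (f j) = {}" if "i < n" "j < n" "i \<noteq> j" for i j
      by (rule disjoint_family_on_reindex[OF h(4) f]) (use that in auto)
    have "1 < \<rho> (\<lambda>k. \<Sum>i<n. restr (A (f i)) y k)"
    proof (rule n)
      show "disjoint_family_on (\<lambda>i. supp (restr (A (f i)) y)) {..<n}"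
        using dis by (fastforce simp: disjoint_family_on_def supp_restr)
    qed (use h f in \<open>auto simp: c00_pos_restr\<close>)
    also have "\<dots> \<le> \<rho> y"
      by (intro mono c00_pos_sum sum_restr_disjoint_le h) (use h dis in \<open>auto simp: c00_pos_restr\<close>)
    finally show False using h(2) by simp
  qed
qed

text \<open>Unit vectors on the sets \<open>A i\<close> at which \<open>g\<close> is at least
  \<open>\<eta>\<close> satisfy a lower \<open>l_1\<close> estimate with constant
  \<open>\<eta>\<close>, witnessed by the single functional \<open>g\<close>.\<close>

lemma card_large_dual_pieces:
  assumes "no_l1 \<rho>" "\<eta> > 0"
  obtains n where "\<And>g I A. g \<in> c00_pos \<Longrightarrow> dominated \<rho> g 1 \<Longrightarrow> finite I \<Longrightarrow>
    disjoint_family_on A (I :: nat set) \<Longrightarrow> (\<And>i. i \<in> I \<Longrightarrow> \<not> dominated \<rho> (restr (A i) g) \<eta>) \<Longrightarrow> card I < n"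
proof -
  obtain n :: nat where n: "\<And>x. (\<And>i. i < n \<Longrightarrow> x i \<in> c00_pos) \<Longrightarrow> (\<And>i. i < n \<Longrightarrow> \<rho> (x i) \<le> 1) \<Longrightarrow>
     disjoint_family_on (\<lambda>i. supp (x i)) {..<n} \<Longrightarrow>
     (\<exists>c. (\<forall>i<n. 0 \<le> c i) \<and> \<rho> (\<lambda>k. \<Sum>i<n. c i * x i k) < \<eta> * (\<Sum>i<n. c i))"
    using no_l1E[OF assms] by blast
  show ?thesis
  proof (rule that, rule ccontr)
    fix g and I :: "nat set" and A
    assume h: "g \<in> c00_pos" "dominated \<rho> g 1" "finite I" "disjoint_family_on A I"
      "\<And>i. i \<in> I \<Longrightarrow> \<not> dominated \<rho> (restr (A i) g) \<eta>" "\<not> card I < n"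
    obtain f where f: "inj_on f {..<n}" "f ` {..<n} \<subseteq> I"
      using ex_inj_into[OF h(3), of n] h(6) by auto
    have dis: "A (f i) \<inter> A (f j) = {}" if "i < n" "j < n" "i \<noteq> j" for i j
      by (rule disjoint_family_on_reindex[OF h(4) f]) (use that in auto)
    have "\<exists>x\<in>c00_pos. supp x \<subseteq> B \<and> \<rho> x \<le> 1 \<and> \<eta> \<le> pairing x g"
      if nd: "\<not> dominated \<rho> (restr B g) \<eta>" for B
    proof -
      obtain x where x: "x \<in> c00_pos" "\<eta> * \<rho> x < pairing x (restr B g)"
        using nd unfolding dominated_def by (meson not_le)
      define x' where "x' = restr B x"
      have x'c: "x' \<in> c00_pos" unfolding x'_def by (rule c00_pos_restr[OF x(1)])
      have "\<eta> * \<rho> x' \<le> \<eta> * \<rho> x" using restr_mono[OF x(1)] assms(2) by (simp add: x'_def)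
      then have big: "\<eta> * \<rho> x' < pairing x' g" using x by (simp add: pairing_restr_right x'_def)
      have "\<exists>i. x' i \<noteq> 0"
      proof (rule ccontr)
        assume "\<not> ?thesis"
        then have "x' = (\<lambda>i. 0)" by auto
        then show False using big by (simp add: zero pairing_def)
      qed
      then obtain i where i: "x' i \<noteq> 0" by blast
      have p: "0 < \<rho> x'" by (rule pos[OF x'c i])
      have "pairing (\<lambda>i. x' i / \<rho> x') g = pairing x' g / \<rho> x'"
        using pairing_scale_left[OF x'c, of "1 / \<rho> x'" g] by simp
      moreover have "\<eta> \<le> pairing x' g / \<rho> x'" using big p by (simp add: pos_le_divide_eq)
      ultimately have "\<eta> \<le> pairing (\<lambda>i. x' i / \<rho> x') g" by simp
      moreover have "supp (\<lambda>i. x' i / \<rho> x') \<subseteq> B" by (auto simp: supp_def x'_def restr_def split: if_splits)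
      ultimately show ?thesis using normalize[OF x'c i] by (intro bexI[of _ "\<lambda>i. x' i / \<rho> x'"]) auto
    qed
    then have "\<forall>i. \<exists>x. i < n \<longrightarrow> x \<in> c00_pos \<and> supp x \<subseteq> A (f i) \<and> \<rho> x \<le> 1 \<and> \<eta> \<le> pairing x g"
      using h(5) f(2) by blast
    then obtain x where x: "\<And>i. i < n \<Longrightarrow> x i \<in> c00_pos \<and> supp (x i) \<subseteq> A (f i) \<and> \<rho> (x i) \<le> 1 \<and> \<eta> \<le> pairing (x i) g"
      by metis
    have "disjoint_family_on (\<lambda>i. supp (x i)) {..<n}"
      using dis x unfolding disjoint_family_on_def by (metis inf_mono lessThan_iff subset_empty)
    then obtain c where c: "\<And>i. i < n \<Longrightarrow> 0 \<le> c i" "\<rho> (\<lambda>k. \<Sum>i<n. c i * x i k) < \<eta> * (\<Sum>i<n. c i)"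
      using n[of x] x by blast
    have cx: "(\<lambda>k. c i * x i k) \<in> c00_pos" if "i < n" for i
      using x[OF that] c(1)[OF that] by (simp add: c00_pos_scale)
    have "\<eta> * (\<Sum>i<n. c i) \<le> (\<Sum>i<n. c i * pairing (x i) g)"
      unfolding sum_distrib_left
    proof (rule sum_mono)
      fix i assume "i \<in> {..<n}"
      then have "c i * \<eta> \<le> c i * pairing (x i) g" using x c(1) by (intro mult_left_mono) auto
      then show "\<eta> * c i \<le> c i * pairing (x i) g" by (simp add: mult.commute)
    qed
    also have "\<dots> = (\<Sum>i<n. pairing (\<lambda>k. c i * x i k) g)"
      by (intro sum.cong refl) (use x in \<open>simp add: pairing_scale_left\<close>)
    also have "\<dots> = pairing (\<lambda>k. \<Sum>i<n. c i * x i k) g"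
      by (intro pairing_sum_left[symmetric]) (use cx in auto)
    also have "\<dots> \<le> 1 * \<rho> (\<lambda>k. \<Sum>i<n. c i * x i k)"
      by (intro dominatedD[OF h(2)] c00_pos_sum) (use cx in auto)
    finally show False using c(2) by simp
  qed
qed

text \<open>Removing from a norming functional \<open>g\<close> of \<open>y\<close> a maximal disjoint family of sets on which
  \<open>y \<cdot> g\<close> is small but \<open>g\<close> is not.\<close>

lemma truncated_norming_functional:
  assumes "no_l1 \<rho>" "\<delta> > 0"
  obtains \<epsilon> where "\<epsilon> > 0" "\<And>y. y \<in> c00_pos \<Longrightarrow> \<rho> y = 1 \<Longrightarrow> \<exists>g\<in>c00_pos. supp g \<subseteq> supp y \<and>
    dominated \<rho> g 1 \<and> 1 / 2 \<le> pairing y g \<and> (\<forall>E. pairing (restr E y) g \<le> \<epsilon> \<longrightarrow> dominated \<rho> (restr E g) \<delta>)"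
proof -
  obtain n where n: "\<And>g I A. g \<in> c00_pos \<Longrightarrow> dominated \<rho> g 1 \<Longrightarrow> finite I \<Longrightarrow>
    disjoint_family_on A (I :: nat set) \<Longrightarrow> (\<And>i. i \<in> I \<Longrightarrow> \<not> dominated \<rho> (restr (A i) g) \<delta>) \<Longrightarrow> card I < n"
    using card_large_dual_pieces[OF assms] by blast
  \<comment> \<open>Fewer than \<open>n\<close> sets are removed at a cost of at most
    \<open>\<epsilon>\<close> each, so at least half of \<open>pairing y g = 1\<close> is
    left.\<close>
  define \<epsilon> where "\<epsilon> = 1 / (2 * (real n + 1))"
  have \<epsilon>: "\<epsilon> > 0" by (simp add: \<epsilon>_def)
  show ?thesis
  proof (rule that[OF \<epsilon>])
    fix y assume y: "y \<in> c00_pos" "\<rho> y = 1"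
    obtain g where g: "g \<in> c00_pos" "supp g \<subseteq> supp y" "pairing y g = \<rho> y" "dominated \<rho> g 1"
      using norming_functional[OF y(1)] by blast
    have g0: "0 \<le> g i" for i using g(1) by (simp add: c00_pos_def)
    define P where "P = (\<lambda>r. \<exists>A. disjoint_family_on A {..<r::nat} \<and>
      (\<forall>i<r. pairing (restr (A i) y) g \<le> \<epsilon> \<and> \<not> dominated \<rho> (restr (A i) g) \<delta>))"
    obtain r where r: "P r" "\<not> P (Suc r)"
    proof (rule ex_maximal_nat[of P n])
      show "P 0" by (simp add: P_def disjoint_family_on_def)
      show "r < n" if "P r" for r
      proof -
        from that obtain A where A: "disjoint_family_on A {..<r}"
          "\<forall>i<r. \<not> dominated \<rho> (restr (A i) g) \<delta>" unfolding P_def by blast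
        show ?thesis using n[OF g(1,4) _ A(1)] A(2) by simp
      qed
    qed
    then obtain A where A: "disjoint_family_on A {..<r}"
      "\<And>i. i < r \<Longrightarrow> pairing (restr (A i) y) g \<le> \<epsilon>" "\<And>i. i < r \<Longrightarrow> \<not> dominated \<rho> (restr (A i) g) \<delta>"
      unfolding P_def by blast
    have "r < n" using n[OF g(1,4) _ A(1)] A(3) by simp
    define F where "F = - (\<Union>i<r. A i)"
    show "\<exists>g\<in>c00_pos. supp g \<subseteq> supp y \<and> dominated \<rho> g 1 \<and> 1 / 2 \<le> pairing y g \<and>
      (\<forall>E. pairing (restr E y) g \<le> \<epsilon> \<longrightarrow> dominated \<rho> (restr E g) \<delta>)"
    proof (intro bexI[of _ "restr F g"] conjI allI impI)
      show "restr F g \<in> c00_pos" by (rule c00_pos_restr[OF g(1)])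
      show "supp (restr F g) \<subseteq> supp y" using g(2) by (auto simp: supp_restr)
      show "dominated \<rho> (restr F g) 1" by (rule dominated_restr[OF g(4) g0])
      have "pairing (restr (- F) y) g \<le> pairing (\<lambda>k. \<Sum>i<r. restr (A i) y k) g"
      proof (rule pairing_mono_left)
        show "(\<lambda>k. \<Sum>i<r. restr (A i) y k) \<in> c00_pos"
          using y by (intro c00_pos_sum c00_pos_restr) auto
        show "restr (- F) y k \<le> (\<Sum>i<r. restr (A i) y k)" for k
        proof (cases "k \<in> - F")
          case True
          then obtain i where i: "i < r" "k \<in> A i" by (auto simp: F_def)
          have "restr (A i) y k \<le> (\<Sum>i<r. restr (A i) y k)"
            using i y by (intro member_le_sum) (auto simp: restr_def c00_pos_def)
          then show ?thesis using i True by (simp add: restr_def)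
        next
          case False
          then show ?thesis using y by (simp add: restr_def sum_nonneg c00_pos_def)
        qed
      qed (use y g0 in \<open>auto simp: c00_pos_restr\<close>)
      also have "\<dots> = (\<Sum>i<r. pairing (restr (A i) y) g)"
        using y by (intro pairing_sum_left c00_pos_restr) auto
      also have "\<dots> \<le> (\<Sum>i<r. \<epsilon>)" using A(2) by (intro sum_mono) auto
      also have "\<dots> \<le> real n * \<epsilon>" using \<open>r < n\<close> \<epsilon> by (simp add: mult_right_mono)
      also have "\<dots> \<le> 1 / 2" by (simp add: \<epsilon>_def field_simps)
      finally show "1 / 2 \<le> pairing y (restr F g)"
        using pairing_restr_Compl[OF y(1), of g F] g(3) y by (simp add: pairing_restr_right)
      fix E assume E: "pairing (restr E y) (restr F g) \<le> \<epsilon>"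
      have EF: "pairing (restr (E \<inter> F) y) g \<le> \<epsilon>"
        using E y by (simp add: pairing_restr_right c00_pos_restr restr_restr Int_commute)
      show "dominated \<rho> (restr E (restr F g)) \<delta>"
      proof (rule ccontr)
        assume nd: "\<not> dominated \<rho> (restr E (restr F g)) \<delta>"
        have "P (Suc r)" unfolding P_def
        proof (intro exI[of _ "A(r := E \<inter> F)"] conjI)
          show "disjoint_family_on (A(r := E \<inter> F)) {..<Suc r}"
            by (rule disjoint_family_on_extend[OF A(1)]) (auto simp: F_def)
        qed (use A EF nd in \<open>auto simp: less_Suc_eq restr_restr\<close>)
        then show False using r by simp
      qed
    qed
  qed
qed

text \<open>A longest chain of sets \<open>E\<^sub>i\<close> on which \<open>y\<close> is large while the functionals norming \<open>y\<close> on the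
  previous sets nearly vanish gives functionals that detect every piece of \<open>y\<close>.\<close>

lemma detecting_functionals:
  assumes "no_linf \<rho>" "\<delta> > 0"
  obtains \<epsilon> n where "\<epsilon> > 0" "\<And>y. y \<in> c00_pos \<Longrightarrow> \<rho> y = 1 \<Longrightarrow> \<exists>r h. r \<le> (n::nat) \<and>
    (\<forall>i<r. h i \<in> c00_pos \<and> supp (h i) \<subseteq> supp y \<and> dominated \<rho> (h i) 1) \<and>
    (\<forall>E. (\<forall>i<r. pairing (restr E y) (h i) \<le> \<epsilon>) \<longrightarrow> \<rho> (restr E y) \<le> \<delta>)"
proof -
  obtain n where n: "\<And>y I A. y \<in> c00_pos \<Longrightarrow> \<rho> y \<le> 1 \<Longrightarrow> finite I \<Longrightarrow>
    disjoint_family_on A (I :: nat set) \<Longrightarrow> (\<And>i. i \<in> I \<Longrightarrow> \<delta> / 2 \<le> \<rho> (restr (A i) y)) \<Longrightarrow> card I < n"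
    using card_large_pieces[OF assms(1), of "\<delta> / 2"] assms(2) by auto
  define \<epsilon> where "\<epsilon> = \<delta> / (2 * (real n + 1))"
  have \<epsilon>: "\<epsilon> > 0" using assms(2) by (simp add: \<epsilon>_def)
  show ?thesis
  proof (rule that[OF \<epsilon>, of n])
    fix y assume y: "y \<in> c00_pos" "\<rho> y = 1"
    define Q where "Q = (\<lambda>(r::nat) E h. (\<forall>i<r. h i \<in> c00_pos \<and> supp (h i) \<subseteq> E i \<inter> supp y \<and> dominated \<rho> (h i) 1 \<and>
        \<delta> < pairing (restr (E i) y) (h i)) \<and> (\<forall>j<r. \<forall>i<j. pairing (restr (E j) y) (h i) \<le> \<epsilon>))"
    have bound: "r < n" if "Q r E h" for r E h
    proof (rule ccontr)
      assume "\<not> r < n"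
      then have nr: "n \<le> r" by simp
      \<comment> \<open>Deleting the later sets makes the family disjoint. Since \<open>h i\<close>
        nearly vanishes on the later sets, it keeps at least \<open>\<delta> / 2\<close> on what
        remains of \<open>E i\<close>, and too many large disjoint pieces of \<open>y\<close>
        contradict the bound \<open>n\<close>.\<close>
      define D where "D = (\<lambda>i. E i - (\<Union>j\<in>{i<..<n}. E j))"
      have "disjoint_family_on D {..<n}"
        unfolding disjoint_family_on_def
      proof (intro ballI impI)
        fix i j assume "i \<in> {..<n}" "j \<in> {..<n}" "i \<noteq> j"
        then show "D i \<inter> D j = {}" by (cases i j rule: linorder_cases) (auto simp: D_def)
      qed
      moreover have "\<delta> / 2 \<le> \<rho> (restr (D i) y)" if i: "i < n" for i
      proof -
        have hi: "h i \<in> c00_pos" "dominated \<rho> (h i) 1" "\<delta> < pairing (restr (E i) y) (h i)"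
          using \<open>Q r E h\<close> i nr by (auto simp: Q_def)
        have h0: "0 \<le> h i k" for k using hi(1) by (simp add: c00_pos_def)
        have "pairing (restr (E i) y) (h i) \<le>
            pairing (\<lambda>k. restr (D i) y k + (\<Sum>j\<in>{i<..<n}. restr (E j) y k)) (h i)"
        proof (rule pairing_mono_left)
          show "restr (E i) y k \<le> restr (D i) y k + (\<Sum>j\<in>{i<..<n}. restr (E j) y k)" for k
          proof (cases "k \<in> E i \<and> k \<notin> D i")
            case True
            then obtain j where j: "j \<in> {i<..<n}" "k \<in> E j" by (auto simp: D_def)
            have "restr (E j) y k \<le> (\<Sum>j\<in>{i<..<n}. restr (E j) y k)"
              using j y by (intro member_le_sum) (auto simp: restr_def c00_pos_def)
            then show ?thesis using j True by (simp add: restr_def)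
          next
            case False
            have "0 \<le> (\<Sum>j\<in>{i<..<n}. restr (E j) y k)"
              using y by (intro sum_nonneg) (auto simp: restr_def c00_pos_def)
            then show ?thesis using False y by (auto simp: restr_def c00_pos_def)
          qed
          show "(\<lambda>k. restr (D i) y k + (\<Sum>j\<in>{i<..<n}. restr (E j) y k)) \<in> c00_pos"
            using y by (intro c00_pos_add c00_pos_sum c00_pos_restr) auto
        qed (use y h0 in \<open>auto simp: c00_pos_restr\<close>)
        also have "\<dots> = pairing (restr (D i) y) (h i) + pairing (\<lambda>k. \<Sum>j\<in>{i<..<n}. restr (E j) y k) (h i)"
          using y by (intro pairing_add_left c00_pos_sum c00_pos_restr) auto
        also have "pairing (\<lambda>k. \<Sum>j\<in>{i<..<n}. restr (E j) y k) (h i) = (\<Sum>j\<in>{i<..<n}. pairing (restr (E j) y) (h i))"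
          using y by (intro pairing_sum_left c00_pos_restr) auto
        also have "\<dots> \<le> (\<Sum>j\<in>{i<..<n}. \<epsilon>)"
          using \<open>Q r E h\<close> nr by (intro sum_mono) (auto simp: Q_def)
        also have "\<dots> = real (card {i<..<n}) * \<epsilon>" by simp
        also have "\<dots> \<le> real n * \<epsilon>" using \<epsilon> by (intro mult_right_mono) auto
        also have "\<dots> \<le> \<delta> / 2" using assms(2) by (simp add: \<epsilon>_def field_simps)
        finally have "\<delta> / 2 \<le> pairing (restr (D i) y) (h i)" using hi(3) by simp
        also have "\<dots> \<le> 1 * \<rho> (restr (D i) y)" by (rule dominatedD[OF hi(2) c00_pos_restr[OF y(1)]])
        finally show ?thesis by simp
      qed
      ultimately have "card {..<n} < n" using y by (intro n[of y _ D]) auto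
      then show False by simp
    qed
    define P where "P = (\<lambda>r. \<exists>E h. Q r E h)"
    obtain r where r: "P r" "\<not> P (Suc r)"
      by (rule ex_maximal_nat[of P n]) (use bound in \<open>auto simp: P_def Q_def\<close>)
    then obtain E h where Eh: "Q r E h" unfolding P_def by blast
    have "\<rho> (restr E' y) \<le> \<delta>" if E': "\<forall>i<r. pairing (restr E' y) (h i) \<le> \<epsilon>" for E'
    proof (rule ccontr)
      assume big: "\<not> \<rho> (restr E' y) \<le> \<delta>"
      obtain g where g: "g \<in> c00_pos" "supp g \<subseteq> supp (restr E' y)"
        "pairing (restr E' y) g = \<rho> (restr E' y)" "dominated \<rho> g 1"
        using norming_functional[OF c00_pos_restr[OF y(1)]] by blast
      have "Q (Suc r) (E(r := E')) (h(r := g))"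
        using Eh g big E' unfolding Q_def by (auto simp: less_Suc_eq supp_restr)
      then show False using r(2) unfolding P_def by blast
    qed
    then show "\<exists>r h. r \<le> n \<and> (\<forall>i<r. h i \<in> c00_pos \<and> supp (h i) \<subseteq> supp y \<and> dominated \<rho> (h i) 1) \<and>
      (\<forall>E. (\<forall>i<r. pairing (restr E y) (h i) \<le> \<epsilon>) \<longrightarrow> \<rho> (restr E y) \<le> \<delta>)"
      using Eh bound[OF Eh] unfolding Q_def by (intro exI[of _ r] exI[of _ h]) auto
  qed
qed

text \<open>The truncated functional takes care of \<open>g\<close>, and a small multiple of the
  detecting functionals added to it takes care of \<open>y\<close>. All summands are nonnegative, so
  a set of small total mass has small mass for each of them.\<close>

lemma regular_exists:
  assumes "no_linf \<rho>" "no_l1 \<rho>" "\<delta> > 0"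
  obtains \<epsilon> where "\<epsilon> > 0" "\<And>y. y \<in> c00_pos \<Longrightarrow> \<rho> y = 1 \<Longrightarrow> \<exists>g. regular \<rho> 4 \<delta> \<epsilon> y g"
proof -
  obtain \<epsilon>1 where \<epsilon>1: "\<epsilon>1 > 0" "\<And>y. y \<in> c00_pos \<Longrightarrow> \<rho> y = 1 \<Longrightarrow> \<exists>g\<in>c00_pos. supp g \<subseteq> supp y \<and>
    dominated \<rho> g 1 \<and> 1 / 2 \<le> pairing y g \<and> (\<forall>E. pairing (restr E y) g \<le> \<epsilon>1 \<longrightarrow> dominated \<rho> (restr E g) (\<delta> / 4))"
    using truncated_norming_functional[OF assms(2), of "\<delta> / 4"] assms(3) by auto
  obtain \<epsilon>2 n where \<epsilon>2: "\<epsilon>2 > 0" "\<And>y. y \<in> c00_pos \<Longrightarrow> \<rho> y = 1 \<Longrightarrow> \<exists>r h. r \<le> (n::nat) \<and>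
    (\<forall>i<r. h i \<in> c00_pos \<and> supp (h i) \<subseteq> supp y \<and> dominated \<rho> (h i) 1) \<and>
    (\<forall>E. (\<forall>i<r. pairing (restr E y) (h i) \<le> \<epsilon>2) \<longrightarrow> \<rho> (restr E y) \<le> \<delta>)"
    using detecting_functionals[OF assms(1,3)] by blast
  \<comment> \<open>The added functionals number at most \<open>n\<close>; their sum, multiplied by
    \<open>t\<close>, has dual norm at most 1 and spoils the bound on restrictions of
    \<open>g1\<close> by at most \<open>\<delta> / 4\<close>.\<close>
  define t where "t = min 1 (\<delta> / 4) / (real n + 1)"
  have t: "t > 0" using assms(3) by (simp add: t_def)
  have tn: "t * real n \<le> min 1 (\<delta> / 4)"
  proof -
    have "t * real n \<le> t * (real n + 1)" using t by (intro mult_left_mono) auto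
    then show ?thesis by (simp add: t_def)
  qed
  define \<epsilon> where "\<epsilon> = min \<epsilon>1 (t * \<epsilon>2) / 2"
  have \<epsilon>: "\<epsilon> > 0" using \<epsilon>1 \<epsilon>2 t by (simp add: \<epsilon>_def)
  show ?thesis
  proof (rule that[OF \<epsilon>])
    fix y assume y: "y \<in> c00_pos" "\<rho> y = 1"
    obtain g1 where g1: "g1 \<in> c00_pos" "supp g1 \<subseteq> supp y" "dominated \<rho> g1 1" "1 / 2 \<le> pairing y g1"
      "\<And>E. pairing (restr E y) g1 \<le> \<epsilon>1 \<Longrightarrow> dominated \<rho> (restr E g1) (\<delta> / 4)"
      using \<epsilon>1(2)[OF y] by blast
    obtain r h where h: "r \<le> n" "\<And>i. i < r \<Longrightarrow> h i \<in> c00_pos" "\<And>i. i < r \<Longrightarrow> supp (h i) \<subseteq> supp y"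
      "\<And>i. i < r \<Longrightarrow> dominated \<rho> (h i) 1"
      "\<And>E. (\<And>i. i < r \<Longrightarrow> pairing (restr E y) (h i) \<le> \<epsilon>2) \<Longrightarrow> \<rho> (restr E y) \<le> \<delta>"
      using \<epsilon>2(2)[OF y] by blast
    define S where "S = (\<lambda>k. \<Sum>i<r. h i k)"
    define g where "g = (\<lambda>k. g1 k + t * S k)"
    have Sc: "S \<in> c00_pos" unfolding S_def using h by (intro c00_pos_sum) auto
    have tS: "(\<lambda>k. t * S k) \<in> c00_pos" using Sc t by (simp add: c00_pos_scale)
    have gc: "g \<in> c00_pos" unfolding g_def by (intro c00_pos_add g1 tS)
    have g0: "0 \<le> g k" for k using gc by (simp add: c00_pos_def)
    have gs: "supp g \<subseteq> supp y"
    proof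
      fix k assume "k \<in> supp g"
      then have "g1 k \<noteq> 0 \<or> S k \<noteq> 0" by (auto simp: g_def supp_def)
      moreover have "k \<in> supp y" if "S k \<noteq> 0"
        using supp_sum_subset[of h "{..<r}"] h(3) that by (auto simp: S_def supp_def)
      ultimately show "k \<in> supp y" using g1(2) by (auto simp: supp_def)
    qed
    have domS: "dominated \<rho> (\<lambda>k. t * S k) (min 1 (\<delta> / 4))"
    proof -
      have "dominated \<rho> S (\<Sum>i<r. 1)" unfolding S_def by (rule dominated_sum) (use h in auto)
      then have "dominated \<rho> (\<lambda>k. t * S k) (t * real r)" using dominated_scale t by fastforce
      moreover have "t * real r \<le> min 1 (\<delta> / 4)"
        using tn h(1) t by (meson mult_left_mono of_nat_le_iff less_imp_le order_trans)
      ultimately show ?thesis by (rule dominated_mono[OF _ order_refl])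
    qed
    have dom_add: "dominated \<rho> (\<lambda>k. a k + b k) (A + B)" if "dominated \<rho> a A" "dominated \<rho> b B" for a b A B
      using that by (simp add: dominated_def pairing_add_right distrib_right add_mono)
    have domg: "dominated \<rho> g 2" unfolding g_def
      by (rule dominated_mono[OF dom_add[OF g1(3) domS]]) auto
    define P where "P = pairing y g"
    have P1: "1 / 2 \<le> P"
    proof -
      have "pairing y g1 \<le> pairing y g"
        using tS by (intro pairing_mono_right y) (auto simp: g_def c00_pos_def)
      then show ?thesis using g1(4) by (simp add: P_def)
    qed
    have P2: "P \<le> 2" using dominatedD[OF domg y(1)] y(2) by (simp add: P_def)
    \<comment> \<open>Normalization of the pairing to 1. The dual norm of \<open>g\<close> is at
      most 2 and \<open>P \<ge> 1 / 2\<close>, hence the constant 4.\<close>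
    define g' where "g' = (\<lambda>k. (1 / P) * g k)"
    have key: "\<rho> (restr E y) \<le> \<delta> \<and> dominated \<rho> (restr E g) (\<delta> / 2)" if E: "pairing (restr E y) g \<le> 2 * \<epsilon>" for E
    proof -
      have Ec: "restr E y \<in> c00_pos" by (rule c00_pos_restr[OF y(1)])
      have split: "pairing (restr E y) g = pairing (restr E y) g1 + t * (\<Sum>i<r. pairing (restr E y) (h i))"
        by (simp add: g_def S_def pairing_add_right pairing_scale_right pairing_sum_right)
      have nn: "0 \<le> pairing (restr E y) g1" "\<And>i. i < r \<Longrightarrow> 0 \<le> pairing (restr E y) (h i)"
        using g1(1) h(2) Ec by (auto intro!: pairing_nonneg simp: c00_pos_def)
      have "0 \<le> t * (\<Sum>i<r. pairing (restr E y) (h i))" using nn t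
        by (intro mult_nonneg_nonneg sum_nonneg) auto
      then have "pairing (restr E y) g1 \<le> \<epsilon>1" using E split by (simp add: \<epsilon>_def)
      then have d1: "dominated \<rho> (restr E g1) (\<delta> / 4)" by (rule g1(5))
      have "pairing (restr E y) (h i) \<le> \<epsilon>2" if i: "i < r" for i
      proof -
        have "pairing (restr E y) (h i) \<le> (\<Sum>i<r. pairing (restr E y) (h i))"
          using i nn by (intro member_le_sum) auto
        then have "t * pairing (restr E y) (h i) \<le> t * (\<Sum>i<r. pairing (restr E y) (h i))"
          using t by (intro mult_left_mono) auto
        also have "\<dots> \<le> 2 * \<epsilon>" using E split nn by simp
        also have "\<dots> \<le> t * \<epsilon>2" by (simp add: \<epsilon>_def)
        finally show ?thesis using t by simp
      qed
      then have "\<rho> (restr E y) \<le> \<delta>" by (rule h(5))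
      moreover have "restr E g = (\<lambda>k. restr E g1 k + restr E (\<lambda>k. t * S k) k)"
        by (auto simp: restr_def g_def)
      moreover have "dominated \<rho> (restr E (\<lambda>k. t * S k)) (min 1 (\<delta> / 4))"
        using tS by (intro dominated_restr domS) (auto simp: c00_pos_def)
      ultimately show ?thesis
        using dominated_mono[OF dom_add[OF d1], of _ "min 1 (\<delta> / 4)" "restr E g" "\<delta> / 2"] by simp
    qed
    have "regular \<rho> 4 \<delta> \<epsilon> y g'" unfolding regular_def
    proof (intro conjI allI impI)
      show "g' \<in> c00_pos" unfolding g'_def using P1 by (intro c00_pos_scale gc) auto
      show "supp g' \<subseteq> supp y" using gs by (auto simp: g'_def supp_def)
      show "pairing y g' = 1" 
        unfolding g'_def pairing_scale_right P_def[symmetric] using P1 by simp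
      have c: "0 \<le> 1 / P" "1 / P \<le> 2" using P1 by (auto simp: field_simps)
      show "dominated \<rho> g' 4" unfolding g'_def
        by (rule dominated_mono[OF dominated_scale[OF domg c(1)]]) (use c in auto)
      fix E assume "pairing (restr E y) g' \<le> \<epsilon>"
      then have "(1 / P) * pairing (restr E y) g \<le> \<epsilon>" unfolding g'_def pairing_scale_right .
      then have "pairing (restr E y) g \<le> P * \<epsilon>" using P1 by (simp add: field_simps)
      also have "\<dots> \<le> 2 * \<epsilon>" using P2 \<epsilon> by (intro mult_right_mono) auto
      finally have k: "\<rho> (restr E y) \<le> \<delta>" "dominated \<rho> (restr E g) (\<delta> / 2)" using key by blast+
      show "\<rho> (restr E y) \<le> \<delta>" by (rule k)
      have "restr E g' = (\<lambda>k. (1 / P) * restr E g k)" by (auto simp: g'_def restr_def)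
      moreover have "(1 / P) * (\<delta> / 2) \<le> \<delta>" using mult_right_mono[OF c(2), of "\<delta> / 2"] assms(3) by simp
      ultimately show "dominated \<rho> (restr E g') \<delta>"
        using dominated_mono[OF dominated_scale[OF k(2) c(1)]] by simp
    qed (use y in auto)
    then show "\<exists>g. regular \<rho> 4 \<delta> \<epsilon> y g" by blast
  qed
qed

end

section \<open>Block sequences and asymptotic estimates\<close>

definition block :: "(nat \<Rightarrow> nat \<Rightarrow> real) \<Rightarrow> bool" where
  "block z \<longleftrightarrow> (\<forall>i. z i \<in> c00_pos \<and> supp (z i) \<noteq> {}) \<and> (\<forall>n. successive n (\<lambda>i. supp (z i)))"

definition comb :: "(nat \<Rightarrow> nat \<Rightarrow> real) \<Rightarrow> (nat \<Rightarrow> real) \<Rightarrow> nat \<Rightarrow> real" where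
  "comb z a = (\<lambda>k. \<Sum>i\<in>supp a. a i * z i k)"

definition block_cone :: "(nat \<Rightarrow> nat \<Rightarrow> real) \<Rightarrow> (nat \<Rightarrow> real) set" where
  "block_cone z = comb z ` c00_pos"

lemma block_c00_pos: "block z \<Longrightarrow> z i \<in> c00_pos"
  and block_supp_ne: "block z \<Longrightarrow> supp (z i) \<noteq> {}"
  and block_successive: "block z \<Longrightarrow> successive n (\<lambda>i. supp (z i))"
  by (auto simp: block_def)

lemma block_less:
  assumes "block z" "i < j" "a \<in> supp (z i)" "b \<in> supp (z j)" shows "a < b"
  using successiveD[OF block_successive[OF assms(1), of "Suc j"] assms(2)] assms by simp

text \<open>The supports are nonempty and move to the right by at least one position each time. This
  turns conditions on indices into admissibility conditions on positions.\<close>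

lemma block_index_le: "block z \<Longrightarrow> k \<in> supp (z i) \<Longrightarrow> i \<le> k"
proof (induction i arbitrary: k)
  case (Suc i)
  obtain l where l: "l \<in> supp (z i)" using block_supp_ne[OF Suc.prems(1)] by blast
  have "i \<le> l" by (rule Suc.IH[OF Suc.prems(1) l])
  also have "l < k" using block_less[OF Suc.prems(1) _ l Suc.prems(2)] by simp
  finally show ?case by simp
qed simp

lemma comb_superset: "supp a \<subseteq> S \<Longrightarrow> finite S \<Longrightarrow> comb z a k = (\<Sum>i\<in>S. a i * z i k)"
  unfolding comb_def by (intro sum.mono_neutral_left) (auto simp: supp_def)

lemma comb_scale: "a \<in> c00_pos \<Longrightarrow> comb z (\<lambda>i. c * a i) = (\<lambda>k. c * comb z a k)"
  by (rule ext, subst (1 2) comb_superset[of _ "supp a"])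
    (auto simp: c00_pos_def supp_def sum_distrib_left mult.assoc)

lemma comb_add:
  assumes "a \<in> c00_pos" "b \<in> c00_pos"
  shows "comb z (\<lambda>i. a i + b i) = (\<lambda>k. comb z a k + comb z b k)"
proof
  fix k
  let ?S = "supp a \<union> supp b"
  have "finite ?S" "supp (\<lambda>i. a i + b i) \<subseteq> ?S" using assms by (auto simp: c00_pos_def supp_def)
  then show "comb z (\<lambda>i. a i + b i) k = comb z a k + comb z b k"
    using comb_superset[of "\<lambda>i. a i + b i" ?S z k] comb_superset[of a ?S z k] comb_superset[of b ?S z k]
    by (simp add: distrib_right sum.distrib)
qed

lemma comb_unit: "comb z (unit i) = z i"
  by (rule ext, subst comb_superset[of _ "{i}"]) (auto simp: supp_def unit_def)

lemma comb_zero: "comb z (\<lambda>i. 0) = (\<lambda>k. 0)"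
  by (simp add: comb_def supp_def)

lemma comb_sum:
  assumes "finite I" "\<And>i. i \<in> I \<Longrightarrow> a i \<in> c00_pos"
  shows "comb z (\<lambda>k. \<Sum>i\<in>I. a i k) = (\<lambda>k. \<Sum>i\<in>I. comb z (a i) k)"
  using assms
proof (induction I rule: finite_induct)
  case (insert x F)
  then show ?case by (simp add: comb_add c00_pos_sum)
qed (simp add: comb_zero)

lemma comb_c00_pos:
  assumes "\<And>i. z i \<in> c00_pos" "a \<in> c00_pos" shows "comb z a \<in> c00_pos"
  unfolding comb_def
  by (intro c00_pos_sum c00_pos_scale) (use assms in \<open>auto simp: c00_pos_def\<close>)

lemma block_cone_c00_pos: "block z \<Longrightarrow> x \<in> block_cone z \<Longrightarrow> x \<in> c00_pos"
  using comb_c00_pos[of z] block_c00_pos[of z] by (auto simp: block_cone_def)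

lemma block_cone_base: "z i \<in> block_cone z"
  unfolding block_cone_def using comb_unit[of z i] c00_pos_unit[of i] by (metis imageI)

lemma block_cone_scale:
  assumes "x \<in> block_cone z" "0 \<le> c" shows "(\<lambda>k. c * x k) \<in> block_cone z"
proof -
  obtain a where a: "a \<in> c00_pos" "x = comb z a" using assms(1) by (auto simp: block_cone_def)
  then have "(\<lambda>k. c * x k) = comb z (\<lambda>i. c * a i)" by (simp add: comb_scale)
  then show ?thesis unfolding block_cone_def using c00_pos_scale[OF a(1) assms(2)] by blast
qed

lemma block_cone_sum:
  assumes "finite I" "\<And>i. i \<in> I \<Longrightarrow> x i \<in> block_cone z"
  shows "(\<lambda>k. \<Sum>i\<in>I. x i k) \<in> block_cone z"
proof -
  have "\<forall>i. \<exists>a. i \<in> I \<longrightarrow> a \<in> c00_pos \<and> x i = comb z a" using assms(2) by (auto simp: block_cone_def)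
  then obtain a where a: "\<And>i. i \<in> I \<Longrightarrow> a i \<in> c00_pos" "\<And>i. i \<in> I \<Longrightarrow> x i = comb z (a i)" by metis
  have "(\<lambda>k. \<Sum>i\<in>I. x i k) = comb z (\<lambda>k. \<Sum>i\<in>I. a i k)"
    using a assms(1) by (simp add: comb_sum)
  then show ?thesis unfolding block_cone_def using a assms(1) by (auto intro!: c00_pos_sum)
qed

text \<open>The estimates that a space of bounded distortion satisfies asymptotically: \<open>ell n\<close> plays the
  role of \<open>n\<^sup>1\<^sup>/\<^sup>q\<close> in an asymptotic \<open>\<ell>\<^sub>p\<close> space, \<open>1/p + 1/q = 1\<close>.\<close>

locale asymptotic = lattice_norm \<rho> for \<rho> +
  fixes ell :: "nat \<Rightarrow> real" and K :: real
  assumes K: "1 \<le> K" and ell_pos: "0 < ell n"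
    and lower: "successive n A \<Longrightarrow> x \<in> c00_pos \<Longrightarrow> (\<And>k. k \<in> supp x \<Longrightarrow> n \<le> k) \<Longrightarrow>
      (\<Sum>i<n. \<rho> (restr (A i) x)) \<le> K * ell n * \<rho> x"
    and upper: "(\<And>i. i < n \<Longrightarrow> y i \<in> c00_pos) \<Longrightarrow> (\<And>i. i < n \<Longrightarrow> \<rho> (y i) \<le> 1) \<Longrightarrow>
      (\<And>i k. i < n \<Longrightarrow> k \<in> supp (y i) \<Longrightarrow> n \<le> k) \<Longrightarrow> successive n (\<lambda>i. supp (y i)) \<Longrightarrow>
      \<rho> (\<lambda>k. \<Sum>i<n. y i k) \<le> K * (real n / ell n)"
    and ratio: "0 < \<delta> \<Longrightarrow> \<exists>\<gamma>>0. \<forall>k n. 1 \<le> k \<and> real k \<le> \<gamma> * real n \<longrightarrow>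
      ell k \<le> \<delta> * ell n \<and> real k / ell k \<le> \<delta> * (real n / ell n)"
begin

text \<open>For a subfamily \<open>ell n\<close> improves to \<open>ell (card I)\<close>; this gain
  will make a small number of exceptional indices harmless.\<close>

lemma lower_on:
  assumes suc: "successive n A" and I: "I \<subseteq> {..<n}" and x: "x \<in> c00_pos" "\<And>k. k \<in> supp x \<Longrightarrow> n \<le> k"
  shows "(\<Sum>i\<in>I. \<rho> (restr (A i) x)) \<le> K * ell (card I) * \<rho> x"
proof -
  have fin: "finite I" using I finite_subset by blast
  obtain e where e: "bij_betw e {..<card I} I" "strict_mono_on {..<card I} e"
    using ex_bij_betw_strict_mono_card[OF fin] by blast
  have cI: "card I \<le> n" using card_mono[OF _ I] by simp
  have eI: "e i < n" if "i < card I" for i using e(1) I that by (auto simp: bij_betw_def)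
  have "(\<Sum>i\<in>I. \<rho> (restr (A i) x)) = (\<Sum>i<card I. \<rho> (restr (A (e i)) x))"
    by (rule sum.reindex_bij_betw[OF e(1), symmetric])
  also have "\<dots> \<le> K * ell (card I) * \<rho> x"
  proof (rule lower)
    show "successive (card I) (\<lambda>i. A (e i))" unfolding successive_def
    proof (intro allI impI ballI)
      fix i j a b assume "i < j" "j < card I" "a \<in> A (e i)" "b \<in> A (e j)"
      moreover from this have "e i < e j" using strict_mono_onD[OF e(2), of i j] by simp
      ultimately show "a < b" using successiveD[OF suc _ eI] by blast
    qed
    show "card I \<le> k" if "k \<in> supp x" for k using x(2)[OF that] cI by simp
  qed (rule x)
  finally show ?thesis .
qed

lemma upper_on:
  assumes suc: "successive n (\<lambda>i. supp (y i))" and I: "I \<subseteq> {..<n}" and c: "0 < c"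
    and y: "\<And>i. i \<in> I \<Longrightarrow> y i \<in> c00_pos" "\<And>i. i \<in> I \<Longrightarrow> \<rho> (y i) \<le> c"
      "\<And>i k. i \<in> I \<Longrightarrow> k \<in> supp (y i) \<Longrightarrow> n \<le> k"
  shows "\<rho> (\<lambda>k. \<Sum>i\<in>I. y i k) \<le> c * K * (real (card I) / ell (card I))"
proof -
  have fin: "finite I" using I finite_subset by blast
  obtain e where e: "bij_betw e {..<card I} I" "strict_mono_on {..<card I} e"
    using ex_bij_betw_strict_mono_card[OF fin] by blast
  have cI: "card I \<le> n" using card_mono[OF _ I] by simp
  have eI: "e i \<in> I" if "i < card I" for i using e(1) that by (auto simp: bij_betw_def)
  have en: "e i < n" if "i < card I" for i using eI[OF that] I by auto
  define y' where "y' = (\<lambda>i k. (1 / c) * y (e i) k)"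
  have sy: "supp (y' i) = supp (y (e i))" for i using c by (auto simp: y'_def supp_def)
  have bound: "\<rho> (\<lambda>k. \<Sum>i<card I. y' i k) \<le> K * (real (card I) / ell (card I))"
  proof (rule upper)
    fix i assume i: "i < card I"
    show "y' i \<in> c00_pos" unfolding y'_def using c by (intro c00_pos_scale y eI i) auto
    have "\<rho> (y' i) = (1 / c) * \<rho> (y (e i))" unfolding y'_def using c by (intro scale y eI i) auto
    then show "\<rho> (y' i) \<le> 1" using y(2)[OF eI[OF i]] c by (simp add: pos_divide_le_eq)
    show "card I \<le> k" if "k \<in> supp (y' i)" for k using y(3)[OF eI[OF i], of k] that cI by (simp add: sy)
  next
    show "successive (card I) (\<lambda>i. supp (y' i))" unfolding successive_def sy
    proof (intro allI impI ballI)
      fix i j a b assume "i < j" "j < card I" "a \<in> supp (y (e i))" "b \<in> supp (y (e j))"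
      moreover from this have "e i < e j" using strict_mono_onD[OF e(2), of i j] by simp
      ultimately show "a < b" using successiveD[OF suc _ en] by blast
    qed
  qed
  moreover have "(\<lambda>k. \<Sum>i\<in>I. y i k) = (\<lambda>k. c * (\<Sum>i<card I. y' i k))"
    using c by (simp add: y'_def sum_distrib_left[symmetric] sum.reindex_bij_betw[OF e(1)]
        sum.reindex_bij_betw[OF e(1), of "\<lambda>i. y i _"] sum_divide_distrib[symmetric])
  moreover have "\<rho> (\<lambda>k. c * (\<Sum>i<card I. y' i k)) = c * \<rho> (\<lambda>k. \<Sum>i<card I. y' i k)"
    using c eI y by (intro scale c00_pos_sum) (auto simp: y'_def intro!: c00_pos_divide)
  ultimately show ?thesis using mult_left_mono[OF bound, of c] c by (simp add: mult.assoc)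
qed

lemma dual_on:
  assumes suc: "successive n A" and I: "I \<subseteq> {..<n}" and A: "\<And>i k. i < n \<Longrightarrow> k \<in> A i \<Longrightarrow> n \<le> k" and c: "0 \<le> c"
    and h: "\<And>i. i \<in> I \<Longrightarrow> supp (h i) \<subseteq> A i" "\<And>i. i \<in> I \<Longrightarrow> dominated \<rho> (h i) c"
  shows "dominated \<rho> (\<lambda>k. \<Sum>i\<in>I. h i k) (c * K * ell (card I))"
  unfolding dominated_def
proof
  fix z assume z: "z \<in> c00_pos"
  \<comment> \<open>The lower estimate applies only beyond position \<open>n\<close>. The sets
    \<open>A i\<close> lie there, so cutting off the initial segment does not change the
    pairing.\<close>
  define z' where "z' = restr {n..} z"
  have z'c: "z' \<in> c00_pos" unfolding z'_def by (rule c00_pos_restr[OF z])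
  have "pairing z (\<lambda>k. \<Sum>i\<in>I. h i k) = (\<Sum>i\<in>I. pairing z (h i))" by (rule pairing_sum_right)
  also have "\<dots> \<le> (\<Sum>i\<in>I. c * \<rho> (restr (A i) z'))"
  proof (rule sum_mono)
    fix i assume i: "i \<in> I"
    have "pairing z (h i) = pairing (restr (A i) z) (h i)"
      using pairing_restr_right[OF z, of "A i" "h i"] restr_idem[OF h(1)[OF i]] by simp
    also have "restr (A i) z = restr (A i) z'"
      using A[of i] i I by (auto simp: z'_def restr_def fun_eq_iff)
    also have "pairing (restr (A i) z') (h i) \<le> c * \<rho> (restr (A i) z')"
      by (rule dominatedD[OF h(2)[OF i] c00_pos_restr[OF z'c]])
    finally show "pairing z (h i) \<le> c * \<rho> (restr (A i) z')" .
  qed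
  also have "\<dots> = c * (\<Sum>i\<in>I. \<rho> (restr (A i) z'))" by (simp add: sum_distrib_left)
  also have "\<dots> \<le> c * (K * ell (card I) * \<rho> z')"
    using c by (intro mult_left_mono lower_on[OF suc I z'c]) (auto simp: z'_def supp_restr)
  also have "\<dots> \<le> c * (K * ell (card I) * \<rho> z)"
    using c K ell_pos[of "card I"] restr_mono[OF z, of "{n..}"]
    by (intro mult_left_mono) (auto simp: z'_def)
  finally show "pairing z (\<lambda>k. \<Sum>i\<in>I. h i k) \<le> c * K * ell (card I) * \<rho> z" by (simp add: mult.assoc)
qed

text \<open>By Markov's inequality a set of mass at most \<open>\<epsilon> * \<gamma>\<close> takes
  more than \<open>\<epsilon>\<close> from at most \<open>\<gamma> * n\<close> of the pairs. On the
  other pairs regularity gives \<open>\<delta>\<close>; the exceptional ones are so few that the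
  estimates for subfamilies and the comparison of \<open>ell k\<close> with \<open>ell n\<close>
  leave only \<open>C * \<delta>'\<close> of them. The weights \<open>ell n / n\<close> and
  \<open>1 / ell n\<close> cancel the growth of the asymptotic estimates and multiply to
  \<open>1 / n\<close>.\<close>

lemma regular_combination:
  assumes n: "1 \<le> n" and reg: "\<And>i. i < n \<Longrightarrow> regular \<rho> C \<delta> \<epsilon> (y i) (g i)"
    and suc: "successive n (\<lambda>i. supp (y i))" and adm: "\<And>i k. i < n \<Longrightarrow> k \<in> supp (y i) \<Longrightarrow> n \<le> k"
    and pos: "0 < C" "0 < \<delta>" "0 < \<epsilon>" "0 < \<delta>'"
    and \<gamma>: "\<And>k. 1 \<le> k \<Longrightarrow> real k \<le> \<gamma> * real n \<Longrightarrow> ell k \<le> \<delta>' * ell n \<and> real k / ell k \<le> \<delta>' * (real n / ell n)"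
  shows "regular \<rho> (K * C) (K * (\<delta> + C * \<delta>')) (\<epsilon> * \<gamma>)
    (\<lambda>k. (ell n / real n) * (\<Sum>i<n. y i k)) (\<lambda>k. (1 / ell n) * (\<Sum>i<n. g i k))"
proof -
  have y: "y i \<in> c00_pos" "\<rho> (y i) \<le> C" and g: "g i \<in> c00_pos" "supp (g i) \<subseteq> supp (y i)" "dominated \<rho> (g i) C"
    and yg: "pairing (y i) (g i) = 1" 
    and sm: "\<And>E. pairing (restr E (y i)) (g i) \<le> \<epsilon> \<Longrightarrow> \<rho> (restr E (y i)) \<le> \<delta>"
    "\<And>E. pairing (restr E (y i)) (g i) \<le> \<epsilon> \<Longrightarrow> dominated \<rho> (restr E (g i)) \<delta>" if "i < n" for i
    using reg[OF that] by (auto simp: regular_def)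
  define x where "x = (\<lambda>k. (ell n / real n) * (\<Sum>i<n. y i k))"
  define h where "h = (\<lambda>k. (1 / ell n) * (\<Sum>i<n. g i k))"
  have ln: "0 < ell n / real n" using ell_pos n by simp
  have sumy: "(\<lambda>k. \<Sum>i<n. y i k) \<in> c00_pos" using y by (intro c00_pos_sum) auto
  have xc: "x \<in> c00_pos" unfolding x_def using ln by (intro c00_pos_scale sumy) auto
  have hc: "h \<in> c00_pos" unfolding h_def using ell_pos[of n] g by (intro c00_pos_scale c00_pos_sum) auto
  have cross: "pairing (restr E (y i)) (g j) = 0" if "i < n" "j < n" "i \<noteq> j" for E i j
    using successive_disjoint[OF suc that] g(2)[OF that(2)] by (intro pairing_disjoint) (auto simp: supp_restr)
  have restr_x: "restr E x = (\<lambda>k. (ell n / real n) * (\<Sum>i<n. restr E (y i) k))" for E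
    by (auto simp: restr_def x_def)
  have pair: "pairing (restr E x) h = (\<Sum>i<n. pairing (restr E (y i)) (g i)) / real n" for E
  proof -
    have "pairing (restr E x) h = (ell n / real n) * pairing (\<lambda>k. \<Sum>i<n. restr E (y i) k) h"
      unfolding restr_x using y by (intro pairing_scale_left c00_pos_sum c00_pos_restr) auto
    also have "pairing (\<lambda>k. \<Sum>i<n. restr E (y i) k) h = (\<Sum>i<n. pairing (restr E (y i)) h)"
      using y by (intro pairing_sum_left c00_pos_restr) auto
    also have "\<dots> = (\<Sum>i<n. (1 / ell n) * pairing (restr E (y i)) (g i))"
    proof (intro sum.cong refl)
      fix i assume i: "i \<in> {..<n}"
      have "(\<Sum>j<n. pairing (restr E (y i)) (g j)) = (\<Sum>j\<in>{i}. pairing (restr E (y i)) (g j))"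
        using i cross by (intro sum.mono_neutral_right) auto
      then show "pairing (restr E (y i)) h = (1 / ell n) * pairing (restr E (y i)) (g i)"
        unfolding h_def pairing_scale_right pairing_sum_right by simp
    qed
    also have "(ell n / real n) * \<dots> = (\<Sum>i<n. pairing (restr E (y i)) (g i)) / real n"
      using ell_pos[of n] by (simp add: sum_distrib_left[symmetric] sum_divide_distrib[symmetric])
    finally show ?thesis .
  qed
  show ?thesis unfolding x_def[symmetric] h_def[symmetric] regular_def
  proof (intro conjI allI impI xc hc)
    show "supp h \<subseteq> supp x"
    proof
      fix k assume "k \<in> supp h"
      then have "(\<Sum>i<n. g i k) \<noteq> 0" by (auto simp: h_def supp_def)
      then obtain i where i: "i < n" "g i k \<noteq> 0" by (meson sum.neutral lessThan_iff)
      then have "y i k > 0" using g(2)[OF i(1)] y(1)[OF i(1)] by (auto simp: supp_def c00_pos_def order_less_le)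
      moreover have "y i k \<le> (\<Sum>i<n. y i k)" using i y by (intro member_le_sum) (auto simp: c00_pos_def)
      ultimately have "(\<Sum>i<n. y i k) > 0" by simp
      then have "x k > 0" unfolding x_def using ln by (rule mult_pos_pos[rotated])
      then show "k \<in> supp x" by (simp add: supp_def)
    qed
    have "restr UNIV f = f" for f :: "nat \<Rightarrow> real" by (simp add: restr_def)
    then show "pairing x h = 1" using pair[of UNIV] yg n by simp
    have "\<rho> x = (ell n / real n) * \<rho> (\<lambda>k. \<Sum>i<n. y i k)"
      unfolding x_def using ln by (intro scale sumy) auto
    also have "\<dots> \<le> (ell n / real n) * (C * K * (real (card {..<n}) / ell (card {..<n})))"
      using ln by (intro mult_left_mono upper_on[OF suc order_refl pos(1)] y adm) auto
    also have "\<dots> = K * C" using ell_pos[of n] n by simp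
    finally show "\<rho> x \<le> K * C" .
    have "dominated \<rho> (\<lambda>k. \<Sum>i<n. g i k) (C * K * ell (card {..<n}))"
      by (rule dual_on[OF suc order_refl]) (use adm pos g in auto)
    then have "dominated \<rho> h ((1 / ell n) * (C * K * ell (card {..<n})))"
      unfolding h_def using ell_pos[of n] by (intro dominated_scale) auto
    then show "dominated \<rho> h (K * C)" using ell_pos[of n] by (simp add: mult.commute)
    fix E assume E: "pairing (restr E x) h \<le> \<epsilon> * \<gamma>"
    define Bd where "Bd = {i. i < n \<and> \<epsilon> < pairing (restr E (y i)) (g i)}"
    define Gd where "Gd = {..<n} - Bd"
    have fin: "finite Bd" "Bd \<subseteq> {..<n}" "Gd \<subseteq> {..<n}" "finite Gd" by (auto simp: Bd_def Gd_def)
    have part: "(\<Sum>i<n. f i) = (\<Sum>i\<in>Gd. f i) + (\<Sum>i\<in>Bd. f i)" for f :: "nat \<Rightarrow> real"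
      unfolding Gd_def using fin by (intro sum.subset_diff) auto
    have "real (card Bd) * \<epsilon> = (\<Sum>i\<in>Bd. \<epsilon>)" by simp
    also have "\<dots> \<le> (\<Sum>i\<in>Bd. pairing (restr E (y i)) (g i))" by (intro sum_mono) (auto simp: Bd_def)
    also have "\<dots> \<le> (\<Sum>i<n. pairing (restr E (y i)) (g i))"
      using fin y g by (intro sum_mono2) (auto intro!: pairing_nonneg c00_pos_restr simp: c00_pos_nonneg)
    also have "\<dots> \<le> \<epsilon> * \<gamma> * real n" using E n by (simp add: pair field_simps)
    finally have "real (card Bd) * \<epsilon> \<le> (\<gamma> * real n) * \<epsilon>" by (simp add: mult_ac)
    then have cB: "real (card Bd) \<le> \<gamma> * real n" using pos(3) by simp
    have good: "pairing (restr E (y i)) (g i) \<le> \<epsilon>" if "i \<in> Gd" for i using that by (auto simp: Gd_def Bd_def)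
    have good_n: "card Gd \<le> n" using card_mono[OF _ fin(3)] by simp
    define yG where "yG = (\<lambda>i. if i \<in> Gd then restr E (y i) else (\<lambda>k. 0))"
    define gG where "gG = (\<lambda>i. if i \<in> Gd then restr E (g i) else (\<lambda>k. 0))"
    have sumG: "(\<Sum>i\<in>Gd. restr E (y i) k) = (\<Sum>i<n. yG i k)" "(\<Sum>i\<in>Gd. restr E (g i) k) = (\<Sum>i<n. gG i k)" for k
      using fin by (auto simp: yG_def gG_def intro!: sum.mono_neutral_cong_left)
    have "\<rho> (\<lambda>k. \<Sum>i<n. yG i k) \<le> \<delta> * K * (real (card {..<n}) / ell (card {..<n}))"
    proof (rule upper_on[OF _ order_refl pos(2)])
      show "successive n (\<lambda>i. supp (yG i))"
        by (rule successive_subset[OF suc]) (auto simp: yG_def supp_def restr_def split: if_splits)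
      fix i assume i: "i \<in> {..<n}"
      show "yG i \<in> c00_pos" using i y by (auto simp: yG_def c00_pos_restr)
      show "\<rho> (yG i) \<le> \<delta>" using i sm(1)[OF _ good] pos(2) by (auto simp: yG_def zero)
      show "n \<le> k" if "k \<in> supp (yG i)" for k
        using that adm i by (auto simp: yG_def supp_def restr_def split: if_splits)
    qed
    then have yG: "\<rho> (\<lambda>k. \<Sum>i\<in>Gd. restr E (y i) k) \<le> \<delta> * K * (real n / ell n)" by (simp add: sumG)
    have yB: "\<rho> (\<lambda>k. \<Sum>i\<in>Bd. restr E (y i) k) \<le> C * K * (\<delta>' * (real n / ell n))"
    proof (cases "Bd = {}")
      case True
      then show ?thesis using pos K ell_pos[of n] by (simp add: zero)
    next
      case False
      then have c1: "1 \<le> card Bd" using fin by (simp add: Suc_le_eq card_gt_0_iff)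
      have "\<rho> (\<lambda>k. \<Sum>i\<in>Bd. restr E (y i) k) \<le> C * K * (real (card Bd) / ell (card Bd))"
      proof (rule upper_on[OF _ fin(2) pos(1)])
        show "successive n (\<lambda>i. supp (restr E (y i)))"
          by (rule successive_subset[OF suc]) (auto simp: supp_restr)
        fix i assume i: "i \<in> Bd"
        then show "restr E (y i) \<in> c00_pos" using fin y by (auto intro!: c00_pos_restr)
        show "\<rho> (restr E (y i)) \<le> C" using i fin y restr_mono[of "y i" E] by force
        show "n \<le> k" if "k \<in> supp (restr E (y i))" for k using that adm i fin by (auto simp: supp_restr)
      qed
      also have "\<dots> \<le> C * K * (\<delta>' * (real n / ell n))"
        using \<gamma>[OF c1 cB] pos K by (intro mult_left_mono) auto
      finally show ?thesis .
    qed
    have cG: "(\<lambda>k. \<Sum>i\<in>Gd. restr E (y i) k) \<in> c00_pos" "(\<lambda>k. \<Sum>i\<in>Bd. restr E (y i) k) \<in> c00_pos"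
      using fin y by (auto intro!: c00_pos_sum c00_pos_restr)
    have "\<rho> (restr E x) = (ell n / real n) * \<rho> (\<lambda>k. \<Sum>i<n. restr E (y i) k)"
      unfolding restr_x using ln y by (intro scale c00_pos_sum c00_pos_restr) auto
    also have "\<dots> \<le> (ell n / real n) * (\<delta> * K * (real n / ell n) + C * K * (\<delta>' * (real n / ell n)))"
      unfolding part using ln by (intro mult_left_mono order_trans[OF triangle[OF cG]] add_mono yG yB) auto
    also have "\<dots> = K * (\<delta> + C * \<delta>')" using ell_pos[of n] n by (simp add: field_simps)
    finally show "\<rho> (restr E x) \<le> K * (\<delta> + C * \<delta>')" .
    have "dominated \<rho> (\<lambda>k. \<Sum>i<n. gG i k) (\<delta> * K * ell (card {..<n}))"
    proof (rule dual_on[OF suc order_refl])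
      fix i assume i: "i \<in> {..<n}"
      show "supp (gG i) \<subseteq> supp (y i)" using g(2) i by (auto simp: gG_def supp_def restr_def split: if_splits)
      show "dominated \<rho> (gG i) \<delta>"
        using i sm(2)[OF _ good] pos nonneg by (auto simp: gG_def dominated_def pairing_def)
    qed (use adm pos in auto)
    then have gG: "dominated \<rho> (\<lambda>k. \<Sum>i\<in>Gd. restr E (g i) k) (\<delta> * K * ell n)" by (simp add: sumG)
    have gB: "dominated \<rho> (\<lambda>k. \<Sum>i\<in>Bd. restr E (g i) k) (C * K * (\<delta>' * ell n))"
    proof (cases "Bd = {}")
      case True
      then show ?thesis using pos K ell_pos[of n] nonneg by (auto simp: dominated_def pairing_def)
    next
      case False
      then have c1: "1 \<le> card Bd" using fin by (simp add: Suc_le_eq card_gt_0_iff)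
      have "dominated \<rho> (\<lambda>k. \<Sum>i\<in>Bd. restr E (g i) k) (C * K * ell (card Bd))"
      proof (rule dual_on[OF suc fin(2)])
        fix i assume "i \<in> Bd"
        then have i: "i < n" using fin by auto
        show "supp (restr E (g i)) \<subseteq> supp (y i)" using g(2)[OF i] by (auto simp: supp_restr)
        show "dominated \<rho> (restr E (g i)) C" using g[OF i] by (intro dominated_restr) (auto simp: c00_pos_def)
      qed (use adm pos in auto)
      moreover have "C * K * ell (card Bd) \<le> C * K * (\<delta>' * ell n)"
        using \<gamma>[OF c1 cB] pos K by (intro mult_left_mono) auto
      ultimately show ?thesis by (rule dominated_mono[OF _ order_refl])
    qed
    have "restr E h = (\<lambda>k. (1 / ell n) * ((\<Sum>i\<in>Gd. restr E (g i) k) + (\<Sum>i\<in>Bd. restr E (g i) k)))"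
      unfolding part[symmetric] by (auto simp: restr_def h_def)
    moreover have "dominated \<rho> (\<lambda>k. (\<Sum>i\<in>Gd. restr E (g i) k) + (\<Sum>i\<in>Bd. restr E (g i) k))
        (\<delta> * K * ell n + C * K * (\<delta>' * ell n))"
      using gG gB by (simp add: dominated_def pairing_add_right distrib_right add_mono)
    ultimately have "dominated \<rho> (restr E h) ((1 / ell n) * (\<delta> * K * ell n + C * K * (\<delta>' * ell n)))"
      using ell_pos[of n] by (simp only:) (intro dominated_scale, auto)
    also have "(1 / ell n) * (\<delta> * K * ell n + C * K * (\<delta>' * ell n)) = K * (\<delta> + C * \<delta>')"
      using ell_pos[of n] by (simp add: field_simps)
    finally show "dominated \<rho> (restr E h) (K * (\<delta> + C * \<delta>'))" .
  qed
qed

end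

section \<open>The distorting norm\<close>

lemma mass_restr_product:
  assumes "x \<in> c00_pos"
  shows "mass (restr E (\<lambda>k. x k * h k)) = pairing (restr E x) h"
proof -
  have "supp (restr E (\<lambda>k. x k * h k)) \<subseteq> supp x" "supp (restr E x) \<subseteq> supp x"
    by (auto simp: supp_def restr_def)
  then show ?thesis using assms
    by (simp add: mass_superset[of _ "supp x"] pairing_superset[of _ "supp x"] c00_pos_def restr_def
        if_distrib[of "\<lambda>y. y * _"] cong: if_cong)
qed

lemma restr_UNIV: "restr UNIV f = f"
  by (simp add: restr_def)

lemma regular_prob_vector: "regular \<rho> C \<delta> \<epsilon> y g \<Longrightarrow> prob_vector (\<lambda>k. y k * g k)"
  using mass_restr_product[of y UNIV g] c00_pos_mult[of g y]
  by (auto simp: regular_def prob_vector_def restr_UNIV c00_pos_nonneg)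

text \<open>Disjointness of the supports removes all mixed terms, and the weights multiply to
  \<open>1 / n\<close>. This identity connects averages of probability vectors with vectors and
  functionals of \<open>X\<close>.\<close>

lemma combination_product:
  assumes suc: "successive n (\<lambda>i. supp (y i))" and g: "\<And>i. i < n \<Longrightarrow> supp (g i) \<subseteq> supp (y i)" and c: "c \<noteq> 0"
  shows "(\<lambda>k. ((c / real n) * (\<Sum>i<n. y i k)) * ((1 / c) * (\<Sum>i<n. g i k))) = average (\<lambda>i k. y i k * g i k) n"
proof
  fix k
  have "(\<Sum>i<n. y i k) * (\<Sum>j<n. g j k) = (\<Sum>i<n. \<Sum>j<n. y i k * g j k)" by (rule sum_product)
  also have "\<dots> = (\<Sum>i<n. \<Sum>j\<in>{i}. y i k * g j k)"
  proof (rule sum.cong[OF refl])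
    fix i assume i: "i \<in> {..<n}"
    have "y i k * g j k = 0" if "j < n" "j \<noteq> i" for j
    proof -
      have "supp (y i) \<inter> supp (g j) = {}"
        using successive_disjoint[OF suc, of i j] g[of j] i that by auto
      then show ?thesis by (auto simp: supp_def)
    qed
    then show "(\<Sum>j<n. y i k * g j k) = (\<Sum>j\<in>{i}. y i k * g j k)"
      using i by (intro sum.mono_neutral_right) auto
  qed
  finally have "(\<Sum>i<n. y i k) * (\<Sum>j<n. g j k) = (\<Sum>i<n. y i k * g i k)" by simp
  then show "((c / real n) * (\<Sum>i<n. y i k)) * ((1 / c) * (\<Sum>i<n. g i k)) = average (\<lambda>i k. y i k * g i k) n k"
    using c by (simp add: average_def)
qed

context lattice_norm
begin

text \<open>The functionals in \<open>G\<close> give only a seminorm; the summand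
  \<open>\<kappa> * \<rho>\<close> makes it an equivalent norm, and a small \<open>\<kappa>\<close>
  keeps the values on vectors nearly annihilated by \<open>G\<close> small.\<close>

lemma sup_norm:
  assumes Gne: "G \<noteq> {}" and Gc: "G \<subseteq> c00_pos" and Gdom: "\<forall>h\<in>G. dominated \<rho> h C" and \<kappa>: "\<kappa> > 0"
  defines "\<nu> \<equiv> (\<lambda>x. \<kappa> * \<rho> x + (SUP h\<in>G. pairing x h))"
  shows "lattice_norm \<nu>" "\<And>x. x \<in> c00_pos \<Longrightarrow> \<kappa> * \<rho> x \<le> \<nu> x \<and> \<nu> x \<le> (\<kappa> + C) * \<rho> x"
    "\<And>x h. x \<in> c00_pos \<Longrightarrow> h \<in> G \<Longrightarrow> pairing x h \<le> \<nu> x"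
    "\<And>x B. (\<And>h. h \<in> G \<Longrightarrow> pairing x h \<le> B) \<Longrightarrow> \<nu> x \<le> \<kappa> * \<rho> x + B"
proof -
  have G: "G \<noteq> {}" "\<And>h. h \<in> G \<Longrightarrow> h \<in> c00_pos" "\<And>h. h \<in> G \<Longrightarrow> dominated \<rho> h C"
    using Gne Gc Gdom by auto
  define S where "S = (\<lambda>x. SUP h\<in>G. pairing x h)"
  have bdd: "bdd_above (pairing x ` G)" if "x \<in> c00_pos" for x
    using dominatedD[OF G(3) that] by (auto simp: bdd_above_def)
  have up: "pairing x h \<le> S x" if "x \<in> c00_pos" "h \<in> G" for x h
    unfolding S_def by (intro cSUP_upper bdd that)
  have low: "S x \<le> B" if "\<And>h. h \<in> G \<Longrightarrow> pairing x h \<le> B" for x B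
    unfolding S_def by (intro cSUP_least G(1) that)
  have S0: "0 \<le> S x" if "x \<in> c00_pos" for x
  proof -
    obtain h where h: "h \<in> G" using G(1) by blast
    have "0 \<le> pairing x h" using G(2)[OF h] by (intro pairing_nonneg that) (simp add: c00_pos_def)
    then show ?thesis using up[OF that h] by simp
  qed
  have \<nu>: "\<nu> x = \<kappa> * \<rho> x + S x" for x by (simp add: \<nu>_def S_def)
  show bounds: "\<kappa> * \<rho> x \<le> \<nu> x \<and> \<nu> x \<le> (\<kappa> + C) * \<rho> x" if "x \<in> c00_pos" for x
    using S0[OF that] low[of x "C * \<rho> x"] dominatedD[OF G(3) that] by (auto simp: \<nu> distrib_right)
  show "pairing x h \<le> \<nu> x" if "x \<in> c00_pos" "h \<in> G" for x h
    using up[OF that] nonneg[OF that(1)] \<kappa> by (simp add: \<nu> add_increasing)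
  show "\<nu> x \<le> \<kappa> * \<rho> x + B" if "\<And>h. h \<in> G \<Longrightarrow> pairing x h \<le> B" for x B
    using low[OF that] by (simp add: \<nu>)
  show "lattice_norm \<nu>"
  proof
    fix f g :: "nat \<Rightarrow> real" and c :: real
    assume f: "f \<in> c00_pos"
    show nn: "0 \<le> \<nu> f" using S0[OF f] nonneg[OF f] \<kappa> by (simp add: \<nu>)
    show "f = (\<lambda>i. 0)" if "\<nu> f = 0"
    proof -
      have "\<kappa> * \<rho> f \<le> 0" using bounds[OF f] that by simp
      then have "\<rho> f = 0" using \<kappa> nonneg[OF f] by (simp add: mult_le_0_iff)
      then show ?thesis by (rule definite[OF f])
    qed
    show "\<nu> (\<lambda>i. c * f i) = c * \<nu> f" if c: "0 \<le> c"
    proof -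
      have cf: "(\<lambda>i. c * f i) \<in> c00_pos" by (rule c00_pos_scale[OF f c])
      have le: "S (\<lambda>i. c * f i) \<le> c * S f"
        using up[OF f] c by (intro low) (simp add: pairing_scale_left[OF f] mult_left_mono)
      have "c * S f \<le> S (\<lambda>i. c * f i)"
      proof (cases "c = 0")
        case True
        then show ?thesis using S0[OF cf] by simp
      next
        case False
        then have "c > 0" using c by simp
        have "pairing f h \<le> S (\<lambda>i. c * f i) / c" if "h \<in> G" for h
          using up[OF cf that] \<open>c > 0\<close> by (simp add: pairing_scale_left[OF f] pos_le_divide_eq mult.commute)
        from low[OF this] show ?thesis using \<open>c > 0\<close> by (simp add: pos_le_divide_eq mult.commute)
      qed
      then show ?thesis using le scale[OF f c] by (simp add: \<nu> algebra_simps)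
    qed
    assume g: "g \<in> c00_pos"
    have "S (\<lambda>i. f i + g i) \<le> S f + S g"
      using up[OF f] up[OF g] by (intro low) (simp add: pairing_add_left[OF f g] add_mono)
    moreover have "\<kappa> * \<rho> (\<lambda>i. f i + g i) \<le> \<kappa> * (\<rho> f + \<rho> g)"
      using triangle[OF f g] \<kappa> by (intro mult_left_mono) auto
    ultimately show "\<nu> (\<lambda>i. f i + g i) \<le> \<nu> f + \<nu> g" by (simp add: \<nu> algebra_simps)
    show "\<nu> f \<le> \<nu> g" if le: "\<And>i. f i \<le> g i"
    proof -
      have "pairing f h \<le> S g" if h: "h \<in> G" for h
        using pairing_mono_left[OF f g le, of h] up[OF g h] G(2)[OF h] by (simp add: c00_pos_def)
      then have "S f \<le> S g" by (rule low)
      moreover have "\<kappa> * \<rho> f \<le> \<kappa> * \<rho> g" using mono[OF f g le] \<kappa> by (intro mult_left_mono) auto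
      ultimately show ?thesis by (simp add: \<nu>)
    qed
  qed
qed

text \<open>The cut is made at \<open>E = {w \<le> x h}\<close>. On \<open>E\<close> the minimum is
  \<open>w\<close>, so \<open>w\<close> has small mass there and \<open>h'\<close> is small; off
  \<open>E\<close> the minimum is \<open>x h\<close>, so regularity makes the remaining part of
  \<open>x\<close> small.\<close>

lemma pairing_separated_le:
  assumes x: "regular \<rho> C \<delta> \<epsilon> x h" and h': "h' \<in> c00_pos" "dominated \<rho> h' C'" and w: "w \<in> c00_pos"
    and small: "\<And>E. mass (restr E w) \<le> \<epsilon> \<Longrightarrow> dominated \<rho> (restr E h') \<delta>'"
    and sep: "\<And>S. finite S \<Longrightarrow> (\<Sum>k\<in>S. min (x k * h k) (w k)) \<le> \<epsilon>" and pos: "0 \<le> \<delta>'" "0 \<le> C'"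
  shows "pairing x h' \<le> \<delta>' * C + C' * \<delta>"
proof -
  define v where "v = (\<lambda>k. x k * h k)"
  define E where "E = {k. w k \<le> v k}"
  define S where "S = supp x \<union> supp w"
  have xc: "x \<in> c00_pos" "h \<in> c00_pos" "\<rho> x \<le> C" using x by (auto simp: regular_def)
  have v0: "0 \<le> v k" "0 \<le> w k" for k using xc w by (auto simp: v_def c00_pos_def)
  have fin: "finite S" using xc w by (simp add: S_def c00_pos_def)
  have "mass (restr E w) = (\<Sum>k\<in>S. restr E w k)"
    by (intro mass_superset fin) (auto simp: supp_restr S_def)
  also have "\<dots> \<le> (\<Sum>k\<in>S. min (v k) (w k))" using v0 by (intro sum_mono) (auto simp: restr_def E_def)
  also have "\<dots> \<le> \<epsilon>" unfolding v_def by (rule sep[OF fin])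
  finally have d: "dominated \<rho> (restr E h') \<delta>'" by (rule small)
  have "pairing (restr (- E) x) h = mass (restr (- E) v)"
    unfolding v_def by (rule mass_restr_product[OF xc(1), symmetric])
  also have "\<dots> = (\<Sum>k\<in>S. restr (- E) v k)"
    by (intro mass_superset fin) (auto simp: supp_def restr_def S_def v_def)
  also have "\<dots> \<le> (\<Sum>k\<in>S. min (v k) (w k))" using v0 by (intro sum_mono) (auto simp: restr_def E_def)
  also have "\<dots> \<le> \<epsilon>" unfolding v_def by (rule sep[OF fin])
  finally have r: "\<rho> (restr (- E) x) \<le> \<delta>" using x by (auto simp: regular_def)
  have "pairing x h' = pairing (restr E x) h' + pairing (restr (- E) x) h'"
    by (rule pairing_restr_Compl[OF xc(1)])
  also have "pairing (restr E x) h' = pairing x (restr E h')" by (rule pairing_restr_right[OF xc(1), symmetric])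
  also have "\<dots> + pairing (restr (- E) x) h' \<le> \<delta>' * \<rho> x + C' * \<rho> (restr (- E) x)"
    by (intro add_mono dominatedD[OF d xc(1)] dominatedD[OF h'(2) c00_pos_restr[OF xc(1)]])
  also have "\<dots> \<le> \<delta>' * C + C' * \<delta>" using xc(3) r pos by (intro add_mono mult_left_mono) auto
  finally show ?thesis .
qed

end

context asymptotic
begin

text \<open>All functionals that belong to some mixture enter the norm at once, independently of any
  block sequence; thus one norm distorts every block cone. The averages and mixtures that witness
  this are then built inside the given \<open>w\<close>.\<close>

theorem distorting_norm:
  assumes "no_linf \<rho>" "no_l1 \<rho>" "0 < D"
  obtains \<nu> a b where "lattice_norm \<nu>" "0 < a" "0 < b" "\<And>x. x \<in> c00_pos \<Longrightarrow> a * \<rho> x \<le> \<nu> x \<and> \<nu> x \<le> b * \<rho> x"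
    "\<And>w. block w \<Longrightarrow> \<exists>x\<in>block_cone w. \<exists>x'\<in>block_cone w. D * (\<nu> x * \<rho> x') < \<nu> x' * \<rho> x"
proof -
  \<comment> \<open>The constant of a regular pair after two combinations: 4 at the start and a
    factor \<open>K\<close> for each combination.\<close>
  define C where "C = 4 * K * K"
  \<comment> \<open>Chosen for the final comparison,
    \<open>D * (3 * ds * C * C) = 3 / (4 * C) < 1 / C\<close>.\<close>
  define ds where "ds = 1 / (4 * D * C ^ 3)"
  \<comment> \<open>Two combinations turn \<open>\<eta>\<close> into \<open>5 * K * \<eta>\<close>
    and then into \<open>9 * K * K * \<eta> = ds\<close>.\<close>
  define \<eta> where "\<eta> = ds / (9 * K * K)"
  have C1: "1 \<le> C" "4 * K \<le> C" using K mult_mono[of 1 K 1 K] by (auto simp: C_def)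
  have ds: "0 < ds" using C1 assms(3) by (simp add: ds_def)
  have \<eta>: "0 < \<eta>" using ds K by (simp add: \<eta>_def)
  have lev2: "K * (K * (\<eta> + 4 * \<eta>) + K * 4 * \<eta>) = ds" using K by (simp add: \<eta>_def field_simps)
  have lev1: "K * (\<eta> + 4 * \<eta>) \<le> ds"
  proof -
    have "K * (\<eta> + 4 * \<eta>) \<le> K * (\<eta> + 4 * \<eta>) + K * 4 * \<eta>" using K \<eta> by simp
    also have "\<dots> \<le> K * (K * (\<eta> + 4 * \<eta>) + K * 4 * \<eta>)"
      using K \<eta> mult_right_mono[of 1 K "K * (\<eta> + 4 * \<eta>) + K * 4 * \<eta>"] by simp
    finally show ?thesis using lev2 by simp
  qed
  obtain \<epsilon>0 where \<epsilon>0: "\<epsilon>0 > 0" "\<And>y. y \<in> c00_pos \<Longrightarrow> \<rho> y = 1 \<Longrightarrow> \<exists>g. regular \<rho> 4 \<eta> \<epsilon>0 y g"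
    using regular_exists[OF assms(1,2) \<eta>] by blast
  obtain \<gamma>0 where \<gamma>0: "\<gamma>0 > 0" "\<And>k n. 1 \<le> k \<Longrightarrow> real k \<le> \<gamma>0 * real n \<Longrightarrow>
      ell k \<le> \<eta> * ell n \<and> real k / ell k \<le> \<eta> * (real n / ell n)"
    using ratio[OF \<eta>] by blast
  define \<gamma> where "\<gamma> = min \<gamma>0 1"
  have \<gamma>: "0 < \<gamma>" "\<gamma> \<le> 1" using \<gamma>0 by (auto simp: \<gamma>_def)
  have \<gamma>r: "ell k \<le> \<eta> * ell n \<and> real k / ell k \<le> \<eta> * (real n / ell n)" if "1 \<le> k" "real k \<le> \<gamma> * real n" for k n
  proof (rule \<gamma>0(2)[OF that(1)])
    have "\<gamma> * real n \<le> \<gamma>0 * real n" by (intro mult_right_mono) (auto simp: \<gamma>_def)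
    then show "real k \<le> \<gamma>0 * real n" using that by simp
  qed
  define \<epsilon>1 where "\<epsilon>1 = \<epsilon>0 * \<gamma>"
  \<comment> \<open>Each of the two combinations shrinks the mass threshold by
    \<open>\<gamma>\<close>: from \<open>\<epsilon>0\<close> to \<open>\<epsilon>1\<close>, then to
    \<open>\<epsilon>\<close>.\<close>
  define \<epsilon> where "\<epsilon> = \<epsilon>1 * \<gamma>"
  have \<epsilon>: "0 < \<epsilon>" "\<epsilon> \<le> \<epsilon>1" "0 < \<epsilon>1" using \<epsilon>0 \<gamma> by (auto simp: \<epsilon>_def \<epsilon>1_def mult_left_le)
  \<comment> \<open>Makes \<open>10 * sqrt \<theta> \<le> \<epsilon> / 2\<close>; with tolerance
    \<open>\<epsilon> / 4\<close> for averages the overlap of an average and a mixture is then at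
    most \<open>\<epsilon>\<close>.\<close>
  define \<theta> where "\<theta> = min 1 ((\<epsilon> / 20)\<^sup>2)"
  have \<theta>: "0 < \<theta>" "\<theta> \<le> 1" using \<epsilon> by (auto simp: \<theta>_def)
  have "sqrt \<theta> \<le> sqrt ((\<epsilon> / 20)\<^sup>2)" by (intro real_sqrt_le_mono) (auto simp: \<theta>_def)
  then have sq: "2 * (\<epsilon> / 4) + 10 * sqrt \<theta> \<le> \<epsilon>" using \<epsilon> by simp
  interpret T: tsirelson_space \<theta> by unfold_locales (use \<theta> in auto)
  obtain m :: nat where m: "1 / \<theta> \<le> real m" using real_arch_simple by blast
  have m1: "1 \<le> m" using m \<theta> by (cases m) (auto simp: field_simps)
  \<comment> \<open>The first kind of vectors: averages, available arbitrarily far out in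
    \<open>w\<close> and with any prescribed number \<open>N\<close> of pieces.\<close>
  have type_a: "\<exists>a n x h. p \<le> a \<and> 1 \<le> n \<and> x \<in> block_cone w \<and> supp x \<subseteq> (\<Union>i\<in>{a..<a + n}. supp (w i)) \<and>
      regular \<rho> (K * 4) (K * (\<eta> + 4 * \<eta>)) \<epsilon>1 x h \<and> T.averaged N (\<epsilon> / 4) (\<lambda>k. x k * h k)"
    if w: "block w" and N: "1 \<le> N" for w p N
  proof -
    have wc: "w i \<in> c00_pos" for i by (rule block_c00_pos[OF w])
    have wp: "0 < \<rho> (w i)" for i using block_supp_ne[OF w, of i] pos[OF wc, of i] by (auto simp: supp_def)
    define y where "y = (\<lambda>i k. (1 / \<rho> (w i)) * w i k)"
    have yc: "y i \<in> c00_pos" "\<rho> (y i) = 1" for i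
    proof -
      obtain k where "w i k \<noteq> 0" using block_supp_ne[OF w, of i] by (auto simp: supp_def)
      from normalize[OF wc this] show "y i \<in> c00_pos" "\<rho> (y i) = 1" by (simp_all add: y_def)
    qed
    have sy: "supp (y i) = supp (w i)" for i using wp[of i] by (auto simp: y_def supp_def)
    have "\<forall>i. \<exists>g. regular \<rho> 4 \<eta> \<epsilon>0 (y i) g" using \<epsilon>0(2) yc by blast
    then obtain g where g: "\<And>i. regular \<rho> 4 \<eta> \<epsilon>0 (y i) (g i)" by metis
    have gs: "supp (g i) \<subseteq> supp (y i)" for i using g by (auto simp: regular_def)
    define u where "u = (\<lambda>i k. y i k * g i k)"
    have us: "supp (u i) \<subseteq> supp (w i)" for i unfolding sy[symmetric] by (auto simp: u_def supp_def)
    obtain a n where an: "p \<le> a" "n \<le> a" "1 \<le> n" "T.averaged N (\<epsilon> / 4) (average (\<lambda>i. u (a + i)) n)"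
    proof (rule T.averaged_exists[of u N "\<epsilon> / 4" p])
      show "prob_vector (u i)" for i unfolding u_def by (rule regular_prob_vector[OF g])
      show "successive n (\<lambda>i. supp (u i))" for n
        by (rule successive_subset[OF block_successive[OF w]]) (rule us)
      show "i \<le> k" if "k \<in> supp (u i)" for i k using block_index_le[OF w] us that by blast
    qed (use N \<epsilon> in auto)
    define x where "x = (\<lambda>k. (ell n / real n) * (\<Sum>i<n. y (a + i) k))"
    define h where "h = (\<lambda>k. (1 / ell n) * (\<Sum>i<n. g (a + i) k))"
    have suc: "successive n (\<lambda>i. supp (y (a + i)))"
      using successive_shift[OF block_successive[OF w]] by (simp add: sy)
    have "regular \<rho> (K * 4) (K * (\<eta> + 4 * \<eta>)) (\<epsilon>0 * \<gamma>) x h" unfolding x_def h_def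
    proof (rule regular_combination[OF an(3) g suc])
      show "n \<le> k" if "k \<in> supp (y (a + i))" for i k
        using block_index_le[OF w, of k "a + i"] that an(2) by (simp add: sy)
    qed (use \<eta> \<epsilon>0 \<gamma>r in auto)
    moreover have "(\<lambda>k. x k * h k) = average (\<lambda>i. u (a + i)) n"
      unfolding x_def h_def u_def using ell_pos[of n] by (intro combination_product suc gs) auto
    moreover have "x \<in> block_cone w" unfolding x_def y_def
      using ell_pos[of n] wp by (intro block_cone_scale block_cone_sum block_cone_base) (auto simp: less_imp_le)
    moreover have "supp x \<subseteq> (\<Union>i\<in>{a..<a + n}. supp (w i))"
    proof
      fix k assume "k \<in> supp x"
      then have "(\<Sum>i<n. y (a + i) k) \<noteq> 0" by (auto simp: x_def supp_def)
      then obtain i where "i < n" "y (a + i) k \<noteq> 0" by (meson sum.neutral lessThan_iff)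
      then have "k \<in> supp (w (a + i))" "a + i \<in> {a..<a + n}" using sy[of "a + i"] by (auto simp: supp_def)
      then show "k \<in> (\<Union>i\<in>{a..<a + n}. supp (w i))" by blast
    qed
    ultimately have "p \<le> a \<and> 1 \<le> n \<and> x \<in> block_cone w \<and> supp x \<subseteq> (\<Union>i\<in>{a..<a + n}. supp (w i)) \<and>
      regular \<rho> (K * 4) (K * (\<eta> + 4 * \<eta>)) \<epsilon>1 x h \<and> T.averaged N (\<epsilon> / 4) (\<lambda>k. x k * h k)"
      using an by (simp add: \<epsilon>1_def)
    then show ?thesis by blast
  qed
  \<comment> \<open>A functional is tied to a mixture only by the dual half of regularity, which is
    all that \<open>pairing_separated_le\<close> asks of \<open>h'\<close>; the vector of the pair
    need not be recorded.\<close>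
  define H where "H = {h. h \<in> c00_pos \<and> dominated \<rho> h C \<and>
    (\<exists>w\<in>c00_pos. T.mixed m (\<epsilon> / 4) w \<and> (\<forall>E. mass (restr E w) \<le> \<epsilon> \<longrightarrow> dominated \<rho> (restr E h) ds))}"
  \<comment> \<open>The zero functional ensures that the supremum is taken over a nonempty
    set.\<close>
  define G where "G = insert (\<lambda>k. 0) H"
  define \<nu> where "\<nu> = (\<lambda>x. ds * \<rho> x + (SUP h\<in>G. pairing x h))"
  have G: "G \<noteq> {}" "G \<subseteq> c00_pos" "\<forall>h\<in>G. dominated \<rho> h C"
    using C1 nonneg by (auto simp: G_def H_def dominated_def pairing_def)
  have \<nu>: "lattice_norm \<nu>"
    "\<And>x. x \<in> c00_pos \<Longrightarrow> ds * \<rho> x \<le> \<nu> x \<and> \<nu> x \<le> (ds + C) * \<rho> x"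
    "\<And>x h. x \<in> c00_pos \<Longrightarrow> h \<in> G \<Longrightarrow> pairing x h \<le> \<nu> x"
    "\<And>x B. (\<And>h. h \<in> G \<Longrightarrow> pairing x h \<le> B) \<Longrightarrow> \<nu> x \<le> ds * \<rho> x + B"
    unfolding \<nu>_def using sup_norm[OF G ds] by blast+
  show ?thesis
  proof (rule that[of \<nu> ds "ds + C"])
    show "lattice_norm \<nu>" by (rule \<nu>(1))
    show "0 < ds" "0 < ds + C" using ds C1 by auto
    show "ds * \<rho> x \<le> \<nu> x \<and> \<nu> x \<le> (ds + C) * \<rho> x" if "x \<in> c00_pos" for x by (rule \<nu>(2)[OF that])
    fix w assume w: "block w"
    obtain x h where x: "x \<in> block_cone w" "regular \<rho> (K * 4) (K * (\<eta> + 4 * \<eta>)) \<epsilon>1 x h"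
      "T.averaged m (\<epsilon> / 4) (\<lambda>k. x k * h k)"
      using type_a[OF w m1, of 0] by blast
    \<comment> \<open>The last position occupied by the first \<open>p\<close> blocks, and at least
      1. It serves as the number of pieces of an average that starts at block \<open>p\<close> or
      later, which is the growth condition in \<open>mixed\<close>.\<close>
    define B where "B = (\<lambda>p. Max (insert 1 (\<Union>i<p. supp (w i))))"
    have finB: "finite (insert 1 (\<Union>i<p. supp (w i)))" for p
      using block_c00_pos[OF w] by (auto simp: c00_pos_def)
    have B1: "1 \<le> B p" and Bk: "k \<in> supp (w i) \<Longrightarrow> i < p \<Longrightarrow> k \<le> B p" for p k i
      unfolding B_def using finB by (auto intro!: Max_ge)
    define R where "R = (\<lambda>p a n x h. p \<le> a \<and> 1 \<le> n \<and> x \<in> block_cone w \<and> supp x \<subseteq> (\<Union>i\<in>{a..<a + n}. supp (w i)) \<and>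
      regular \<rho> (K * 4) (K * (\<eta> + 4 * \<eta>)) \<epsilon>1 x h \<and> T.averaged (B p) (\<epsilon> / 4) (\<lambda>k. x k * h k))"
    have "\<exists>a n x h. R p a n x h" for p unfolding R_def by (rule type_a[OF w B1])
    then obtain a n xs hs where R: "\<And>p. R p (a p) (n p) (xs p) (hs p)" by metis
    have s: "p \<le> a p" "1 \<le> n p" "xs p \<in> block_cone w" "supp (xs p) \<subseteq> (\<Union>i\<in>{a p..<a p + n p}. supp (w i))"
      "regular \<rho> (K * 4) (K * (\<eta> + 4 * \<eta>)) \<epsilon>1 (xs p) (hs p)"
      "T.averaged (B p) (\<epsilon> / 4) (\<lambda>k. xs p k * hs p k)" for p
      using R[of p] unfolding R_def by blast+
    \<comment> \<open>Starting at block \<open>m\<close> makes the \<open>m\<close> averages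
      admissible, and each of them starts after the last block used by its predecessor.\<close>
    define P where "P = rec_nat m (\<lambda>_ p. a p + n p)"
    have P: "P 0 = m" "\<And>j. P (Suc j) = a (P j) + n (P j)" by (simp_all add: P_def)
    have "P j \<le> P (Suc j)" for j using s(1)[of "P j"] by (simp add: P)
    then have Pmono: "P i \<le> P j" if "i \<le> j" for i j using lift_Suc_mono_le[of P] that by blast
    define X where "X = (\<lambda>j. xs (P j))"
    define Y where "Y = (\<lambda>j. hs (P j))"
    have sX: "\<exists>i\<ge>P j. i < P (Suc j) \<and> k \<in> supp (w i)" if kX: "k \<in> supp (X j)" for j k
    proof -
      obtain i where "i \<in> {a (P j)..<a (P j) + n (P j)}" "k \<in> supp (w i)"
        using s(4)[of "P j"] kX unfolding X_def by blast
      then show ?thesis using s(1)[of "P j"] by (intro exI[of _ i]) (auto simp: P)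
    qed
    have sucX: "successive m (\<lambda>j. supp (X j))" unfolding successive_def
    proof (intro allI impI ballI)
      fix j j' k k' assume h: "j < j'" "j' < m" "k \<in> supp (X j)" "k' \<in> supp (X j')"
      obtain i where i: "i < P (Suc j)" "k \<in> supp (w i)" using sX[OF h(3)] by auto
      obtain i' where i': "P j' \<le> i'" "k' \<in> supp (w i')" using sX[OF h(4)] by auto
      have "P (Suc j) \<le> P j'" using h(1) by (intro Pmono) simp
      then have "i < i'" using i(1) i'(1) by simp
      then show "k < k'" by (rule block_less[OF w _ i(2) i'(2)])
    qed
    define x' where "x' = (\<lambda>k. (ell m / real m) * (\<Sum>j<m. X j k))"
    define h' where "h' = (\<lambda>k. (1 / ell m) * (\<Sum>j<m. Y j k))"
    have "regular \<rho> (K * (K * 4)) (K * (K * (\<eta> + 4 * \<eta>) + K * 4 * \<eta>)) (\<epsilon>1 * \<gamma>) x' h'" unfolding x'_def h'_def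
    proof (rule regular_combination[OF m1 _ sucX])
      show "regular \<rho> (K * 4) (K * (\<eta> + 4 * \<eta>)) \<epsilon>1 (X j) (Y j)" for j unfolding X_def Y_def by (rule s(5))
      show "m \<le> k" if kX: "k \<in> supp (X j)" for j k
      proof -
        obtain i where "P j \<le> i" "k \<in> supp (w i)" using sX[OF kX] by blast
        then show ?thesis using block_index_le[OF w, of k i] Pmono[of 0 j] P(1) by simp
      qed
    qed (use \<eta> \<epsilon> K \<gamma>r in auto)
    then have x': "regular \<rho> C ds \<epsilon> x' h'" unfolding lev2 by (simp add: C_def \<epsilon>_def mult_ac)
    define u where "u = (\<lambda>j k. X j k * Y j k)"
    have su: "supp (u j) \<subseteq> supp (X j)" for j by (auto simp: u_def supp_def)
    have YX: "supp (Y j) \<subseteq> supp (X j)" for j using s(5)[of "P j"] by (auto simp: X_def Y_def regular_def)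
    have w': "(\<lambda>k. x' k * h' k) = average u m"
      unfolding x'_def h'_def u_def using ell_pos[of m] by (intro combination_product sucX YX) auto
    have "T.mixed m (\<epsilon> / 4) (\<lambda>k. x' k * h' k)" unfolding T.mixed_def w'
    proof (intro exI[of _ u] exI[of _ "\<lambda>j. B (P j)"] conjI allI impI ballI refl)
      show "successive m (\<lambda>j. supp (u j))" by (rule successive_subset[OF sucX su])
      show "u j \<in> c00_pos" for j
        using regular_prob_vector[OF s(5)[of "P j"]] by (simp add: u_def X_def Y_def prob_vector_def)
      show "1 \<le> B (P j)" for j by (rule B1)
      show "T.averaged (B (P j)) (\<epsilon> / 4) (u j)" for j unfolding u_def X_def Y_def by (rule s(6))
      fix j j' k assume "j < m" "j' < j" "k \<in> supp (u j')"
      then obtain i where "i < P (Suc j')" "k \<in> supp (w i)" using sX[of k j'] su[of j'] by auto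
      moreover have "P (Suc j') \<le> P j" using \<open>j' < j\<close> by (intro Pmono) auto
      ultimately show "k \<le> B (P j)" by (intro Bk[of _ i]) auto
    qed
    moreover have "mass (restr E (\<lambda>k. x' k * h' k)) = pairing (restr E x') h'" for E
      using x' by (intro mass_restr_product) (simp add: regular_def)
    ultimately have h'G: "h' \<in> G" unfolding G_def H_def
      using x' regular_prob_vector[OF x'] by (auto simp: regular_def prob_vector_def intro!: bexI[of _ "\<lambda>k. x' k * h' k"])
    have x'block_cone: "x' \<in> block_cone w" unfolding x'_def
      using ell_pos[of m] s(3) by (intro block_cone_scale block_cone_sum) (auto simp: X_def less_imp_le)
    have \<nu>x': "1 \<le> \<nu> x'" using \<nu>(3)[OF _ h'G, of x'] x' by (simp add: regular_def)
    have \<rho>x': "\<rho> x' \<le> C" using x' by (simp add: regular_def)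
    have xr: "x \<in> c00_pos" "\<rho> x \<le> C" "1 \<le> C * \<rho> x"
    proof -
      show xc: "x \<in> c00_pos" using x by (simp add: regular_def)
      show "\<rho> x \<le> C" using x(2) C1 by (simp add: regular_def)
      have "1 \<le> K * 4 * \<rho> x" using x(2) dominatedD[of \<rho> h "K * 4" x] by (auto simp: regular_def)
      also have "\<dots> \<le> C * \<rho> x" using C1 nonneg[OF xc] by (intro mult_right_mono) auto
      finally show "1 \<le> C * \<rho> x" .
    qed
    have "pairing x g \<le> ds * C + C * ds" if g: "g \<in> G" for g
    proof (cases "g = (\<lambda>k. 0)")
      case True
      then show ?thesis using ds C1 by (simp add: pairing_def)
    next
      case False
      then obtain w where w: "w \<in> c00_pos" "T.mixed m (\<epsilon> / 4) w"
        "\<And>E. mass (restr E w) \<le> \<epsilon> \<Longrightarrow> dominated \<rho> (restr E g) ds" and gc: "g \<in> c00_pos" "dominated \<rho> g C"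
        using g by (auto simp: G_def H_def)
      have "regular \<rho> C ds \<epsilon> x h"
        using x(2) C1 lev1 \<epsilon> dominated_mono[of _ "K * (\<eta> + 4 * \<eta>)" _ ds] dominated_mono[of h "K * 4" h C]
        unfolding regular_def by (auto intro: order_trans)
      moreover have "(\<Sum>k\<in>S. min (x k * h k) (w k)) \<le> \<epsilon>" if "finite S" for S
        using T.averaged_mixed_separated[OF x(3) w(2) order_refl m that] sq by linarith
      ultimately show ?thesis
        using ds C1 by (intro pairing_separated_le[OF _ gc w(1,3)]) auto
    qed
    then have "\<nu> x \<le> ds * \<rho> x + (ds * C + C * ds)" by (rule \<nu>(4))
    also have "\<dots> \<le> ds * C + (ds * C + C * ds)" using xr ds by simp
    also have "\<dots> = 3 * ds * C" by simp
    finally have \<nu>x: "\<nu> x \<le> 3 * ds * C" .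
    have "D * (\<nu> x * \<rho> x') \<le> D * (3 * ds * C * C)"
      using \<nu>x \<rho>x' assms(3) ds C1 nonneg[of x'] x'
      by (intro mult_left_mono mult_mono) (auto simp: regular_def)
    also have "\<dots> = 3 / (4 * C)" using assms(3) C1 by (simp add: ds_def power3_eq_cube field_simps)
    also have "\<dots> < 1 / C" using C1 by (simp add: field_simps)
    also have "\<dots> \<le> \<rho> x" using xr C1 by (simp add: pos_divide_le_eq mult.commute)
    also have "\<dots> \<le> \<nu> x' * \<rho> x" using \<nu>x' nonneg[OF xr(1)] mult_right_mono[of 1 "\<nu> x'" "\<rho> x"] by simp
    finally show "\<exists>x\<in>block_cone w. \<exists>x'\<in>block_cone w. D * (\<nu> x * \<rho> x') < \<nu> x' * \<rho> x" using x(1) x'block_cone by blast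
  qed
qed

end

section \<open>Passing to block sequences\<close>

definition subblock :: "(nat \<Rightarrow> nat \<Rightarrow> real) \<Rightarrow> (nat \<Rightarrow> nat \<Rightarrow> real) \<Rightarrow> bool" where
  "subblock w z \<longleftrightarrow> block w \<and> (\<forall>i. w i \<in> block_cone z)"

lemma blockI:
  assumes c: "\<And>i. z i \<in> c00_pos" "\<And>i. supp (z i) \<noteq> {}"
    and less: "\<And>i a b. a \<in> supp (z i) \<Longrightarrow> b \<in> supp (z (Suc i)) \<Longrightarrow> a < b"
  shows "block z"
proof -
  have "a < b" if "i < j" "a \<in> supp (z i)" "b \<in> supp (z j)" for i j a b
    using that
  proof (induction j arbitrary: b)
    case (Suc j)
    show ?case
    proof (cases "i = j")
      case True
      then show ?thesis using less Suc.prems by blast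
    next
      case False
      obtain l where l: "l \<in> supp (z j)" using c(2) by blast
      have "a < l" using Suc.IH[OF _ Suc.prems(2) l] Suc.prems(1) False by simp
      also have "l < b" using less[OF l Suc.prems(3)] .
      finally show ?thesis .
    qed
  qed simp
  then show ?thesis using c unfolding block_def successive_def by blast
qed

lemma subblock_block: "subblock w z \<Longrightarrow> block w"
  by (simp add: subblock_def)

lemma subblock_refl: "block z \<Longrightarrow> subblock z z"
  by (simp add: subblock_def block_cone_base)

lemma comb_in_block_cone:
  assumes "a \<in> c00_pos" "\<And>i. i \<in> supp a \<Longrightarrow> w i \<in> block_cone z"
  shows "comb w a \<in> block_cone z"
  unfolding comb_def
  by (intro block_cone_sum block_cone_scale) (use assms in \<open>auto simp: c00_pos_def\<close>)

lemma subblock_cone: "subblock w z \<Longrightarrow> x \<in> block_cone w \<Longrightarrow> x \<in> block_cone z"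
  using comb_in_block_cone[of _ w z] by (auto simp: subblock_def block_cone_def)

lemma subblock_trans: "subblock v w \<Longrightarrow> subblock w z \<Longrightarrow> subblock v z"
  using subblock_cone[of w z] by (auto simp: subblock_def)

lemma block_tail:
  assumes "block z" shows "block (\<lambda>i. z (n + i))"
  by (rule blockI) (use assms block_less[OF assms] in \<open>auto simp: block_c00_pos block_supp_ne\<close>)

lemma comb_comb:
  assumes b: "\<And>i. b i \<in> c00_pos" and a: "a \<in> c00_pos"
  shows "comb (\<lambda>i. comb z (b i)) a = comb z (comb b a)"
proof -
  have "comb z (comb b a) = comb z (\<lambda>k. \<Sum>i\<in>supp a. a i * b i k)" by (simp add: comb_def[of b])
  also have "\<dots> = (\<lambda>k. \<Sum>i\<in>supp a. comb z (\<lambda>k. a i * b i k) k)"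
    by (intro comb_sum c00_pos_scale b) (use a in \<open>auto simp: c00_pos_def\<close>)
  also have "\<dots> = (\<lambda>k. \<Sum>i\<in>supp a. a i * comb z (b i) k)" by (simp add: comb_scale[OF b])
  finally show ?thesis by (simp add: comb_def[of "\<lambda>i. comb z (b i)"])
qed

lemma supp_comb:
  assumes z: "block z" and a: "a \<in> c00_pos"
  shows "supp (comb z a) = (\<Union>i\<in>supp a. supp (z i))"
proof -
  have nn: "0 \<le> a i * z i k" for i k
    using block_c00_pos[OF z, of i] a by (simp add: c00_pos_def)
  have "comb z a k = 0 \<longleftrightarrow> (\<forall>i\<in>supp a. z i k = 0)" for k
    unfolding comb_def
    by (subst sum_nonneg_eq_0_iff) (use a nn in \<open>auto simp: c00_pos_def supp_def\<close>)
  then show ?thesis by (auto simp: supp_def)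
qed

lemma in_supp_comb:
  "block z \<Longrightarrow> a \<in> c00_pos \<Longrightarrow> l \<in> supp a \<Longrightarrow> k \<in> supp (z l) \<Longrightarrow> k \<in> supp (comb z a)"
  by (auto simp: supp_comb)

text \<open>Restricting coefficients means restricting the vector to a union of block supports; thus
  splittings in coordinates are splittings in the ambient lattice.\<close>

lemma comb_restr:
  assumes z: "block z" and a: "a \<in> c00_pos"
  shows "comb z (restr A a) = restr (\<Union>i\<in>A. supp (z i)) (comb z a)"
proof
  fix k
  have fin: "finite (supp a)" using a by (simp add: c00_pos_def)
  have e: "comb z (restr A a) k = (\<Sum>i\<in>supp a. restr A a i * z i k)"
    by (intro comb_superset fin) (auto simp: supp_restr)
  show "comb z (restr A a) k = restr (\<Union>i\<in>A. supp (z i)) (comb z a) k"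
  proof (cases "\<exists>i\<in>A. k \<in> supp (z i)")
    case True
    then obtain i where i: "i \<in> A" "k \<in> supp (z i)" by blast
    have "z j k = 0" if "j \<noteq> i" for j
      using block_less[OF z, of i j k k] block_less[OF z, of j i k k] i(2) that
      by (cases i j rule: linorder_cases) (auto simp: supp_def)
    then have t: "restr A a j * z j k = a j * z j k" for j using i by (cases "j = i") (auto simp: restr_def)
    have "comb z (restr A a) k = comb z a k" using e by (simp add: t comb_def[of z a])
    moreover have "restr (\<Union>i\<in>A. supp (z i)) (comb z a) k = comb z a k" using i by (auto simp: restr_def)
    ultimately show ?thesis by simp
  next
    case False
    then have t: "restr A a j * z j k = 0" for j by (auto simp: restr_def supp_def)
    have "comb z (restr A a) k = 0" unfolding e by (intro sum.neutral ballI t)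
    moreover have "restr (\<Union>i\<in>A. supp (z i)) (comb z a) k = 0" using False by (auto simp: restr_def)
    ultimately show ?thesis by simp
  qed
qed

lemma successive_Union_block:
  assumes z: "block z" and A: "successive n A"
  shows "successive n (\<lambda>i. \<Union>l\<in>A i. supp (z l))"
  unfolding successive_def
proof (intro allI impI ballI)
  fix i j a b assume h: "i < j" "j < n" "a \<in> (\<Union>l\<in>A i. supp (z l))" "b \<in> (\<Union>l\<in>A j. supp (z l))"
  then obtain l m where l: "l \<in> A i" "a \<in> supp (z l)" and m: "m \<in> A j" "b \<in> supp (z m)" by auto
  have "l < m" by (rule successiveD[OF A h(1,2) l(1) m(1)])
  then show "a < b" by (rule block_less[OF z _ l(2) m(2)])
qed

lemma block_comb:
  assumes z: "block z" and b: "block b" shows "block (\<lambda>i. comb z (b i))"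
proof (rule blockI)
  fix i
  have bc: "b i \<in> c00_pos" for i by (rule block_c00_pos[OF b])
  show "comb z (b i) \<in> c00_pos" by (intro comb_c00_pos block_c00_pos z bc)
  show "supp (comb z (b i)) \<noteq> {}"
    using block_supp_ne[OF b, of i] block_supp_ne[OF z] by (auto simp: supp_comb[OF z bc])
  fix k k' assume h: "k \<in> supp (comb z (b i))" "k' \<in> supp (comb z (b (Suc i)))"
  then obtain l l' where l: "l \<in> supp (b i)" "k \<in> supp (z l)" "l' \<in> supp (b (Suc i))" "k' \<in> supp (z l')"
    by (auto simp: supp_comb[OF z bc])
  have "l < l'" using block_less[OF b _ l(1,3)] by simp
  then show "k < k'" by (rule block_less[OF z _ l(2,4)])
qed

lemma block_reflect:
  assumes z: "block z" and bc: "\<And>i. b i \<in> c00_pos" and w: "block (\<lambda>i. comb z (b i))"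
  shows "block b"
proof (rule blockI)
  fix i
  show "b i \<in> c00_pos" by (rule bc)
  show "supp (b i) \<noteq> {}" using block_supp_ne[OF w, of i] by (auto simp: supp_comb[OF z bc])
  fix l l' assume l: "l \<in> supp (b i)" "l' \<in> supp (b (Suc i))"
  obtain k where k: "k \<in> supp (z l)" using block_supp_ne[OF z] by blast
  obtain k' where k': "k' \<in> supp (z l')" using block_supp_ne[OF z] by blast
  have kb: "k \<in> supp (comb z (b i))" "k' \<in> supp (comb z (b (Suc i)))"
    by (rule in_supp_comb[OF z bc l(1) k], rule in_supp_comb[OF z bc l(2) k'])
  have kk: "k < k'" by (rule block_less[OF w _ kb]) simp
  show "l < l'"
  proof (rule ccontr)
    assume "\<not> l < l'"
    then have "l' < l \<or> l' = l" by linarith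
    then show False
    proof
      assume "l' < l"
      then have "k' < k" by (rule block_less[OF z _ k' k])
      then show False using kk by simp
    next
      assume eq: "l' = l"
      then have "l \<in> supp (b (Suc i))" using l(2) by simp
      then have "k \<in> supp (comb z (b (Suc i)))" by (rule in_supp_comb[OF z bc _ k])
      then have "k < k" by (intro block_less[OF w _ kb(1)]) auto
      then show False by simp
    qed
  qed
qed

text \<open>Block sequences of a block sublattice correspond to block sequences of its coefficients,
  so a result about all block sequences, applied in coordinates, covers all subblocks of
  \<open>z\<close>.\<close>

lemma subblock_coordinates:
  assumes z: "block z" and w: "subblock w z"
  obtains b where "block b" "w = (\<lambda>i. comb z (b i))"
proof -
  have "\<forall>i. \<exists>a. a \<in> c00_pos \<and> w i = comb z a" using w by (auto simp: subblock_def block_cone_def)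
  then obtain b where b: "\<And>i. b i \<in> c00_pos" "\<And>i. w i = comb z (b i)" by metis
  have eq: "w = (\<lambda>i. comb z (b i))" using b(2) by auto
  have "block b" by (rule block_reflect[OF z b(1)]) (use w eq in \<open>simp add: subblock_def\<close>)
  then show ?thesis using that eq by blast
qed

lemma block_cone_comb:
  assumes "\<And>i. b i \<in> c00_pos"
  shows "block_cone (\<lambda>i. comb z (b i)) = comb z ` block_cone b"
  unfolding block_cone_def image_image by (intro image_cong refl comb_comb assms)

text \<open>Along a decreasing chain of subblocks the \<open>n\<close>-th stage acquires
  \<open>Q n\<close>. The diagonal sequence is a subblock of that stage only from its
  \<open>n\<close>-th member on, which is why the conclusion concerns tails.\<close>

lemma diagonal_subblock:
  fixes Q :: "nat \<Rightarrow> (nat \<Rightarrow> nat \<Rightarrow> real) \<Rightarrow> bool"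
  assumes z: "block z" and her: "\<And>n w w'. Q n w \<Longrightarrow> subblock w' w \<Longrightarrow> Q n w'"
    and ex: "\<And>n w. subblock w z \<Longrightarrow> \<exists>w'. subblock w' w \<and> Q n w'"
  shows "\<exists>w. subblock w z \<and> (\<forall>n. Q n (\<lambda>i. w (n + i)))"
proof -
  have "\<forall>n w. \<exists>w'. subblock w z \<longrightarrow> subblock w' w \<and> Q n w'" using ex by blast
  then obtain f where f: "\<And>n w. subblock w z \<Longrightarrow> subblock (f n w) w \<and> Q n (f n w)" by metis
  define Z where "Z = rec_nat (f 0 z) (\<lambda>n w. f (Suc n) w)"
  have Z: "Z 0 = f 0 z" "\<And>n. Z (Suc n) = f (Suc n) (Z n)" by (simp_all add: Z_def)
  have Zz: "subblock (Z n) z" for n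
  proof (induction n)
    case 0
    show ?case using f[OF subblock_refl[OF z]] by (simp add: Z)
  next
    case (Suc n)
    then show ?case using f[OF Suc] subblock_trans by (metis Z(2))
  qed
  have ZQ: "Q n (Z n)" for n
    by (cases n) (use f[OF subblock_refl[OF z]] f[OF Zz] in \<open>auto simp: Z\<close>)
  have Zdec: "subblock (Z (n + i)) (Z n)" for n i
  proof (induction i)
    case 0
    show ?case using subblock_refl[OF subblock_block[OF Zz[of n]]] by simp
  next
    case (Suc i)
    have "subblock (Z (Suc (n + i))) (Z (n + i))" using f[OF Zz[of "n + i"]] by (simp add: Z)
    then show ?case using subblock_trans[OF _ Suc] by simp
  qed
  \<comment> \<open>The member with index \<open>i\<close> of a block sequence is supported in
    \<open>{i..}\<close>, so this index pushes the support beyond that of \<open>x\<close>.\<close>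
  define w where "w = rec_nat (Z 0 0) (\<lambda>n x. Z (Suc n) (Suc (Max (supp x))))"
  have w: "w 0 = Z 0 0" "\<And>n. w (Suc n) = Z (Suc n) (Suc (Max (supp (w n))))" by (simp_all add: w_def)
  have wZ: "\<exists>i. w n = Z n i" for n by (cases n) (auto simp: w)
  have Zb: "block (Z n)" for n using Zz by (simp add: subblock_def)
  have wb: "block w"
  proof (rule blockI)
    fix i
    obtain j where j: "w i = Z i j" using wZ by blast
    show c: "w i \<in> c00_pos" "supp (w i) \<noteq> {}" unfolding j using Zb by (auto simp: block_c00_pos block_supp_ne)
    fix a b assume ab: "a \<in> supp (w i)" "b \<in> supp (w (Suc i))"
    have "a \<le> Max (supp (w i))" using ab c by (simp add: c00_pos_def)
    also have "Max (supp (w i)) < b" using block_index_le[OF Zb ab(2)[unfolded w(2)]] by simp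
    finally show "a < b" .
  qed
  have tail: "subblock (\<lambda>i. w (n + i)) (Z n)" for n
    unfolding subblock_def
  proof (intro conjI allI)
    show "block (\<lambda>i. w (n + i))" by (rule block_tail[OF wb])
    fix i
    obtain j where "w (n + i) = Z (n + i) j" using wZ by blast
    then show "w (n + i) \<in> block_cone (Z n)" using subblock_cone[OF Zdec block_cone_base] by simp
  qed
  show ?thesis
  proof (intro exI[of _ w] conjI allI)
    show "subblock w z" using tail[of 0] subblock_trans[OF _ Zz[of 0]] by simp
    show "Q n (\<lambda>i. w (n + i))" for n by (rule her[OF ZQ tail])
  qed
qed

section \<open>Transport between a block sublattice and its coordinates\<close>

lemma lattice_norm_comb:
  assumes \<rho>: "lattice_norm \<rho>" and z: "block z"
  shows "lattice_norm (\<lambda>a. \<rho> (comb z a))"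
proof -
  interpret lattice_norm \<rho> by (rule \<rho>)
  have c: "comb z a \<in> c00_pos" if "a \<in> c00_pos" for a
    by (intro comb_c00_pos block_c00_pos z that)
  show ?thesis
  proof
    fix f g :: "nat \<Rightarrow> real" and r :: real
    assume f: "f \<in> c00_pos"
    show "0 \<le> \<rho> (comb z f)" by (intro nonneg c f)
    show "f = (\<lambda>i. 0)" if "\<rho> (comb z f) = 0"
    proof -
      have "supp (comb z f) = {}" using definite[OF c[OF f] that] by (simp add: supp_def)
      then have "supp f = {}" using block_supp_ne[OF z] by (auto simp: supp_comb[OF z f])
      then show ?thesis by (auto simp: supp_def)
    qed
    show "\<rho> (comb z (\<lambda>i. r * f i)) = r * \<rho> (comb z f)" if "0 \<le> r"
      using scale[OF c[OF f] that] by (simp add: comb_scale[OF f])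
    assume g: "g \<in> c00_pos"
    show "\<rho> (comb z (\<lambda>i. f i + g i)) \<le> \<rho> (comb z f) + \<rho> (comb z g)"
      using triangle[OF c[OF f] c[OF g]] by (simp add: comb_add[OF f g])
    show "\<rho> (comb z f) \<le> \<rho> (comb z g)" if le: "\<And>i. f i \<le> g i"
    proof (intro mono c f g)
      fix k
      have fin: "finite (supp f \<union> supp g)" using f g by (simp add: c00_pos_def)
      have "comb z f k = (\<Sum>i\<in>supp f \<union> supp g. f i * z i k)" "comb z g k = (\<Sum>i\<in>supp f \<union> supp g. g i * z i k)"
        by (intro comb_superset fin; simp)+
      moreover have "f i * z i k \<le> g i * z i k" for i
        using le block_c00_pos[OF z, of i] by (intro mult_right_mono) (auto simp: c00_pos_def)
      ultimately show "comb z f k \<le> comb z g k" by (simp add: sum_mono)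
    qed
  qed
qed

lemma disjoint_supp_comb:
  assumes z: "block z" and a: "\<And>i. i \<in> I \<Longrightarrow> a i \<in> c00_pos" and d: "disjoint_family_on (\<lambda>i. supp (a i)) I"
  shows "disjoint_family_on (\<lambda>i. supp (comb z (a i))) I"
  unfolding disjoint_family_on_def
proof (intro ballI impI)
  fix i j assume ij: "i \<in> I" "j \<in> I" "i \<noteq> j"
  show "supp (comb z (a i)) \<inter> supp (comb z (a j)) = {}"
  proof (rule ccontr)
    assume "supp (comb z (a i)) \<inter> supp (comb z (a j)) \<noteq> {}"
    then obtain k l l' where k: "l \<in> supp (a i)" "k \<in> supp (z l)" "l' \<in> supp (a j)" "k \<in> supp (z l')"
      using ij a by (auto simp: supp_comb[OF z])
    have "l \<noteq> l'" using disjoint_family_onD[OF d ij] k by auto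
    then have "l < l' \<or> l' < l" by linarith
    then have "k < k" using block_less[OF z _ k(2,4)] block_less[OF z _ k(4,2)] by blast
    then show False by simp
  qed
qed

text \<open>Disjoint coefficient vectors have disjoint combinations, so the same \<open>n\<close>
  works in coordinates.\<close>

lemma no_linf_comb:
  assumes "no_linf \<rho>" and z: "block z" shows "no_linf (\<lambda>a. \<rho> (comb z a))"
  unfolding no_linf_def
proof (intro allI impI)
  fix \<eta> :: real assume \<eta>: "\<eta> > 0"
  obtain n :: nat where n: "\<And>x. (\<And>i. i < n \<Longrightarrow> x i \<in> c00_pos) \<Longrightarrow> (\<And>i. i < n \<Longrightarrow> \<eta> \<le> \<rho> (x i)) \<Longrightarrow>
     disjoint_family_on (\<lambda>i. supp (x i)) {..<n} \<Longrightarrow> 1 < \<rho> (\<lambda>k. \<Sum>i<n. x i k)"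
    using no_linfE[OF assms(1) \<eta>] by blast
  have "1 < \<rho> (comb z (\<lambda>k. \<Sum>i<n. x i k))"
    if x: "\<And>i. i < n \<Longrightarrow> x i \<in> c00_pos" "\<And>i. i < n \<Longrightarrow> \<eta> \<le> \<rho> (comb z (x i))"
      "disjoint_family_on (\<lambda>i. supp (x i)) {..<n}" for x
  proof -
    have "1 < \<rho> (\<lambda>k. \<Sum>i<n. comb z (x i) k)"
      by (intro n comb_c00_pos block_c00_pos[OF z] disjoint_supp_comb[OF z] x) (use x in auto)
    then show ?thesis using x(1) by (subst comb_sum) auto
  qed
  then show "\<exists>n::nat. \<forall>x. (\<forall>i<n. x i \<in> c00_pos \<and> \<eta> \<le> \<rho> (comb z (x i))) \<and>
     disjoint_family_on (\<lambda>i. supp (x i)) {..<n} \<longrightarrow> 1 < \<rho> (comb z (\<lambda>k. \<Sum>i<n. x i k))"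
    by (intro exI[of _ n]) simp
qed

lemma no_l1_comb:
  assumes "no_l1 \<rho>" and z: "block z" shows "no_l1 (\<lambda>a. \<rho> (comb z a))"
  unfolding no_l1_def
proof (intro allI impI)
  fix \<eta> :: real assume \<eta>: "\<eta> > 0"
  obtain n :: nat where n: "\<And>x. (\<And>i. i < n \<Longrightarrow> x i \<in> c00_pos) \<Longrightarrow> (\<And>i. i < n \<Longrightarrow> \<rho> (x i) \<le> 1) \<Longrightarrow>
     disjoint_family_on (\<lambda>i. supp (x i)) {..<n} \<Longrightarrow>
     (\<exists>c. (\<forall>i<n. 0 \<le> c i) \<and> \<rho> (\<lambda>k. \<Sum>i<n. c i * x i k) < \<eta> * (\<Sum>i<n. c i))"
    using no_l1E[OF assms(1) \<eta>] by blast
  have "\<exists>c. (\<forall>i<n. 0 \<le> c i) \<and> \<rho> (comb z (\<lambda>k. \<Sum>i<n. c i * x i k)) < \<eta> * (\<Sum>i<n. c i)"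
    if x: "\<And>i. i < n \<Longrightarrow> x i \<in> c00_pos" "\<And>i. i < n \<Longrightarrow> \<rho> (comb z (x i)) \<le> 1"
      "disjoint_family_on (\<lambda>i. supp (x i)) {..<n}" for x
  proof -
    have "\<exists>c. (\<forall>i<n. 0 \<le> c i) \<and> \<rho> (\<lambda>k. \<Sum>i<n. c i * comb z (x i) k) < \<eta> * (\<Sum>i<n. c i)"
      by (intro n comb_c00_pos block_c00_pos[OF z] disjoint_supp_comb[OF z] x) (use x in auto)
    then obtain c where c: "\<forall>i<n. 0 \<le> c i" "\<rho> (\<lambda>k. \<Sum>i<n. c i * comb z (x i) k) < \<eta> * (\<Sum>i<n. c i)" by blast
    have "comb z (\<lambda>k. \<Sum>i<n. c i * x i k) = (\<lambda>k. \<Sum>i<n. comb z (\<lambda>k. c i * x i k) k)"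
      using c x by (intro comb_sum c00_pos_scale) auto
    also have "\<dots> = (\<lambda>k. \<Sum>i<n. c i * comb z (x i) k)" using x(1) by (simp add: comb_scale)
    finally show ?thesis using c by (intro exI[of _ c]) simp
  qed
  then show "\<exists>n::nat. \<forall>x. (\<forall>i<n. x i \<in> c00_pos \<and> \<rho> (comb z (x i)) \<le> 1) \<and>
     disjoint_family_on (\<lambda>i. supp (x i)) {..<n} \<longrightarrow>
     (\<exists>c. (\<forall>i<n. 0 \<le> c i) \<and> \<rho> (comb z (\<lambda>k. \<Sum>i<n. c i * x i k)) < \<eta> * (\<Sum>i<n. c i))"
    by (intro exI[of _ n]) simp
qed

lemma comb_at:
  assumes z: "block z" and a: "a \<in> c00_pos" and k: "k \<in> supp (z l)"
  shows "comb z a k = a l * z l k"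
proof -
  have "z j k = 0" if "j \<noteq> l" for j
    using block_less[OF z, of l j k k] block_less[OF z, of j l k k] k that
    by (cases l j rule: linorder_cases) (auto simp: supp_def)
  moreover have "comb z a k = (\<Sum>i\<in>insert l (supp a). a i * z i k)"
    using a by (intro comb_superset) (auto simp: c00_pos_def)
  moreover have "(\<Sum>i\<in>insert l (supp a). a i * z i k) = (\<Sum>i\<in>{l}. a i * z i k)"
    using a calculation(1) by (intro sum.mono_neutral_right) (auto simp: c00_pos_def)
  ultimately show ?thesis by simp
qed

text \<open>A lattice norm on a block sublattice extends to the whole lattice by an infimal convolution
  with a multiple of the ambient norm.\<close>

lemma extend_lattice_norm:
  assumes \<rho>: "lattice_norm \<rho>" and z: "block z" and \<nu>1: "lattice_norm \<nu>1" and c: "0 < c" "c \<le> C"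
    and eq: "\<And>a. a \<in> c00_pos \<Longrightarrow> c * \<rho> (comb z a) \<le> \<nu>1 a \<and> \<nu>1 a \<le> C * \<rho> (comb z a)"
  obtains \<nu> where "lattice_norm \<nu>" "\<And>x. x \<in> c00_pos \<Longrightarrow> c * \<rho> x \<le> \<nu> x \<and> \<nu> x \<le> C * \<rho> x"
    "\<And>a. a \<in> c00_pos \<Longrightarrow> \<nu> (comb z a) = \<nu>1 a"
proof -
  interpret R: lattice_norm \<rho> by (rule \<rho>)
  interpret N: lattice_norm \<nu>1 by (rule \<nu>1)
  define V where "V = (\<lambda>x. {\<nu>1 a + C * \<rho> r | a r. a \<in> c00_pos \<and> r \<in> c00_pos \<and> (\<forall>k. x k \<le> comb z a k + r k)})"
  define \<nu> where "\<nu> = (\<lambda>x. Inf (V x))"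
  have C: "0 < C" using c by simp
  have cc: "comb z a \<in> c00_pos" if "a \<in> c00_pos" for a by (intro comb_c00_pos block_c00_pos[OF z] that)
  have V0: "0 \<le> v" if "v \<in> V x" for v x
    using that C R.nonneg N.nonneg by (auto simp: V_def intro!: add_nonneg_nonneg mult_nonneg_nonneg)
  have bdd: "bdd_below (V x)" for x using V0 by (auto simp: bdd_below_def)
  have low: "\<nu> x \<le> \<nu>1 a + C * \<rho> r" if "a \<in> c00_pos" "r \<in> c00_pos" "\<And>k. x k \<le> comb z a k + r k" for x a r
    unfolding \<nu>_def by (intro cInf_lower bdd) (use that in \<open>auto simp: V_def\<close>)
  have great: "B \<le> \<nu> x" if x: "x \<in> c00_pos"
    and B: "\<And>a r. a \<in> c00_pos \<Longrightarrow> r \<in> c00_pos \<Longrightarrow> (\<And>k. x k \<le> comb z a k + r k) \<Longrightarrow> B \<le> \<nu>1 a + C * \<rho> r" for x B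
  proof -
    have "\<nu>1 (\<lambda>i. 0) + C * \<rho> x \<in> V x" unfolding V_def
      using x by (intro CollectI exI[of _ "\<lambda>i. 0"] exI[of _ x]) (simp add: comb_zero)
    then show ?thesis unfolding \<nu>_def by (intro cInf_greatest) (use B in \<open>auto simp: V_def\<close>)
  qed
  have bounds: "c * \<rho> x \<le> \<nu> x \<and> \<nu> x \<le> C * \<rho> x" if x: "x \<in> c00_pos" for x
  proof
    show "\<nu> x \<le> C * \<rho> x" using low[of "\<lambda>i. 0" x x] x by (simp add: comb_zero N.zero)
    show "c * \<rho> x \<le> \<nu> x"
    proof (rule great[OF x])
      fix a r assume ar: "a \<in> c00_pos" "r \<in> c00_pos" "\<And>k. x k \<le> comb z a k + r k"
      have "\<rho> x \<le> \<rho> (\<lambda>k. comb z a k + r k)" by (intro R.mono x c00_pos_add cc ar)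
      also have "\<dots> \<le> \<rho> (comb z a) + \<rho> r" by (intro R.triangle cc ar)
      finally have "c * \<rho> x \<le> c * (\<rho> (comb z a) + \<rho> r)" using c by (intro mult_left_mono) auto
      also have "\<dots> \<le> \<nu>1 a + C * \<rho> r"
        using eq[OF ar(1)] mult_right_mono[OF c(2) R.nonneg[OF ar(2)]] by (simp add: distrib_left)
      finally show "c * \<rho> x \<le> \<nu>1 a + C * \<rho> r" .
    qed
  qed
  have ext: "\<nu> (comb z a) = \<nu>1 a" if a: "a \<in> c00_pos" for a
  proof (rule antisym)
    show "\<nu> (comb z a) \<le> \<nu>1 a" using low[of a "\<lambda>i. 0" "comb z a"] a by (simp add: R.zero)
    show "\<nu>1 a \<le> \<nu> (comb z a)"
    proof (rule great[OF cc[OF a]])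
      fix b r assume br: "b \<in> c00_pos" "r \<in> c00_pos" "\<And>k. comb z a k \<le> comb z b k + r k"
      \<comment> \<open>The part of \<open>a\<close> not covered by \<open>b\<close>. Its
        combination lies below the remainder \<open>r\<close>, so the upper constant
        \<open>C\<close> bounds its \<open>\<nu>1\<close>-norm by \<open>C * \<rho> r\<close>; the
        infimal convolution therefore gains nothing on the block sublattice.\<close>
      define d where "d = (\<lambda>i. max 0 (a i - b i))"
      have d: "d \<in> c00_pos"
      proof (rule c00_pos_subsetI[where S="supp a"])
        show "supp d \<subseteq> supp a"
        proof
          fix i assume "i \<in> supp d"
          then show "i \<in> supp a" using c00_pos_nonneg[OF br(1), of i]
            by (auto simp: d_def supp_def max_def split: if_splits)
        qed
      qed (use a in \<open>auto simp: d_def c00_pos_def\<close>)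
      have dr: "comb z d k \<le> r k" for k
      proof (cases "\<exists>l. k \<in> supp (z l)")
        case True
        then obtain l where l: "k \<in> supp (z l)" by blast
        have z0: "0 \<le> z l k" using block_c00_pos[OF z, of l] by (simp add: c00_pos_def)
        have "d l * z l k = max 0 (a l * z l k - b l * z l k)"
          using z0 by (simp add: d_def max_mult_distrib_right left_diff_distrib)
        also have "\<dots> \<le> r k"
          using br(3)[of k] c00_pos_nonneg[OF br(2), of k]
          by (simp add: comb_at[OF z a l] comb_at[OF z br(1) l])
        finally show ?thesis by (simp add: comb_at[OF z d l])
      next
        case False
        then have "comb z d k = 0" using supp_comb[OF z d] by (auto simp: supp_def)
        then show ?thesis using br(2) by (simp add: c00_pos_def)
      qed
      have "\<nu>1 a \<le> \<nu>1 (\<lambda>i. b i + d i)" by (intro N.mono a c00_pos_add br d) (auto simp: d_def)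
      also have "\<dots> \<le> \<nu>1 b + \<nu>1 d" by (intro N.triangle br d)
      also have "\<nu>1 d \<le> C * \<rho> (comb z d)" using eq[OF d] by simp
      also have "\<dots> \<le> C * \<rho> r" using C by (intro mult_left_mono R.mono cc d br dr) auto
      finally show "\<nu>1 a \<le> \<nu>1 b + C * \<rho> r" by simp
    qed
  qed
  have "lattice_norm \<nu>"
  proof
    fix f g :: "nat \<Rightarrow> real" and s :: real
    assume f: "f \<in> c00_pos"
    show nn: "0 \<le> \<nu> f" using bounds[OF f] c R.nonneg[OF f] by (meson mult_nonneg_nonneg less_imp_le order_trans)
    show "f = (\<lambda>i. 0)" if "\<nu> f = 0"
    proof -
      have "c * \<rho> f \<le> 0" using bounds[OF f] that by simp
      then have "\<rho> f = 0" using c R.nonneg[OF f] by (simp add: mult_le_0_iff)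
      then show ?thesis by (rule R.definite[OF f])
    qed
    have le: "\<nu> (\<lambda>i. s * f i) \<le> s * \<nu> f" if s: "0 < s" and f: "f \<in> c00_pos" for s f
    proof -
      have "\<nu> (\<lambda>i. s * f i) / s \<le> \<nu> f"
      proof (rule great[OF f])
        fix a r assume ar: "a \<in> c00_pos" "r \<in> c00_pos" "\<And>k. f k \<le> comb z a k + r k"
        have "\<nu> (\<lambda>i. s * f i) \<le> \<nu>1 (\<lambda>i. s * a i) + C * \<rho> (\<lambda>i. s * r i)"
        proof (rule low)
          show "s * f k \<le> comb z (\<lambda>i. s * a i) k + s * r k" for k
            using mult_left_mono[OF ar(3)[of k], of s] s by (simp add: comb_scale[OF ar(1)] distrib_left)
        qed (use s ar in \<open>auto intro: c00_pos_scale\<close>)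
        also have "\<dots> = s * (\<nu>1 a + C * \<rho> r)" using s ar by (simp add: N.scale R.scale distrib_left)
        finally show "\<nu> (\<lambda>i. s * f i) / s \<le> \<nu>1 a + C * \<rho> r" using s by (simp add: pos_divide_le_eq mult.commute)
      qed
      then show ?thesis using s by (simp add: pos_divide_le_eq mult.commute)
    qed
    show "\<nu> (\<lambda>i. s * f i) = s * \<nu> f" if s: "0 \<le> s"
    proof (cases "s = 0")
      case True
      then show ?thesis using bounds[of "\<lambda>i. 0"] by (simp add: R.zero)
    next
      case False
      then have s: "0 < s" using s by simp
      have "\<nu> (\<lambda>i. (1 / s) * (s * f i)) \<le> (1 / s) * \<nu> (\<lambda>i. s * f i)"
        using s f by (intro le c00_pos_scale) auto
      then have "s * \<nu> f \<le> \<nu> (\<lambda>i. s * f i)" using s by (simp add: field_simps)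
      then show ?thesis using le[OF s f] by simp
    qed
    assume g: "g \<in> c00_pos"
    have fg: "(\<lambda>i. f i + g i) \<in> c00_pos" by (rule c00_pos_add[OF f g])
    have "\<nu> (\<lambda>i. f i + g i) - \<nu> g \<le> \<nu> f"
    proof (rule great[OF f])
      fix a r assume ar: "a \<in> c00_pos" "r \<in> c00_pos" "\<And>k. f k \<le> comb z a k + r k"
      have "\<nu> (\<lambda>i. f i + g i) - (\<nu>1 a + C * \<rho> r) \<le> \<nu> g"
      proof (rule great[OF g])
        fix b q assume bq: "b \<in> c00_pos" "q \<in> c00_pos" "\<And>k. g k \<le> comb z b k + q k"
        have "\<nu> (\<lambda>i. f i + g i) \<le> \<nu>1 (\<lambda>i. a i + b i) + C * \<rho> (\<lambda>i. r i + q i)"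
        proof (rule low)
          show "f k + g k \<le> comb z (\<lambda>i. a i + b i) k + (r k + q k)" for k
            using ar(3)[of k] bq(3)[of k] by (simp add: comb_add[OF ar(1) bq(1)])
        qed (intro c00_pos_add ar bq)+
        also have "\<dots> \<le> (\<nu>1 a + \<nu>1 b) + C * (\<rho> r + \<rho> q)"
          using C ar bq by (intro add_mono mult_left_mono N.triangle R.triangle) auto
        finally show "\<nu> (\<lambda>i. f i + g i) - (\<nu>1 a + C * \<rho> r) \<le> \<nu>1 b + C * \<rho> q"
          by (simp add: distrib_left)
      qed
      then show "\<nu> (\<lambda>i. f i + g i) - \<nu> g \<le> \<nu>1 a + C * \<rho> r" by simp
    qed
    then show "\<nu> (\<lambda>i. f i + g i) \<le> \<nu> f + \<nu> g" by simp
    show "\<nu> f \<le> \<nu> g" if le: "\<And>i. f i \<le> g i"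
      by (rule great[OF g], rule low) (use le order_trans in blast)+
  qed
  then show ?thesis using that bounds ext by blast
qed

section \<open>Splittings into successive sets and the asymptotic estimates they yield\<close>

context lattice_norm
begin

text \<open>A norming functional of the sum exceeds \<open>\<eta>\<close> on fewer than
  \<open>p\<close> of the summands, since otherwise it would have too many large pieces.\<close>

lemma sum_of_normalized_le:
  assumes "no_l1 \<rho>" "\<eta> > 0"
  obtains p :: nat where "\<And>y J. finite J \<Longrightarrow> disjoint_family_on (\<lambda>i. supp (y i)) (J :: nat set) \<Longrightarrow>
    (\<And>i. i \<in> J \<Longrightarrow> y i \<in> c00_pos) \<Longrightarrow> (\<And>i. i \<in> J \<Longrightarrow> \<rho> (y i) \<le> 1) \<Longrightarrow>
    \<rho> (\<lambda>k. \<Sum>i\<in>J. y i k) \<le> real p + \<eta> * real (card J)"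
proof -
  obtain p :: nat where p: "\<And>g I A. g \<in> c00_pos \<Longrightarrow> dominated \<rho> g 1 \<Longrightarrow> finite I \<Longrightarrow>
    disjoint_family_on A (I :: nat set) \<Longrightarrow> (\<And>i. i \<in> I \<Longrightarrow> \<not> dominated \<rho> (restr (A i) g) \<eta>) \<Longrightarrow> card I < p"
    using card_large_dual_pieces[OF assms] by blast
  show ?thesis
  proof (rule that[of p])
    fix y and J :: "nat set"
    assume J: "finite J" "disjoint_family_on (\<lambda>i. supp (y i)) J" and y: "\<And>i. i \<in> J \<Longrightarrow> y i \<in> c00_pos" "\<And>i. i \<in> J \<Longrightarrow> \<rho> (y i) \<le> 1"
    have sc: "(\<lambda>k. \<Sum>i\<in>J. y i k) \<in> c00_pos" using J y by (intro c00_pos_sum)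
    obtain f where f: "f \<in> c00_pos" "pairing (\<lambda>k. \<Sum>i\<in>J. y i k) f = \<rho> (\<lambda>k. \<Sum>i\<in>J. y i k)" "dominated \<rho> f 1"
      using norming_functional[OF sc] by blast
    define I where "I = {i \<in> J. \<eta> < pairing (y i) f}"
    have I: "finite I" "I \<subseteq> J" using J by (auto simp: I_def)
    have "card I < p"
    proof (rule p[OF f(1,3) I(1)])
      show "disjoint_family_on (\<lambda>i. supp (y i)) I" using J(2) I(2) by (rule disjoint_family_on_mono[rotated])
      fix i assume i: "i \<in> I"
      then have iJ: "i \<in> J" using I by auto
      show "\<not> dominated \<rho> (restr (supp (y i)) f) \<eta>"
      proof
        assume d: "dominated \<rho> (restr (supp (y i)) f) \<eta>"
        have "pairing (y i) f = pairing (y i) (restr (supp (y i)) f)"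
          by (simp add: pairing_restr_right[OF y(1)[OF iJ]] restr_idem)
        also have "\<dots> \<le> \<eta> * \<rho> (y i)" by (rule dominatedD[OF d y(1)[OF iJ]])
        also have "\<dots> \<le> \<eta>" using y(2)[OF iJ] assms(2) by (simp add: mult_left_le)
        finally show False using i by (simp add: I_def)
      qed
    qed
    have "\<rho> (\<lambda>k. \<Sum>i\<in>J. y i k) = (\<Sum>i\<in>J. pairing (y i) f)"
      unfolding f(2)[symmetric] using J y by (intro pairing_sum_left)
    also have "\<dots> \<le> (\<Sum>i\<in>J. (if i \<in> I then 1 else 0) + \<eta>)"
    proof (rule sum_mono)
      fix i assume i: "i \<in> J"
      have "pairing (y i) f \<le> 1 * \<rho> (y i)" by (rule dominatedD[OF f(3) y(1)[OF i]])
      then show "pairing (y i) f \<le> (if i \<in> I then 1 else 0) + \<eta>" using i y(2)[OF i] assms(2) by (auto simp: I_def)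
    qed
    also have "\<dots> = real (card I) + \<eta> * real (card J)"
      using J I by (simp add: sum.distrib sum.If_cases Int_absorb1 Int_absorb2)
    also have "\<dots> \<le> real p + \<eta> * real (card J)" using \<open>card I < p\<close> by simp
    finally show "\<rho> (\<lambda>k. \<Sum>i\<in>J. y i k) \<le> real p + \<eta> * real (card J)" .
  qed
qed

text \<open>After normalization of \<open>x\<close> fewer than \<open>p\<close> pieces have norm
  \<open>\<eta>\<close> or more, and each of these has norm at most 1.\<close>

lemma sum_of_pieces_le:
  assumes "no_linf \<rho>" "\<eta> > 0"
  obtains p :: nat where "\<And>x J A. finite J \<Longrightarrow> disjoint_family_on A (J :: nat set) \<Longrightarrow> x \<in> c00_pos \<Longrightarrow>
    (\<Sum>i\<in>J. \<rho> (restr (A i) x)) \<le> (real p + \<eta> * real (card J)) * \<rho> x"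
proof -
  obtain p :: nat where p: "\<And>y I A. y \<in> c00_pos \<Longrightarrow> \<rho> y \<le> 1 \<Longrightarrow> finite I \<Longrightarrow>
    disjoint_family_on A (I :: nat set) \<Longrightarrow> (\<And>i. i \<in> I \<Longrightarrow> \<eta> \<le> \<rho> (restr (A i) y)) \<Longrightarrow> card I < p"
    using card_large_pieces[OF assms] by blast
  show ?thesis
  proof (rule that[of p])
    fix x and J :: "nat set" and A :: "nat \<Rightarrow> nat set"
    assume J: "finite J" "disjoint_family_on A J" and x: "x \<in> c00_pos"
    show "(\<Sum>i\<in>J. \<rho> (restr (A i) x)) \<le> (real p + \<eta> * real (card J)) * \<rho> x"
    proof (cases "\<exists>k. x k \<noteq> 0")
      case False
      then have "x = (\<lambda>k. 0)" by auto
      then show ?thesis by (simp add: restr_def zero)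
    next
      case True
      then obtain k where k: "x k \<noteq> 0" by blast
      have xp: "0 < \<rho> x" by (rule pos[OF x k])
      define y where "y = (\<lambda>i. x i / \<rho> x)"
      have y: "y \<in> c00_pos" "\<rho> y = 1" using normalize[OF x k] by (auto simp: y_def)
      have yr: "\<rho> (restr B x) = \<rho> x * \<rho> (restr B y)" for B
      proof -
        have "restr B x = (\<lambda>k. \<rho> x * restr B y k)" using xp by (auto simp: restr_def y_def)
        then show ?thesis using scale[OF c00_pos_restr[OF y(1)], of "\<rho> x" B] xp by simp
      qed
      define I where "I = {i \<in> J. \<eta> \<le> \<rho> (restr (A i) y)}"
      have I: "finite I" "I \<subseteq> J" using J by (auto simp: I_def)
      have "card I < p"
        by (rule p[OF y(1) _ I(1) disjoint_family_on_mono[OF I(2) J(2)]]) (auto simp: y I_def)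
      have "(\<Sum>i\<in>J. \<rho> (restr (A i) y)) \<le> (\<Sum>i\<in>J. (if i \<in> I then 1 else 0) + \<eta>)"
        using restr_mono[OF y(1)] y(2) assms(2) by (intro sum_mono) (auto simp: I_def add_increasing2)
      also have "\<dots> = real (card I) + \<eta> * real (card J)"
        using J I by (simp add: sum.distrib sum.If_cases Int_absorb1 Int_absorb2)
      also have "\<dots> \<le> real p + \<eta> * real (card J)" using \<open>card I < p\<close> by simp
      finally have "\<rho> x * (\<Sum>i\<in>J. \<rho> (restr (A i) y)) \<le> \<rho> x * (real p + \<eta> * real (card J))"
        using xp by (intro mult_left_mono) auto
      then show ?thesis by (simp add: yr sum_distrib_left mult.commute)
    qed
  qed
qed

end

text \<open>For a vector of \<open>l_p\<close> that splits evenly into \<open>n\<close> pieces, this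
  is the norm times \<open>n\<close> to the power \<open>1/q\<close>. The ratio to
  \<open>\<rho>\<close> is therefore the candidate for \<open>ell n\<close>.\<close>

definition split_norm :: "((nat \<Rightarrow> real) \<Rightarrow> real) \<Rightarrow> nat \<Rightarrow> (nat \<Rightarrow> real) \<Rightarrow> real" where
  "split_norm \<rho> n x = (SUP A\<in>{A. successive n A}. \<Sum>i<n. \<rho> (restr (A i) x))"

context lattice_norm
begin

lemma split_sum_le:
  assumes "x \<in> c00_pos" shows "(\<Sum>i<n. \<rho> (restr (A i) x)) \<le> real n * \<rho> x"
  using sum_mono[of "{..<n}" "\<lambda>i. \<rho> (restr (A i) x)" "\<lambda>_. \<rho> x"] restr_mono[OF assms] by simp

lemma split_norm_upper:
  assumes "successive n A" "x \<in> c00_pos"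
  shows "(\<Sum>i<n. \<rho> (restr (A i) x)) \<le> split_norm \<rho> n x"
  unfolding split_norm_def
proof (rule cSUP_upper)
  show "bdd_above ((\<lambda>A. \<Sum>i<n. \<rho> (restr (A i) x)) ` {A. successive n A})"
    using split_sum_le[OF assms(2)] unfolding bdd_above_def by blast
qed (use assms in simp)

lemma split_norm_leI:
  assumes "\<And>A. successive n A \<Longrightarrow> (\<Sum>i<n. \<rho> (restr (A i) x)) \<le> B"
  shows "split_norm \<rho> n x \<le> B"
  unfolding split_norm_def
proof (rule cSUP_least)
  have "successive n (\<lambda>i. {})" by (simp add: successive_def)
  then show "{A. successive n A} \<noteq> {}" by blast
qed (use assms in simp)

lemma split_norm_pad:
  assumes "successive m A" "m \<le> n" "x \<in> c00_pos"
  shows "(\<Sum>i<m. \<rho> (restr (A i) x)) \<le> split_norm \<rho> n x"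
proof -
  define A' where "A' = (\<lambda>i. if i < m then A i else {})"
  have suc: "successive n A'" unfolding successive_def A'_def
  proof (intro allI impI ballI)
    fix i j a b
    assume h: "i < j" "j < n" "a \<in> (if i < m then A i else {})" "b \<in> (if j < m then A j else {})"
    have "j < m" "b \<in> A j" using h(4) by (auto split: if_splits)
    moreover have "a \<in> A i" using h(3) by (auto split: if_splits)
    ultimately show "a < b" using successiveD[OF assms(1) h(1)] by blast
  qed
  have "(\<Sum>i<m. \<rho> (restr (A i) x)) = (\<Sum>i<m. \<rho> (restr (A' i) x))" by (simp add: A'_def)
  also have "\<dots> \<le> (\<Sum>i<n. \<rho> (restr (A' i) x))"
    using assms by (intro sum_mono2) (auto intro!: nonneg c00_pos_restr)
  also have "\<dots> \<le> split_norm \<rho> n x" by (rule split_norm_upper[OF suc assms(3)])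
  finally show ?thesis .
qed

lemma split_norm_bounds:
  assumes x: "x \<in> c00_pos" and n: "1 \<le> n"
  shows "\<rho> x \<le> split_norm \<rho> n x" "split_norm \<rho> n x \<le> real n * \<rho> x"
proof -
  have "successive 1 (\<lambda>i. UNIV)" by (simp add: successive_def)
  from split_norm_pad[OF this n x] show "\<rho> x \<le> split_norm \<rho> n x" by (simp add: restr_UNIV)
  show "split_norm \<rho> n x \<le> real n * \<rho> x" by (rule split_norm_leI[OF split_sum_le[OF x]])
qed

lemma lattice_norm_split_norm:
  assumes n: "1 \<le> n" shows "lattice_norm (split_norm \<rho> n)"
proof
  fix f g :: "nat \<Rightarrow> real" and c :: real
  assume f: "f \<in> c00_pos"
  show "0 \<le> split_norm \<rho> n f" using split_norm_bounds(1)[OF f n] nonneg[OF f] by simp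
  show "f = (\<lambda>i. 0)" if "split_norm \<rho> n f = 0"
    using split_norm_bounds(1)[OF f n] nonneg[OF f] that by (intro definite[OF f]) simp
  have le: "split_norm \<rho> n (\<lambda>i. c * f i) \<le> c * split_norm \<rho> n f" if "0 \<le> c" and f: "f \<in> c00_pos" for c f
  proof (rule split_norm_leI)
    fix A assume A: "successive n A"
    have "\<rho> (restr (A i) (\<lambda>i. c * f i)) = c * \<rho> (restr (A i) f)" for i
      using scale[OF c00_pos_restr[OF f] that(1), of "A i"]
      by (simp add: restr_def if_distrib[of "\<lambda>y. c * y"] cong: if_cong)
    then have "(\<Sum>i<n. \<rho> (restr (A i) (\<lambda>i. c * f i))) = c * (\<Sum>i<n. \<rho> (restr (A i) f))"
      by (simp add: sum_distrib_left)
    also have "\<dots> \<le> c * split_norm \<rho> n f" using split_norm_upper[OF A f] that by (intro mult_left_mono)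
    finally show "(\<Sum>i<n. \<rho> (restr (A i) (\<lambda>i. c * f i))) \<le> c * split_norm \<rho> n f" .
  qed
  show "split_norm \<rho> n (\<lambda>i. c * f i) = c * split_norm \<rho> n f" if c: "0 \<le> c"
  proof (cases "c = 0")
    case True
    then show ?thesis using split_norm_bounds[of "\<lambda>i. 0" n] n by (simp add: zero)
  next
    case False
    have "split_norm \<rho> n (\<lambda>i. (1 / c) * (c * f i)) \<le> (1 / c) * split_norm \<rho> n (\<lambda>i. c * f i)"
      by (intro le c00_pos_scale f c) (use c in auto)
    then have "c * split_norm \<rho> n f \<le> split_norm \<rho> n (\<lambda>i. c * f i)" using False c by (simp add: field_simps)
    then show ?thesis using le[OF c f] by simp
  qed
  assume g: "g \<in> c00_pos"
  show "split_norm \<rho> n (\<lambda>i. f i + g i) \<le> split_norm \<rho> n f + split_norm \<rho> n g"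
  proof (rule split_norm_leI)
    fix A assume A: "successive n A"
    have "\<rho> (restr (A i) (\<lambda>i. f i + g i)) \<le> \<rho> (restr (A i) f) + \<rho> (restr (A i) g)" for i
    proof -
      have "restr (A i) (\<lambda>i. f i + g i) = (\<lambda>k. restr (A i) f k + restr (A i) g k)" by (auto simp: restr_def)
      then show ?thesis using triangle[OF c00_pos_restr[OF f] c00_pos_restr[OF g]] by simp
    qed
    then have "(\<Sum>i<n. \<rho> (restr (A i) (\<lambda>i. f i + g i))) \<le> (\<Sum>i<n. \<rho> (restr (A i) f)) + (\<Sum>i<n. \<rho> (restr (A i) g))"
      unfolding sum.distrib[symmetric] by (intro sum_mono)
    also have "\<dots> \<le> split_norm \<rho> n f + split_norm \<rho> n g"
      by (intro add_mono split_norm_upper A f g)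
    finally show "(\<Sum>i<n. \<rho> (restr (A i) (\<lambda>i. f i + g i))) \<le> split_norm \<rho> n f + split_norm \<rho> n g" .
  qed
  show "split_norm \<rho> n f \<le> split_norm \<rho> n g" if fg: "\<And>i. f i \<le> g i"
  proof (rule split_norm_leI)
    fix A assume A: "successive n A"
    have "(\<Sum>i<n. \<rho> (restr (A i) f)) \<le> (\<Sum>i<n. \<rho> (restr (A i) g))"
      using f g fg by (intro sum_mono mono c00_pos_restr) (auto simp: restr_def)
    also have "\<dots> \<le> split_norm \<rho> n g" by (rule split_norm_upper[OF A g])
    finally show "(\<Sum>i<n. \<rho> (restr (A i) f)) \<le> split_norm \<rho> n g" .
  qed
qed

text \<open>At most \<open>2 * n\<close> pairs of a set and a vector overlap, and each contributes
  at most 1. This is the source of the upper estimate: where the split norm is at least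
  \<open>ell n * \<rho>\<close>, the sum has norm at most \<open>2 * n / ell n\<close>.\<close>

lemma split_norm_sum_le:
  assumes y: "\<And>i. i < n \<Longrightarrow> y i \<in> c00_pos" "\<And>i. i < n \<Longrightarrow> \<rho> (y i) \<le> 1" and suc: "successive n (\<lambda>i. supp (y i))"
  shows "split_norm \<rho> n (\<lambda>k. \<Sum>i<n. y i k) \<le> 2 * real n"
proof (rule split_norm_leI)
  fix A assume A: "successive n A"
  have "(\<Sum>j<n. \<rho> (restr (A j) (\<lambda>k. \<Sum>i<n. y i k))) \<le> (\<Sum>j<n. \<Sum>i<n. \<rho> (restr (A j) (y i)))"
  proof (rule sum_mono)
    fix j
    have "restr (A j) (\<lambda>k. \<Sum>i<n. y i k) = (\<lambda>k. \<Sum>i<n. restr (A j) (y i) k)" by (auto simp: restr_def)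
    then show "\<rho> (restr (A j) (\<lambda>k. \<Sum>i<n. y i k)) \<le> (\<Sum>i<n. \<rho> (restr (A j) (y i)))"
      using sum_le[of "{..<n}" "\<lambda>i. restr (A j) (y i)"] y by (simp add: c00_pos_restr)
  qed
  also have "\<dots> \<le> 1 * (real n + real n)"
  proof (rule sum_overlaps_le[OF A suc])
    fix i j assume ij: "i < n" "j < n"
    show "\<rho> (restr (A i) (y j)) \<le> 1" using restr_mono[OF y(1)[OF ij(2)], of "A i"] y(2)[OF ij(2)] by simp
    assume "A i \<inter> supp (y j) = {}"
    then have "restr (A i) (y j) = (\<lambda>k. 0)" by (intro ext) (auto simp: restr_def supp_def)
    then show "\<rho> (restr (A i) (y j)) \<le> 0" by (simp add: zero)
  qed simp
  finally show "(\<Sum>j<n. \<rho> (restr (A j) (\<lambda>k. \<Sum>i<n. y i k))) \<le> 2 * real n" by simp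
qed

text \<open>Consecutive sets are merged in groups of \<open>g\<close>; each group costs the factor
  \<open>c\<close>, and the unions of the groups form a splitting into \<open>k\<close> successive
  sets.\<close>

lemma split_norm_grouping:
  assumes x: "x \<in> c00_pos" and kg: "n \<le> k * g" and k: "1 \<le> k" and c: "0 \<le> c"
    and pieces: "\<And>y A. y \<in> c00_pos \<Longrightarrow> successive g A \<Longrightarrow> (\<Sum>l<g. \<rho> (restr (A l) y)) \<le> c * \<rho> y"
  shows "split_norm \<rho> n x \<le> c * split_norm \<rho> k x"
proof (rule split_norm_leI)
  fix A assume A: "successive n A"
  define A' where "A' = (\<lambda>i. if i < n then A i else {})"
  define G where "G = (\<lambda>i. \<Union>l<g. A' (i * g + l))"
  have suc: "a < b" if "i < j" "a \<in> A' i" "b \<in> A' j" for i j a b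
    using that successiveD[OF A that(1), of a b] by (auto simp: A'_def split: if_splits)
  have sG: "successive k G" unfolding successive_def
  proof (intro allI impI ballI)
    fix i j a b assume h: "i < j" "j < k" "a \<in> G i" "b \<in> G j"
    obtain l where l: "l < g" "a \<in> A' (i * g + l)" using h(3) by (auto simp: G_def)
    obtain l' where l': "l' < g" "b \<in> A' (j * g + l')" using h(4) by (auto simp: G_def)
    have "i * g + l < Suc i * g" using l by simp
    also have "\<dots> \<le> j * g" using h(1) by (intro mult_right_mono) auto
    finally have "i * g + l < j * g + l'" by simp
    then show "a < b" by (rule suc[OF _ l(2) l'(2)])
  qed
  have "(\<Sum>i<n. \<rho> (restr (A i) x)) = (\<Sum>i<n. \<rho> (restr (A' i) x))" by (simp add: A'_def)
  also have "\<dots> \<le> (\<Sum>i<k * g. \<rho> (restr (A' i) x))"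
    using kg x by (intro sum_mono2) (auto intro!: nonneg c00_pos_restr)
  also have "\<dots> = (\<Sum>i<k. \<Sum>l<g. \<rho> (restr (A' (i * g + l)) x))" by (rule sum_blocks)
  also have "\<dots> = (\<Sum>i<k. \<Sum>l<g. \<rho> (restr (A' (i * g + l)) (restr (G i) x)))"
    by (intro sum.cong refl arg_cong[of _ _ \<rho>]) (auto simp: restr_def G_def fun_eq_iff)
  also have "\<dots> \<le> (\<Sum>i<k. c * \<rho> (restr (G i) x))"
  proof (intro sum_mono pieces c00_pos_restr x)
    show "successive g (\<lambda>l. A' (i * g + l))" for i
      unfolding successive_def using suc by (metis nat_add_left_cancel_less)
  qed
  also have "\<dots> = c * (\<Sum>i<k. \<rho> (restr (G i) x))" by (simp add: sum_distrib_left)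
  also have "\<dots> \<le> c * split_norm \<rho> k x" using c by (intro mult_left_mono split_norm_upper sG x)
  finally show "(\<Sum>i<n. \<rho> (restr (A i) x)) \<le> c * split_norm \<rho> k x" .
qed

end

lemma in_block_cone_tail: "n \<le> i \<Longrightarrow> w i \<in> block_cone (\<lambda>i. w (n + i))"
  using block_cone_base[of "\<lambda>i. w (n + i)" "i - n"] by simp

context lattice_norm
begin

text \<open>The test vector \<open>X\<close> is a sum of \<open>k\<close> blocks from the unit ball,
  each a multiple of a sum of \<open>j\<close> normalized vectors. Its split norm for
  \<open>k\<close> is at most \<open>2 * k\<close>, so its norm is at most
  \<open>2 * k / lk\<close>; but splitting it into all \<open>k * j\<close> vectors gives a split
  norm for \<open>n\<close> of at least \<open>k * j / s\<close>.\<close>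

lemma ell_ratio_lower:
  assumes w: "block w" and k: "1 \<le> k" and j: "1 \<le> j" and kj: "k * j \<le> n"
    and lo: "\<And>x. x \<in> block_cone (\<lambda>i. w (k + i)) \<Longrightarrow> lk * \<rho> x \<le> split_norm \<rho> k x"
    and up: "\<And>x. x \<in> block_cone (\<lambda>i. w (n + i)) \<Longrightarrow> split_norm \<rho> n x \<le> C * \<rho> x"
    and lk: "0 < lk" and C: "0 \<le> C" and s: "0 < s"
    and sums: "\<And>y. (\<And>l. l < j \<Longrightarrow> y l \<in> c00_pos) \<Longrightarrow> (\<And>l. l < j \<Longrightarrow> \<rho> (y l) \<le> 1) \<Longrightarrow>
      successive j (\<lambda>l. supp (y l)) \<Longrightarrow> \<rho> (\<lambda>i. \<Sum>l<j. y l i) \<le> s"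
  shows "real j * lk \<le> 2 * s * C"
proof -
  have kn: "k \<le> n" using kj j by (metis One_nat_def Suc_le_eq le_trans mult.right_neutral mult_le_mono2)
  have wc: "w i \<in> c00_pos" for i by (rule block_c00_pos[OF w])
  have wp: "0 < \<rho> (w i)" for i using block_supp_ne[OF w, of i] pos[OF wc, of i] by (auto simp: supp_def)
  define e where "e = (\<lambda>l i. (1 / \<rho> (w (n + l))) * w (n + l) i)"
  have ec: "e l \<in> c00_pos" for l unfolding e_def using wp[of "n + l"] by (intro c00_pos_scale wc) auto
  have e1: "\<rho> (e l) = 1" for l unfolding e_def using wp[of "n + l"] scale[OF wc, of "1 / \<rho> (w (n + l))" "n + l"] by simp
  have se: "supp (e l) = supp (w (n + l))" for l using wp[of "n + l"] by (auto simp: e_def supp_def)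
  have suc: "successive m (\<lambda>l. supp (e (a + l)))" for m a
    using successive_shift[OF block_successive[OF w, of "(n + a) + m"]] by (simp add: se add.assoc)
  define Z where "Z = (\<lambda>i x. (1 / s) * (\<Sum>l<j. e (i * j + l) x))"
  define X where "X = (\<lambda>x. \<Sum>i<k. Z i x)"
  have Zsum: "(\<lambda>x. \<Sum>l<j. e (i * j + l) x) \<in> c00_pos" for i using ec by (intro c00_pos_sum) auto
  have Zc: "Z i \<in> c00_pos" for i unfolding Z_def using s by (intro c00_pos_scale Zsum) auto
  have Z1: "\<rho> (Z i) \<le> 1" for i
  proof -
    have "\<rho> (Z i) = (1 / s) * \<rho> (\<lambda>x. \<Sum>l<j. e (i * j + l) x)" unfolding Z_def using s by (intro scale Zsum) auto
    also have "\<dots> \<le> (1 / s) * s" using s ec e1 suc by (intro mult_left_mono sums) auto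
    finally show ?thesis using s by simp
  qed
  have Xc: "X \<in> c00_pos" unfolding X_def using Zc by (intro c00_pos_sum) auto
  have Xe: "X x = (1 / s) * (\<Sum>l<k * j. e l x)" for x
    by (simp add: X_def Z_def sum_blocks sum_distrib_left[symmetric] sum_divide_distrib[symmetric])
  have cone: "X \<in> block_cone (\<lambda>i. w (m + i))" if "m \<le> n" for m
    unfolding X_def Z_def e_def using s wp that
    by (intro block_cone_sum block_cone_scale in_block_cone_tail) (auto simp: less_imp_le)
  have "successive k (\<lambda>i. supp (Z i))" unfolding successive_def
  proof (intro allI impI ballI)
    fix i i' a b assume h: "i < i'" "i' < k" "a \<in> supp (Z i)" "b \<in> supp (Z i')"
    have ex: "\<exists>l<j. c \<in> supp (e (i * j + l))" if "c \<in> supp (Z i)" for c i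
    proof -
      have "(\<Sum>l<j. e (i * j + l) c) \<noteq> 0" using that by (auto simp: Z_def supp_def)
      then show ?thesis by (metis (mono_tags, lifting) in_supp_iff lessThan_iff sum.neutral)
    qed
    obtain l where l: "l < j" "a \<in> supp (e (i * j + l))" using ex[OF h(3)] by blast
    obtain l' where l': "l' < j" "b \<in> supp (e (i' * j + l'))" using ex[OF h(4)] by blast
    have "i * j + l < Suc i * j" using l by simp
    also have "\<dots> \<le> i' * j" using h(1) by (intro mult_right_mono) auto
    finally have "n + (i * j + l) < n + (i' * j + l')" by simp
    then show "a < b" using l(2) l'(2) unfolding se by (rule block_less[OF w])
  qed
  then have "split_norm \<rho> k X \<le> 2 * real k" unfolding X_def using Zc Z1 by (intro split_norm_sum_le) auto
  then have 1: "lk * \<rho> X \<le> 2 * real k" using lo[OF cone[OF kn]] by simp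
  have "real (k * j) / s = (\<Sum>l<k * j. (1 / s) * \<rho> (e l))" by (simp add: e1)
  also have "\<dots> \<le> (\<Sum>l<k * j. \<rho> (restr (supp (e l)) X))"
  proof (rule sum_mono)
    fix l assume l: "l \<in> {..<k * j}"
    have "(1 / s) * \<rho> (e l) = \<rho> (\<lambda>x. (1 / s) * e l x)" using s by (intro scale[symmetric] ec) auto
    also have "\<dots> \<le> \<rho> (restr (supp (e l)) X)"
    proof (intro mono c00_pos_scale ec c00_pos_restr Xc)
      fix x
      have "e l x \<le> (\<Sum>l<k * j. e l x)" using l ec by (intro member_le_sum) (auto simp: c00_pos_def)
      then show "(1 / s) * e l x \<le> restr (supp (e l)) X x"
        using s by (auto simp: restr_def Xe supp_def divide_right_mono)
    qed (use s in simp)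
    finally show "(1 / s) * \<rho> (e l) \<le> \<rho> (restr (supp (e l)) X)" .
  qed
  also have "\<dots> \<le> split_norm \<rho> n X" using suc[of "k * j" 0] by (intro split_norm_pad kj Xc) simp
  also have "\<dots> \<le> C * \<rho> X" by (rule up[OF cone[OF order_refl]])
  finally have "lk * (real (k * j) / s) \<le> lk * (C * \<rho> X)" using lk by (intro mult_left_mono) auto
  also have "\<dots> = C * (lk * \<rho> X)" by simp
  also have "\<dots> \<le> C * (2 * real k)" using 1 C by (rule mult_left_mono)
  finally have "real k * (real j * lk) \<le> real k * (2 * s * C)" using s by (simp add: field_simps)
  then show ?thesis using k by simp
qed

text \<open>Undistorted split norms are proportional to \<open>\<rho>\<close> up to a constant on a
  subblock, and \<open>ell n\<close> is the factor of proportionality. The upper comparison is the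
  lower estimate, the lower comparison gives the upper estimate through
  \<open>split_norm_sum_le\<close>. Diagonalization handles all \<open>n\<close> but leaves only the
  tail beyond \<open>n\<close> for each, hence the admissibility conditions.\<close>

lemma asymptotic_subblock:
  assumes linf: "no_linf \<rho>" and l1: "no_l1 \<rho>" and D: "0 < D" and z: "block z"
    and bd: "\<And>\<nu> a b w. lattice_norm \<nu> \<Longrightarrow> 0 < a \<Longrightarrow> 0 < b \<Longrightarrow>
      (\<And>x. x \<in> c00_pos \<Longrightarrow> a * \<rho> x \<le> \<nu> x \<and> \<nu> x \<le> b * \<rho> x) \<Longrightarrow> subblock w z \<Longrightarrow>
      \<exists>w'. subblock w' w \<and> (\<forall>x\<in>block_cone w'. \<forall>x'\<in>block_cone w'. \<nu> x * \<rho> x' \<le> D * (\<nu> x' * \<rho> x))"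
  obtains w ell K where "subblock w z" "asymptotic (\<lambda>a. \<rho> (comb w a)) ell K"
proof -
  define E where "E = D * D"
  have E: "0 < E" using D by (simp add: E_def)
  define Q where "Q = (\<lambda>n w. 1 \<le> n \<longrightarrow> (\<exists>l>0. \<forall>x\<in>block_cone w. l * \<rho> x \<le> split_norm \<rho> n x \<and> split_norm \<rho> n x \<le> E * l * \<rho> x))"
  have her: "Q n w'" if "Q n w" "subblock w' w" for n w w'
    using that subblock_cone[OF that(2)] unfolding Q_def by blast
  have ex: "\<exists>w'. subblock w' w \<and> Q n w'" if w: "subblock w z" for n w
  proof (cases "1 \<le> n")
    case False
    then show ?thesis using subblock_refl[OF subblock_block[OF w]] by (auto simp: Q_def)
  next
    case n: True
    obtain w' where w': "subblock w' w" "\<And>x x'. x \<in> block_cone w' \<Longrightarrow> x' \<in> block_cone w' \<Longrightarrow>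
        split_norm \<rho> n x * \<rho> x' \<le> D * (split_norm \<rho> n x' * \<rho> x)"
      using bd[OF lattice_norm_split_norm[OF n], of 1 "real n" w] split_norm_bounds n w by auto
    have b: "block w'" by (rule subblock_block[OF w'(1)])
    have wc: "w' 0 \<in> c00_pos" by (rule block_c00_pos[OF b])
    have wp: "0 < \<rho> (w' 0)" using block_supp_ne[OF b, of 0] pos[OF wc] by (auto simp: supp_def)
    have sp: "0 < split_norm \<rho> n (w' 0)" using split_norm_bounds(1)[OF wc n] wp by simp
    \<comment> \<open>The ratio at one reference vector divided by \<open>D\<close>; all ratios on
      the cone lie between \<open>l\<close> and \<open>D * D * l\<close>.\<close>
    define l where "l = split_norm \<rho> n (w' 0) / (D * \<rho> (w' 0))"
    have l: "0 < l" using sp wp D by (simp add: l_def)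
    have "l * \<rho> x \<le> split_norm \<rho> n x \<and> split_norm \<rho> n x \<le> E * l * \<rho> x" if x: "x \<in> block_cone w'" for x
    proof
      have "split_norm \<rho> n (w' 0) * \<rho> x \<le> D * (split_norm \<rho> n x * \<rho> (w' 0))"
        by (rule w'(2)[OF block_cone_base x])
      then show "l * \<rho> x \<le> split_norm \<rho> n x" using wp D by (simp add: l_def field_simps)
      have "split_norm \<rho> n x * \<rho> (w' 0) \<le> D * (split_norm \<rho> n (w' 0) * \<rho> x)"
        by (rule w'(2)[OF x block_cone_base])
      also have "\<dots> = (E * l * \<rho> x) * \<rho> (w' 0)" using wp D by (simp add: l_def E_def)
      finally show "split_norm \<rho> n x \<le> E * l * \<rho> x" using wp by simp
    qed
    then show ?thesis using w'(1) l unfolding Q_def by blast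
  qed
  have "\<exists>w. subblock w z \<and> (\<forall>n. Q n (\<lambda>i. w (n + i)))"
    by (rule diagonal_subblock[OF z], erule (1) her, erule ex)
  then obtain w where w: "subblock w z" "\<And>n. Q n (\<lambda>i. w (n + i))" by blast
  have wb: "block w" by (rule subblock_block[OF w(1)])
  have "\<exists>l>0. 1 \<le> n \<longrightarrow> (\<forall>x\<in>block_cone (\<lambda>i. w (n + i)). l * \<rho> x \<le> split_norm \<rho> n x \<and> split_norm \<rho> n x \<le> E * l * \<rho> x)" for n
    using w(2)[of n] unfolding Q_def by (cases "1 \<le> n") (auto intro: exI[of _ 1])
  then obtain ell where ell: "\<And>n. 0 < ell n"
    "\<And>n x. 1 \<le> n \<Longrightarrow> x \<in> block_cone (\<lambda>i. w (n + i)) \<Longrightarrow> ell n * \<rho> x \<le> split_norm \<rho> n x"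
    "\<And>n x. 1 \<le> n \<Longrightarrow> x \<in> block_cone (\<lambda>i. w (n + i)) \<Longrightarrow> split_norm \<rho> n x \<le> E * ell n * \<rho> x"
    by metis
  define K where "K = 2 + E"
  have cc: "comb w a \<in> c00_pos" if "a \<in> c00_pos" for a by (intro comb_c00_pos block_c00_pos[OF wb] that)
  have tl: "comb w a \<in> block_cone (\<lambda>i. w (n + i))" if "a \<in> c00_pos" "\<And>k. k \<in> supp a \<Longrightarrow> n \<le> k" for a n
    by (intro comb_in_block_cone in_block_cone_tail that)
  have "asymptotic (\<lambda>a. \<rho> (comb w a)) ell K"
  proof (intro asymptotic.intro asymptotic_axioms.intro)
    show "lattice_norm (\<lambda>a. \<rho> (comb w a))" by (rule lattice_norm_comb[OF lattice_norm_axioms wb])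
    show "1 \<le> K" using E by (simp add: K_def)
    show "0 < ell n" for n by (rule ell)
  next
    fix n and A :: "nat \<Rightarrow> nat set" and x
    assume A: "successive n A" and x: "x \<in> c00_pos" "\<And>k. k \<in> supp x \<Longrightarrow> n \<le> k"
    show "(\<Sum>i<n. \<rho> (comb w (restr (A i) x))) \<le> K * ell n * \<rho> (comb w x)"
    proof (cases "n = 0")
      case True
      then show ?thesis using E ell(1)[of n] nonneg[OF cc[OF x(1)]] by (simp add: K_def)
    next
      case False
      have "(\<Sum>i<n. \<rho> (comb w (restr (A i) x))) = (\<Sum>i<n. \<rho> (restr (\<Union>l\<in>A i. supp (w l)) (comb w x)))"
        by (simp add: comb_restr[OF wb x(1)])
      also have "\<dots> \<le> split_norm \<rho> n (comb w x)"
        by (intro split_norm_upper successive_Union_block[OF wb A] cc x)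
      also have "\<dots> \<le> E * ell n * \<rho> (comb w x)" using False by (intro ell(3) tl x) auto
      also have "\<dots> \<le> K * ell n * \<rho> (comb w x)"
        using ell(1)[of n] nonneg[OF cc[OF x(1)]] by (intro mult_right_mono) (auto simp: K_def)
      finally show ?thesis .
    qed
  next
    fix n and y :: "nat \<Rightarrow> nat \<Rightarrow> real"
    assume y: "\<And>i. i < n \<Longrightarrow> y i \<in> c00_pos" "\<And>i. i < n \<Longrightarrow> \<rho> (comb w (y i)) \<le> 1"
      "\<And>i k. i < n \<Longrightarrow> k \<in> supp (y i) \<Longrightarrow> n \<le> k" "successive n (\<lambda>i. supp (y i))"
    show "\<rho> (comb w (\<lambda>k. \<Sum>i<n. y i k)) \<le> K * (real n / ell n)"
    proof (cases "n = 0")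
      case True
      then show ?thesis by (simp add: comb_zero zero)
    next
      case False
      have sumc: "(\<lambda>k. \<Sum>i<n. y i k) \<in> c00_pos" using y by (intro c00_pos_sum) auto
      have eq: "comb w (\<lambda>k. \<Sum>i<n. y i k) = (\<lambda>k. \<Sum>i<n. comb w (y i) k)" using y(1) by (subst comb_sum) auto
      have "ell n * \<rho> (comb w (\<lambda>k. \<Sum>i<n. y i k)) \<le> split_norm \<rho> n (comb w (\<lambda>k. \<Sum>i<n. y i k))"
      proof (intro ell(2) tl sumc)
        show "n \<le> k" if "k \<in> supp (\<lambda>k. \<Sum>i<n. y i k)" for k
          using supp_sum_subset[of y "{..<n}"] that y(3) by auto
      qed (use False in simp)
      also have "\<dots> \<le> 2 * real n" unfolding eq
      proof (rule split_norm_sum_le)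
        have "successive n (\<lambda>i. \<Union>l\<in>supp (y i). supp (w l))" by (rule successive_Union_block[OF wb y(4)])
        then show "successive n (\<lambda>i. supp (comb w (y i)))"
          by (rule successive_subset) (simp add: supp_comb[OF wb] y)
      qed (use y cc in auto)
      finally have "\<rho> (comb w (\<lambda>k. \<Sum>i<n. y i k)) \<le> 2 * real n / ell n"
        using ell(1)[of n] by (simp add: field_simps)
      also have "\<dots> \<le> K * (real n / ell n)"
        using E ell(1)[of n] mult_right_mono[of 2 K "real n / ell n"] by (simp add: K_def)
      finally show ?thesis .
    qed
  next
    fix \<delta> :: real assume \<delta>: "0 < \<delta>"
    define \<eta> where "\<eta> = \<delta> / (4 * E)"
    have \<eta>: "0 < \<eta>" using \<delta> E by (simp add: \<eta>_def)
    obtain p :: nat where p: "\<And>y J. finite J \<Longrightarrow> disjoint_family_on (\<lambda>i. supp (y i)) (J :: nat set) \<Longrightarrow>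
      (\<And>i. i \<in> J \<Longrightarrow> y i \<in> c00_pos) \<Longrightarrow> (\<And>i. i \<in> J \<Longrightarrow> \<rho> (y i) \<le> 1) \<Longrightarrow>
      \<rho> (\<lambda>k. \<Sum>i\<in>J. y i k) \<le> real p + \<eta> * real (card J)"
      using sum_of_normalized_le[OF l1 \<eta>] by blast
    obtain q :: nat where q: "\<And>x J A. finite J \<Longrightarrow> disjoint_family_on A (J :: nat set) \<Longrightarrow> x \<in> c00_pos \<Longrightarrow>
      (\<Sum>i\<in>J. \<rho> (restr (A i) x)) \<le> (real q + \<eta> * real (card J)) * \<rho> x"
      using sum_of_pieces_le[OF linf \<eta>] by blast
    have dis: "disjoint_family_on A {..<n}" if "successive n A" for n A
      using successive_disjoint[OF that] by (auto simp: disjoint_family_on_def)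
    \<comment> \<open>Ensures that the exceptional counts \<open>p\<close> and \<open>q\<close> are
      at most \<open>\<eta> * j\<close> for every \<open>j \<ge> J0\<close>.\<close>
    obtain J0 :: nat where J0: "(real p + real q) / \<eta> + 1 \<le> real J0" using real_arch_simple by blast
    have pq0: "0 \<le> (real p + real q) / \<eta>" using \<eta> by simp
    have J1: "1 \<le> J0" using J0 pq0 by (cases J0) auto
    show "\<exists>\<gamma>>0. \<forall>k n. 1 \<le> k \<and> real k \<le> \<gamma> * real n \<longrightarrow>
      ell k \<le> \<delta> * ell n \<and> real k / ell k \<le> \<delta> * (real n / ell n)"
    proof (intro exI[of _ "1 / real J0"] conjI allI impI)
      show "0 < 1 / real J0" using J1 by simp
      fix k n :: nat assume kn: "1 \<le> k \<and> real k \<le> 1 / real J0 * real n"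
      then have k1: "1 \<le> k" by simp
      have "real (k * J0) \<le> real n" using kn J1 by (simp add: field_simps)
      then have kJ: "k * J0 \<le> n" by linarith
      \<comment> \<open>The inequality \<open>k * j \<le> n\<close> provides room for the test
        vector that bounds \<open>ell k\<close>; \<open>n \<le> k * (j + 1)\<close> allows the
        grouping that bounds \<open>ell n\<close>.\<close>
      define j where "j = n div k"
      have j: "J0 \<le> j" using kJ k1 by (simp add: j_def less_eq_div_iff_mult_less_eq mult.commute)
      have kj: "k * j \<le> n" "n \<le> k * (j + 1)"
        using k1 by (simp_all add: j_def, metis dividend_less_div_times le_eq_less_or_eq mult.commute add.commute not_one_le_zero neq0_conv)
      have n1: "1 \<le> n" using kJ k1 J1 by (metis One_nat_def Suc_le_eq le_trans nat_0_less_mult_iff)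
      have jr: "(real p + real q) / \<eta> \<le> real j" "1 \<le> real j" using j J0 J1 by linarith+
      then have pq: "real p \<le> \<eta> * real j" "real q \<le> \<eta> * real j"
        using \<eta> by (simp_all add: field_simps)
      define s where "s = real p + \<eta> * real j"
      have s: "0 < s" "s \<le> 2 * \<eta> * real j" using \<eta> jr pq by (auto simp: s_def intro: add_nonneg_pos)
      have "real j * ell k \<le> 2 * s * (E * ell n)"
      proof (rule ell_ratio_lower[OF wb k1 _ kj(1)])
        show "1 \<le> j" using jr by linarith
        show "ell k * \<rho> x \<le> split_norm \<rho> k x" if "x \<in> block_cone (\<lambda>i. w (k + i))" for x
          by (rule ell(2)[OF k1 that])
        show "split_norm \<rho> n x \<le> E * ell n * \<rho> x" if "x \<in> block_cone (\<lambda>i. w (n + i))" for x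
          by (rule ell(3)[OF n1 that])
        show "\<rho> (\<lambda>i. \<Sum>l<j. y l i) \<le> s"
          if "\<And>l. l < j \<Longrightarrow> y l \<in> c00_pos" "\<And>l. l < j \<Longrightarrow> \<rho> (y l) \<le> 1" "successive j (\<lambda>l. supp (y l))" for y
          using p[of "{..<j}" y] that dis[OF that(3)] by (simp add: s_def)
      qed (use ell(1)[of k] ell(1)[of n] E s in auto)
      also have "\<dots> \<le> 2 * (2 * \<eta> * real j) * (E * ell n)"
        using s E ell(1)[of n] by (intro mult_right_mono mult_left_mono) auto
      also have "\<dots> = real j * (\<delta> * ell n)" using E by (simp add: \<eta>_def)
      finally show "ell k \<le> \<delta> * ell n" using jr by simp
      define c where "c = real q + \<eta> * real (j + 1)"
      have ej: "\<eta> * 1 \<le> \<eta> * real j" using jr(2) less_imp_le[OF \<eta>] by (rule mult_left_mono)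
      have ceq: "c = real q + \<eta> * real j + \<eta>" by (simp add: c_def distrib_left)
      have c: "0 \<le> c" "c \<le> 3 * \<eta> * real j" using ceq ej pq(2) \<eta> by linarith+
      have wn: "w n \<in> c00_pos" by (rule block_c00_pos[OF wb])
      have wp: "0 < \<rho> (w n)" using block_supp_ne[OF wb, of n] pos[OF wn] by (auto simp: supp_def)
      have "k \<le> n" using kj(1) jr by (metis j J1 le_trans mult.right_neutral mult_le_mono2)
      have "ell n * \<rho> (w n) \<le> split_norm \<rho> n (w n)" by (intro ell(2) n1 in_block_cone_tail order_refl)
      also have "\<dots> \<le> c * split_norm \<rho> k (w n)"
      proof (rule split_norm_grouping[OF wn kj(2) k1 c(1)])
        show "(\<Sum>l<j + 1. \<rho> (restr (A l) y)) \<le> c * \<rho> y" if "y \<in> c00_pos" "successive (j + 1) A" for y A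
          using q[OF _ dis[OF that(2)] that(1)] by (simp add: c_def)
      qed
      also have "\<dots> \<le> c * (E * ell k * \<rho> (w n))"
        using c \<open>k \<le> n\<close> by (intro mult_left_mono ell(3) k1 in_block_cone_tail)
      finally have "ell n \<le> c * (E * ell k)" using wp by simp
      also have "\<dots> \<le> (3 * \<eta> * real j) * (E * ell k)" using c E ell(1)[of k] by (intro mult_right_mono) auto
      also have "\<dots> = (3 / 4 * \<delta> * real j) * ell k" using E by (simp add: \<eta>_def)
      also have "\<dots> \<le> (\<delta> * real j) * ell k" using \<delta> ell(1)[of k] by (intro mult_right_mono) auto
      finally have "real k * ell n \<le> real k * ((\<delta> * real j) * ell k)" by (rule mult_left_mono) simp
      also have "\<dots> = \<delta> * real (k * j) * ell k" by simp
      also have "\<dots> \<le> \<delta> * real n * ell k" using kj(1) \<delta> ell(1)[of k] by (intro mult_right_mono mult_left_mono) (auto simp del: of_nat_mult)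
      finally show "real k / ell k \<le> \<delta> * (real n / ell n)" using ell(1)[of k] ell(1)[of n] by (simp add: field_simps)
    qed
  qed
  then show ?thesis using that w(1) by blast
qed

text \<open>The absence of distortion yields an asymptotic subblock \<open>w\<close>, and there a
  distorting norm in coordinates. The negated claim speaks about norms on the whole lattice, so this
  norm has to be extended before the contradiction is reached.\<close>

theorem distorted_subblock:
  assumes linf: "no_linf \<rho>" and l1: "no_l1 \<rho>" and D: "0 < D" and z: "block z"
  shows "\<exists>\<nu> a b w. lattice_norm \<nu> \<and> 0 < a \<and> 0 < b \<and>
    (\<forall>x\<in>c00_pos. a * \<rho> x \<le> \<nu> x \<and> \<nu> x \<le> b * \<rho> x) \<and> subblock w z \<and>
    (\<forall>w'. subblock w' w \<longrightarrow> (\<exists>x\<in>block_cone w'. \<exists>x'\<in>block_cone w'. D * (\<nu> x' * \<rho> x) < \<nu> x * \<rho> x'))"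
proof (rule ccontr)
  assume no: "\<not> ?thesis"
  have bd: "\<exists>w'. subblock w' w \<and> (\<forall>x\<in>block_cone w'. \<forall>x'\<in>block_cone w'. \<nu> x * \<rho> x' \<le> D * (\<nu> x' * \<rho> x))"
    if "lattice_norm \<nu>" "0 < a" "0 < b" "\<And>x. x \<in> c00_pos \<Longrightarrow> a * \<rho> x \<le> \<nu> x \<and> \<nu> x \<le> b * \<rho> x" "subblock w z" for \<nu> a b w
  proof (rule ccontr)
    assume c: "\<not> ?thesis"
    have "\<exists>x\<in>block_cone w'. \<exists>x'\<in>block_cone w'. D * (\<nu> x' * \<rho> x) < \<nu> x * \<rho> x'" if "subblock w' w" for w'
      using c that by (meson not_le)
    then have "lattice_norm \<nu> \<and> 0 < a \<and> 0 < b \<and>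
      (\<forall>x\<in>c00_pos. a * \<rho> x \<le> \<nu> x \<and> \<nu> x \<le> b * \<rho> x) \<and> subblock w z \<and>
      (\<forall>w'. subblock w' w \<longrightarrow> (\<exists>x\<in>block_cone w'. \<exists>x'\<in>block_cone w'. D * (\<nu> x' * \<rho> x) < \<nu> x * \<rho> x'))"
      using that by simp
    with no show False by blast
  qed
  obtain w ell K where w: "subblock w z" and as: "asymptotic (\<lambda>a. \<rho> (comb w a)) ell K"
    by (rule asymptotic_subblock[OF linf l1 D z]) (rule bd)
  have wb: "block w" by (rule subblock_block[OF w])
  interpret A: asymptotic "\<lambda>a. \<rho> (comb w a)" ell K by (rule as)
  obtain \<nu>1 a b where \<nu>1: "lattice_norm \<nu>1" "0 < a" "0 < b"
    "\<And>x. x \<in> c00_pos \<Longrightarrow> a * \<rho> (comb w x) \<le> \<nu>1 x \<and> \<nu>1 x \<le> b * \<rho> (comb w x)"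
    "\<And>v. block v \<Longrightarrow> \<exists>x\<in>block_cone v. \<exists>x'\<in>block_cone v. D * (\<nu>1 x * \<rho> (comb w x')) < \<nu>1 x' * \<rho> (comb w x)"
    using A.distorting_norm[OF no_linf_comb[OF linf wb] no_l1_comb[OF l1 wb] D] by blast
  \<comment> \<open>The extension lemma needs the lower constant to be at most the upper
    one.\<close>
  define C where "C = max a b"
  have C: "a \<le> C" "0 < C" using \<nu>1(2) by (auto simp: C_def)
  have cc: "comb w x \<in> c00_pos" if "x \<in> c00_pos" for x by (intro comb_c00_pos block_c00_pos[OF wb] that)
  have eq: "a * \<rho> (comb w x) \<le> \<nu>1 x \<and> \<nu>1 x \<le> C * \<rho> (comb w x)" if "x \<in> c00_pos" for x
    using \<nu>1(4)[OF that] mult_right_mono[OF _ nonneg[OF cc[OF that]], of b C] by (simp add: C_def)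
  obtain \<nu> where \<nu>: "lattice_norm \<nu>" "\<And>x. x \<in> c00_pos \<Longrightarrow> a * \<rho> x \<le> \<nu> x \<and> \<nu> x \<le> C * \<rho> x"
    "\<And>x. x \<in> c00_pos \<Longrightarrow> \<nu> (comb w x) = \<nu>1 x"
    using extend_lattice_norm[OF lattice_norm_axioms wb \<nu>1(1,2) C(1) eq] by blast
  obtain w' where w': "subblock w' w"
    "\<And>x x'. x \<in> block_cone w' \<Longrightarrow> x' \<in> block_cone w' \<Longrightarrow> \<nu> x * \<rho> x' \<le> D * (\<nu> x' * \<rho> x)"
    using bd[OF \<nu>(1) \<nu>1(2) C(2) \<nu>(2) w] by blast
  obtain v where v: "block v" "w' = (\<lambda>i. comb w (v i))" using subblock_coordinates[OF wb w'(1)] by blast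
  obtain x x' where x: "x \<in> block_cone v" "x' \<in> block_cone v" "D * (\<nu>1 x * \<rho> (comb w x')) < \<nu>1 x' * \<rho> (comb w x)"
    using \<nu>1(5)[OF v(1)] by blast
  have xc: "x \<in> c00_pos" "x' \<in> c00_pos" using x v(1) by (auto intro: block_cone_c00_pos)
  have "comb w x \<in> block_cone w'" "comb w x' \<in> block_cone w'"
    unfolding v(2) block_cone_comb[OF block_c00_pos[OF v(1)]] using x by auto
  then have "\<nu> (comb w x') * \<rho> (comb w x) \<le> D * (\<nu> (comb w x) * \<rho> (comb w x'))" by (intro w'(2))
  then show False using x(3) by (simp add: \<nu>(3) xc)
qed

end

section \<open>Unconditional bases\<close>

text \<open>The first half of the open mapping argument. By Baire's theorem some set
  \<open>{x. T x \<le> n}\<close> is dense in a ball, and differences of its elements approximate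
  all vectors of a fixed small norm. Continuity of \<open>T\<close> is not at hand, so approximation
  is all that results.\<close>

lemma approximation_of_sublinear:
  fixes T :: "'a::banach \<Rightarrow> real"
  assumes T0: "\<And>x. 0 \<le> T x" and diff: "\<And>x y. T (x - y) \<le> T x + T y"
    and scale: "\<And>r x. T (r *\<^sub>R x) \<le> \<bar>r\<bar> * T x"
  obtains L where "0 < L" "\<And>y. \<exists>u. T u \<le> L * norm y \<and> norm (y - u) \<le> norm y / 2"
proof -
  define B where "B = (\<lambda>n::nat. closure {x. T x \<le> real n})"
  have "(\<Union>n. B n) = UNIV"
  proof -
    have "\<exists>n. x \<in> B n" for x
    proof -
      obtain n :: nat where "T x \<le> real n" using real_arch_simple by blast
      then have "x \<in> {x. T x \<le> real n}" by simp
      then have "x \<in> B n" unfolding B_def by (rule subsetD[OF closure_subset])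
      then show ?thesis by blast
    qed
    then show ?thesis by auto
  qed
  moreover have "interior (\<Union>(range B)) = {}" if "\<And>n. interior (B n) = {}"
  proof -
    have "euclidean interior_of \<Union>(range B) = {}"
      by (rule Baire_category_alt)
        (use that in \<open>auto simp: completely_metrizable_space_euclidean B_def\<close>)
    then show ?thesis by simp
  qed
  ultimately obtain n where "interior (B n) \<noteq> {}" by auto
  then obtain x0 where "x0 \<in> interior (B n)" by blast
  then obtain r where r: "r > 0" "ball x0 r \<subseteq> B n" by (auto simp: mem_interior)
  define \<delta> where "\<delta> = r / 2"
  have \<delta>: "\<delta> > 0" using r by (simp add: \<delta>_def)
  have near: "\<exists>u. T u \<le> 2 * real n \<and> norm (y - u) \<le> \<delta> / 2" if y: "norm y = \<delta>" for y
  proof -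
    have "x0 \<in> ball x0 r" "x0 + y \<in> ball x0 r" using r(1) y by (auto simp: \<delta>_def dist_norm)
    then have B: "x0 \<in> B n" "x0 + y \<in> B n" using r(2) by auto
    have \<delta>4: "0 < \<delta> / 4" using \<delta> by simp
    obtain a where a: "T a \<le> real n" "dist a x0 < \<delta> / 4"
      using B(1)[unfolded B_def closure_approachable, rule_format, OF \<delta>4] by auto
    obtain b where b: "T b \<le> real n" "dist b (x0 + y) < \<delta> / 4"
      using B(2)[unfolded B_def closure_approachable, rule_format, OF \<delta>4] by auto
    have "norm (y - (b - a)) = norm ((x0 + y - b) - (x0 - a))" by (simp add: algebra_simps)
    also have "\<dots> \<le> norm (x0 + y - b) + norm (x0 - a)" by (rule norm_triangle_ineq4)
    also have "\<dots> \<le> \<delta> / 2" using a b by (simp add: dist_norm norm_minus_commute)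
    finally show ?thesis using diff[of b a] a b by (intro exI[of _ "b - a"]) simp
  qed
  define L where "L = 2 * real n / \<delta> + 1"
  have L: "0 < L" using \<delta> by (simp add: L_def add_nonneg_pos)
  show ?thesis
  proof (rule that[OF L])
    fix y
    show "\<exists>u. T u \<le> L * norm y \<and> norm (y - u) \<le> norm y / 2"
    proof (cases "y = 0")
      case True
      then show ?thesis using scale[of 0 0] T0[of 0] by (intro exI[of _ 0]) simp
    next
      case False
      define s where "s = norm y / \<delta>"
      have s: "s > 0" using False \<delta> by (simp add: s_def)
      have ns: "norm ((1 / s) *\<^sub>R y) = \<delta>" using False \<delta> by (simp add: s_def)
      obtain u where u: "T u \<le> 2 * real n" "norm ((1 / s) *\<^sub>R y - u) \<le> \<delta> / 2"
        using near[OF ns] by blast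
      have "T (s *\<^sub>R u) \<le> s * T u" using scale[of s u] s by simp
      also have "\<dots> \<le> s * (2 * real n)" using s u by (intro mult_left_mono) auto
      also have "\<dots> \<le> L * norm y" using \<delta> by (simp add: s_def L_def field_simps)
      finally have 1: "T (s *\<^sub>R u) \<le> L * norm y" .
      have "y - s *\<^sub>R u = s *\<^sub>R ((1 / s) *\<^sub>R y - u)" using s by (simp add: scaleR_diff_right)
      then have "norm (y - s *\<^sub>R u) = s * norm ((1 / s) *\<^sub>R y - u)" using s by simp
      also have "\<dots> \<le> s * (\<delta> / 2)" using u s by (intro mult_left_mono) auto
      also have "\<dots> = norm y / 2" using \<delta> by (simp add: s_def)
      finally show ?thesis using 1 by blast
    qed
  qed
qed

text \<open>A convex function on a cube is largest at a vertex, and the vertices of the cube of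
  multipliers are the subsets of \<open>F\<close>.\<close>

lemma norm_sum_multipliers_le:
  fixes f :: "'i \<Rightarrow> 'a::real_normed_vector"
  assumes "finite F" "\<And>A. A \<subseteq> F \<Longrightarrow> norm (v + sum f A) \<le> M" "\<And>i. i \<in> F \<Longrightarrow> 0 \<le> b i \<and> b i \<le> 1"
  shows "norm (v + (\<Sum>i\<in>F. b i *\<^sub>R f i)) \<le> M"
  using assms
proof (induction F arbitrary: v rule: finite_induct)
  case empty
  then show ?case using empty(1)[of "{}"] by simp
next
  case (insert x F)
  define w where "w = (\<Sum>i\<in>F. b i *\<^sub>R f i)"
  have 1: "norm ((v + f x) + w) \<le> M" unfolding w_def
  proof (rule insert.IH)
    fix A assume A: "A \<subseteq> F"
    then have "x \<notin> A" "finite A" using insert.hyps finite_subset by auto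
    then show "norm (v + f x + sum f A) \<le> M"
      using insert.prems(1)[of "insert x A"] A by (auto simp: add.assoc)
  qed (use insert.prems in auto)
  have 2: "norm (v + w) \<le> M" unfolding w_def
    by (rule insert.IH) (use insert.prems in auto)
  have bx: "0 \<le> b x" "b x \<le> 1" using insert.prems by auto
  have "v + (\<Sum>i\<in>insert x F. b i *\<^sub>R f i) = b x *\<^sub>R ((v + f x) + w) + (1 - b x) *\<^sub>R (v + w)"
    using insert.hyps by (simp add: w_def algebra_simps)
  also have "norm \<dots> \<le> b x * norm ((v + f x) + w) + (1 - b x) * norm (v + w)"
    using bx by (intro order_trans[OF norm_triangle_ineq]) simp
  also have "\<dots> \<le> b x * M + (1 - b x) * M" using 1 2 bx by (intro add_mono mult_left_mono) auto
  finally show ?case by (simp add: algebra_simps)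
qed

section \<open>The equivalent lattice norm given by bounded multipliers\<close>

locale unconditional_space = banach_space_over scl
  for scl :: "'k::{real_normed_field,euclidean_space} \<Rightarrow> 'a::banach \<Rightarrow> 'a" +
  fixes e :: "nat \<Rightarrow> 'a"
  assumes unconditional: "unconditional_basis scl e"
begin

definition coord :: "'a \<Rightarrow> nat \<Rightarrow> 'k" where
  "coord x = (THE a. (\<lambda>n. scl (a n) (e n)) sums x)"

lemma ex1_coord: "\<exists>!a. (\<lambda>n. scl (a n) (e n)) sums x"
  using unconditional by (simp add: unconditional_basis_def schauder_basis_def)

lemma coord_sums: "(\<lambda>n. scl (coord x n) (e n)) sums x"
  unfolding coord_def by (rule theI'[OF ex1_coord])

lemma coord_unique: "(\<lambda>n. scl (a n) (e n)) sums x \<Longrightarrow> coord x = a"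
  using ex1_coord coord_sums by blast

lemma coord_has_sum: "((\<lambda>n. scl (coord x n) (e n)) has_sum x) UNIV"
  using unconditional coord_sums by (auto simp: unconditional_basis_def)

lemma scl_bounded_linear: "bounded_linear (scl k)"
proof
  show "scl k (x + y) = scl k x + scl k y" for x y by (rule scale_right_distrib)
  show "scl k (r *\<^sub>R x) = r *\<^sub>R scl k x" for r x
    by (metis mult.commute scale_scale scl_of_real)
  show "\<exists>K. \<forall>x. norm (scl k x) \<le> norm x * K" by (intro exI[of _ "norm k"]) (simp add: norm_scl mult.commute)
qed

lemma coord_add: "coord (x + y) = (\<lambda>n. coord x n + coord y n)"
  by (rule coord_unique) (use sums_add[OF coord_sums coord_sums] in \<open>simp add: scale_left_distrib\<close>)

lemma coord_scl: "coord (scl k x) = (\<lambda>n. k * coord x n)"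
  by (rule coord_unique)
    (use bounded_linear.sums[OF scl_bounded_linear coord_sums, of k x] in \<open>simp add: scale_scale\<close>)

lemma scaleR_eq_scl: "r *\<^sub>R x = scl (of_real r) x"
  by (simp add: scl_of_real)

lemma coord_minus: "coord (x - y) = (\<lambda>n. coord x n - coord y n)"
  using coord_add[of "x - y" y] by (auto simp: fun_eq_iff)

lemma coord_zero: "coord 0 = (\<lambda>n. 0)"
  using coord_minus[of 0 0] by simp

lemma coord_sum: "coord (sum f I) n = (\<Sum>i\<in>I. coord (f i) n)"
  by (induction I rule: infinite_finite_induct) (simp_all add: coord_zero coord_add)

lemma coord_finite_sum:
  assumes "finite F"
  shows "coord (\<Sum>i\<in>F. scl (a i) (e i)) = (\<lambda>n. if n \<in> F then a n else 0)"
proof (rule coord_unique)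
  have "(\<lambda>n. if n \<in> F then scl (a n) (e n) else 0) sums (\<Sum>i\<in>F. scl (a i) (e i))"
    by (rule sums_If_finite_set[OF assms])
  then show "(\<lambda>n. scl (if n \<in> F then a n else 0) (e n)) sums (\<Sum>i\<in>F. scl (a i) (e i))"
    by (simp add: if_distrib[of "\<lambda>k. scl k _"] scale_zero_left cong: if_cong)
qed

lemma eq_if_coord_eq: "coord x = coord y \<Longrightarrow> x = y"
  using coord_sums[of x] coord_sums[of y] sums_unique2 by metis

definition multiplied :: "nat set \<Rightarrow> (nat \<Rightarrow> 'k) \<Rightarrow> 'a \<Rightarrow> 'a" where
  "multiplied F b x = (\<Sum>i\<in>F. scl (b i * coord x i) (e i))"

definition multipliers :: "(nat set \<times> (nat \<Rightarrow> 'k)) set" where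
  "multipliers = {(F, b). finite F \<and> (\<forall>i. norm (b i) \<le> 1)}"

definition sup_norm :: "'a \<Rightarrow> real" where
  "sup_norm x = (SUP (F, b)\<in>multipliers. norm (multiplied F b x))"

text \<open>Unconditional convergence bounds all finite partial sums of the expansion. From there
  convexity reaches multipliers in \<open>{0..1}\<close>, positive and negative parts reach real
  ones, and components with respect to \<open>Basis\<close> reach those in the scalar field.\<close>

lemma multiplied_bounded: "\<exists>M. \<forall>(F, b)\<in>multipliers. norm (multiplied F b x) \<le> M"
proof -
  define f where "f = (\<lambda>i. scl (coord x i) (e i))"
  have "(sum f \<longlongrightarrow> x) (finite_subsets_at_top UNIV)"
    using coord_has_sum[of x] by (simp add: f_def has_sum_def)
  then have "eventually (\<lambda>F. dist (sum f F) x < 1) (finite_subsets_at_top UNIV)"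
    by (rule tendstoD) simp
  then obtain F0 where F0: "finite F0" "\<And>F. finite F \<Longrightarrow> F0 \<subseteq> F \<Longrightarrow> dist (sum f F) x < 1"
    unfolding eventually_finite_subsets_at_top by auto
  \<comment> \<open>Sums over finite sets containing \<open>F0\<close> are within 1 of
    \<open>x\<close>, so terms outside \<open>F0\<close> contribute at most 2 together.\<close>
  define M where "M = 2 + (\<Sum>i\<in>F0. norm (f i))"
  have M: "norm (sum f F) \<le> M" if F: "finite F" for F
  proof -
    have "sum f (F0 \<union> F) = sum f F0 + sum f (F - F0)"
      using F F0(1) sum.union_disjoint[of F0 "F - F0" f] by simp
    then have "sum f (F - F0) = (sum f (F0 \<union> F) - x) - (sum f F0 - x)" by simp
    then have "norm (sum f (F - F0)) \<le> norm (sum f (F0 \<union> F) - x) + norm (sum f F0 - x)"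
      by (metis norm_triangle_ineq4)
    also have "\<dots> \<le> 2" using F0(2)[of "F0 \<union> F"] F0(2)[of F0] F F0(1) by (simp add: dist_norm)
    finally have 1: "norm (sum f (F - F0)) \<le> 2" .
    have "norm (sum f (F \<inter> F0)) \<le> (\<Sum>i\<in>F \<inter> F0. norm (f i))" by (rule norm_sum)
    also have "\<dots> \<le> (\<Sum>i\<in>F0. norm (f i))" using F0(1) by (intro sum_mono2) auto
    finally have 2: "norm (sum f (F \<inter> F0)) \<le> (\<Sum>i\<in>F0. norm (f i))" .
    have "sum f F = sum f (F - F0) + sum f (F \<inter> F0)"
      using F sum.Int_Diff[of F f F0] by (simp add: add.commute)
    then show ?thesis using norm_triangle_ineq[of "sum f (F - F0)" "sum f (F \<inter> F0)"] 1 2 by (simp add: M_def)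
  qed
  have pos: "norm (\<Sum>i\<in>F. r i *\<^sub>R f i) \<le> M" if "finite F" "\<And>i. 0 \<le> r i \<and> r i \<le> 1" for F r
  proof -
    have "norm (0 + (\<Sum>i\<in>F. r i *\<^sub>R f i)) \<le> M"
      by (rule norm_sum_multipliers_le[OF that(1)]) (use that(2) in \<open>auto intro: M finite_subset[OF _ that(1)]\<close>)
    then show ?thesis by simp
  qed
  have real: "norm (\<Sum>i\<in>F. r i *\<^sub>R f i) \<le> 2 * M" if "finite F" "\<And>i. \<bar>r i\<bar> \<le> 1" for F r
  proof -
    have "(\<Sum>i\<in>F. r i *\<^sub>R f i) = (\<Sum>i\<in>F. max 0 (r i) *\<^sub>R f i) - (\<Sum>i\<in>F. max 0 (- r i) *\<^sub>R f i)"
      unfolding sum_subtractf[symmetric] by (intro sum.cong refl) (auto simp: max_def scaleR_diff_left[symmetric])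
    then have "norm (\<Sum>i\<in>F. r i *\<^sub>R f i) \<le> norm (\<Sum>i\<in>F. max 0 (r i) *\<^sub>R f i) + norm (\<Sum>i\<in>F. max 0 (- r i) *\<^sub>R f i)"
      by (metis norm_triangle_ineq4)
    also have "\<dots> \<le> M + M"
    proof -
      have "r i \<le> 1" "- r i \<le> 1" for i using that(2)[of i] by (auto simp: abs_le_iff)
      then show ?thesis by (intro add_mono pos that(1)) auto
    qed
    finally show ?thesis by simp
  qed
  have "norm (multiplied F b x) \<le> real DIM('k) * (2 * M)" if Fb: "finite F" "\<And>i. norm (b i) \<le> 1" for F b
  proof -
    have "scl (b i * coord x i) (e i) = (\<Sum>\<beta>\<in>Basis. scl \<beta> ((b i \<bullet> \<beta>) *\<^sub>R f i))" for i
    proof -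
      have "b i = (\<Sum>\<beta>\<in>Basis. (b i \<bullet> \<beta>) *\<^sub>R \<beta>)" by (simp add: euclidean_representation)
      then have "scl (b i * coord x i) (e i) = scl (\<Sum>\<beta>\<in>Basis. (b i \<bullet> \<beta>) *\<^sub>R \<beta>) (f i)"
        by (simp add: f_def scale_scale)
      also have "\<dots> = (\<Sum>\<beta>\<in>Basis. scl ((b i \<bullet> \<beta>) *\<^sub>R \<beta>) (f i))" by (rule scale_sum_left)
      also have "\<dots> = (\<Sum>\<beta>\<in>Basis. scl \<beta> ((b i \<bullet> \<beta>) *\<^sub>R f i))"
        by (intro sum.cong refl) (simp add: scaleR_eq_scl scale_scale scaleR_conv_of_real mult.commute)
      finally show ?thesis .
    qed
    then have "multiplied F b x = (\<Sum>\<beta>\<in>Basis. scl \<beta> (\<Sum>i\<in>F. (b i \<bullet> \<beta>) *\<^sub>R f i))"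
      by (simp add: multiplied_def scale_sum_right sum.swap[of _ F])
    also have "norm \<dots> \<le> (\<Sum>\<beta>\<in>(Basis :: 'k set). 2 * M)"
    proof (rule sum_norm_le)
      fix \<beta> :: 'k assume \<beta>: "\<beta> \<in> Basis"
      have "norm (\<Sum>i\<in>F. (b i \<bullet> \<beta>) *\<^sub>R f i) \<le> 2 * M"
        by (rule real[OF Fb(1)]) (use Basis_le_norm[OF \<beta>] Fb(2) order_trans in blast)
      then show "norm (scl \<beta> (\<Sum>i\<in>F. (b i \<bullet> \<beta>) *\<^sub>R f i)) \<le> 2 * M" using \<beta> by (simp add: norm_scl)
    qed
    finally show ?thesis by simp
  qed
  then show ?thesis by (intro exI[of _ "real DIM('k) * (2 * M)"]) (auto simp: multipliers_def)
qed

lemma multiplied_le: "finite F \<Longrightarrow> (\<And>i. norm (b i) \<le> 1) \<Longrightarrow> norm (multiplied F b x) \<le> sup_norm x"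
  unfolding sup_norm_def
proof (rule cSUP_upper2[where x="(F, b)"])
  show "bdd_above ((\<lambda>(F, b). norm (multiplied F b x)) ` multipliers)"
    using multiplied_bounded[of x] by (auto simp: bdd_above_def)
qed (auto simp: multipliers_def)

lemma sup_norm_leI:
  assumes "\<And>F b. finite F \<Longrightarrow> (\<And>i. norm (b i) \<le> 1) \<Longrightarrow> norm (multiplied F b x) \<le> B"
  shows "sup_norm x \<le> B"
  unfolding sup_norm_def
proof (rule cSUP_least)
  have "({}, \<lambda>_. 0) \<in> multipliers" by (simp add: multipliers_def)
  then show "multipliers \<noteq> {}" by blast
qed (use assms in \<open>auto simp: multipliers_def\<close>)

lemma multiplied_add: "multiplied F b (x + y) = multiplied F b x + multiplied F b y"
  by (simp add: multiplied_def coord_add distrib_left scale_left_distrib sum.distrib)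

lemma multiplied_scl: "multiplied F b (scl k x) = scl k (multiplied F b x)"
  by (simp add: multiplied_def coord_scl scale_sum_right scale_scale mult.left_commute)

lemma sup_norm_nonneg: "0 \<le> sup_norm x"
  using multiplied_le[of "{}" "\<lambda>_. 0" x] by (simp add: multiplied_def)

lemma sup_norm_add: "sup_norm (x + y) \<le> sup_norm x + sup_norm y"
  by (rule sup_norm_leI)
    (auto simp: multiplied_add intro: order_trans[OF norm_triangle_ineq] add_mono multiplied_le)

lemma sup_norm_scl_le: "sup_norm (scl k x) \<le> norm k * sup_norm x"
  by (rule sup_norm_leI) (simp add: multiplied_scl norm_scl mult_left_mono multiplied_le)

lemma sup_norm_scl: "sup_norm (scl k x) = norm k * sup_norm x"
proof (cases "k = 0")
  case True
  then show ?thesis using sup_norm_scl_le[of k x] sup_norm_nonneg[of "scl k x"] by simp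
next
  case False
  have "sup_norm (scl (inverse k) (scl k x)) \<le> norm (inverse k) * sup_norm (scl k x)" by (rule sup_norm_scl_le)
  then have "sup_norm x \<le> norm (inverse k) * sup_norm (scl k x)" using False by (simp add: scale_scale)
  then have "norm k * sup_norm x \<le> norm k * (norm (inverse k) * sup_norm (scl k x))"
    by (rule mult_left_mono) simp
  also have "\<dots> = norm (k * inverse k) * sup_norm (scl k x)" by (simp only: norm_mult mult.assoc)
  finally have "norm k * sup_norm x \<le> sup_norm (scl k x)" using False by simp
  then show ?thesis using sup_norm_scl_le[of k x] by simp
qed

lemma sup_norm_diff: "sup_norm (x - y) \<le> sup_norm x + sup_norm y"
  using sup_norm_add[of x "scl (-1) y"] sup_norm_scl[of "-1" y] by (simp add: scale_minus_left)

text \<open>The quotient of the coordinates, times the given multiplier, is again a multiplier of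
  modulus at most 1. Where \<open>coord y i = 0\<close> also \<open>coord x i = 0\<close>, and the
  value 0 of the division fits.\<close>

lemma sup_norm_mono:
  assumes "\<And>i. norm (coord x i) \<le> norm (coord y i)"
  shows "sup_norm x \<le> sup_norm y"
proof (rule sup_norm_leI)
  fix F :: "nat set" and b :: "nat \<Rightarrow> 'k" assume F: "finite F" and b: "\<And>i. norm (b i) \<le> 1"
  define b' where "b' = (\<lambda>i. b i * coord x i / coord y i)"
  have "b i * coord x i = b' i * coord y i" for i
    using assms[of i] by (cases "coord y i = 0") (auto simp: b'_def)
  then have "multiplied F b x = multiplied F b' y" by (simp add: multiplied_def)
  moreover have "norm (b' i) \<le> 1" for i
  proof -
    have "norm (b i) * norm (coord x i) \<le> 1 * norm (coord y i)"
      using assms b by (intro mult_mono) auto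
    then show ?thesis by (cases "coord y i = 0") (auto simp: b'_def norm_mult norm_divide pos_divide_le_eq)
  qed
  ultimately show "norm (multiplied F b x) \<le> sup_norm y" using multiplied_le[OF F] by simp
qed

definition partial :: "nat \<Rightarrow> 'a \<Rightarrow> 'a" where
  "partial n x = (\<Sum>i<n. scl (coord x i) (e i))"

lemma partial_tendsto: "(\<lambda>n. partial n x) \<longlonglongrightarrow> x"
  using coord_sums[of x] by (simp add: sums_def partial_def)

lemma partial_le: "norm (partial n x) \<le> sup_norm x"
  using multiplied_le[of "{..<n}" "\<lambda>_. 1" x] by (simp add: multiplied_def partial_def)

lemma norm_le_sup_norm: "norm x \<le> sup_norm x"
  by (rule LIMSEQ_le_const2[OF tendsto_norm[OF partial_tendsto]]) (auto intro: partial_le)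

lemma basis_nonzero: "e n \<noteq> 0"
proof
  assume "e n = 0"
  then have "(\<lambda>i. scl (if i = n then 1 else 0) (e i)) sums 0"
    by (intro sums_zero[THEN back_subst[of "\<lambda>f. f sums 0"]]) (auto simp: scale_zero_left)
  from fun_cong[OF coord_unique[OF this], of n] show False by (simp add: coord_zero)
qed

text \<open>Neither \<open>sup_norm\<close> nor the coordinate functionals are known to be
  continuous here, so the open mapping argument is carried out by hand. Iterated approximation
  writes \<open>x\<close> as a series of vectors \<open>u k\<close> with geometrically decreasing
  \<open>sup_norm\<close>; the point is that the coordinates of \<open>x\<close> are the sums of the
  coordinates of the \<open>u k\<close>, which allows \<open>sup_norm\<close> to be summed along the
  series.\<close>

theorem sup_norm_equivalent:
  obtains K where "1 \<le> K" "\<And>x. sup_norm x \<le> K * norm x"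
proof -
  have scaleR: "sup_norm (r *\<^sub>R x) \<le> \<bar>r\<bar> * sup_norm x" for r x
    using sup_norm_scl_le[of "of_real r" x] by (simp add: scaleR_eq_scl)
  obtain L where L: "0 < L" "\<And>y. \<exists>u. sup_norm u \<le> L * norm y \<and> norm (y - u) \<le> norm y / 2"
    using approximation_of_sublinear[of sup_norm, OF sup_norm_nonneg sup_norm_diff scaleR] by blast
  then obtain g where g: "\<And>y. sup_norm (g y) \<le> L * norm y" "\<And>y. norm (y - g y) \<le> norm y / 2" by metis
  have "sup_norm x \<le> 2 * L * norm x" for x
  proof -
    define y where "y = rec_nat x (\<lambda>_ z. z - g z)"
    define u where "u = (\<lambda>k. g (y k))"
    have y: "y 0 = x" "\<And>k. y (Suc k) = y k - u k" by (simp_all add: y_def u_def)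
    have ny: "norm (y k) \<le> norm x * (1 / 2) ^ k" for k
    proof (induction k)
      case (Suc k)
      then show ?case using g(2)[of "y k"] by (simp add: y u_def)
    qed (simp add: y)
    define M where "M = (\<lambda>k. L * norm x * (1 / 2) ^ k)"
    have uM: "sup_norm (u k) \<le> M k" for k
    proof -
      have "L * norm (y k) \<le> L * (norm x * (1 / 2) ^ k)" using ny L(1) by (intro mult_left_mono) auto
      then show ?thesis using g(1)[of "y k"] by (simp add: u_def M_def mult.assoc)
    qed
    have M: "M sums (2 * L * norm x)"
      using sums_mult[OF geometric_sums[of "1 / 2 :: real"], of "L * norm x"] by (simp add: M_def mult_ac)
    have sumM: "summable M" by (rule sums_summable[OF M])
    have part: "(\<Sum>k<n. u k) = x - y n" for n by (induction n) (simp_all add: y)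
    have "y \<longlonglongrightarrow> 0"
      by (rule Lim_null_comparison[where g="\<lambda>k. norm x * (1 / 2) ^ k"])
        (use ny in \<open>auto intro!: tendsto_mult_right_zero LIMSEQ_power_zero\<close>)
    then have ux: "u sums x" unfolding sums_def part using tendsto_diff[OF tendsto_const[of x], of y 0] by simp
    have cu: "norm (coord (u k) i) * norm (e i) \<le> M k" for k i
      using multiplied_le[of "{i}" "\<lambda>_. 1" "u k"] uM[of k] by (simp add: multiplied_def norm_scl)
    have sumc: "summable (\<lambda>k. coord (u k) i)" for i
    proof (rule summable_comparison_test[where g="\<lambda>k. M k / norm (e i)"])
      show "\<exists>N. \<forall>k\<ge>N. norm (coord (u k) i) \<le> M k / norm (e i)"
        using cu basis_nonzero[of i] by (auto simp: pos_le_divide_eq)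
    qed (intro summable_divide sumM)
    define \<gamma> where "\<gamma> = (\<lambda>i. \<Sum>k. coord (u k) i)"
    have scl_sums: "(\<lambda>k. scl (b * coord (u k) i) (e i)) sums scl (b * \<gamma> i) (e i)" for b i
    proof -
      have "bounded_linear (\<lambda>k. scl k v)" for v
      proof
        show "scl (a + b) v = scl a v + scl b v" for a b by (rule scale_left_distrib)
        show "scl (r *\<^sub>R a) v = r *\<^sub>R scl a v" for r a
          by (simp add: scaleR_eq_scl scale_scale scaleR_conv_of_real)
        show "\<exists>K. \<forall>x. norm (scl x v) \<le> norm x * K" by (intro exI[of _ "norm v"]) (simp add: norm_scl)
      qed
      from bounded_linear.sums[OF this sums_mult[OF summable_sums[OF sumc[of i]], of b]]
      show ?thesis by (simp add: \<gamma>_def)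
    qed
    have mult_sums: "(\<lambda>k. multiplied F b (u k)) sums (\<Sum>i\<in>F. scl (b i * \<gamma> i) (e i))" for F b
      unfolding multiplied_def by (intro sums_sum scl_sums)
    \<comment> \<open>For fixed \<open>k\<close> the error of the partial expansion of
      \<open>u k\<close> tends to 0, and it is at most \<open>2 * M k\<close> throughout, so
      Tannery's theorem permits summation over \<open>k\<close>. Uniqueness of expansions then
      identifies \<open>\<gamma>\<close> with \<open>coord x\<close>.\<close>
    have "(\<lambda>m. \<Sum>i<m. scl (\<gamma> i) (e i)) \<longlonglongrightarrow> x"
    proof -
      define a where "a = (\<lambda>k m. norm (partial m (u k) - u k))"
      have aM: "norm (a k m) \<le> 2 * M k" for k m
      proof -
        have "norm (partial m (u k) - u k) \<le> norm (partial m (u k)) + norm (u k)" by (rule norm_triangle_ineq4)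
        also have "\<dots> \<le> 2 * M k" using partial_le[of m "u k"] norm_le_sup_norm[of "u k"] uM[of k] by simp
        finally show ?thesis by (simp add: a_def)
      qed
      have a0: "(\<lambda>m. a k m) \<longlonglongrightarrow> 0" for k
        unfolding a_def using tendsto_norm[OF tendsto_diff[OF partial_tendsto[of "u k"] tendsto_const[of "u k"]]] by simp
      have ev: "eventually (\<lambda>(k, n). norm (a k n) \<le> 2 * M k) (at_top \<times>\<^sub>F sequentially)"
        by (rule always_eventually) (use aM in auto)
      have "(\<lambda>m. \<Sum>k. a k m) \<longlonglongrightarrow> (\<Sum>k. 0)"
        using tannerys_theorem[OF a0 ev summable_mult[OF sumM] sequentially_bot] by blast
      then have lim: "(\<lambda>m. \<Sum>k. a k m) \<longlonglongrightarrow> 0" by simp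
      have "norm ((\<Sum>i<m. scl (\<gamma> i) (e i)) - x) \<le> (\<Sum>k. a k m)" for m
      proof -
        have "(\<lambda>k. partial m (u k)) sums (\<Sum>i<m. scl (\<gamma> i) (e i))"
          using mult_sums[of "{..<m}" "\<lambda>_. 1"] by (simp add: multiplied_def partial_def)
        from sums_diff[OF this ux]
        have eq: "(\<Sum>i<m. scl (\<gamma> i) (e i)) - x = (\<Sum>k. partial m (u k) - u k)" by (simp add: sums_iff)
        have "summable (\<lambda>k. norm (partial m (u k) - u k))"
          by (rule summable_comparison_test[where g="\<lambda>k. 2 * M k"])
            (use aM[of _ m] in \<open>auto simp: a_def intro!: summable_mult sumM\<close>)
        from summable_norm[OF this] show ?thesis unfolding eq a_def .
      qed
      then have "(\<lambda>m. (\<Sum>i<m. scl (\<gamma> i) (e i)) - x) \<longlonglongrightarrow> 0"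
        by (intro Lim_null_comparison[OF _ lim]) auto
      then show ?thesis by (simp add: LIM_zero_iff)
    qed
    then have "coord x = \<gamma>" by (intro coord_unique) (simp add: sums_def)
    show ?thesis
    proof (rule sup_norm_leI)
      fix F :: "nat set" and b :: "nat \<Rightarrow> 'k" assume F: "finite F" "\<And>i. norm (b i) \<le> 1"
      have le: "norm (multiplied F b (u k)) \<le> M k" for k
        using multiplied_le[where F=F and b=b and x="u k"] F uM[of k] by simp
      have sn: "summable (\<lambda>k. norm (multiplied F b (u k)))"
        by (rule summable_comparison_test[OF _ sumM]) (use le in auto)
      have "multiplied F b x = (\<Sum>k. multiplied F b (u k))"
        using mult_sums[of F b] by (simp add: sums_iff multiplied_def \<open>coord x = \<gamma>\<close>)
      also have "norm \<dots> \<le> (\<Sum>k. norm (multiplied F b (u k)))" by (rule summable_norm[OF sn])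
      also have "\<dots> \<le> (\<Sum>k. M k)" by (rule suminf_le[OF le sn sumM])
      also have "\<dots> = 2 * L * norm x" using M by (simp add: sums_iff)
      finally show "norm (multiplied F b x) \<le> 2 * L * norm x" .
    qed
  qed
  then have "sup_norm x \<le> (2 * L + 1) * norm x" for x
    by (simp add: distrib_right add_increasing2)
  then show ?thesis using L(1) by (intro that[of "2 * L + 1"]) auto
qed

end

section \<open>Exclusion of disjoint l_1^n and l_infinity^n in the lattice norm\<close>

lemma finite_half_net:
  obtains S :: "'k::{real_normed_field,euclidean_space} set"
  where "finite S" "\<And>s. s \<in> S \<Longrightarrow> norm s = 1" "\<And>t. norm t = 1 \<Longrightarrow> \<exists>s\<in>S. norm (t - s) \<le> 1 / 2"
proof -
  have "\<exists>k. finite k \<and> k \<subseteq> sphere (0::'k) 1 \<and> sphere 0 1 \<subseteq> (\<Union>x\<in>k. ball x (1 / 2))"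
    using compact_sphere[of "0::'k" 1, THEN compact_imp_seq_compact, THEN seq_compact_imp_totally_bounded]
    by (auto dest: spec[of _ "1 / 2 :: real"])
  then obtain S where S: "finite S" "S \<subseteq> sphere (0::'k) 1" "sphere 0 1 \<subseteq> (\<Union>x\<in>S. ball x (1 / 2))" by blast
  show ?thesis
  proof (rule that[OF S(1)])
    show "norm s = 1" if "s \<in> S" for s using that S(2) by auto
    show "\<exists>s\<in>S. norm (t - s) \<le> 1 / 2" if "norm t = 1" for t
    proof -
      have "t \<in> sphere 0 1" using that by simp
      then obtain s where "s \<in> S" "t \<in> ball s (1 / 2)" using S(3) by blast
      then show ?thesis by (intro bexI[of _ s]) (auto simp: dist_norm norm_minus_commute)
    qed
  qed
qed

context banach_space_over
begin

lemma contains_l1n_uniformlyI: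
  assumes d: "0 < d" "d \<le> D"
    and X: "\<And>n. 1 \<le> n \<Longrightarrow> \<exists>X :: nat \<Rightarrow> 'a. \<forall>c.
      d * (\<Sum>i<n. norm (c i)) \<le> norm (\<Sum>i<n. scl (c i) (X i)) \<and>
      norm (\<Sum>i<n. scl (c i) (X i)) \<le> D * (\<Sum>i<n. norm (c i))"
  shows "contains_l1n_uniformly scl"
  unfolding contains_l1n_uniformly_def
proof (intro exI[of _ "D / d"] allI impI)
  fix n :: nat assume "1 \<le> n"
  then obtain X :: "nat \<Rightarrow> 'a" where X: "\<And>c. d * (\<Sum>i<n. norm (c i)) \<le> norm (\<Sum>i<n. scl (c i) (X i)) \<and>
      norm (\<Sum>i<n. scl (c i) (X i)) \<le> D * (\<Sum>i<n. norm (c i))"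
    using X by blast
  have shift: "(\<Sum>i=1..n. f i) = (\<Sum>i<n. f (Suc i))" for f :: "nat \<Rightarrow> 'x::comm_monoid_add"
    by (simp add: sum.atLeast1_atMost_eq)
  show "\<exists>x d' D'. 0 < d' \<and> d' \<le> D' \<and> D' / d' \<le> D / d \<and> (\<forall>c.
      d' * (\<Sum>i=1..n. norm (c i)) \<le> norm (\<Sum>i=1..n. scl (c i) (x i)) \<and>
      norm (\<Sum>i=1..n. scl (c i) (x i)) \<le> D' * (\<Sum>i=1..n. norm (c i)))"
    unfolding shift
    by (rule exI[of _ "\<lambda>i. X (i - 1)"], rule exI[of _ d], rule exI[of _ D]) (use d X[of "\<lambda>i. _ (Suc i)"] in auto)
qed

end

context unconditional_space
begin

definition embed :: "(nat \<Rightarrow> real) \<Rightarrow> 'a" where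
  "embed f = (\<Sum>i\<in>supp f. scl (of_real (f i)) (e i))"

definition modulus :: "'a \<Rightarrow> nat \<Rightarrow> real" where
  "modulus x = (\<lambda>n. norm (coord x n))"

definition basis_norm :: "(nat \<Rightarrow> real) \<Rightarrow> real" where
  "basis_norm f = sup_norm (embed f)"

lemma coord_embed: "f \<in> c00_pos \<Longrightarrow> coord (embed f) = (\<lambda>n. of_real (f n))"
  unfolding embed_def by (subst coord_finite_sum) (auto simp: c00_pos_def supp_def)

lemma modulus_embed: "f \<in> c00_pos \<Longrightarrow> modulus (embed f) = f"
  by (auto simp: modulus_def coord_embed c00_pos_nonneg)

lemma modulus_scl: "modulus (scl k x) = (\<lambda>n. norm k * modulus x n)"
  by (simp add: modulus_def coord_scl norm_mult)

lemma basis_norm_modulus: "modulus x \<in> c00_pos \<Longrightarrow> basis_norm (modulus x) = sup_norm x"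
  unfolding basis_norm_def
  by (rule antisym; rule sup_norm_mono) (simp_all add: coord_embed, simp_all add: modulus_def)

lemma vec_add: "f \<in> c00_pos \<Longrightarrow> g \<in> c00_pos \<Longrightarrow> embed (\<lambda>i. f i + g i) = embed f + embed g"
  by (rule eq_if_coord_eq) (simp add: coord_embed coord_add c00_pos_add)

lemma vec_scale: "f \<in> c00_pos \<Longrightarrow> 0 \<le> c \<Longrightarrow> embed (\<lambda>i. c * f i) = scl (of_real c) (embed f)"
  by (rule eq_if_coord_eq) (simp add: coord_embed coord_scl c00_pos_scale)

lemma lattice_norm_basis_norm: "lattice_norm basis_norm"
proof
  fix f g :: "nat \<Rightarrow> real" and c :: real
  assume f: "f \<in> c00_pos"
  show "0 \<le> basis_norm f" by (simp add: basis_norm_def sup_norm_nonneg)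
  show "f = (\<lambda>i. 0)" if "basis_norm f = 0"
  proof -
    have "embed f = 0" using norm_le_sup_norm[of "embed f"] that by (simp add: basis_norm_def)
    then show ?thesis using coord_embed[OF f] by (simp add: coord_zero fun_eq_iff)
  qed
  show "basis_norm (\<lambda>i. c * f i) = c * basis_norm f" if "0 \<le> c"
    using that f by (simp add: basis_norm_def vec_scale sup_norm_scl)
  assume g: "g \<in> c00_pos"
  show "basis_norm (\<lambda>i. f i + g i) \<le> basis_norm f + basis_norm g"
    using f g by (simp add: basis_norm_def vec_add sup_norm_add)
  show "basis_norm f \<le> basis_norm g" if "\<And>i. f i \<le> g i"
    unfolding basis_norm_def using f g that by (intro sup_norm_mono) (simp add: coord_embed c00_pos_nonneg)
qed

lemma modulus_sum_disjoint:
  assumes J: "finite J" and dis: "disjoint_family_on (\<lambda>j. supp (modulus (x j))) J"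
  shows "modulus (\<Sum>j\<in>J. scl (d j) (x j)) = (\<lambda>k. \<Sum>j\<in>J. norm (d j) * modulus (x j) k)"
proof
  fix k
  have c: "coord (\<Sum>j\<in>J. scl (d j) (x j)) k = (\<Sum>j\<in>J. d j * coord (x j) k)"
    by (simp add: coord_sum coord_scl)
  show "modulus (\<Sum>j\<in>J. scl (d j) (x j)) k = (\<Sum>j\<in>J. norm (d j) * modulus (x j) k)"
  proof (cases "\<exists>i\<in>J. coord (x i) k \<noteq> 0")
    case True
    then obtain i where i: "i \<in> J" "coord (x i) k \<noteq> 0" by blast
    have z: "coord (x j) k = 0" if "j \<in> J" "j \<noteq> i" for j
      using disjoint_family_onD[OF dis i(1) that(1)] that i(2) by (auto simp: supp_def modulus_def)
    have "(\<Sum>j\<in>J. d j * coord (x j) k) = (\<Sum>j\<in>{i}. d j * coord (x j) k)"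
      using i J z by (intro sum.mono_neutral_right) auto
    moreover have "(\<Sum>j\<in>J. norm (d j) * modulus (x j) k) = (\<Sum>j\<in>{i}. norm (d j) * modulus (x j) k)"
      using i J z by (intro sum.mono_neutral_right) (auto simp: modulus_def)
    ultimately show ?thesis unfolding modulus_def c by (simp add: norm_mult)
  next
    case False
    then have "(\<Sum>j\<in>J. d j * coord (x j) k) = 0" "(\<Sum>j\<in>J. norm (d j) * modulus (x j) k) = 0"
      by (auto simp: modulus_def intro!: sum.neutral)
    then show ?thesis unfolding modulus_def c by simp
  qed
qed

lemma sup_norm_sum_disjoint:
  assumes J: "finite J" and x: "\<And>j. j \<in> J \<Longrightarrow> x j \<in> c00_pos" and dis: "disjoint_family_on (\<lambda>j. supp (x j)) J"
  shows "sup_norm (\<Sum>j\<in>J. scl (d j) (embed (x j))) = basis_norm (\<lambda>k. \<Sum>j\<in>J. norm (d j) * x j k)"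
proof -
  have m: "modulus (embed (x j)) = x j" if "j \<in> J" for j using modulus_embed x that by blast
  have "disjoint_family_on (\<lambda>j. supp (modulus (embed (x j)))) J"
    using dis by (simp add: disjoint_family_on_def m)
  from modulus_sum_disjoint[OF J this, of d]
  have eq: "modulus (\<Sum>j\<in>J. scl (d j) (embed (x j))) = (\<lambda>k. \<Sum>j\<in>J. norm (d j) * x j k)"
    by (simp add: m cong: sum.cong)
  have "(\<lambda>k. \<Sum>j\<in>J. norm (d j) * x j k) \<in> c00_pos"
    using J x by (intro c00_pos_sum c00_pos_scale) auto
  then show ?thesis using basis_norm_modulus[of "\<Sum>j\<in>J. scl (d j) (embed (x j))"] eq by simp
qed

text \<open>The \<open>sup_norm\<close> of a combination of disjoint vectors depends only on the
  moduli of the coefficients, so a lower \<open>l_1\<close> estimate for nonnegative coefficients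
  holds for all scalars. The upper constant is enlarged from 1 to \<open>1 + \<eta> / K\<close> only
  to exceed the lower one.\<close>

lemma no_l1_basis_norm:
  assumes "\<not> contains_l1n_uniformly scl" shows "no_l1 basis_norm"
proof (rule ccontr)
  interpret R: lattice_norm basis_norm by (rule lattice_norm_basis_norm)
  obtain K where K: "1 \<le> K" "\<And>x. sup_norm x \<le> K * norm x" using sup_norm_equivalent by blast
  assume "\<not> no_l1 basis_norm"
  then obtain \<eta> where \<eta>: "\<eta> > 0" and bad: "\<And>n::nat. \<exists>x. (\<forall>i<n. x i \<in> c00_pos \<and> basis_norm (x i) \<le> 1) \<and>
     disjoint_family_on (\<lambda>i. supp (x i)) {..<n} \<and>
     (\<forall>c. (\<forall>i<n. 0 \<le> c i) \<longrightarrow> \<eta> * (\<Sum>i<n. c i) \<le> basis_norm (\<lambda>k. \<Sum>i<n. c i * x i k))"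
    unfolding no_l1_def by (auto simp: not_less) (meson not_le)
  have "contains_l1n_uniformly scl"
  proof (rule contains_l1n_uniformlyI[of "\<eta> / K" "1 + \<eta> / K"])
    show "0 < \<eta> / K" "\<eta> / K \<le> 1 + \<eta> / K" using \<eta> K by auto
    fix n :: nat assume "1 \<le> n"
    obtain x where x: "\<And>i. i < n \<Longrightarrow> x i \<in> c00_pos" "\<And>i. i < n \<Longrightarrow> basis_norm (x i) \<le> 1"
      "disjoint_family_on (\<lambda>i. supp (x i)) {..<n}"
      "\<And>c. (\<And>i. i < n \<Longrightarrow> 0 \<le> c i) \<Longrightarrow> \<eta> * (\<Sum>i<n. c i) \<le> basis_norm (\<lambda>k. \<Sum>i<n. c i * x i k)"
      using bad[of n] by blast
    show "\<exists>X. \<forall>c. \<eta> / K * (\<Sum>i<n. norm (c i)) \<le> norm (\<Sum>i<n. scl (c i) (X i)) \<and>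
      norm (\<Sum>i<n. scl (c i) (X i)) \<le> (1 + \<eta> / K) * (\<Sum>i<n. norm (c i))"
    proof (intro exI[of _ "\<lambda>i. embed (x i)"] allI conjI)
      fix c :: "nat \<Rightarrow> 'k"
      have "\<eta> * (\<Sum>i<n. norm (c i)) \<le> basis_norm (\<lambda>k. \<Sum>i<n. norm (c i) * x i k)" by (rule x(4)) simp
      also have "\<dots> = sup_norm (\<Sum>i<n. scl (c i) (embed (x i)))"
        by (rule sup_norm_sum_disjoint[symmetric]) (use x in auto)
      also have "\<dots> \<le> K * norm (\<Sum>i<n. scl (c i) (embed (x i)))" by (rule K)
      finally show "\<eta> / K * (\<Sum>i<n. norm (c i)) \<le> norm (\<Sum>i<n. scl (c i) (embed (x i)))"
        using K(1) by (simp add: field_simps)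
      have "norm (\<Sum>i<n. scl (c i) (embed (x i))) \<le> (\<Sum>i<n. norm (c i))"
      proof (rule sum_norm_le)
        fix i assume "i \<in> {..<n}"
        then have "norm (embed (x i)) \<le> 1" using norm_le_sup_norm[of "embed (x i)"] x(2)[of i] by (simp add: basis_norm_def)
        then show "norm (scl (c i) (embed (x i))) \<le> norm (c i)" by (simp add: norm_scl mult_left_le)
      qed
      also have "\<dots> \<le> (1 + \<eta> / K) * (\<Sum>i<n. norm (c i))"
        using \<eta> K mult_right_mono[of 1 "1 + \<eta> / K" "\<Sum>i<n. norm (c i)"] by (simp add: sum_nonneg)
      finally show "norm (\<Sum>i<n. scl (c i) (embed (x i))) \<le> (1 + \<eta> / K) * (\<Sum>i<n. norm (c i))" .
    qed
  qed
  then show False using assms by simp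
qed

text \<open>A copy of \<open>\<ell>\<^sub>\<infinity>\<^sup>N\<close> contains the span of \<open>n\<close> vectors with unimodular coordinates running through all
  \<open>n\<close>-tuples of a finite net of the unit sphere of the scalar field, which is a copy of \<open>\<ell>\<^sub>1\<^sup>n\<close>.\<close>

lemma no_linf_basis_norm:
  assumes "\<not> contains_l1n_uniformly scl" shows "no_linf basis_norm"
proof (rule ccontr)
  interpret R: lattice_norm basis_norm by (rule lattice_norm_basis_norm)
  obtain K where K: "1 \<le> K" "\<And>x. sup_norm x \<le> K * norm x" using sup_norm_equivalent by blast
  obtain S :: "'k set" where S: "finite S" "\<And>s. s \<in> S \<Longrightarrow> norm s = 1"
    "\<And>t. norm t = 1 \<Longrightarrow> \<exists>s\<in>S. norm (t - s) \<le> 1 / 2" using finite_half_net by blast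
  assume "\<not> no_linf basis_norm"
  then obtain \<eta> where \<eta>: "\<eta> > 0" and bad: "\<And>n::nat. \<exists>x. (\<forall>i<n. x i \<in> c00_pos \<and> \<eta> \<le> basis_norm (x i)) \<and>
     disjoint_family_on (\<lambda>i. supp (x i)) {..<n} \<and> basis_norm (\<lambda>k. \<Sum>i<n. x i k) \<le> 1"
    unfolding no_linf_def by (auto simp: not_less)
  define d where "d = \<eta> / (2 * K)"
  have d: "0 < d" using \<eta> K by (simp add: d_def)
  have "contains_l1n_uniformly scl"
  proof (rule contains_l1n_uniformlyI[of d "1 + d"])
    show "0 < d" "d \<le> 1 + d" using d by auto
    fix n :: nat assume "1 \<le> n"
    \<comment> \<open>One disjoint vector is needed for each \<open>n\<close>-tuple of net points,
      so the copy of \<open>l_infinity\<close> must have dimension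
      \<open>card \<Phi>\<close>.\<close>
    define \<Phi> where "\<Phi> = PiE {..<n} (\<lambda>_. S)"
    have "finite \<Phi>" unfolding \<Phi>_def by (intro finite_PiE S) auto
    then obtain \<phi> where \<phi>: "bij_betw \<phi> {..<card \<Phi>} \<Phi>"
      using ex_bij_betw_nat_finite by (metis atLeast0LessThan)
    define N where "N = card \<Phi>"
    obtain x where x: "\<And>j. j < N \<Longrightarrow> x j \<in> c00_pos" "\<And>j. j < N \<Longrightarrow> \<eta> \<le> basis_norm (x j)"
      "disjoint_family_on (\<lambda>j. supp (x j)) {..<N}" "basis_norm (\<lambda>k. \<Sum>j<N. x j k) \<le> 1"
      using bad[of N] by blast
    have \<phi>S: "\<phi> j i \<in> S" if "j < N" "i < n" for i j
      using \<phi> that by (auto simp: bij_betw_def N_def \<Phi>_def PiE_def Pi_def)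
    show "\<exists>X. \<forall>c. d * (\<Sum>i<n. norm (c i)) \<le> norm (\<Sum>i<n. scl (c i) (X i)) \<and>
      norm (\<Sum>i<n. scl (c i) (X i)) \<le> (1 + d) * (\<Sum>i<n. norm (c i))"
    proof (intro exI[of _ "\<lambda>i. \<Sum>j<N. scl (\<phi> j i) (embed (x j))"] allI)
      fix c :: "nat \<Rightarrow> 'k"
      define \<sigma> where "\<sigma> = (\<Sum>i<n. norm (c i))"
      have \<sigma>0: "0 \<le> \<sigma>" by (simp add: \<sigma>_def sum_nonneg)
      define b where "b = (\<lambda>j. \<Sum>i<n. c i * \<phi> j i)"
      define V where "V = (\<Sum>i<n. scl (c i) (\<Sum>j<N. scl (\<phi> j i) (embed (x j))))"
      have "V = (\<Sum>j<N. \<Sum>i<n. scl (c i * \<phi> j i) (embed (x j)))"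
        unfolding V_def by (subst sum.swap) (simp add: scale_sum_right scale_scale)
      also have "\<dots> = (\<Sum>j<N. scl (b j) (embed (x j)))" by (simp add: b_def scale_sum_left)
      finally have Veq: "sup_norm V = basis_norm (\<lambda>k. \<Sum>j<N. norm (b j) * x j k)"
        using sup_norm_sum_disjoint[of "{..<N}" x b] x by simp
      have b1: "norm (b j) \<le> \<sigma>" if "j < N" for j
        unfolding b_def \<sigma>_def using \<phi>S[OF that] S(2) by (intro sum_norm_le) (simp add: norm_mult)
      have "norm V \<le> sup_norm V" by (rule norm_le_sup_norm)
      also have "\<dots> \<le> basis_norm (\<lambda>k. \<sigma> * (\<Sum>j<N. x j k))" unfolding Veq sum_distrib_left
        using x(1) b1 \<sigma>0 by (intro R.mono c00_pos_sum c00_pos_scale sum_mono mult_right_mono) (auto simp: c00_pos_nonneg)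
      also have "\<dots> = \<sigma> * basis_norm (\<lambda>k. \<Sum>j<N. x j k)"
        using x(1) \<sigma>0 by (intro R.scale c00_pos_sum) auto
      also have "\<dots> \<le> \<sigma>" using x(4) \<sigma>0 by (simp add: mult_left_le)
      also have "\<dots> \<le> (1 + d) * \<sigma>" using \<sigma>0 d mult_right_mono[of 1 "1 + d" \<sigma>] by simp
      finally have up: "norm V \<le> (1 + d) * \<sigma>" .
      have "\<forall>i. \<exists>s\<in>S. norm (c i) / 2 \<le> norm (c i) - norm (c i * s - of_real (norm (c i)))"
      proof
        fix i
        \<comment> \<open>The unimodular scalar that rotates \<open>c i\<close> to its modulus; a
          net point within 1/2 of it loses at most half of that modulus.\<close>
        define t where "t = (if c i = 0 then 1 else of_real (norm (c i)) / c i)"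
        have t: "norm t = 1" "c i * t = of_real (norm (c i))" by (auto simp: t_def norm_divide)
        obtain s where s: "s \<in> S" "norm (t - s) \<le> 1 / 2" using S(3)[OF t(1)] by blast
        have "c i * s - of_real (norm (c i)) = - (c i * (t - s))" by (simp add: t(2)[symmetric] right_diff_distrib)
        then have "norm (c i * s - of_real (norm (c i))) = norm (c i) * norm (t - s)" by (simp add: norm_mult)
        also have "\<dots> \<le> norm (c i) * (1 / 2)" using s by (intro mult_left_mono) auto
        finally show "\<exists>s\<in>S. norm (c i) / 2 \<le> norm (c i) - norm (c i * s - of_real (norm (c i)))" using s by auto
      qed
      then obtain s where s: "\<And>i. s i \<in> S" "\<And>i. norm (c i) / 2 \<le> norm (c i) - norm (c i * s i - of_real (norm (c i)))" by metis
      have "restrict s {..<n} \<in> \<Phi>" using s(1) by (auto simp: \<Phi>_def)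
      then have "restrict s {..<n} \<in> \<phi> ` {..<N}" using bij_betw_imp_surj_on[OF \<phi>] by (simp add: N_def)
      then obtain j where j: "j < N" "\<phi> j = restrict s {..<n}" by auto
      have "b j = of_real \<sigma> + (\<Sum>i<n. c i * s i - of_real (norm (c i)))"
        by (simp add: b_def j(2) \<sigma>_def sum_subtractf)
      then have "norm (of_real \<sigma> :: 'k) \<le> norm (b j) + norm (\<Sum>i<n. c i * s i - of_real (norm (c i)))"
        by (metis add_diff_cancel norm_triangle_ineq4)
      also have "norm (\<Sum>i<n. c i * s i - of_real (norm (c i))) \<le> (\<Sum>i<n. norm (c i) / 2)"
        using s(2) by (intro sum_norm_le) (smt (verit) field_sum_of_halves)
      also have "\<dots> = \<sigma> / 2" by (simp add: \<sigma>_def sum_divide_distrib)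
      finally have bj: "\<sigma> / 2 \<le> norm (b j)" using \<sigma>0 by simp
      have "\<sigma> / 2 * \<eta> \<le> norm (b j) * basis_norm (x j)"
        using bj x(2)[OF j(1)] \<eta> \<sigma>0 by (intro mult_mono) auto
      also have "\<dots> = basis_norm (\<lambda>k. norm (b j) * x j k)" using x(1)[OF j(1)] by (simp add: R.scale)
      also have "\<dots> \<le> basis_norm (\<lambda>k. \<Sum>j<N. norm (b j) * x j k)"
      proof (rule R.mono)
        fix k
        show "norm (b j) * x j k \<le> (\<Sum>j<N. norm (b j) * x j k)"
          using j x(1) by (intro member_le_sum) (auto simp: c00_pos_nonneg)
      qed (use x(1) j in \<open>auto intro!: c00_pos_sum c00_pos_scale\<close>)
      also have "\<dots> \<le> K * norm V" unfolding Veq[symmetric] by (rule K)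
      finally have "d * \<sigma> \<le> norm V" using K(1) by (simp add: d_def field_simps)
      then show "d * (\<Sum>i<n. norm (c i)) \<le> norm (\<Sum>i<n. scl (c i) (\<Sum>j<N. scl (\<phi> j i) (embed (x j)))) \<and>
        norm (\<Sum>i<n. scl (c i) (\<Sum>j<N. scl (\<phi> j i) (embed (x j)))) \<le> (1 + d) * (\<Sum>i<n. norm (c i))"
        using up by (simp add: V_def \<sigma>_def)
    qed
  qed
  then show False using assms by simp
qed

end

section \<open>Infinite dimensional subspaces and distortion of the closed span of a block
  sequence\<close>

lemma block_unit: "block unit"
  by (rule blockI) (auto simp: c00_pos_unit, auto simp: supp_def unit_def split: if_splits)

context banach_space_over
begin

text \<open>The kernel has codimension at most 1 in \<open>Y\<close>: a finite spanning set of it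
  and one vector off the kernel would span \<open>Y\<close>.\<close>

lemma infinite_dimensional_kernel:
  assumes Y: "subspace Y" "infinite_dimensional scl Y"
    and add: "\<And>x y. \<phi> (x - y) = \<phi> x - (\<phi> y :: 'k)" and scl: "\<And>k x. \<phi> (scl k x) = k * \<phi> x"
  shows "infinite_dimensional scl {y \<in> Y. \<phi> y = 0}"
  unfolding infinite_dimensional_def
proof
  assume "\<exists>B. finite B \<and> span B = {y \<in> Y. \<phi> y = 0}"
  then obtain B where B: "finite B" "span B = {y \<in> Y. \<phi> y = 0}" by blast
  show False
  proof (cases "\<forall>y\<in>Y. \<phi> y = 0")
    case True
    then have "span B = Y" using B by auto
    then show False using Y(2) B(1) by (auto simp: infinite_dimensional_def)
  next
    case False
    then obtain z where z: "z \<in> Y" "\<phi> z \<noteq> 0" by blast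
    have "span (insert z B) = Y"
    proof
      have "B \<subseteq> Y" using span_superset[of B] B(2) by auto
      then show "span (insert z B) \<subseteq> Y" using z Y(1) by (intro span_minimal) auto
      show "Y \<subseteq> span (insert z B)"
      proof
        fix y assume y: "y \<in> Y"
        define u where "u = y - scl (\<phi> y / \<phi> z) z"
        have "u \<in> span B" unfolding B(2) u_def
          using y z Y(1) by (auto simp: add scl intro!: subspace_diff subspace_scale)
        moreover have "span B \<subseteq> span (insert z B)" by (rule span_mono) auto
        ultimately have "u \<in> span (insert z B)" by blast
        moreover have "z \<in> span (insert z B)" by (rule span_base) simp
        ultimately have "u + scl (\<phi> y / \<phi> z) z \<in> span (insert z B)" by (intro span_add span_scale)
        then show "y \<in> span (insert z B)" by (simp add: u_def)
      qed
    qed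
    then show False using Y(2) B(1) by (auto simp: infinite_dimensional_def)
  qed
qed

lemma infinite_dimensional_nonzero:
  assumes "subspace Y" "infinite_dimensional scl Y" obtains y where "y \<in> Y" "y \<noteq> 0"
proof -
  have "span {} \<noteq> Y" using assms(2) unfolding infinite_dimensional_def by blast
  then show ?thesis using that subspace_0[OF assms(1)] by (auto simp: span_empty)
qed

lemma subspace_closure:
  assumes "subspace V" shows "subspace (closure V)"
  unfolding subspace_def
proof (intro conjI ballI allI)
  show "0 \<in> closure V" using subspace_0[OF assms] closure_subset by auto
  fix x assume "x \<in> closure V"
  then obtain f where f: "\<And>n::nat. f n \<in> V" "f \<longlonglongrightarrow> x" by (auto simp: closure_sequential)
  show "scl c x \<in> closure V" for c
  proof -
    have "bounded_linear (scl c)"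
    proof
      show "scl c (x + y) = scl c x + scl c y" for x y by (rule scale_right_distrib)
      show "scl c (r *\<^sub>R x) = r *\<^sub>R scl c x" for r x by (metis mult.commute scale_scale scl_of_real)
      show "\<exists>K. \<forall>x. norm (scl c x) \<le> norm x * K"
        by (intro exI[of _ "norm c"]) (simp add: norm_scl mult.commute)
    qed
    from bounded_linear.tendsto[OF this f(2)] show ?thesis unfolding closure_sequential
      using f(1) subspace_scale[OF assms] by (intro exI[of _ "\<lambda>n. scl c (f n)"]) auto
  qed
  fix y assume "y \<in> closure V"
  then obtain g where g: "\<And>n::nat. g n \<in> V" "g \<longlonglongrightarrow> y" by (auto simp: closure_sequential)
  show "x + y \<in> closure V" unfolding closure_sequential
    using tendsto_add[OF f(2) g(2)] f(1) g(1) subspace_add[OF assms]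
    by (intro exI[of _ "\<lambda>n. f n + g n"]) auto
qed

end

context unconditional_space
begin

lemma vanishing_coordinates:
  assumes Y: "subspace Y" "infinite_dimensional scl Y"
  obtains y where "y \<in> Y" "y \<noteq> 0" "\<And>i. i < n \<Longrightarrow> coord y i = 0"
proof -
  have "subspace {y \<in> Y. \<forall>i<n. coord y i = 0} \<and> infinite_dimensional scl {y \<in> Y. \<forall>i<n. coord y i = 0}"
  proof (induction n)
    case 0
    then show ?case using Y by simp
  next
    case (Suc n)
    have eq: "{y \<in> Y. \<forall>i<Suc n. coord y i = 0} = {y \<in> {y \<in> Y. \<forall>i<n. coord y i = 0}. coord y n = 0}"
      by (auto simp: less_Suc_eq)
    have "subspace {y \<in> Y. \<forall>i<Suc n. coord y i = 0}"
      using Y(1) by (auto simp: subspace_def coord_zero coord_add coord_scl)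
    moreover have "infinite_dimensional scl {y \<in> Y. \<forall>i<Suc n. coord y i = 0}" unfolding eq
      by (rule infinite_dimensional_kernel) (use Suc in \<open>auto simp: coord_minus coord_scl\<close>)
    ultimately show ?case by blast
  qed
  then obtain y where "y \<in> {y \<in> Y. \<forall>i<n. coord y i = 0}" "y \<noteq> 0"
    using infinite_dimensional_nonzero by blast
  then show ?thesis using that by blast
qed

lemma modulus_partial: "modulus (partial m x) = restr {..<m} (modulus x)"
  by (auto simp: modulus_def partial_def coord_finite_sum restr_def)

lemma trunc_c00_pos: "restr {..<m} (modulus x) \<in> c00_pos"
  by (rule c00_pos_subsetI[where S="{..<m}"]) (auto simp: restr_def modulus_def supp_def)

lemma basis_norm_trunc: "basis_norm (restr {..<m} (modulus x)) = sup_norm (partial m x)"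
  unfolding modulus_partial[symmetric] by (rule basis_norm_modulus) (simp add: modulus_partial trunc_c00_pos)

lemma sup_norm_partial_le: "sup_norm (partial m x) \<le> sup_norm x"
  by (rule sup_norm_mono) (simp add: partial_def coord_finite_sum)

text \<open>A lattice norm is controlled only on finitely supported sequences, so general vectors
  are reached through truncations of the modulus; by monotonicity the supremum is a limit.\<close>

definition extended_norm :: "((nat \<Rightarrow> real) \<Rightarrow> real) \<Rightarrow> 'a \<Rightarrow> real" where
  "extended_norm \<nu> x = (SUP m. \<nu> (restr {..<m} (modulus x)))"

lemma extended_norm:
  assumes \<nu>: "lattice_norm \<nu>" and ab: "0 < a" "0 < b"
    and eq: "\<And>f. f \<in> c00_pos \<Longrightarrow> a * basis_norm f \<le> \<nu> f \<and> \<nu> f \<le> b * basis_norm f"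
  shows "a * norm x \<le> extended_norm \<nu> x" "extended_norm \<nu> x \<le> b * sup_norm x"
    "extended_norm \<nu> (x + y) \<le> extended_norm \<nu> x + extended_norm \<nu> y"
    "extended_norm \<nu> (scl k x) = norm k * extended_norm \<nu> x"
    "modulus x \<in> c00_pos \<Longrightarrow> extended_norm \<nu> x = \<nu> (modulus x)"
proof -
  interpret N: lattice_norm \<nu> by (rule \<nu>)
  have le: "\<nu> (restr {..<m} (modulus x)) \<le> b * sup_norm x" for m x
  proof -
    have "\<nu> (restr {..<m} (modulus x)) \<le> b * sup_norm (partial m x)"
      using eq[OF trunc_c00_pos, of m x] by (simp add: basis_norm_trunc)
    also have "\<dots> \<le> b * sup_norm x" using ab by (intro mult_left_mono sup_norm_partial_le) auto
    finally show ?thesis .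
  qed
  have upper: "\<nu> (restr {..<m} (modulus x)) \<le> extended_norm \<nu> x" for m x
    unfolding extended_norm_def by (rule cSUP_upper) (use le[of _ x] in \<open>auto simp: bdd_above_def\<close>)
  have least: "extended_norm \<nu> x \<le> B" if "\<And>m. \<nu> (restr {..<m} (modulus x)) \<le> B" for x B
    unfolding extended_norm_def by (rule cSUP_least) (use that in auto)
  show "extended_norm \<nu> x \<le> b * sup_norm x" by (rule least[OF le])
  have "a * norm (partial m x) \<le> extended_norm \<nu> x" for m
  proof -
    have "a * norm (partial m x) \<le> a * sup_norm (partial m x)"
      using ab norm_le_sup_norm by (intro mult_left_mono) auto
    also have "\<dots> \<le> \<nu> (restr {..<m} (modulus x))" using eq[OF trunc_c00_pos, of m x] by (simp add: basis_norm_trunc)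
    also have "\<dots> \<le> extended_norm \<nu> x" by (rule upper)
    finally show ?thesis .
  qed
  then show "a * norm x \<le> extended_norm \<nu> x"
    by (intro LIMSEQ_le_const2[OF tendsto_mult[OF tendsto_const[of a] tendsto_norm[OF partial_tendsto[of x]]]]) auto
  show "extended_norm \<nu> (x + y) \<le> extended_norm \<nu> x + extended_norm \<nu> y"
  proof (rule least)
    fix m
    have "\<nu> (restr {..<m} (modulus (x + y))) \<le> \<nu> (\<lambda>i. restr {..<m} (modulus x) i + restr {..<m} (modulus y) i)"
      by (intro N.mono trunc_c00_pos c00_pos_add) (auto simp: restr_def modulus_def coord_add norm_triangle_ineq)
    also have "\<dots> \<le> \<nu> (restr {..<m} (modulus x)) + \<nu> (restr {..<m} (modulus y))"
      by (intro N.triangle trunc_c00_pos)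
    also have "\<dots> \<le> extended_norm \<nu> x + extended_norm \<nu> y" by (intro add_mono upper)
    finally show "\<nu> (restr {..<m} (modulus (x + y))) \<le> extended_norm \<nu> x + extended_norm \<nu> y" .
  qed
  have s: "\<nu> (restr {..<m} (modulus (scl k x))) = norm k * \<nu> (restr {..<m} (modulus x))" for m k x
  proof -
    have "restr {..<m} (modulus (scl k x)) = (\<lambda>i. norm k * restr {..<m} (modulus x) i)"
      by (auto simp: restr_def modulus_scl)
    then show ?thesis using N.scale[OF trunc_c00_pos, of "norm k" m x] by simp
  qed
  have sle: "extended_norm \<nu> (scl k x) \<le> norm k * extended_norm \<nu> x" for k x
    by (rule least) (simp add: s upper mult_left_mono)
  show "extended_norm \<nu> (scl k x) = norm k * extended_norm \<nu> x"
  proof (cases "k = 0")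
    case True
    have "\<nu> (restr {..<0} (modulus (scl k x))) \<le> extended_norm \<nu> (scl k x)" by (rule upper)
    then show ?thesis using True sle[of k x] N.nonneg[OF trunc_c00_pos, of 0 "scl k x"] by simp
  next
    case False
    have "extended_norm \<nu> (scl (inverse k) (scl k x)) \<le> norm (inverse k) * extended_norm \<nu> (scl k x)" by (rule sle)
    then have "extended_norm \<nu> x \<le> norm (inverse k) * extended_norm \<nu> (scl k x)" using False by (simp add: scale_scale)
    then have "norm k * extended_norm \<nu> x \<le> norm k * (norm (inverse k) * extended_norm \<nu> (scl k x))"
      by (rule mult_left_mono) simp
    also have "\<dots> = norm (k * inverse k) * extended_norm \<nu> (scl k x)" by (simp only: norm_mult mult.assoc)
    finally show ?thesis using sle[of k x] False by simp
  qed
  assume fin: "modulus x \<in> c00_pos"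
  show "extended_norm \<nu> x = \<nu> (modulus x)"
  proof (rule antisym)
    show "extended_norm \<nu> x \<le> \<nu> (modulus x)" by (rule least[OF N.restr_mono[OF fin]])
    obtain m where "supp (modulus x) \<subseteq> {..<m}"
      using c00_pos_finite[OF fin] by (meson finite_nat_iff_bounded)
    then show "\<nu> (modulus x) \<le> extended_norm \<nu> x" using upper[of m x] by (simp add: restr_idem)
  qed
qed

lemma equivalent_norm_on_extended_norm:
  assumes \<nu>: "lattice_norm \<nu>" "0 < a" "0 < b"
    "\<And>f. f \<in> c00_pos \<Longrightarrow> a * basis_norm f \<le> \<nu> f \<and> \<nu> f \<le> b * basis_norm f"
  shows "equivalent_norm_on scl Z (extended_norm \<nu>)"
proof -
  obtain K where K: "1 \<le> K" "\<And>x. sup_norm x \<le> K * norm x" using sup_norm_equivalent by blast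
  note N = extended_norm[OF \<nu>]
  have up: "extended_norm \<nu> x \<le> (b * K) * norm x" for x
  proof -
    have "b * sup_norm x \<le> b * (K * norm x)" using \<nu>(3) K by (intro mult_left_mono) auto
    then show ?thesis using N(2)[of x] by (simp add: mult.assoc)
  qed
  have nn: "0 \<le> extended_norm \<nu> x" for x
    using N(1)[of x] \<nu>(2) by (meson mult_nonneg_nonneg less_imp_le norm_ge_zero order_trans)
  have z: "extended_norm \<nu> x = 0 \<longleftrightarrow> x = 0" for x
  proof
    assume "extended_norm \<nu> x = 0"
    then have "a * norm x \<le> 0" using N(1)[of x] by simp
    then show "x = 0" using \<nu>(2) by (simp add: mult_le_0_iff)
  next
    assume "x = 0"
    then show "extended_norm \<nu> x = 0" using up[of x] nn[of x] by simp
  qed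
  show ?thesis unfolding equivalent_norm_on_def is_norm_on_def
  proof (intro conjI ballI allI)
    show "\<exists>a b. 0 < a \<and> 0 < b \<and> (\<forall>x\<in>Z. a * norm x \<le> extended_norm \<nu> x \<and> extended_norm \<nu> x \<le> b * norm x)"
      using N(1) up \<nu>(2,3) K(1) by (intro exI[of _ a] exI[of _ "b * K"]) auto
  qed (use nn z N in auto)
qed

definition combinations :: "(nat \<Rightarrow> nat \<Rightarrow> real) \<Rightarrow> 'a set" where
  "combinations w = {\<Sum>i\<in>I. scl (d i) (embed (w i)) | I d. finite I}"

lemma subspace_combinations: "subspace (combinations w)"
  unfolding subspace_def
proof (intro conjI ballI allI)
  show "0 \<in> combinations w" unfolding combinations_def by (intro CollectI exI[of _ "{}"]) simp
  fix x assume "x \<in> combinations w"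
  then obtain I d where x: "finite I" "x = (\<Sum>i\<in>I. scl (d i) (embed (w i)))" by (auto simp: combinations_def)
  show "scl k x \<in> combinations w" for k
    unfolding combinations_def x(2)
    by (intro CollectI exI[of _ I] exI[of _ "\<lambda>i. k * d i"]) (simp add: x scale_sum_right scale_scale)
  fix y assume "y \<in> combinations w"
  then obtain J c where y: "finite J" "y = (\<Sum>i\<in>J. scl (c i) (embed (w i)))" by (auto simp: combinations_def)
  define f where "f = (\<lambda>i. (if i \<in> I then d i else 0) + (if i \<in> J then c i else 0))"
  have "(\<Sum>i\<in>I \<union> J. scl (f i) (embed (w i))) = (\<Sum>i\<in>I \<union> J. scl (if i \<in> I then d i else 0) (embed (w i)))
      + (\<Sum>i\<in>I \<union> J. scl (if i \<in> J then c i else 0) (embed (w i)))"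
    by (simp add: f_def scale_left_distrib sum.distrib)
  also have "(\<Sum>i\<in>I \<union> J. scl (if i \<in> I then d i else 0) (embed (w i))) = x"
    unfolding x(2) by (rule sum.mono_neutral_cong_right) (use x y in auto)
  also have "(\<Sum>i\<in>I \<union> J. scl (if i \<in> J then c i else 0) (embed (w i))) = y"
    unfolding y(2) by (rule sum.mono_neutral_cong_right) (use x y in auto)
  finally have "x + y = (\<Sum>i\<in>I \<union> J. scl (f i) (embed (w i)))" ..
  then show "x + y \<in> combinations w" unfolding combinations_def using x(1) y(1) by blast
qed

lemma infinite_dimensional_combinations:
  assumes w: "block w" shows "infinite_dimensional scl (closure (combinations w))"
  unfolding infinite_dimensional_def
proof
  assume "\<exists>B. finite B \<and> span B = closure (combinations w)"
  then obtain B where B: "finite B" "span B = closure (combinations w)" by blast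
  define f where "f = (\<lambda>i. embed (w i))"
  have wc: "w i \<in> c00_pos" for i by (rule block_c00_pos[OF w])
  have cf: "coord (f j) k = of_real (w j k)" for j k by (simp add: f_def coord_embed[OF wc])
  have sep: "w j k = 0" if "k \<in> supp (w i)" "j \<noteq> i" for i j k
    using block_less[OF w, of i j k k] block_less[OF w, of j i k k] that
    by (cases i j rule: linorder_cases) (auto simp: supp_def)
  have inj: "inj f"
  proof (rule injI)
    fix i j assume eq: "f i = f j"
    obtain k where k: "k \<in> supp (w i)" using block_supp_ne[OF w] by blast
    then have "w j k \<noteq> 0" using cf[of i k] cf[of j k] eq by (auto simp: supp_def)
    then show "i = j" using sep[OF k, of j] by blast
  qed
  have "f i \<in> combinations w" for i unfolding combinations_def f_def
    by (intro CollectI exI[of _ "{i}"] exI[of _ "\<lambda>_. 1"]) simp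
  then have "range f \<subseteq> span B" unfolding B(2) using closure_subset by blast
  moreover have "independent (range f)"
    unfolding independent_explicit_finite_subsets
  proof (intro allI impI ballI)
    fix S u v assume S: "S \<subseteq> range f" "finite S" "(\<Sum>v\<in>S. scl (u v) v) = 0" "v \<in> S"
    then obtain i where i: "v = f i" by blast
    obtain k where k: "k \<in> supp (w i)" using block_supp_ne[OF w] by blast
    have z: "coord v' k = 0" if "v' \<in> S" "v' \<noteq> v" for v'
    proof -
      obtain j where "v' = f j" using S(1) \<open>v' \<in> S\<close> by blast
      then show ?thesis using sep[OF k, of j] that i cf[of j k] by auto
    qed
    have "0 = coord (\<Sum>v\<in>S. scl (u v) v) k" using S(3) by (simp add: coord_zero)
    also have "\<dots> = (\<Sum>v\<in>S. u v * coord v k)" by (simp add: coord_sum coord_scl)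
    also have "\<dots> = (\<Sum>v\<in>{v}. u v * coord v k)" using S z by (intro sum.mono_neutral_right) auto
    finally have "u v * coord v k = 0" by simp
    then show "u v = 0" using k cf[of i k] i by (auto simp: supp_def)
  qed
  ultimately have "finite (range f)" using independent_span_bound[OF B(1)] by blast
  then show False using inj finite_imageD by blast
qed

end

context unconditional_space
begin

lemma sup_norm_sum_le: "sup_norm (sum f I) \<le> (\<Sum>i\<in>I. sup_norm (f i))"
proof (induction I rule: infinite_finite_induct)
  case (insert x F)
  then show ?case using sup_norm_add[of "f x" "sum f F"] by simp
qed (use sup_norm_scl[of 0 0] in simp_all)

lemma modulus_combination:
  assumes w: "block w" and I: "finite I"
  shows "(\<lambda>i. if i \<in> I then norm (d i) else 0) \<in> c00_pos"
    "modulus (\<Sum>i\<in>I. scl (d i) (embed (w i))) = comb w (\<lambda>i. if i \<in> I then norm (d i) else 0)"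
proof -
  have wc: "w i \<in> c00_pos" for i by (rule block_c00_pos[OF w])
  have m: "modulus (embed (w i)) = w i" for i by (rule modulus_embed[OF wc])
  show c: "(\<lambda>i. if i \<in> I then norm (d i) else 0) \<in> c00_pos"
    by (rule c00_pos_subsetI[OF _ _ I]) (auto simp: supp_def)
  have "disjoint_family_on (\<lambda>i. supp (modulus (embed (w i)))) I"
    unfolding m disjoint_family_on_def
  proof (intro ballI impI)
    fix i j :: nat assume "i \<noteq> j"
    then have "i < j \<or> j < i" by linarith
    then show "supp (w i) \<inter> supp (w j) = {}" using block_less[OF w, of i j] block_less[OF w, of j i] by blast
  qed
  from modulus_sum_disjoint[OF I this, of d]
  have "modulus (\<Sum>i\<in>I. scl (d i) (embed (w i))) = (\<lambda>k. \<Sum>i\<in>I. norm (d i) * w i k)" by (simp add: m)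
  also have "\<dots> = comb w (\<lambda>i. if i \<in> I then norm (d i) else 0)"
    by (rule ext, subst comb_superset[of _ I]) (auto simp: supp_def I)
  finally show "modulus (\<Sum>i\<in>I. scl (d i) (embed (w i))) = comb w (\<lambda>i. if i \<in> I then norm (d i) else 0)" .
qed

text \<open>The vector \<open>y\<close> is chosen with vanishing coordinates on the supports of \<open>w i\<close>, \<open>i < p\<close>;
  removing these coordinates from an approximating combination then does not increase the error.\<close>

lemma approximating_combination:
  assumes w: "block w" and Y: "subspace Y" "infinite_dimensional scl Y" "Y \<subseteq> closure (combinations w)"
    and e: "0 < \<epsilon>" "\<epsilon> \<le> 1"
  shows "\<exists>y I d q. y \<in> Y \<and> I \<subseteq> {p..<q} \<and> 0 < sup_norm (\<Sum>i\<in>I. scl (d i) (embed (w i))) \<and>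
    sup_norm ((\<Sum>i\<in>I. scl (d i) (embed (w i))) - y) \<le> \<epsilon> * sup_norm (\<Sum>i\<in>I. scl (d i) (embed (w i)))"
proof -
  obtain K where K: "1 \<le> K" "\<And>x. sup_norm x \<le> K * norm x" using sup_norm_equivalent by blast
  have wc: "w i \<in> c00_pos" for i by (rule block_c00_pos[OF w])
  \<comment> \<open>This position separates the blocks before \<open>p\<close> from all the
    others.\<close>
  obtain n where n: "n \<in> supp (w p)" "\<And>k. k \<in> supp (w p) \<Longrightarrow> n \<le> k"
    proof
    obtain m where "m \<in> supp (w p)" using block_supp_ne[OF w, of p] by blast
    then show "(LEAST k. k \<in> supp (w p)) \<in> supp (w p)" by (rule LeastI)
  qed (rule Least_le)
  have low: "k < n" if "k \<in> supp (w i)" "i < p" for i k by (rule block_less[OF w that(2,1) n(1)])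
  have high: "n \<le> k" if "k \<in> supp (w i)" "p \<le> i" for i k
    using n(2) block_less[OF w, of p i n k] n(1) that by (cases "i = p") auto
  obtain y where y: "y \<in> Y" "y \<noteq> 0" "\<And>i. i < n \<Longrightarrow> coord y i = 0"
    using vanishing_coordinates[OF Y(1,2), of n] by blast
  have yp: "0 < sup_norm y" using y(2) norm_le_sup_norm[of y] by (smt (verit) zero_less_norm_iff)
  \<comment> \<open>Division by \<open>K\<close> turns a norm approximation into one for
    \<open>sup_norm\<close>. The factor \<open>1 / 2\<close> pays for the comparison
    \<open>sup_norm y \<le> 2 * sup_norm v\<close>, since the final error is measured by
    \<open>v\<close>.\<close>
  define \<delta> where "\<delta> = \<epsilon> / 2 * sup_norm y / K"
  have \<delta>: "0 < \<delta>" using e yp K by (simp add: \<delta>_def)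
  obtain u where u: "u \<in> combinations w" "dist u y < \<delta>"
    using Y(3) y(1) \<delta> unfolding closure_approachable subset_iff by (metis closure_approachable)
  then obtain I d where I: "finite I" "u = (\<Sum>i\<in>I. scl (d i) (embed (w i)))" by (auto simp: combinations_def)
  define J where "J = I \<inter> {p..}"
  define v where "v = (\<Sum>i\<in>J. scl (d i) (embed (w i)))"
  have fJ: "finite J" using I by (simp add: J_def)
  obtain q where q: "J \<subseteq> {p..<q}"
    using finite_nat_iff_bounded[of J] fJ by (auto simp: J_def subset_eq)
  have coord_comb: "coord (\<Sum>i\<in>A. scl (d i) (embed (w i))) k = (\<Sum>i\<in>A. d i * of_real (w i k))" for A k
    by (simp add: coord_sum coord_scl coord_embed[OF wc])
  have "sup_norm (v - y) \<le> sup_norm (u - y)"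
  proof (rule sup_norm_mono)
    fix k
    show "norm (coord (v - y) k) \<le> norm (coord (u - y) k)"
    proof (cases "k < n")
      case True
      have "coord v k = 0" unfolding v_def coord_comb
        using True high[of k] by (intro sum.neutral) (fastforce simp: J_def supp_def)
      then show ?thesis using y(3)[OF True] by (simp add: coord_minus)
    next
      case False
      have "coord u k = coord v k" unfolding v_def I(2) coord_comb
      proof (rule sum.mono_neutral_right[OF I(1)])
        show "\<forall>i\<in>I - J. d i * of_real (w i k) = 0"
          using False low[of k] by (fastforce simp: J_def supp_def)
      qed (simp add: J_def)
      then show ?thesis by (simp add: coord_minus)
    qed
  qed
  also have "\<dots> \<le> K * norm (u - y)" by (rule K)
  also have "\<dots> \<le> K * \<delta>" using u(2) K(1) by (intro mult_left_mono) (auto simp: dist_norm)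
  also have "\<dots> = \<epsilon> / 2 * sup_norm y" using K(1) by (simp add: \<delta>_def)
  finally have 1: "sup_norm (v - y) \<le> \<epsilon> / 2 * sup_norm y" .
  have "sup_norm y \<le> sup_norm v + sup_norm (v - y)" using sup_norm_diff[of v "v - y"] by simp
  moreover have "\<epsilon> / 2 * sup_norm y \<le> 1 / 2 * sup_norm y" using e yp by (intro mult_right_mono) auto
  ultimately have 2: "sup_norm y \<le> 2 * sup_norm v" using 1 by simp
  have "\<epsilon> / 2 * sup_norm y \<le> \<epsilon> / 2 * (2 * sup_norm v)" using e 2 by (intro mult_left_mono) auto
  then have "sup_norm (v - y) \<le> \<epsilon> * sup_norm v" using 1 by simp
  then show ?thesis using y(1) q yp 2 by (intro exI[of _ y] exI[of _ J] exI[of _ d] exI[of _ q]) (auto simp: v_def)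
qed

lemma sum_half_powers_le: "finite J \<Longrightarrow> (\<Sum>j\<in>J. (1 / 2) ^ Suc j) \<le> (1::real)"
  using sum_le_suminf[of "\<lambda>j. (1 / 2) ^ Suc j :: real" J] power_half_series by (simp add: sums_iff)

text \<open>The moduli of combinations that approximate vectors of \<open>Y\<close> form a subblock
  \<open>W\<close> of the tail. Two vectors of its cone with distorted norms are lifted to the
  combinations and then moved into \<open>Y\<close>. Each of the four norms in the quotient changes
  by a factor of at most 2, and one passage from \<open>sup_norm\<close> to the norm costs
  \<open>K\<close>, whence \<open>16 * K\<close>.\<close>

lemma distortion_ratio:
  assumes w: "block w" and Y: "subspace Y" "infinite_dimensional scl Y" "Y \<subseteq> closure (combinations w)"
    and \<nu>: "lattice_norm \<nu>" "0 < a" "0 < b"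
      "\<And>f. f \<in> c00_pos \<Longrightarrow> a * basis_norm f \<le> \<nu> f \<and> \<nu> f \<le> b * basis_norm f"
    and dist: "\<And>w'. subblock w' (\<lambda>i. w (n + i)) \<Longrightarrow> \<exists>x\<in>block_cone w'. \<exists>x'\<in>block_cone w'.
        D * (\<nu> x' * basis_norm x) < \<nu> x * basis_norm x'"
    and D: "0 < D" and K: "1 \<le> K" "\<And>x. sup_norm x \<le> K * norm x"
  shows "\<exists>y z. y \<in> Y \<and> z \<in> Y \<and> norm y = 1 \<and> norm z = 1 \<and>
    D / (16 * K) \<le> extended_norm \<nu> y / extended_norm \<nu> z"
proof -
  interpret R: lattice_norm basis_norm by (rule lattice_norm_basis_norm)
  interpret N: lattice_norm \<nu> by (rule \<nu>(1))
  note EN = extended_norm[OF \<nu>]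
  \<comment> \<open>The error has to be at most half of the value not only for
    \<open>sup_norm\<close> but, via the equivalence constants, also for the extension of
    \<open>\<nu>\<close>.\<close>
  define \<epsilon> where "\<epsilon> = min (1 / 2) (a / (2 * b))"
  have \<epsilon>: "0 < \<epsilon>" "\<epsilon> \<le> 1 / 2" "\<epsilon> * b \<le> a / 2"
  proof -
    show "0 < \<epsilon>" "\<epsilon> \<le> 1 / 2" using \<nu>(2,3) by (auto simp: \<epsilon>_def)
    have "\<epsilon> * b \<le> a / (2 * b) * b" using \<nu>(3) by (intro mult_right_mono) (auto simp: \<epsilon>_def)
    then show "\<epsilon> * b \<le> a / 2" using \<nu>(3) by simp
  qed
  define V where "V = (\<lambda>I d. \<Sum>i\<in>I. scl (d i) (embed (w i)))"
  define R where "R = (\<lambda>j p y I d q. y \<in> Y \<and> I \<subseteq> {p..<q} \<and> 0 < sup_norm (V I d) \<and>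
    sup_norm (V I d - y) \<le> (\<epsilon> * (1 / 2) ^ Suc j) * sup_norm (V I d))"
  have "\<exists>y I d q. R j p y I d q" for j p
    unfolding R_def V_def
  proof (rule approximating_combination[OF w Y])
    show "0 < \<epsilon> * (1 / 2) ^ Suc j" using \<epsilon> by simp
    have "\<epsilon> * (1 / 2) ^ Suc j \<le> \<epsilon> * 1" using \<epsilon>(1) by (intro mult_left_mono power_le_one) auto
    then show "\<epsilon> * (1 / 2) ^ Suc j \<le> 1" using \<epsilon>(2) by simp
  qed
  then obtain y' I' d' q' where R: "\<And>j p. R j p (y' j p) (I' j p) (d' j p) (q' j p)" by metis
  \<comment> \<open>Starting at \<open>n\<close> puts the whole subblock into the tail on which
    \<open>\<nu>\<close> is known to distort.\<close>
  define P where "P = rec_nat n (\<lambda>j p. q' j p)"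
  have P: "P 0 = n" "\<And>j. P (Suc j) = q' j (P j)" by (simp_all add: P_def)
  define y where "y = (\<lambda>j. y' j (P j))"
  define I where "I = (\<lambda>j. I' j (P j))"
  define d where "d = (\<lambda>j. d' j (P j))"
  define v where "v = (\<lambda>j. V (I j) (d j))"
  have r: "y j \<in> Y" "I j \<subseteq> {P j..<P (Suc j)}" "0 < sup_norm (v j)"
    "sup_norm (v j - y j) \<le> (\<epsilon> * (1 / 2) ^ Suc j) * sup_norm (v j)" for j
    using R[of j "P j"] unfolding R_def P y_def I_def d_def v_def by blast+
  have fI: "finite (I j)" for j using r(2) finite_subset by blast
  define c where "c = (\<lambda>j i. if i \<in> I j then norm (d j i) else 0)"
  have cc: "c j \<in> c00_pos" and mv: "modulus (v j) = comb w (c j)" for j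
    using modulus_combination[OF w fI[of j], of "d j"] by (simp_all add: c_def v_def V_def)
  have sc: "supp (c j) \<subseteq> {P j..<P (Suc j)}" for j using r(2)[of j] by (auto simp: c_def supp_def)
  have cne: "supp (c j) \<noteq> {}" for j
  proof
    assume "supp (c j) = {}"
    then have "modulus (v j) = (\<lambda>k. 0)" by (simp add: mv comb_def)
    then have "coord (v j) = coord 0" by (auto simp: modulus_def coord_zero fun_eq_iff)
    then have "v j = 0" by (rule eq_if_coord_eq)
    then show False using r(3)[of j] sup_norm_scl[of 0 0] by simp
  qed
  have cb: "block c"
  proof (rule blockI)
    show "k < k'" if "k \<in> supp (c i)" "k' \<in> supp (c (Suc i))" for i k k'
      using subsetD[OF sc that(1)] subsetD[OF sc that(2)] by simp
  qed (use cc cne in auto)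
  define W where "W = (\<lambda>j. modulus (v j))"
  have W: "W = (\<lambda>j. comb w (c j))" by (simp add: W_def mv)
  have Wb: "block W" unfolding W by (rule block_comb[OF w cb])
  have Wc: "W j \<in> c00_pos" for j by (rule block_c00_pos[OF Wb])
  have "P j \<le> P (Suc j)" for j using cne[of j] sc[of j] by (auto simp: subset_eq)
  then have nP: "n \<le> P j" for j using lift_Suc_mono_le[of P 0 j] P(1) by simp
  have nc: "n \<le> i" if "i \<in> supp (c j)" for i j using subsetD[OF sc that] nP[of j] by simp
  have "W j \<in> block_cone (\<lambda>i. w (n + i))" for j
    unfolding W using nc[of _ j] by (intro comb_in_block_cone cc in_block_cone_tail) blast
  then have sub: "subblock W (\<lambda>i. w (n + i))" using Wb by (simp add: subblock_def)
  have key: "\<exists>A\<in>Y. \<nu> x / 2 \<le> extended_norm \<nu> A \<and> extended_norm \<nu> A \<le> 2 * \<nu> x \<and>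
      basis_norm x / 2 \<le> sup_norm A \<and> norm A \<le> 2 * basis_norm x" if xW: "x \<in> block_cone W" for x
  proof -
    obtain \<alpha> where \<alpha>: "\<alpha> \<in> c00_pos" "x = comb W \<alpha>" using xW by (auto simp: block_cone_def)
    have a0: "0 \<le> \<alpha> j" for j using \<alpha>(1) by (simp add: c00_pos_def)
    have fin: "finite (supp \<alpha>)" using \<alpha>(1) by (simp add: c00_pos_def)
    define A where "A = (\<Sum>j\<in>supp \<alpha>. scl (of_real (\<alpha> j)) (v j))"
    define A' where "A' = (\<Sum>j\<in>supp \<alpha>. scl (of_real (\<alpha> j)) (y j))"
    have "disjoint_family_on (\<lambda>j. supp (modulus (v j))) (supp \<alpha>)"
      unfolding disjoint_family_on_def
    proof (intro ballI impI)
      fix i j :: nat assume "i \<noteq> j"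
      then have "i < j \<or> j < i" by linarith
      then show "supp (modulus (v i)) \<inter> supp (modulus (v j)) = {}"
        using block_less[OF Wb, of i j] block_less[OF Wb, of j i] unfolding W_def by blast
    qed
    from modulus_sum_disjoint[OF fin this, of "\<lambda>j. of_real (\<alpha> j)"]
    have mA: "modulus A = x" by (simp add: A_def \<alpha>(2) comb_def W_def a0)
    have xc: "x \<in> c00_pos" using block_cone_c00_pos[OF Wb xW] .
    have sA: "sup_norm A = basis_norm x" using basis_norm_modulus[of A] mA xc by simp
    have nA: "extended_norm \<nu> A = \<nu> x" using EN(5)[of A] mA xc by simp
    have "sup_norm (A - A') \<le> (\<Sum>j\<in>supp \<alpha>. sup_norm (scl (of_real (\<alpha> j)) (v j - y j)))"
      unfolding A_def A'_def sum_subtractf[symmetric] scale_right_diff_distrib[symmetric] by (rule sup_norm_sum_le)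
    also have "\<dots> \<le> (\<Sum>j\<in>supp \<alpha>. (\<epsilon> * sup_norm A) * (1 / 2) ^ Suc j)"
    proof (rule sum_mono)
      fix j assume j: "j \<in> supp \<alpha>"
      have "\<alpha> j * sup_norm (v j) = sup_norm (scl (of_real (\<alpha> j)) (v j))" by (simp add: sup_norm_scl a0)
      also have "\<dots> \<le> sup_norm A"
      proof (rule sup_norm_mono)
        fix k
        have "\<alpha> j * W j k \<le> (\<Sum>j\<in>supp \<alpha>. \<alpha> j * W j k)"
          using j fin a0 Wc by (intro member_le_sum) (auto simp: c00_pos_nonneg)
        then have "\<alpha> j * modulus (v j) k \<le> modulus A k" unfolding mA by (simp add: \<alpha>(2) comb_def W_def)
        then show "norm (coord (scl (of_real (\<alpha> j)) (v j)) k) \<le> norm (coord A k)"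
          by (simp add: coord_scl norm_mult a0 modulus_def)
      qed
      finally have le: "\<alpha> j * sup_norm (v j) \<le> sup_norm A" .
      have "sup_norm (scl (of_real (\<alpha> j)) (v j - y j)) = \<alpha> j * sup_norm (v j - y j)" by (simp add: sup_norm_scl a0)
      also have "\<dots> \<le> \<alpha> j * ((\<epsilon> * (1 / 2) ^ Suc j) * sup_norm (v j))" using r(4) a0 by (rule mult_left_mono)
      also have "\<dots> = (\<epsilon> * (1 / 2) ^ Suc j) * (\<alpha> j * sup_norm (v j))" by simp
      also have "\<dots> \<le> (\<epsilon> * (1 / 2) ^ Suc j) * sup_norm A" using le \<epsilon>(1) by (intro mult_left_mono) auto
      finally show "sup_norm (scl (of_real (\<alpha> j)) (v j - y j)) \<le> (\<epsilon> * sup_norm A) * (1 / 2) ^ Suc j"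
        by (simp add: mult_ac)
    qed
    also have "\<dots> = (\<epsilon> * sup_norm A) * (\<Sum>j\<in>supp \<alpha>. (1 / 2) ^ Suc j)" by (simp add: sum_distrib_left)
    also have "\<dots> \<le> (\<epsilon> * sup_norm A) * 1"
      using \<epsilon>(1) sup_norm_nonneg[of A] by (intro mult_left_mono sum_half_powers_le fin) auto
    finally have close: "sup_norm (A - A') \<le> \<epsilon> * sup_norm A" by simp
    have "\<epsilon> * sup_norm A \<le> 1 / 2 * sup_norm A" using \<epsilon>(2) sup_norm_nonneg by (rule mult_right_mono)
    then have close2: "sup_norm (A - A') \<le> basis_norm x / 2" using close sA by simp
    have "extended_norm \<nu> (A - A') \<le> b * sup_norm (A - A')" by (rule EN(2))
    also have "\<dots> \<le> b * (\<epsilon> * basis_norm x)" using close sA \<nu>(3) by (intro mult_left_mono) auto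
    also have "\<dots> = (\<epsilon> * b) * basis_norm x" by simp
    also have "\<dots> \<le> a / 2 * basis_norm x" using \<epsilon>(3) R.nonneg[OF xc] by (rule mult_right_mono)
    also have "\<dots> \<le> \<nu> x / 2" using \<nu>(4)[OF xc] by simp
    finally have nclose: "extended_norm \<nu> (A - A') \<le> \<nu> x / 2" .
    have neg: "extended_norm \<nu> (A' - A) = extended_norm \<nu> (A - A')"
      using EN(4)[of "-1" "A - A'"] by simp
    have 1: "\<nu> x / 2 \<le> extended_norm \<nu> A'" using EN(3)[of "A - A'" A'] nclose nA by simp
    have 2: "extended_norm \<nu> A' \<le> 2 * \<nu> x"
      using EN(3)[of "A' - A" A] nclose nA neg N.nonneg[OF xc] by simp
    have 3: "basis_norm x / 2 \<le> sup_norm A'" using sup_norm_add[of "A - A'" A'] close2 sA by simp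
    have "sup_norm A' \<le> sup_norm A + sup_norm (A - A')" using sup_norm_diff[of A "A - A'"] by simp
    then have 4: "norm A' \<le> 2 * basis_norm x" using norm_le_sup_norm[of A'] close2 sA R.nonneg[OF xc] by simp
    have "A' \<in> Y" unfolding A'_def by (intro subspace_sum subspace_scale Y(1) r(1))
    then show ?thesis using 1 2 3 4 by blast
  qed
  obtain x x' where x: "x \<in> block_cone W" "x' \<in> block_cone W" "D * (\<nu> x' * basis_norm x) < \<nu> x * basis_norm x'"
    using dist[OF sub] by blast
  have xc: "x \<in> c00_pos" "x' \<in> c00_pos" using block_cone_c00_pos[OF Wb] x by auto
  have pos_prod: "0 < \<nu> x * basis_norm x'"
    using x(3) D N.nonneg[OF xc(2)] R.nonneg[OF xc(1)] by (smt (verit) mult_nonneg_nonneg)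
  have \<nu>x: "0 < \<nu> x" and \<rho>x': "0 < basis_norm x'"
    using pos_prod N.nonneg[OF xc(1)] R.nonneg[OF xc(2)] by (auto simp: zero_less_mult_iff)
  have \<rho>x: "0 < basis_norm x"
  proof -
    have "0 < b * basis_norm x" using \<nu>(4)[OF xc(1)] \<nu>x by simp
    then show ?thesis using \<nu>(3) by (simp add: zero_less_mult_iff)
  qed
  have \<nu>x': "0 < \<nu> x'"
  proof -
    have "0 < a * basis_norm x'" using \<nu>(2) \<rho>x' by simp
    then show ?thesis using \<nu>(4)[OF xc(2)] by simp
  qed
  obtain A where A: "A \<in> Y" "\<nu> x / 2 \<le> extended_norm \<nu> A" "norm A \<le> 2 * basis_norm x" "basis_norm x / 2 \<le> sup_norm A"
    using key[OF x(1)] by blast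
  obtain B where B: "B \<in> Y" "extended_norm \<nu> B \<le> 2 * \<nu> x'" "basis_norm x' / 2 \<le> sup_norm B" "\<nu> x' / 2 \<le> extended_norm \<nu> B"
    using key[OF x(2)] by blast
  have Ap: "0 < norm A"
  proof -
    have "0 < K * norm A" using A(4) \<rho>x K(2)[of A] by simp
    then show ?thesis using K(1) by (simp add: zero_less_mult_iff)
  qed
  have Bl: "basis_norm x' / (2 * K) \<le> norm B" using B(3) K(2)[of B] K(1) by (simp add: field_simps)
  then have Bp: "0 < norm B" using \<rho>x' K(1) by (smt (verit) divide_pos_pos mult_pos_pos)
  define s where "s = (\<lambda>u. scl (of_real (1 / norm u)) u)"
  have s: "s u \<in> Y" "norm (s u) = 1" "extended_norm \<nu> (s u) = extended_norm \<nu> u / norm u"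
    if "u \<in> Y" "0 < norm u" for u
    using that Y(1) by (auto simp: s_def norm_scl EN(4) subspace_scale norm_divide)
  have "D / (16 * K) = D * (\<nu> x' * basis_norm x) / (16 * K * (\<nu> x' * basis_norm x))"
    using \<nu>x' \<rho>x by simp
  also have "\<dots> \<le> (\<nu> x * basis_norm x') / (16 * K * (\<nu> x' * basis_norm x))"
    using x(3) K(1) \<nu>x' \<rho>x by (intro divide_right_mono) auto
  also have "\<dots> = ((\<nu> x / 2) / (2 * basis_norm x)) / ((2 * \<nu> x') / (basis_norm x' / (2 * K)))"
    using \<nu>x' \<rho>x \<rho>x' K(1) by (simp add: field_simps)
  also have "\<dots> \<le> (extended_norm \<nu> A / norm A) / (extended_norm \<nu> B / norm B)"
  proof (rule frac_le)
    show "0 \<le> extended_norm \<nu> A / norm A" using A(2) \<nu>x by simp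
    show "\<nu> x / 2 / (2 * basis_norm x) \<le> extended_norm \<nu> A / norm A"
      using A \<nu>x Ap by (intro frac_le) auto
    show "0 < extended_norm \<nu> B / norm B" using B(4) \<nu>x' Bp by simp
    show "extended_norm \<nu> B / norm B \<le> 2 * \<nu> x' / (basis_norm x' / (2 * K))"
      using B(2,4) Bl \<nu>x' \<rho>x' K(1) by (intro frac_le) auto
  qed
  finally have "D / (16 * K) \<le> extended_norm \<nu> (s A) / extended_norm \<nu> (s B)"
    using s(3)[OF A(1) Ap] s(3)[OF B(1) Bp] by simp
  then show ?thesis using s(1,2)[OF A(1) Ap] s(1,2)[OF B(1) Bp] by blast
qed

text \<open>For each \<open>n\<close> the distortion is available only on the tail of
  \<open>w\<close> beyond \<open>n\<close>. This is enough, because every infinite dimensional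
  subspace of the closed span almost contains blocks of that tail; the bound \<open>l\<close> is
  reached once \<open>n \<ge> 16 * K * l\<close>.\<close>

lemma arbitrarily_distortable_closure:
  assumes no: "\<not> contains_l1n_uniformly scl"
  obtains w where "block w" "arbitrarily_distortable scl (closure (combinations w))"
proof -
  interpret R: lattice_norm basis_norm by (rule lattice_norm_basis_norm)
  obtain K where K: "1 \<le> K" "\<And>x. sup_norm x \<le> K * norm x" using sup_norm_equivalent by blast
  define Q where "Q = (\<lambda>n w. \<exists>\<nu> a b. lattice_norm \<nu> \<and> 0 < a \<and> 0 < b \<and>
    (\<forall>f\<in>c00_pos. a * basis_norm f \<le> \<nu> f \<and> \<nu> f \<le> b * basis_norm f) \<and>
    (\<forall>w'. subblock w' w \<longrightarrow> (\<exists>x\<in>block_cone w'. \<exists>x'\<in>block_cone w'.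
      real (Suc n) * (\<nu> x' * basis_norm x) < \<nu> x * basis_norm x')))"
  have her: "Q n w'" if "Q n w" "subblock w' w" for n w w'
    using that subblock_trans[OF _ that(2)] unfolding Q_def by meson
  have ex: "\<exists>w'. subblock w' w \<and> Q n w'" if "subblock w unit" for n w
  proof -
    have "0 < real (Suc n)" by simp
    from R.distorted_subblock[OF no_linf_basis_norm[OF no] no_l1_basis_norm[OF no] this subblock_block[OF that]]
    show ?thesis unfolding Q_def by meson
  qed
  have "\<exists>w. subblock w unit \<and> (\<forall>n. Q n (\<lambda>i. w (n + i)))"
    by (rule diagonal_subblock[OF block_unit], erule (1) her, erule ex)
  then obtain w where w: "block w" "\<And>n. Q n (\<lambda>i. w (n + i))" using subblock_block by blast
  have "distortable scl (closure (combinations w)) l" if l: "1 < l" for l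
  proof -
    obtain n :: nat where n: "16 * K * l \<le> real n" using real_arch_simple by blast
    obtain \<nu> a b where \<nu>: "lattice_norm \<nu>" "0 < a" "0 < b"
      "\<And>f. f \<in> c00_pos \<Longrightarrow> a * basis_norm f \<le> \<nu> f \<and> \<nu> f \<le> b * basis_norm f"
      "\<And>w'. subblock w' (\<lambda>i. w (n + i)) \<Longrightarrow> \<exists>x\<in>block_cone w'. \<exists>x'\<in>block_cone w'.
        real (Suc n) * (\<nu> x' * basis_norm x) < \<nu> x * basis_norm x'"
      using w(2)[of n] unfolding Q_def by blast
    note EN = extended_norm[OF \<nu>(1-4)]
    show ?thesis unfolding distortable_def
    proof (intro exI[of _ "extended_norm \<nu>"] conjI allI impI)
      show "equivalent_norm_on scl (closure (combinations w)) (extended_norm \<nu>)"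
        by (rule equivalent_norm_on_extended_norm[OF \<nu>(1-4)])
      fix Y assume Y: "subspace Y \<and> Y \<subseteq> closure (combinations w) \<and> infinite_dimensional scl Y"
      let ?S = "{extended_norm \<nu> y / extended_norm \<nu> z | y z. y \<in> Y \<and> z \<in> Y \<and> norm y = 1 \<and> norm z = 1}"
      have "\<exists>y z. y \<in> Y \<and> z \<in> Y \<and> norm y = 1 \<and> norm z = 1 \<and>
          real (Suc n) / (16 * K) \<le> extended_norm \<nu> y / extended_norm \<nu> z"
        by (rule distortion_ratio[OF w(1) _ _ _ \<nu> _ K]) (use Y in auto)
      then obtain y z where yz: "y \<in> Y" "z \<in> Y" "norm y = 1" "norm z = 1"
          "real (Suc n) / (16 * K) \<le> extended_norm \<nu> y / extended_norm \<nu> z" by blast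
      have "l * (16 * K) \<le> real (Suc n)" using n by (simp add: mult_ac)
      then have "l \<le> real (Suc n) / (16 * K)" using K(1) by (simp add: pos_le_divide_eq)
      then have le: "l \<le> extended_norm \<nu> y / extended_norm \<nu> z" using yz(5) by linarith
      \<comment> \<open>The real-valued \<open>Sup\<close> is an upper bound only for a bounded set,
        so boundedness must be supplied by the equivalence constants.\<close>
      have "r \<le> (b * K) / a" if "r \<in> ?S" for r
      proof -
        obtain y z where yz: "r = extended_norm \<nu> y / extended_norm \<nu> z" "norm y = 1" "norm z = 1"
          using \<open>r \<in> ?S\<close> by blast
        have "b * sup_norm y \<le> b * K" using K(2)[of y] yz \<nu>(3) by simp
        then have "extended_norm \<nu> y \<le> b * K" using EN(2)[of y] by linarith
        moreover have "a \<le> extended_norm \<nu> z" using EN(1)[of z] yz by simp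
        ultimately show ?thesis unfolding yz(1) using \<nu>(2,3) K(1) by (intro frac_le) auto
      qed
      then have bdd: "bdd_above ?S" unfolding bdd_above_def by blast
      have "extended_norm \<nu> y / extended_norm \<nu> z \<in> ?S" using yz by blast
      then show "l \<le> Sup ?S" using le cSup_upper2[OF _ _ bdd] by blast
    qed
  qed
  then show ?thesis using that[OF w(1)] unfolding arbitrarily_distortable_def by blast
qed

end

theorem mainTheorem1:
  fixes scl :: "'k::{real_normed_field,euclidean_space} \<Rightarrow> 'a::banach \<Rightarrow> 'a"
  assumes "banach_space_over scl"
    and "infinite_dimensional scl (UNIV :: 'a set)"
    and "\<exists>e. unconditional_basis scl e"
    and "\<not> contains_l1n_uniformly scl"
  shows "\<exists>Z :: 'a set. module.subspace scl Z \<and> closed Z \<and> infinite_dimensional scl Z \<and>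
           arbitrarily_distortable scl Z"
proof -
  obtain e where e: "unconditional_basis scl e" using assms(3) by blast
  interpret unconditional_space scl e
    by (rule unconditional_space.intro[OF assms(1)]) (rule unconditional_space_axioms.intro[OF e])
  obtain w where "block w" "arbitrarily_distortable scl (closure (combinations w))"
    using arbitrarily_distortable_closure[OF assms(4)] by blast
  then show ?thesis
    using subspace_closure[OF subspace_combinations] infinite_dimensional_combinations
    by (intro exI[of _ "closure (combinations w)"]) auto
qed

end
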